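(* Let $\mathcal C$ be a pre-triangulated degreewise finite dg-category over $\mathbf k=\mathbb F_q$ which is $n$CY for some odd $n\in\mathbb Z$. Assume that $\mathcal E$ is a full additive subcategory of $\mathcal T=H^0(\mathcal C)$ such that the embedding $\mathcal E\hookrightarrow\mathcal T$ induces an exact structure on $\mathcal E$. Then this embedding induces an embedding of Hall algebras $$(\mathcal H(\mathcal E)_{\mathrm{tw}},\diamond)\hookrightarrow\mathcal H_{n\mathrm{CY}}(\mathcal T),\qquad m_z\mapsto a_z,$$ where $(\mathcal H(\mathcal E)_{\mathrm{tw}},\diamond)$ is the twist of $(\mathcal H(\mathcal E)\otimes_{\mathbb Q}\mathbb C,\cdot)$ given by $$m_z\diamond m_x=\begin{cases}q^{\frac12\langle z,x\rangle_{0,\ldots,n}}\,m_z\cdot m_x&\text{for }n\ge1,\\ q^{-\frac12\langle z,x\rangle_{n+1,\ldots,-1}}\,m_z\cdot m_x&\text{for }n\le-1.\end{cases}$$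
   Context: Categories are essentially small and idempotent complete. $\mathrm{Ext}^i(x,y)=H^i(\mathrm{Hom}_{\mathcal C}(x,y))=\mathrm{Hom}_{\mathcal T}(x[-i],y)$; degreewise finite: all these are finite-dimensional. (Weak right) $n$CY: there is an equivalence of bimodules $\mathcal C^\vee\simeq\mathcal C[n]$, where $\mathcal C$ is the diagonal bimodule and $\mathcal C^\vee$ its $\mathbf k$-dual. $\langle z,x\rangle_I=\sum_{i\in I}(-1)^i\dim\mathrm{Ext}^i(z,x)$, computed in $\mathcal T$ (zero for $I=\emptyset$). $\mathrm{Aut}(x)$ is the automorphism group in $\mathcal T$. The embedding $\mathcal E\hookrightarrow\mathcal T$ induces an exact structure on $\mathcal E$ if $\mathcal E$ is extension-closed in $\mathcal T$ (for each triangle $x\xrightarrow{\beta}y\xrightarrow{\gamma}z\to x[1]$ with $x,z\in\mathcal E$, also $y\in\mathcal E$) and in every such triangle $\beta$ is a monomorphism and $\gamma$ is an epimorphism in $\mathcal E$; equivalently, the class of the sequences $x\to y\to z$ is a Quillen exact structure on $\mathcal E$. Hall algebra of $\mathcal E$ (with this exact structure): the $\mathbb Q$-vector space $\mathcal H(\mathcal E)$ with basis $m_x$, $x\in\mathrm{Iso}(\mathcal E)$, and product $m_z\cdot m_x=|\mathrm{Hom}(z,x)|^{-1}\sum_{\delta\in\mathrm{Ext}^1_{\mathcal E}(z,x)}m_{\mathbf{mt}(\delta)}$, where $\mathbf{mt}(\delta)$ is the isomorphism class of the middle term of the extension $\delta$ (here $\mathrm{Ext}^1_{\mathcal E}=\mathrm{Ext}^1_{\mathcal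 T}$). The algebra $\mathcal H_{n\mathrm{CY}}(\mathcal T)=\mathcal H_{n\mathrm{CY}}(\mathcal C)$: the $\mathbb C$-vector space with basis $h_x$ indexed by isomorphism classes of objects of $\mathcal T$, with associative unital product $$h_z\cdot h_x=\sum_{t=(x\to y\to z\to)}\frac{\sqrt{|\mathrm{Aut}(x)||\mathrm{Aut}(y)||\mathrm{Aut}(z)|}}{|\mathrm{Aut}(t)|}q^{\frac12\gamma(t)}h_y,$$ where the sum runs over isomorphism classes of objects $t$, with outer terms $x,z$, of the dg-category $\mathcal C^{\mathscr A_2}$ of exact triangles in $\mathcal C$, and $$\gamma(t)=\rho(t)+\begin{cases}\langle t,t\rangle_{0,\ldots,n}&n\ge-1,\\-\langle t,t\rangle_{n+1,\ldots,-1}&n<-1,\end{cases}$$ with $\rho(t)=\dim\mathrm{Ext}^0(t,t)-\mathrm{rk}(\mathrm{Ext}^0(t,t)\to\mathrm{Ext}^0(x,x)\oplus\mathrm{Ext}^0(y,y)\oplus\mathrm{Ext}^0(z,z))$. Finally $a_x=\sqrt{|\mathrm{Aut}(x)|}\cdot h_x$. *)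

theory Defs
  imports
    Complex_Main
    "HOL-Library.Cardinality"
    "HOL-Library.Function_Algebras"
    "HOL-Library.Product_Plus"
    "HOL-Library.Poly_Mapping"
    "HOL-Algebra.Module"
begin

section \<open>Preliminaries on vector spaces\<close>

definition ksign :: "int \<Rightarrow> 'v::ab_group_add \<Rightarrow> 'v" where
  "ksign i v = (if even i then v else - v)"

text \<open>\<open>S\<close> is a set of representatives of a basis of the image \<open>(V + W) / W\<close> of \<open>V\<close> in the
  quotient by the subspace \<open>W\<close>. For \<open>W \<subseteq> V\<close> this is a basis of \<open>V / W\<close>.\<close>
definition quot_basis ::
  "('k::field \<Rightarrow> 'v::ab_group_add \<Rightarrow> 'v) \<Rightarrow> 'v set \<Rightarrow> 'v set \<Rightarrow> 'v set \<Rightarrow> bool" where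
  "quot_basis s S V W \<longleftrightarrow>
     S \<subseteq> V \<and> V \<subseteq> module.span s (S \<union> W) \<and>
     \<not> module.dependent s S \<and> module.span s S \<inter> W \<subseteq> {0}"

definition quot_findim ::
  "('k::field \<Rightarrow> 'v::ab_group_add \<Rightarrow> 'v) \<Rightarrow> 'v set \<Rightarrow> 'v set \<Rightarrow> bool" where
  "quot_findim s V W \<longleftrightarrow> (\<exists>S. finite S \<and> quot_basis s S V W)"

definition quot_dim ::
  "('k::field \<Rightarrow> 'v::ab_group_add \<Rightarrow> 'v) \<Rightarrow> 'v set \<Rightarrow> 'v set \<Rightarrow> nat" where
  "quot_dim s V W = card (SOME S. finite S \<and> quot_basis s S V W)"


section \<open>Dg-categories and their homotopy categories\<close>

text \<open>All spaces \<open>Hom\<^sup>i(x,y)\<close> are subspaces of one ambient vector space, on which composition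
  is a single operation; only its values on composable morphisms matter. Every small dg-category
  is isomorphic to one of this form: take the direct sum of all \<open>Hom\<^sup>i(x,y)\<close> as ambient space.
  \<open>cmp C g f\<close> is the composite of \<open>g\<close> after \<open>f\<close>.\<close>
record ('k, 'o, 'h) dgcat =
  Ob :: "'o set"
  Hom :: "'o \<Rightarrow> 'o \<Rightarrow> int \<Rightarrow> 'h set"
  scl :: "'k \<Rightarrow> 'h \<Rightarrow> 'h"
  dif :: "'o \<Rightarrow> 'o \<Rightarrow> int \<Rightarrow> 'h \<Rightarrow> 'h"
  cmp :: "'h \<Rightarrow> 'h \<Rightarrow> 'h"
  idt :: "'o \<Rightarrow> 'h"

locale dg_category =
  fixes C :: "('k::field, 'o, 'h::ab_group_add) dgcat"
  assumes vector_space: "vector_space (scl C)"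
    and Hom_subspace: "\<lbrakk>x \<in> Ob C; y \<in> Ob C\<rbrakk> \<Longrightarrow> module.subspace (scl C) (Hom C x y i)"
    and dif_Hom: "\<lbrakk>x \<in> Ob C; y \<in> Ob C; f \<in> Hom C x y i\<rbrakk>
      \<Longrightarrow> dif C x y i f \<in> Hom C x y (i + 1)"
    and dif_add: "\<lbrakk>x \<in> Ob C; y \<in> Ob C; f \<in> Hom C x y i; f' \<in> Hom C x y i\<rbrakk>
      \<Longrightarrow> dif C x y i (f + f') = dif C x y i f + dif C x y i f'"
    and dif_scl: "\<lbrakk>x \<in> Ob C; y \<in> Ob C; f \<in> Hom C x y i\<rbrakk>
      \<Longrightarrow> dif C x y i (scl C c f) = scl C c (dif C x y i f)"
    and dif_dif: "\<lbrakk>x \<in> Ob C; y \<in> Ob C; f \<in> Hom C x y i\<rbrakk>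
      \<Longrightarrow> dif C x y (i + 1) (dif C x y i f) = 0"
    and cmp_Hom: "\<lbrakk>x \<in> Ob C; y \<in> Ob C; z \<in> Ob C; f \<in> Hom C x y i; g \<in> Hom C y z j\<rbrakk>
      \<Longrightarrow> cmp C g f \<in> Hom C x z (i + j)"
    and cmp_add_left: "\<lbrakk>x \<in> Ob C; y \<in> Ob C; z \<in> Ob C; f \<in> Hom C x y i;
        g \<in> Hom C y z j; g' \<in> Hom C y z j\<rbrakk>
      \<Longrightarrow> cmp C (g + g') f = cmp C g f + cmp C g' f"
    and cmp_add_right: "\<lbrakk>x \<in> Ob C; y \<in> Ob C; z \<in> Ob C; f \<in> Hom C x y i; f' \<in> Hom C x y i;
        g \<in> Hom C y z j\<rbrakk>
      \<Longrightarrow> cmp C g (f + f') = cmp C g f + cmp C g f'"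
    and cmp_scl_left: "\<lbrakk>x \<in> Ob C; y \<in> Ob C; z \<in> Ob C; f \<in> Hom C x y i; g \<in> Hom C y z j\<rbrakk>
      \<Longrightarrow> cmp C (scl C c g) f = scl C c (cmp C g f)"
    and cmp_scl_right: "\<lbrakk>x \<in> Ob C; y \<in> Ob C; z \<in> Ob C; f \<in> Hom C x y i; g \<in> Hom C y z j\<rbrakk>
      \<Longrightarrow> cmp C g (scl C c f) = scl C c (cmp C g f)"
    and cmp_assoc: "\<lbrakk>w \<in> Ob C; x \<in> Ob C; y \<in> Ob C; z \<in> Ob C;
        f \<in> Hom C w x i; g \<in> Hom C x y j; h \<in> Hom C y z k\<rbrakk>
      \<Longrightarrow> cmp C h (cmp C g f) = cmp C (cmp C h g) f"
    and idt_Hom: "x \<in> Ob C \<Longrightarrow> idt C x \<in> Hom C x x 0"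
    and cmp_idt_left: "\<lbrakk>x \<in> Ob C; y \<in> Ob C; f \<in> Hom C x y i\<rbrakk> \<Longrightarrow> cmp C (idt C y) f = f"
    and cmp_idt_right: "\<lbrakk>x \<in> Ob C; y \<in> Ob C; f \<in> Hom C x y i\<rbrakk> \<Longrightarrow> cmp C f (idt C x) = f"
    and Leibniz: "\<lbrakk>x \<in> Ob C; y \<in> Ob C; z \<in> Ob C; f \<in> Hom C x y i; g \<in> Hom C y z j\<rbrakk>
      \<Longrightarrow> dif C x z (i + j) (cmp C g f)
        = cmp C (dif C y z j g) f + ksign j (cmp C g (dif C x y i f))"

definition cocyc :: "('k, 'o, 'h::ab_group_add) dgcat \<Rightarrow> int \<Rightarrow> 'o \<Rightarrow> 'o \<Rightarrow> 'h set" where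
  "cocyc C i x y = {f \<in> Hom C x y i. dif C x y i f = 0}"

definition cobnd :: "('k, 'o, 'h::ab_group_add) dgcat \<Rightarrow> int \<Rightarrow> 'o \<Rightarrow> 'o \<Rightarrow> 'h set" where
  "cobnd C i x y = dif C x y (i - 1) ` Hom C x y (i - 1)"

definition ecls :: "('k, 'o, 'h::ab_group_add) dgcat \<Rightarrow> int \<Rightarrow> 'o \<Rightarrow> 'o \<Rightarrow> 'h \<Rightarrow> 'h set" where
  "ecls C i x y f = {g \<in> cocyc C i x y. g - f \<in> cobnd C i x y}"

text \<open>Cohomology is the set of cohomology classes. The homotopy category \<open>T = H\<^sup>0(C)\<close> has
  morphism sets \<open>Ext C 0 x y\<close>; equations between its morphisms are written below as equations
  between classes of representing cocycles.\<close>
definition Ext :: "('k, 'o, 'h::ab_group_add) dgcat \<Rightarrow> int \<Rightarrow> 'o \<Rightarrow> 'o \<Rightarrow> 'h set set" where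
  "Ext C i x y = ecls C i x y ` cocyc C i x y"

definition ext_dim :: "('k::field, 'o, 'h::ab_group_add) dgcat \<Rightarrow> int \<Rightarrow> 'o \<Rightarrow> 'o \<Rightarrow> nat" where
  "ext_dim C i x y = quot_dim (scl C) (cocyc C i x y) (cobnd C i x y)"

definition degreewise_finite :: "('k::field, 'o, 'h::ab_group_add) dgcat \<Rightarrow> bool" where
  "degreewise_finite C \<longleftrightarrow>
     (\<forall>x\<in>Ob C. \<forall>y\<in>Ob C. \<forall>i. quot_findim (scl C) (cocyc C i x y) (cobnd C i x y))"

definition euler_form ::
  "('k::field, 'o, 'h::ab_group_add) dgcat \<Rightarrow> int set \<Rightarrow> 'o \<Rightarrow> 'o \<Rightarrow> real" where
  "euler_form C I z x = (\<Sum>i\<in>I. (- 1) powi i * real (ext_dim C i z x))"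

definition inverse_pair ::
  "('k, 'o, 'h::ab_group_add) dgcat \<Rightarrow> int \<Rightarrow> 'o \<Rightarrow> 'o \<Rightarrow> 'h \<Rightarrow> 'h \<Rightarrow> bool" where
  "inverse_pair C i x y f g \<longleftrightarrow>
     f \<in> cocyc C i x y \<and> g \<in> cocyc C (- i) y x \<and>
     ecls C 0 x x (cmp C g f) = ecls C 0 x x (idt C x) \<and>
     ecls C 0 y y (cmp C f g) = ecls C 0 y y (idt C y)"

definition isomorphic :: "('k, 'o, 'h::ab_group_add) dgcat \<Rightarrow> 'o \<Rightarrow> 'o \<Rightarrow> bool" where
  "isomorphic C x y \<longleftrightarrow> (\<exists>f g. inverse_pair C 0 x y f g)"

definition Aut :: "('k, 'o, 'h::ab_group_add) dgcat \<Rightarrow> 'o \<Rightarrow> 'h set set" where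
  "Aut C x = {ecls C 0 x x f |f. \<exists>g. inverse_pair C 0 x x f g}"

definition iso_class :: "('k, 'o, 'h::ab_group_add) dgcat \<Rightarrow> 'o set \<Rightarrow> 'o \<Rightarrow> 'o set" where
  "iso_class C S x = {y \<in> S. isomorphic C x y}"

definition Iso :: "('k, 'o, 'h::ab_group_add) dgcat \<Rightarrow> 'o set \<Rightarrow> 'o set set" where
  "Iso C S = iso_class C S ` S"

definition zero_object :: "('k, 'o, 'h::ab_group_add) dgcat \<Rightarrow> 'o \<Rightarrow> bool" where
  "zero_object C x \<longleftrightarrow> x \<in> Ob C \<and>
     (\<forall>w\<in>Ob C. (\<exists>!\<alpha>. \<alpha> \<in> Ext C 0 w x) \<and> (\<exists>!\<alpha>. \<alpha> \<in> Ext C 0 x w))"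

definition biproduct :: "('k, 'o, 'h::ab_group_add) dgcat \<Rightarrow> 'o \<Rightarrow> 'o \<Rightarrow> 'o \<Rightarrow> bool" where
  "biproduct C x y s \<longleftrightarrow> s \<in> Ob C \<and>
     (\<exists>i\<^sub>1\<in>cocyc C 0 x s. \<exists>i\<^sub>2\<in>cocyc C 0 y s. \<exists>p\<^sub>1\<in>cocyc C 0 s x. \<exists>p\<^sub>2\<in>cocyc C 0 s y.
        ecls C 0 x x (cmp C p\<^sub>1 i\<^sub>1) = ecls C 0 x x (idt C x) \<and>
        ecls C 0 y y (cmp C p\<^sub>2 i\<^sub>2) = ecls C 0 y y (idt C y) \<and>
        ecls C 0 y x (cmp C p\<^sub>1 i\<^sub>2) = ecls C 0 y x 0 \<and>
        ecls C 0 x y (cmp C p\<^sub>2 i\<^sub>1) = ecls C 0 x y 0 \<and>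
        ecls C 0 s s (cmp C i\<^sub>1 p\<^sub>1 + cmp C i\<^sub>2 p\<^sub>2) = ecls C 0 s s (idt C s))"

definition idempotent_complete :: "('k, 'o, 'h::ab_group_add) dgcat \<Rightarrow> bool" where
  "idempotent_complete C \<longleftrightarrow>
     (\<forall>x\<in>Ob C. \<forall>e\<in>cocyc C 0 x x. ecls C 0 x x (cmp C e e) = ecls C 0 x x e \<longrightarrow>
        (\<exists>y\<in>Ob C. \<exists>r\<in>cocyc C 0 x y. \<exists>s\<in>cocyc C 0 y x.
           ecls C 0 x x (cmp C s r) = ecls C 0 x x e \<and>
           ecls C 0 y y (cmp C r s) = ecls C 0 y y (idt C y)))"

definition mono_in :: "('k, 'o, 'h::ab_group_add) dgcat \<Rightarrow> 'o set \<Rightarrow> 'o \<Rightarrow> 'o \<Rightarrow> 'h \<Rightarrow> bool" where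
  "mono_in C E x y f \<longleftrightarrow>
     (\<forall>w\<in>E. \<forall>u\<in>cocyc C 0 w x. \<forall>v\<in>cocyc C 0 w x.
        ecls C 0 w y (cmp C f u) = ecls C 0 w y (cmp C f v) \<longrightarrow> ecls C 0 w x u = ecls C 0 w x v)"

definition epi_in :: "('k, 'o, 'h::ab_group_add) dgcat \<Rightarrow> 'o set \<Rightarrow> 'o \<Rightarrow> 'o \<Rightarrow> 'h \<Rightarrow> bool" where
  "epi_in C E x y f \<longleftrightarrow>
     (\<forall>w\<in>E. \<forall>u\<in>cocyc C 0 y w. \<forall>v\<in>cocyc C 0 y w.
        ecls C 0 x w (cmp C u f) = ecls C 0 x w (cmp C v f) \<longrightarrow> ecls C 0 y w u = ecls C 0 y w v)"


section \<open>Exact triangles\<close>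

text \<open>An exact triangle \<open>x \<rightarrow> y \<rightarrow> z \<rightarrow>\<close> is encoded as an acyclic three-term twisted complex:
  closed morphisms \<open>f : x \<rightarrow> y\<close> and \<open>g : y \<rightarrow> z\<close> of degree 0 together with a homotopy \<open>h\<close>
  of degree -1, \<open>d h = - g f\<close>, such that the total complex of
  \<open>Hom(w,x) \<rightarrow> Hom(w,y) \<rightarrow> Hom(w,z)\<close> is acyclic for all \<open>w\<close>; equivalently, \<open>(g, h)\<close>
  identifies \<open>z\<close> with the cone of \<open>f\<close>.\<close>
record ('o, 'h) tri =
  tx :: 'o
  ty :: 'o
  tz :: 'o
  tf :: 'h
  tg :: 'h
  th :: 'h

definition tot :: "('k, 'o, 'h::ab_group_add) dgcat \<Rightarrow> ('o, 'h) tri \<Rightarrow> 'o \<Rightarrow> int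
    \<Rightarrow> ('h \<times> 'h \<times> 'h) set" where
  "tot C t w m = Hom C w (tx t) m \<times> Hom C w (ty t) (m - 1) \<times> Hom C w (tz t) (m - 2)"

fun totd :: "('k, 'o, 'h::ab_group_add) dgcat \<Rightarrow> ('o, 'h) tri \<Rightarrow> 'o \<Rightarrow> int
    \<Rightarrow> 'h \<times> 'h \<times> 'h \<Rightarrow> 'h \<times> 'h \<times> 'h" where
  "totd C t w m (a, b, c) =
    (dif C w (tx t) m a,
     - dif C w (ty t) (m - 1) b + cmp C (tf t) a,
     dif C w (tz t) (m - 2) c + cmp C (tg t) b + cmp C (th t) a)"

definition exact_triangle :: "('k, 'o, 'h::ab_group_add) dgcat \<Rightarrow> ('o, 'h) tri \<Rightarrow> bool" where
  "exact_triangle C t \<longleftrightarrow>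
     tx t \<in> Ob C \<and> ty t \<in> Ob C \<and> tz t \<in> Ob C \<and>
     tf t \<in> cocyc C 0 (tx t) (ty t) \<and> tg t \<in> cocyc C 0 (ty t) (tz t) \<and>
     th t \<in> Hom C (tx t) (tz t) (- 1) \<and>
     dif C (tx t) (tz t) (- 1) (th t) + cmp C (tg t) (tf t) = 0 \<and>
     (\<forall>w\<in>Ob C. \<forall>m. \<forall>u\<in>tot C t w m. totd C t w m u = 0 \<longrightarrow>
        (\<exists>v\<in>tot C t w (m - 1). totd C t w (m - 1) v = u))"

text \<open>The third morphism \<open>z \<rightarrow> x[1]\<close> of the triangle in \<open>T\<close>, as an element of \<open>Ext\<^sup>1(z,x)\<close>:
  by acyclicity the cocycle \<open>(0, 0, 1\<^sub>z)\<close> bounds some \<open>(a, b, c)\<close>, and the class of \<open>a\<close> does not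
  depend on the choice. For the standard cone \<open>z = x[1] \<oplus> y\<close> of \<open>f\<close>, the class of \<open>- a\<close> is that
  of the projection onto \<open>x[1]\<close>.\<close>
definition connecting :: "('k, 'o, 'h::ab_group_add) dgcat \<Rightarrow> ('o, 'h) tri \<Rightarrow> 'h set \<Rightarrow> bool" where
  "connecting C t \<delta> \<longleftrightarrow>
     (\<exists>a b c. (a, b, c) \<in> tot C t (tz t) 1 \<and>
        totd C t (tz t) 1 (a, b, c) = (0, 0, idt C (tz t)) \<and>
        \<delta> = ecls C 1 (tz t) (tx t) (- a))"

text \<open>The dg-category of exact triangles: morphisms are those of twisted complexes compatible with
  the filtration, i.e. triangular matrices \<open>(a, b, c, u, v, w)\<close> with
  \<open>a : x \<rightarrow> x'\<close>, \<open>b : y \<rightarrow> y'\<close>, \<open>c : z \<rightarrow> z'\<close>, \<open>u : x \<rightarrow> y'\<close>, \<open>v : y \<rightarrow> z'\<close>, \<open>w : x \<rightarrow> z'\<close>.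
  With \<open>\<Delta> = (f, g, h)\<close> the differential of \<open>\<Phi>\<close> is \<open>d \<Phi> + \<Delta>' \<Phi> - (-1)\<^sup>m \<Phi> \<Delta>\<close>, where \<open>d\<close> carries
  the sign from regarding the terms as \<open>x, y[-1], z[-2]\<close>.\<close>
fun tri_dif :: "('k, 'o, 'h::ab_group_add) dgcat \<Rightarrow> ('o, 'h) tri \<Rightarrow> ('o, 'h) tri \<Rightarrow> int
    \<Rightarrow> 'h \<times> 'h \<times> 'h \<times> 'h \<times> 'h \<times> 'h \<Rightarrow> 'h \<times> 'h \<times> 'h \<times> 'h \<times> 'h \<times> 'h" where
  "tri_dif C t t' m (a, b, c, u, v, w) =
    (dif C (tx t) (tx t') m a,
     - dif C (ty t) (ty t') m b,
     dif C (tz t) (tz t') m c,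
     - dif C (tx t) (ty t') (m - 1) u + cmp C (tf t') a - ksign m (cmp C b (tf t)),
     dif C (ty t) (tz t') (m - 1) v + cmp C (tg t') b - ksign m (cmp C c (tg t)),
     dif C (tx t) (tz t') (m - 2) w + cmp C (tg t') u + cmp C (th t') a
       - ksign m (cmp C v (tf t) + cmp C c (th t)))"

fun tri_cmp :: "('k, 'o, 'h::ab_group_add) dgcat
    \<Rightarrow> 'h \<times> 'h \<times> 'h \<times> 'h \<times> 'h \<times> 'h \<Rightarrow> 'h \<times> 'h \<times> 'h \<times> 'h \<times> 'h \<times> 'h
    \<Rightarrow> 'h \<times> 'h \<times> 'h \<times> 'h \<times> 'h \<times> 'h" where
  "tri_cmp C (a', b', c', u', v', w') (a, b, c, u, v, w) =
    (cmp C a' a, cmp C b' b, cmp C c' c,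
     cmp C u' a + cmp C b' u, cmp C v' b + cmp C c' v,
     cmp C w' a + cmp C v' u + cmp C c' w)"

definition triangles :: "('k, 'o, 'h::ab_group_add) dgcat
    \<Rightarrow> ('k, ('o, 'h) tri, 'h \<times> 'h \<times> 'h \<times> 'h \<times> 'h \<times> 'h) dgcat" where
  "triangles C =
    \<lparr>Ob = {t. exact_triangle C t},
     Hom = (\<lambda>t t' m. Hom C (tx t) (tx t') m \<times> Hom C (ty t) (ty t') m \<times> Hom C (tz t) (tz t') m
        \<times> Hom C (tx t) (ty t') (m - 1) \<times> Hom C (ty t) (tz t') (m - 1)
        \<times> Hom C (tx t) (tz t') (m - 2)),
     scl = (\<lambda>k (a, b, c, u, v, w).
        (scl C k a, scl C k b, scl C k c, scl C k u, scl C k v, scl C k w)),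
     dif = tri_dif C,
     cmp = tri_cmp C,
     idt = (\<lambda>t. (idt C (tx t), idt C (ty t), idt C (tz t), 0, 0, 0))\<rparr>"

text \<open>The representables, up to homotopy equivalence, contain zero and are closed under shifts in
  both directions and under cones of closed morphisms of degree 0. Here \<open>y \<simeq> x[1]\<close> means that there
  is a closed morphism \<open>x \<rightarrow> y\<close> of degree -1 that is invertible up to homotopy.\<close>
definition pretriangulated :: "('k, 'o, 'h::ab_group_add) dgcat \<Rightarrow> bool" where
  "pretriangulated C \<longleftrightarrow>
     (\<exists>x. zero_object C x) \<and>
     (\<forall>x\<in>Ob C. \<exists>y\<in>Ob C. \<exists>f g. inverse_pair C (- 1) x y f g) \<and>
     (\<forall>x\<in>Ob C. \<exists>y\<in>Ob C. \<exists>f g. inverse_pair C 1 x y f g) \<and>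
     (\<forall>x\<in>Ob C. \<forall>y\<in>Ob C. \<forall>f\<in>cocyc C 0 x y.
        \<exists>t. exact_triangle C t \<and> tx t = x \<and> ty t = y \<and> tf t = f)"


section \<open>Bimodules and the Calabi-Yau condition\<close>

text \<open>A bimodule is contravariant in the first and covariant in the second object.
  \<open>lact M x y z j i a m\<close> is the action of \<open>a \<in> Hom\<^sup>j(y,z)\<close> on \<open>m \<in> M\<^sup>i(x,y)\<close>, and
  \<open>ract M x y z i j m b\<close> is the action of \<open>b \<in> Hom\<^sup>j(x,y)\<close> on \<open>m \<in> M\<^sup>i(y,z)\<close>.\<close>
record ('k, 'o, 'h, 'm) dgbimod =
  Mod :: "'o \<Rightarrow> 'o \<Rightarrow> int \<Rightarrow> 'm set"
  mscl :: "'k \<Rightarrow> 'm \<Rightarrow> 'm"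
  mdif :: "'o \<Rightarrow> 'o \<Rightarrow> int \<Rightarrow> 'm \<Rightarrow> 'm"
  lact :: "'o \<Rightarrow> 'o \<Rightarrow> 'o \<Rightarrow> int \<Rightarrow> int \<Rightarrow> 'h \<Rightarrow> 'm \<Rightarrow> 'm"
  ract :: "'o \<Rightarrow> 'o \<Rightarrow> 'o \<Rightarrow> int \<Rightarrow> int \<Rightarrow> 'm \<Rightarrow> 'h \<Rightarrow> 'm"

locale dg_bimodule =
  fixes C :: "('k::field, 'o, 'h::ab_group_add) dgcat"
    and M :: "('k, 'o, 'h, 'm::ab_group_add) dgbimod"
  assumes vector_space: "vector_space (mscl M)"
    and Mod_subspace: "\<lbrakk>x \<in> Ob C; y \<in> Ob C\<rbrakk> \<Longrightarrow> module.subspace (mscl M) (Mod M x y i)"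
    and mdif_Mod: "\<lbrakk>x \<in> Ob C; y \<in> Ob C; m \<in> Mod M x y i\<rbrakk>
      \<Longrightarrow> mdif M x y i m \<in> Mod M x y (i + 1)"
    and mdif_add: "\<lbrakk>x \<in> Ob C; y \<in> Ob C; m \<in> Mod M x y i; m' \<in> Mod M x y i\<rbrakk>
      \<Longrightarrow> mdif M x y i (m + m') = mdif M x y i m + mdif M x y i m'"
    and mdif_scl: "\<lbrakk>x \<in> Ob C; y \<in> Ob C; m \<in> Mod M x y i\<rbrakk>
      \<Longrightarrow> mdif M x y i (mscl M c m) = mscl M c (mdif M x y i m)"
    and mdif_mdif: "\<lbrakk>x \<in> Ob C; y \<in> Ob C; m \<in> Mod M x y i\<rbrakk>
      \<Longrightarrow> mdif M x y (i + 1) (mdif M x y i m) = 0"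
    and lact_Mod: "\<lbrakk>x \<in> Ob C; y \<in> Ob C; z \<in> Ob C; a \<in> Hom C y z j; m \<in> Mod M x y i\<rbrakk>
      \<Longrightarrow> lact M x y z j i a m \<in> Mod M x z (i + j)"
    and lact_add_left: "\<lbrakk>x \<in> Ob C; y \<in> Ob C; z \<in> Ob C; a \<in> Hom C y z j; a' \<in> Hom C y z j;
        m \<in> Mod M x y i\<rbrakk>
      \<Longrightarrow> lact M x y z j i (a + a') m = lact M x y z j i a m + lact M x y z j i a' m"
    and lact_add_right: "\<lbrakk>x \<in> Ob C; y \<in> Ob C; z \<in> Ob C; a \<in> Hom C y z j;
        m \<in> Mod M x y i; m' \<in> Mod M x y i\<rbrakk>
      \<Longrightarrow> lact M x y z j i a (m + m') = lact M x y z j i a m + lact M x y z j i a m'"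
    and lact_scl_left: "\<lbrakk>x \<in> Ob C; y \<in> Ob C; z \<in> Ob C; a \<in> Hom C y z j; m \<in> Mod M x y i\<rbrakk>
      \<Longrightarrow> lact M x y z j i (scl C c a) m = mscl M c (lact M x y z j i a m)"
    and lact_scl_right: "\<lbrakk>x \<in> Ob C; y \<in> Ob C; z \<in> Ob C; a \<in> Hom C y z j; m \<in> Mod M x y i\<rbrakk>
      \<Longrightarrow> lact M x y z j i a (mscl M c m) = mscl M c (lact M x y z j i a m)"
    and ract_Mod: "\<lbrakk>x \<in> Ob C; y \<in> Ob C; z \<in> Ob C; m \<in> Mod M y z i; b \<in> Hom C x y j\<rbrakk>
      \<Longrightarrow> ract M x y z i j m b \<in> Mod M x z (i + j)"
    and ract_add_left: "\<lbrakk>x \<in> Ob C; y \<in> Ob C; z \<in> Ob C; m \<in> Mod M y z i; m' \<in> Mod M y z i;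
        b \<in> Hom C x y j\<rbrakk>
      \<Longrightarrow> ract M x y z i j (m + m') b = ract M x y z i j m b + ract M x y z i j m' b"
    and ract_add_right: "\<lbrakk>x \<in> Ob C; y \<in> Ob C; z \<in> Ob C; m \<in> Mod M y z i;
        b \<in> Hom C x y j; b' \<in> Hom C x y j\<rbrakk>
      \<Longrightarrow> ract M x y z i j m (b + b') = ract M x y z i j m b + ract M x y z i j m b'"
    and ract_scl_left: "\<lbrakk>x \<in> Ob C; y \<in> Ob C; z \<in> Ob C; m \<in> Mod M y z i; b \<in> Hom C x y j\<rbrakk>
      \<Longrightarrow> ract M x y z i j (mscl M c m) b = mscl M c (ract M x y z i j m b)"
    and ract_scl_right: "\<lbrakk>x \<in> Ob C; y \<in> Ob C; z \<in> Ob C; m \<in> Mod M y z i; b \<in> Hom C x y j\<rbrakk>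
      \<Longrightarrow> ract M x y z i j m (scl C c b) = mscl M c (ract M x y z i j m b)"
    and lact_idt: "\<lbrakk>x \<in> Ob C; y \<in> Ob C; m \<in> Mod M x y i\<rbrakk> \<Longrightarrow> lact M x y y 0 i (idt C y) m = m"
    and ract_idt: "\<lbrakk>x \<in> Ob C; y \<in> Ob C; m \<in> Mod M x y i\<rbrakk> \<Longrightarrow> ract M x x y i 0 m (idt C x) = m"
    and lact_cmp: "\<lbrakk>w \<in> Ob C; x \<in> Ob C; y \<in> Ob C; z \<in> Ob C; m \<in> Mod M w x i;
        a \<in> Hom C x y j; a' \<in> Hom C y z k\<rbrakk>
      \<Longrightarrow> lact M w y z k (i + j) a' (lact M w x y j i a m) = lact M w x z (j + k) i (cmp C a' a) m"
    and ract_cmp: "\<lbrakk>w \<in> Ob C; x \<in> Ob C; y \<in> Ob C; z \<in> Ob C; m \<in> Mod M y z i;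
        b \<in> Hom C x y j; b' \<in> Hom C w x k\<rbrakk>
      \<Longrightarrow> ract M w x z (i + j) k (ract M x y z i j m b) b' = ract M w y z i (j + k) m (cmp C b b')"
    and lact_ract: "\<lbrakk>w \<in> Ob C; x \<in> Ob C; y \<in> Ob C; z \<in> Ob C; b \<in> Hom C w x k;
        m \<in> Mod M x y i; a \<in> Hom C y z j\<rbrakk>
      \<Longrightarrow> lact M w y z j (i + k) a (ract M w x y i k m b)
        = ract M w x z (i + j) k (lact M x y z j i a m) b"
    and Leibniz_left: "\<lbrakk>x \<in> Ob C; y \<in> Ob C; z \<in> Ob C; a \<in> Hom C y z j; m \<in> Mod M x y i\<rbrakk>
      \<Longrightarrow> mdif M x z (i + j) (lact M x y z j i a m)
        = lact M x y z (j + 1) i (dif C y z j a) m + ksign j (lact M x y z j (i + 1) a (mdif M x y i m))"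
    and Leibniz_right: "\<lbrakk>x \<in> Ob C; y \<in> Ob C; z \<in> Ob C; m \<in> Mod M y z i; b \<in> Hom C x y j\<rbrakk>
      \<Longrightarrow> mdif M x z (i + j) (ract M x y z i j m b)
        = ract M x y z (i + 1) j (mdif M y z i m) b + ksign i (ract M x y z i (j + 1) m (dif C x y j b))"

definition mcocyc :: "('k, 'o, 'h, 'm::ab_group_add) dgbimod \<Rightarrow> int \<Rightarrow> 'o \<Rightarrow> 'o \<Rightarrow> 'm set" where
  "mcocyc M i x y = {m \<in> Mod M x y i. mdif M x y i m = 0}"

definition mcobnd :: "('k, 'o, 'h, 'm::ab_group_add) dgbimod \<Rightarrow> int \<Rightarrow> 'o \<Rightarrow> 'o \<Rightarrow> 'm set" where
  "mcobnd M i x y = mdif M x y (i - 1) ` Mod M x y (i - 1)"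

definition bimod_morphism :: "('k, 'o, 'h) dgcat \<Rightarrow> ('k, 'o, 'h, 'm::ab_group_add) dgbimod
    \<Rightarrow> ('k, 'o, 'h, 'l::ab_group_add) dgbimod \<Rightarrow> ('o \<Rightarrow> 'o \<Rightarrow> int \<Rightarrow> 'm \<Rightarrow> 'l) \<Rightarrow> bool" where
  "bimod_morphism C M N F \<longleftrightarrow>
     (\<forall>x\<in>Ob C. \<forall>y\<in>Ob C. \<forall>i. \<forall>m\<in>Mod M x y i.
        F x y i m \<in> Mod N x y i \<and>
        (\<forall>m'\<in>Mod M x y i. F x y i (m + m') = F x y i m + F x y i m') \<and>
        (\<forall>c. F x y i (mscl M c m) = mscl N c (F x y i m)) \<and>
        F x y (i + 1) (mdif M x y i m) = mdif N x y i (F x y i m)) \<and>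
     (\<forall>x\<in>Ob C. \<forall>y\<in>Ob C. \<forall>z\<in>Ob C. \<forall>i j. \<forall>m\<in>Mod M x y i. \<forall>a\<in>Hom C y z j.
        F x z (i + j) (lact M x y z j i a m) = lact N x y z j i a (F x y i m)) \<and>
     (\<forall>x\<in>Ob C. \<forall>y\<in>Ob C. \<forall>z\<in>Ob C. \<forall>i j. \<forall>m\<in>Mod M y z i. \<forall>b\<in>Hom C x y j.
        F x z (i + j) (ract M x y z i j m b) = ract N x y z i j (F y z i m) b)"

definition bimod_quasi_iso :: "('k, 'o, 'h) dgcat \<Rightarrow> ('k, 'o, 'h, 'm::ab_group_add) dgbimod
    \<Rightarrow> ('k, 'o, 'h, 'l::ab_group_add) dgbimod \<Rightarrow> ('o \<Rightarrow> 'o \<Rightarrow> int \<Rightarrow> 'm \<Rightarrow> 'l) \<Rightarrow> bool" where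
  "bimod_quasi_iso C M N F \<longleftrightarrow> bimod_morphism C M N F \<and>
     (\<forall>x\<in>Ob C. \<forall>y\<in>Ob C. \<forall>i.
        (\<forall>m\<in>mcocyc M i x y. F x y i m \<in> mcobnd N i x y \<longrightarrow> m \<in> mcobnd M i x y) \<and>
        (\<forall>l\<in>mcocyc N i x y. \<exists>m\<in>mcocyc M i x y. F x y i m - l \<in> mcobnd N i x y))"

text \<open>Equivalence of bimodules is isomorphism in the derived category of bimodules, i.e. a roof of
  quasi-isomorphisms \<open>M \<leftarrow> P \<rightarrow> N\<close>. The ambient type of \<open>P\<close> is fixed, but large enough when \<open>M\<close> is
  a shift of the diagonal bimodule: for \<open>P\<close> one can take the bar resolution, which is spanned by
  chains of composable morphisms, so that its components embed into the functions on
  \<open>'o list \<times> 'h list\<close>.\<close>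
definition bimod_equivalent :: "('k::field, 'o, 'h::ab_group_add) dgcat
    \<Rightarrow> ('k, 'o, 'h, 'm::ab_group_add) dgbimod \<Rightarrow> ('k, 'o, 'h, 'l::ab_group_add) dgbimod \<Rightarrow> bool" where
  "bimod_equivalent C M N \<longleftrightarrow>
     (\<exists>(P :: ('k, 'o, 'h, 'o list \<times> 'h list \<Rightarrow> 'k) dgbimod) F G.
        dg_bimodule C P \<and> bimod_quasi_iso C P M F \<and> bimod_quasi_iso C P N G)"

text \<open>The shift \<open>C[n]\<close> of the diagonal bimodule \<open>(x, y) \<mapsto> Hom(x,y)\<close>.\<close>
definition shifted_diagonal ::
  "('k, 'o, 'h::ab_group_add) dgcat \<Rightarrow> int \<Rightarrow> ('k, 'o, 'h, 'h) dgbimod" where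
  "shifted_diagonal C n =
    \<lparr>Mod = (\<lambda>x y i. Hom C x y (i + n)),
     mscl = scl C,
     mdif = (\<lambda>x y i m. ksign n (dif C x y (i + n) m)),
     lact = (\<lambda>x y z j i a m. ksign (n * j) (cmp C a m)),
     ract = (\<lambda>x y z i j m b. cmp C m b)\<rparr>"

text \<open>The dual \<open>(x, y) \<mapsto> Hom(y,x)\<^sup>\<or>\<close> of the diagonal bimodule, with the usual Koszul signs;
  functionals on \<open>Hom\<^sup>-\<^sup>i(y,x)\<close> are extended by zero to the ambient space.\<close>
definition dual_diagonal ::
  "('k::field, 'o, 'h::ab_group_add) dgcat \<Rightarrow> ('k, 'o, 'h, 'h \<Rightarrow> 'k) dgbimod" where
  "dual_diagonal C =
    \<lparr>Mod = (\<lambda>x y i. {\<phi>.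
        (\<forall>v\<in>Hom C y x (- i). \<forall>v'\<in>Hom C y x (- i). \<phi> (v + v') = \<phi> v + \<phi> v') \<and>
        (\<forall>v\<in>Hom C y x (- i). \<forall>c. \<phi> (scl C c v) = c * \<phi> v) \<and>
        (\<forall>v. v \<notin> Hom C y x (- i) \<longrightarrow> \<phi> v = 0)}),
     mscl = (\<lambda>c \<phi> v. c * \<phi> v),
     mdif = (\<lambda>x y i \<phi> v. if v \<in> Hom C y x (- (i + 1))
        then - ksign i (\<phi> (dif C y x (- (i + 1)) v)) else 0),
     lact = (\<lambda>x y z j i a \<phi> v. if v \<in> Hom C z x (- (i + j)) then ksign j (\<phi> (cmp C v a)) else 0),
     ract = (\<lambda>x y z i j \<phi> b v. if v \<in> Hom C z x (- (i + j)) then \<phi> (cmp C b v) else 0)\<rparr>"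

definition calabi_yau :: "('k::field, 'o, 'h::ab_group_add) dgcat \<Rightarrow> int \<Rightarrow> bool" where
  "calabi_yau C n \<longleftrightarrow> bimod_equivalent C (shifted_diagonal C n) (dual_diagonal C)"


section \<open>Hall algebras\<close>

text \<open>The complex vector space with basis \<open>B\<close>, with the bilinear product given on basis elements by
  \<open>p\<close> and with unit \<open>e \<in> B\<close>.\<close>
definition based_algebra :: "'b set \<Rightarrow> ('b \<Rightarrow> 'b \<Rightarrow> 'b \<Rightarrow>\<^sub>0 complex) \<Rightarrow> 'b
    \<Rightarrow> (complex, 'b \<Rightarrow>\<^sub>0 complex) module" where
  "based_algebra B p e =
    \<lparr>carrier = {u. Poly_Mapping.keys u \<subseteq> B},
     mult = (\<lambda>u v. \<Sum>z\<in>Poly_Mapping.keys u. \<Sum>x\<in>Poly_Mapping.keys v.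
        Poly_Mapping.map ((*) (Poly_Mapping.lookup u z * Poly_Mapping.lookup v x)) (p z x)),
     one = Poly_Mapping.single e 1,
     zero = 0,
     add = (+),
     smult = (\<lambda>c. Poly_Mapping.map ((*) c))\<rparr>"

definition algebra_embedding :: "(complex, 'u) module \<Rightarrow> (complex, 'v) module \<Rightarrow> ('u \<Rightarrow> 'v) \<Rightarrow> bool" where
  "algebra_embedding A B \<Phi> \<longleftrightarrow>
     \<Phi> \<in> ring_hom A B \<and>
     (\<forall>c. \<forall>u\<in>carrier A. \<Phi> (c \<odot>\<^bsub>A\<^esub> u) = c \<odot>\<^bsub>B\<^esub> \<Phi> u) \<and>
     inj_on \<Phi> (carrier A)"

definition full_additive_subcategory ::
  "('k, 'o, 'h::ab_group_add) dgcat \<Rightarrow> 'o set \<Rightarrow> bool" where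
  "full_additive_subcategory C E \<longleftrightarrow>
     E \<subseteq> Ob C \<and> (\<exists>x\<in>E. zero_object C x) \<and> (\<forall>x\<in>E. \<forall>y\<in>E. \<exists>s\<in>E. biproduct C x y s)"

definition induces_exact_structure ::
  "('k, 'o, 'h::ab_group_add) dgcat \<Rightarrow> 'o set \<Rightarrow> bool" where
  "induces_exact_structure C E \<longleftrightarrow>
     (\<forall>t. exact_triangle C t \<and> tx t \<in> E \<and> tz t \<in> E \<longrightarrow>
        ty t \<in> E \<and> mono_in C E (tx t) (ty t) (tf t) \<and> epi_in C E (ty t) (tz t) (tg t))"

definition zero_class :: "('k, 'o, 'h::ab_group_add) dgcat \<Rightarrow> 'o set \<Rightarrow> 'o set" where
  "zero_class C S = {x \<in> S. zero_object C x}"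

definition middle_term ::
  "('k, 'o, 'h::ab_group_add) dgcat \<Rightarrow> 'o set \<Rightarrow> 'o \<Rightarrow> 'o \<Rightarrow> 'h set \<Rightarrow> 'o set" where
  "middle_term C E z x \<delta> = iso_class C E
     (SOME y. \<exists>t. exact_triangle C t \<and> tx t = x \<and> ty t = y \<and> tz t = z \<and> connecting C t \<delta>)"

text \<open>The product \<open>m\<^sub>z \<cdot> m\<^sub>x\<close> in the rational Hall algebra; the arguments are isomorphism classes.\<close>
definition hall_prod :: "('k, 'o, 'h::ab_group_add) dgcat \<Rightarrow> 'o set
    \<Rightarrow> 'o set \<Rightarrow> 'o set \<Rightarrow> 'o set \<Rightarrow>\<^sub>0 rat" where
  "hall_prod C E Z X =
     (let z = (SOME z. z \<in> Z); x = (SOME x. x \<in> X)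
      in Poly_Mapping.map ((*) (1 / of_nat (card (Ext C 0 z x))))
           (\<Sum>\<delta>\<in>Ext C 1 z x. Poly_Mapping.single (middle_term C E z x \<delta>) 1))"

definition twisted_hall_prod :: "('k::{finite,field}, 'o, 'h::ab_group_add) dgcat \<Rightarrow> int \<Rightarrow> 'o set
    \<Rightarrow> 'o set \<Rightarrow> 'o set \<Rightarrow> 'o set \<Rightarrow>\<^sub>0 complex" where
  "twisted_hall_prod C n E Z X =
     (let z = (SOME z. z \<in> Z); x = (SOME x. x \<in> X);
          e = (if n \<ge> 1 then euler_form C {0..n} z x else - euler_form C {n + 1..- 1} z x)
      in Poly_Mapping.map (\<lambda>r. complex_of_real (real CARD('k) powr (e / 2)) * of_rat r)
           (hall_prod C E Z X))"

definition twisted_hall_algebra :: "('k::{finite,field}, 'o, 'h::ab_group_add) dgcat \<Rightarrow> int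
    \<Rightarrow> 'o set \<Rightarrow> (complex, 'o set \<Rightarrow>\<^sub>0 complex) module" where
  "twisted_hall_algebra C n E =
     based_algebra (Iso C E) (twisted_hall_prod C n E) (zero_class C E)"

definition hall_m :: "('k, 'o, 'h::ab_group_add) dgcat \<Rightarrow> 'o set \<Rightarrow> 'o \<Rightarrow> 'o set \<Rightarrow>\<^sub>0 complex" where
  "hall_m C E x = Poly_Mapping.single (iso_class C E x) 1"

definition rho :: "('k::field, 'o, 'h::ab_group_add) dgcat \<Rightarrow> ('o, 'h) tri \<Rightarrow> real" where
  "rho C t = real (ext_dim (triangles C) 0 t t)
     - real (quot_dim (\<lambda>k (a, b, c). (scl C k a, scl C k b, scl C k c))
         ((\<lambda>(a, b, c, u, v, w). (a, b, c)) ` cocyc (triangles C) 0 t t)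
         (cobnd C 0 (tx t) (tx t) \<times> cobnd C 0 (ty t) (ty t) \<times> cobnd C 0 (tz t) (tz t)))"

definition gamma :: "('k::field, 'o, 'h::ab_group_add) dgcat \<Rightarrow> int \<Rightarrow> ('o, 'h) tri \<Rightarrow> real" where
  "gamma C n t = rho C t +
     (if n \<ge> - 1 then euler_form (triangles C) {0..n} t t
      else - euler_form (triangles C) {n + 1..- 1} t t)"

text \<open>The product \<open>h\<^sub>z \<cdot> h\<^sub>x\<close>, with the isomorphism classes of \<open>z\<close> and \<open>x\<close> as arguments. A class of
  triangles has outer terms \<open>x\<close> and \<open>z\<close> if it contains a triangle with these outer terms.\<close>
definition cy_hall_prod :: "('k::{finite,field}, 'o, 'h::ab_group_add) dgcat \<Rightarrow> int
    \<Rightarrow> 'o set \<Rightarrow> 'o set \<Rightarrow> 'o set \<Rightarrow>\<^sub>0 complex" where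
  "cy_hall_prod C n Z X =
     (let z = (SOME z. z \<in> Z); x = (SOME x. x \<in> X)
      in \<Sum>U | U \<in> Iso (triangles C) (Ob (triangles C)) \<and> (\<exists>t\<in>U. tx t = x \<and> tz t = z).
           let t = (SOME t. t \<in> U); y = ty t
           in Poly_Mapping.single (iso_class C (Ob C) y)
                (complex_of_real
                   (sqrt (real (card (Aut C x)) * real (card (Aut C y)) * real (card (Aut C z)))
                    / real (card (Aut (triangles C) t)) * real CARD('k) powr (gamma C n t / 2))))"

definition cy_hall_algebra :: "('k::{finite,field}, 'o, 'h::ab_group_add) dgcat \<Rightarrow> int
    \<Rightarrow> (complex, 'o set \<Rightarrow>\<^sub>0 complex) module" where
  "cy_hall_algebra C n =
     based_algebra (Iso C (Ob C)) (cy_hall_prod C n) (zero_class C (Ob C))"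

definition hall_a :: "('k, 'o, 'h::ab_group_add) dgcat \<Rightarrow> 'o \<Rightarrow> 'o set \<Rightarrow>\<^sub>0 complex" where
  "hall_a C x = Poly_Mapping.single (iso_class C (Ob C) x) (complex_of_real (sqrt (real (card (Aut C x)))))"

end

theory Submission
  imports Defs "HOL-Library.FuncSet"
begin

text \<open>The subcategory \<open>E\<close> is closed under isomorphism, because an isomorphism \<open>x \<rightarrow> y\<close> sits in a
  triangle \<open>x \<rightarrow> y \<rightarrow> 0\<close>. Hence classes in \<open>E\<close> are classes in \<open>C\<close>, the map \<open>m\<^sub>z \<mapsto> a\<^sub>z\<close> merely
  rescales basis vectors by \<open>sqrt |Aut z|\<close>, and only the structure constants have to be compared.
  For a triangle \<open>t\<close> with outer terms \<open>x, z\<close> in \<open>E\<close> this comes down to two identities.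

  \<^bold>\<open>The number of extension classes.\<close> Every \<open>\<delta> \<in> Ext\<^sup>1(z,x)\<close> is the connecting morphism of a
  triangle, namely of a rotated cone (\<open>triangle_of_extension\<close>), and triangles with the same \<open>\<delta>\<close>
  are isomorphic (\<open>connecting_iso\<close>). The classes \<open>\<delta>\<close> with triangle isomorphic to \<open>t\<close> are counted
  by \<open>|{\<delta>}| |Aut t| = |Aut x| |Aut z| |Hom(z,x)|\<close> (\<open>orbit_count\<close>): isomorphisms from \<open>t\<close> to the
  chosen triangles map to pairs of automorphisms of \<open>x\<close> and \<open>z\<close>; such a pair determines \<open>\<delta>\<close> and
  lifts to an isomorphism, and the lifts form a torsor under \<open>Hom(z,x)\<close>. The action is free
  because the triangle lies in \<open>E\<close>: composites of the connecting morphism with morphisms of degree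
  -1 are killed by a monomorphism or an epimorphism.

  \<^bold>\<open>The exponent.\<close> It has to be shown that \<open>\<gamma>(t)\<close> is the Euler form of \<open>z, x\<close> in the range of the
  twist. First, \<open>\<rho>(t) = 0\<close>, since in \<open>E\<close> an endomorphism of \<open>t\<close> with null components is null
  (\<open>E_rho\<close>). For the other summand there is a long exact sequence \<open>Ext\<^sup>m(z,x) \<rightarrow> Ext\<^sup>m(t,t) \<rightarrow>
  Ext\<^sup>m(x,x) \<oplus> Ext\<^sup>m(z,z) \<rightarrow> Ext\<^sup>m\<^sup>+\<^sup>1(z,x)\<close> (\<open>Ext_triangles_count\<close>). In the alternating sum of
  dimensions, the ranks of its connecting maps telescope and leave only those in degrees \<open>-1\<close> and
  \<open>n\<close>. The former vanishes by the exactness of \<open>E\<close>, the latter because Calabi-Yau duality turns it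
  into the former. The contributions of \<open>x\<close> and \<open>z\<close> cancel, since duality gives \<open>dim
  Ext\<^sup>n\<^sup>-\<^sup>m(x,x) = dim Ext\<^sup>m(x,x)\<close> and \<open>n\<close> is odd (\<open>E_euler_form\<close>).

  The long exact sequence itself rests on explicit homotopies. An acyclic three-term complex is
  contractible, and the entries of a contraction yield the connecting morphism, the partial lifts
  of outer components, and the comparison of the remaining morphisms with \<open>Hom(z,x)\<close>.\<close>

  section \<open>Graded morphism spaces and Koszul signs\<close>

  lemma ksign_simps [simp]: "ksign i (0::'v::ab_group_add) = 0" "ksign i (- v) = - ksign i v"
  "ksign i (v + w) = ksign i v + ksign i w" "ksign i (v - w) = ksign i v - ksign i w" "ksign i
  (ksign j v) = ksign (i + j) v" "ksign 0 v = v" by (auto simp: ksign_def)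

  lemma ksign_shift [simp]: "ksign (i + 1) v = - ksign i (v::'v::ab_group_add)" "ksign (1 + i) v =
  - ksign i (v::'v::ab_group_add)" "ksign (i - 1) v = - ksign i (v::'v::ab_group_add)" "ksign (i +
  2) v = ksign i (v::'v::ab_group_add)" "ksign (i - 2) v = ksign i (v::'v::ab_group_add)" "ksign 1
  v = - v" "ksign (- 1) v = - v" "ksign (i + i) v = v" by (auto simp: ksign_def)

  context dg_category begin

  text \<open>Membership records that both objects belong to \<open>C\<close>, so that sums, composites and
  differentials can be typed by the rules \<open>homI\<close> without side conditions on objects.\<close>
definition hom :: "'o \<Rightarrow> 'o \<Rightarrow> int \<Rightarrow> 'h set" where
  "hom x y i = {f. x \<in> Ob C \<and> y \<in> Ob C \<and> f \<in> Hom C x y i}"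

abbreviation comp (infixl "\<cdot>" 70) where "g \<cdot> f \<equiv> cmp C g f"

sublocale V: vector_space "scl C"
  by (rule vector_space)

lemma subspace: "x \<in> Ob C \<Longrightarrow> y \<in> Ob C \<Longrightarrow> V.subspace (Hom C x y i)"
  by (rule Hom_subspace)

lemma homD: "f \<in> hom x y i \<Longrightarrow> x \<in> Ob C" "f \<in> hom x y i \<Longrightarrow> y \<in> Ob C"
  "f \<in> hom x y i \<Longrightarrow> f \<in> Hom C x y i"
  by (auto simp: hom_def)

lemma hom_zero: "x \<in> Ob C \<Longrightarrow> y \<in> Ob C \<Longrightarrow> 0 \<in> hom x y i"
  using V.subspace_0[OF subspace] by (simp add: hom_def)

lemma hom_add: "f \<in> hom x y i \<Longrightarrow> g \<in> hom x y i \<Longrightarrow> f + g \<in> hom x y i"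
  using V.subspace_add[OF subspace] by (auto simp: hom_def)

lemma hom_scl: "f \<in> hom x y i \<Longrightarrow> scl C c f \<in> hom x y i"
  using V.subspace_scale[OF subspace] by (auto simp: hom_def)

lemma hom_diff: "f \<in> hom x y i \<Longrightarrow> g \<in> hom x y i \<Longrightarrow> f - g \<in> hom x y i"
  using V.subspace_diff[OF subspace] by (auto simp: hom_def)

lemma hom_minus: "f \<in> hom x y i \<Longrightarrow> - f \<in> hom x y i"
  using V.subspace_neg[OF subspace] by (auto simp: hom_def)

lemma hom_ksign: "f \<in> hom x y i \<Longrightarrow> ksign j f \<in> hom x y i"
  by (auto simp: ksign_def hom_minus)

lemma hom_cmp: "f \<in> hom x y i \<Longrightarrow> g \<in> hom y z j \<Longrightarrow> k = i + j \<Longrightarrow> g \<cdot> f \<in> hom x z k"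
  using cmp_Hom by (auto simp: hom_def)

lemma hom_dif: "f \<in> hom x y i \<Longrightarrow> k = i + 1 \<Longrightarrow> dif C x y i f \<in> hom x y k"
  using dif_Hom by (auto simp: hom_def)

lemma hom_idt: "x \<in> Ob C \<Longrightarrow> idt C x \<in> hom x x 0"
  using idt_Hom by (auto simp: hom_def)

text \<open>The degree of a composite is a variable constrained by an equation, so that resolution never
  has to unify integer expressions.\<close>
lemmas homI = hom_zero hom_add hom_diff hom_minus hom_ksign hom_cmp hom_dif hom_idt

lemma add_left: "f \<in> hom x y i \<Longrightarrow> g \<in> hom y z j \<Longrightarrow> g' \<in> hom y z j
    \<Longrightarrow> (g + g') \<cdot> f = g \<cdot> f + g' \<cdot> f"
  using cmp_add_left by (auto simp: hom_def)

lemma add_right: "g \<in> hom y z j \<Longrightarrow> f \<in> hom x y i \<Longrightarrow> f' \<in> hom x y i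
    \<Longrightarrow> g \<cdot> (f + f') = g \<cdot> f + g \<cdot> f'"
  using cmp_add_right by (auto simp: hom_def)

lemma zero_left: "f \<in> hom x y i \<Longrightarrow> 0 \<cdot> f = 0"
  using add_left[of f x y i 0 y 0 0] hom_zero[of y y 0] homD(1,2)[of f x y i] by simp

lemma zero_right: "g \<in> hom y z j \<Longrightarrow> g \<cdot> 0 = 0"
  using add_right[of g y z j 0 y 0 0] hom_zero[of y y 0] homD(1,2)[of g y z j] by simp

lemma minus_left: "f \<in> hom x y i \<Longrightarrow> g \<in> hom y z j \<Longrightarrow> (- g) \<cdot> f = - (g \<cdot> f)"
  using add_left[of f x y i g z j "- g"] hom_minus[of g y z j] zero_left[of f x y i]
  by (metis add.right_inverse minus_unique)

lemma minus_right: "g \<in> hom y z j \<Longrightarrow> f \<in> hom x y i \<Longrightarrow> g \<cdot> (- f) = - (g \<cdot> f)"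
  using add_right[of g y z j f x i "- f"] hom_minus[of f x y i] zero_right[of g y z j]
  by (metis add.right_inverse minus_unique)

lemma diff_left: "f \<in> hom x y i \<Longrightarrow> g \<in> hom y z j \<Longrightarrow> g' \<in> hom y z j
    \<Longrightarrow> (g - g') \<cdot> f = g \<cdot> f - g' \<cdot> f"
  using add_left[of f x y i g z j "- g'"] hom_minus[of g' y z j] minus_left[of f x y i g' z j] by simp

lemma diff_right: "g \<in> hom y z j \<Longrightarrow> f \<in> hom x y i \<Longrightarrow> f' \<in> hom x y i
    \<Longrightarrow> g \<cdot> (f - f') = g \<cdot> f - g \<cdot> f'"
  using add_right[of g y z j f x i "- f'"] hom_minus[of f' x y i] minus_right[of g y z j f' x i] by simp

lemma ksign_left: "f \<in> hom x y i \<Longrightarrow> g \<in> hom y z j \<Longrightarrow> (ksign k g) \<cdot> f = ksign k (g \<cdot> f)"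
  by (simp add: ksign_def minus_left)

lemma ksign_right: "g \<in> hom y z j \<Longrightarrow> f \<in> hom x y i \<Longrightarrow> g \<cdot> (ksign k f) = ksign k (g \<cdot> f)"
  by (simp add: ksign_def minus_right)

lemma assoc: "f \<in> hom w x i \<Longrightarrow> g \<in> hom x y j \<Longrightarrow> h \<in> hom y z k
    \<Longrightarrow> (h \<cdot> g) \<cdot> f = h \<cdot> (g \<cdot> f)"
  using cmp_assoc by (auto simp: hom_def)

lemma idt_left: "f \<in> hom x y i \<Longrightarrow> idt C y \<cdot> f = f"
  using cmp_idt_left by (auto simp: hom_def)

lemma idt_right: "f \<in> hom x y i \<Longrightarrow> f \<cdot> idt C x = f"
  using cmp_idt_right by (auto simp: hom_def)

lemma d_add: "f \<in> hom x y i \<Longrightarrow> g \<in> hom x y i \<Longrightarrow> dif C x y i (f + g) = dif C x y i f + dif C x y i g"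
  using dif_add by (auto simp: hom_def)

lemma d_zero: "x \<in> Ob C \<Longrightarrow> y \<in> Ob C \<Longrightarrow> dif C x y i 0 = 0"
  using d_add[of 0 x y i 0] hom_zero[of x y i] by simp

lemma d_minus: "f \<in> hom x y i \<Longrightarrow> dif C x y i (- f) = - dif C x y i f"
  using d_add[of f x y i "- f"] hom_minus[of f x y i] d_zero[of x y i] homD(1,2)[of f x y i]
  by (metis add.right_inverse minus_unique)

lemma d_diff: "f \<in> hom x y i \<Longrightarrow> g \<in> hom x y i \<Longrightarrow> dif C x y i (f - g) = dif C x y i f - dif C x y i g"
  using d_add[of f x y i "- g"] hom_minus[of g x y i] d_minus[of g x y i] by simp

lemma d_ksign: "f \<in> hom x y i \<Longrightarrow> dif C x y i (ksign k f) = ksign k (dif C x y i f)"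
  by (simp add: ksign_def d_minus)

lemma d_d: "f \<in> hom x y i \<Longrightarrow> k = i + 1 \<Longrightarrow> dif C x y k (dif C x y i f) = 0"
  using dif_dif by (auto simp: hom_def)

lemma d_cmp: "f \<in> hom x y i \<Longrightarrow> g \<in> hom y z j \<Longrightarrow> k = i + j
    \<Longrightarrow> dif C x z k (g \<cdot> f) = dif C y z j g \<cdot> f + ksign j (g \<cdot> dif C x y i f)"
  using Leibniz by (auto simp: hom_def)

lemmas dg_simps = add_left add_right minus_left minus_right diff_left diff_right ksign_left ksign_right
  zero_left zero_right d_add d_minus d_diff d_ksign d_d d_cmp assoc

lemma scl_right: "g \<in> hom y z j \<Longrightarrow> f \<in> hom x y i \<Longrightarrow> g \<cdot> scl C c f = scl C c (g \<cdot> f)"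
  using cmp_scl_right by (auto simp: hom_def)

lemma scl_left: "f \<in> hom x y i \<Longrightarrow> g \<in> hom y z j \<Longrightarrow> scl C c g \<cdot> f = scl C c (g \<cdot> f)"
  using cmp_scl_left by (auto simp: hom_def)

lemma d_scl: "f \<in> hom x y i \<Longrightarrow> dif C x y i (scl C c f) = scl C c (dif C x y i f)"
  using dif_scl by (auto simp: hom_def)

lemma scl_ksign: "scl C c (ksign k f) = ksign k (scl C c f)"
  by (simp add: ksign_def)

section \<open>Cocycles, coboundaries and homotopy inverses\<close>

definition cyc :: "'o \<Rightarrow> 'o \<Rightarrow> int \<Rightarrow> 'h set" where
  "cyc x y i = {f \<in> hom x y i. dif C x y i f = 0}"

definition bnd :: "'o \<Rightarrow> 'o \<Rightarrow> int \<Rightarrow> 'h set" where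
  "bnd x y i = dif C x y (i - 1) ` hom x y (i - 1)"

lemma cocyc_eq: "x \<in> Ob C \<Longrightarrow> y \<in> Ob C \<Longrightarrow> cocyc C i x y = cyc x y i"
  by (auto simp: cocyc_def cyc_def hom_def)

lemma cobnd_eq: "x \<in> Ob C \<Longrightarrow> y \<in> Ob C \<Longrightarrow> cobnd C i x y = bnd x y i"
  by (auto simp: cobnd_def bnd_def hom_def)

lemma cycI: "f \<in> hom x y i \<Longrightarrow> dif C x y i f = 0 \<Longrightarrow> f \<in> cyc x y i"
  by (simp add: cyc_def)

lemma cycD: "f \<in> cyc x y i \<Longrightarrow> f \<in> hom x y i" "f \<in> cyc x y i \<Longrightarrow> dif C x y i f = 0"
  by (simp_all add: cyc_def)

lemma bndI: "e \<in> hom x y j \<Longrightarrow> i = j + 1 \<Longrightarrow> dif C x y j e = f \<Longrightarrow> f \<in> bnd x y i"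
  by (auto simp: bnd_def)

lemma bndE:
  assumes "f \<in> bnd x y i" obtains e where "e \<in> hom x y (i - 1)" "dif C x y (i - 1) e = f"
  using assms by (auto simp: bnd_def)

lemma cyc_subspace: "x \<in> Ob C \<Longrightarrow> y \<in> Ob C \<Longrightarrow> V.subspace (cyc x y i)"
  unfolding V.subspace_def
  by (auto simp: cyc_def hom_zero d_zero hom_add d_add hom_scl d_scl)

lemma bnd_subspace: "x \<in> Ob C \<Longrightarrow> y \<in> Ob C \<Longrightarrow> V.subspace (bnd x y i)"
  unfolding V.subspace_def bnd_def
proof (intro conjI ballI allI, goal_cases)
  case 1 then show ?case by (metis d_zero hom_zero image_eqI)
next
  case (2 f g) then show ?case by (auto simp flip: d_add intro!: imageI hom_add)
next
  case (3 c f) then show ?case by (auto simp flip: d_scl intro!: imageI hom_scl)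
qed

lemma cyc_ob: "f \<in> cyc x y i \<Longrightarrow> x \<in> Ob C" "f \<in> cyc x y i \<Longrightarrow> y \<in> Ob C"
  by (auto simp: cyc_def hom_def)
lemma bnd_ob: "f \<in> bnd x y i \<Longrightarrow> x \<in> Ob C" "f \<in> bnd x y i \<Longrightarrow> y \<in> Ob C"
  by (auto simp: bnd_def hom_def)

lemma cyc_zero: "x \<in> Ob C \<Longrightarrow> y \<in> Ob C \<Longrightarrow> 0 \<in> cyc x y i"
  by (rule V.subspace_0[OF cyc_subspace])
lemma bnd_zero: "x \<in> Ob C \<Longrightarrow> y \<in> Ob C \<Longrightarrow> 0 \<in> bnd x y i"
  by (rule V.subspace_0[OF bnd_subspace])
lemma cyc_add: "f \<in> cyc x y i \<Longrightarrow> g \<in> cyc x y i \<Longrightarrow> f + g \<in> cyc x y i"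
  using V.subspace_add[OF cyc_subspace] cyc_ob by blast
lemma bnd_add: "f \<in> bnd x y i \<Longrightarrow> g \<in> bnd x y i \<Longrightarrow> f + g \<in> bnd x y i"
  using V.subspace_add[OF bnd_subspace] bnd_ob by blast
lemma cyc_diff: "f \<in> cyc x y i \<Longrightarrow> g \<in> cyc x y i \<Longrightarrow> f - g \<in> cyc x y i"
  using V.subspace_diff[OF cyc_subspace] cyc_ob by blast
lemma bnd_diff: "f \<in> bnd x y i \<Longrightarrow> g \<in> bnd x y i \<Longrightarrow> f - g \<in> bnd x y i"
  using V.subspace_diff[OF bnd_subspace] bnd_ob by blast
lemma cyc_minus: "f \<in> cyc x y i \<Longrightarrow> - f \<in> cyc x y i"
  using V.subspace_neg[OF cyc_subspace] cyc_ob by blast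
lemma bnd_minus: "f \<in> bnd x y i \<Longrightarrow> - f \<in> bnd x y i"
  using V.subspace_neg[OF bnd_subspace] bnd_ob by blast
lemma bnd_minus_iff: "- f \<in> bnd x y i \<longleftrightarrow> f \<in> bnd x y i"
  using bnd_minus by fastforce
lemma cyc_ksign: "f \<in> cyc x y i \<Longrightarrow> ksign k f \<in> cyc x y i"
  by (simp add: ksign_def cyc_minus)
lemma bnd_ksign: "f \<in> bnd x y i \<Longrightarrow> ksign k f \<in> bnd x y i"
  by (simp add: ksign_def bnd_minus)
lemma bnd_ksign_iff: "ksign k f \<in> bnd x y i \<longleftrightarrow> f \<in> bnd x y i"
  by (simp add: ksign_def bnd_minus_iff)

lemma bnd_sym: "f - g \<in> bnd x y i \<longleftrightarrow> g - f \<in> bnd x y i"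
  by (metis bnd_minus_iff minus_diff_eq)

lemma bnd_cyc: "f \<in> bnd x y i \<Longrightarrow> f \<in> cyc x y i"
  by (auto simp: bnd_def cyc_def intro!: hom_dif d_d)

lemma cyc_cmp: "f \<in> cyc x y i \<Longrightarrow> g \<in> cyc y z j \<Longrightarrow> k = i + j \<Longrightarrow> g \<cdot> f \<in> cyc x z k"
  using zero_left[of f x y i] zero_right[of g y z j]
  by (auto simp: cyc_def intro: hom_cmp) (simp add: d_cmp)

lemma bnd_cmp_left: "f \<in> cyc x y i \<Longrightarrow> g \<in> bnd y z j \<Longrightarrow> k = i + j \<Longrightarrow> g \<cdot> f \<in> bnd x z k"
proof (elim bndE)
  fix e assume a: "f \<in> cyc x y i" "k = i + j" "e \<in> hom y z (j - 1)" "dif C y z (j - 1) e = g"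
  note f = cycD[OF a(1)]
  show ?thesis
    by (rule bndI[of "e \<cdot> f" _ _ "i + (j - 1)"])
      (use a f zero_right[OF a(3)] in \<open>auto simp: d_cmp[OF f(1) a(3) refl] intro!: hom_cmp\<close>)
qed

lemma bnd_cmp_right: "f \<in> bnd x y i \<Longrightarrow> g \<in> cyc y z j \<Longrightarrow> k = i + j \<Longrightarrow> g \<cdot> f \<in> bnd x z k"
proof (elim bndE)
  fix e assume a: "g \<in> cyc y z j" "k = i + j" "e \<in> hom x y (i - 1)" "dif C x y (i - 1) e = f"
  note g = cycD[OF a(1)]
  have "ksign j (g \<cdot> f) \<in> bnd x z k"
    by (rule bndI[of "g \<cdot> e" _ _ "(i - 1) + j"])
      (use a g zero_left[OF a(3)] in \<open>auto simp: d_cmp[OF a(3) g(1) refl] intro!: hom_cmp\<close>)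
  then show ?thesis by (simp add: bnd_ksign_iff)
qed

lemma bnd_trans: "f - g \<in> bnd x y i \<Longrightarrow> g - h \<in> bnd x y i \<Longrightarrow> f - h \<in> bnd x y i"
  using bnd_add[of "f - g" x y i "g - h"] by simp

lemma cyc_idt: "x \<in> Ob C \<Longrightarrow> idt C x \<in> cyc x x 0"
proof -
  assume x: "x \<in> Ob C"
  note i = hom_idt[OF x]
  have "dif C x x 0 (idt C x) = dif C x x 0 (idt C x) + dif C x x 0 (idt C x)"
    using d_cmp[OF i i, of 0] idt_left[OF i] idt_right[OF hom_dif[OF i]] idt_left[OF hom_dif[OF i]] by simp
  then show ?thesis using i by (simp add: cyc_def)
qed

lemma ecls_eq_iff:
  assumes "f \<in> cyc x y i" "g \<in> cyc x y i"
  shows "ecls C i x y f = ecls C i x y g \<longleftrightarrow> f - g \<in> bnd x y i"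
proof -
  note o = cyc_ob[OF assms(1)]
  show ?thesis unfolding ecls_def cocyc_eq[OF o] cobnd_eq[OF o]
  proof
    assume "{g \<in> cyc x y i. g - f \<in> bnd x y i} = {h \<in> cyc x y i. h - g \<in> bnd x y i}"
    moreover have "f \<in> {g \<in> cyc x y i. g - f \<in> bnd x y i}" using assms o by (simp add: bnd_zero)
    ultimately show "f - g \<in> bnd x y i" by blast
  next
    assume b: "f - g \<in> bnd x y i"
    then have b': "g - f \<in> bnd x y i" by (simp add: bnd_sym)
    show "{g \<in> cyc x y i. g - f \<in> bnd x y i} = {h \<in> cyc x y i. h - g \<in> bnd x y i}"
      using bnd_trans[OF _ b] bnd_trans[OF _ b'] by blast
  qed
qed

lemma ecls_self: "f \<in> cyc x y i \<Longrightarrow> f \<in> ecls C i x y f"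
  by (simp add: ecls_def cocyc_eq cobnd_eq cyc_ob bnd_zero)

lemma mem_ecls:
  assumes "x \<in> Ob C" "y \<in> Ob C"
  shows "g \<in> ecls C i x y f \<longleftrightarrow> g \<in> cyc x y i \<and> g - f \<in> bnd x y i"
  using assms by (simp add: ecls_def cocyc_eq cobnd_eq)

lemma inverse_pair_iff:
  assumes "x \<in> Ob C" "y \<in> Ob C"
  shows "inverse_pair C i x y f g \<longleftrightarrow> f \<in> cyc x y i \<and> g \<in> cyc y x (- i) \<and>
    g \<cdot> f - idt C x \<in> bnd x x 0 \<and> f \<cdot> g - idt C y \<in> bnd y y 0"
proof -
  have "g \<cdot> f \<in> cyc x x 0" "f \<cdot> g \<in> cyc y y 0" if "f \<in> cyc x y i" "g \<in> cyc y x (- i)"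
    using cyc_cmp[OF that] cyc_cmp[OF that(2,1)] by simp_all
  then have "ecls C 0 x x (g \<cdot> f) = ecls C 0 x x (idt C x) \<longleftrightarrow> g \<cdot> f - idt C x \<in> bnd x x 0"
    "ecls C 0 y y (f \<cdot> g) = ecls C 0 y y (idt C y) \<longleftrightarrow> f \<cdot> g - idt C y \<in> bnd y y 0"
    if "f \<in> cyc x y i" "g \<in> cyc y x (- i)"
    using that assms cyc_idt ecls_eq_iff by blast+
  then show ?thesis
    unfolding inverse_pair_def cocyc_eq[OF assms] cocyc_eq[OF assms(2,1)] by blast
qed

lemma inverse_pair_sym: "inverse_pair C 0 x y f g \<Longrightarrow> inverse_pair C 0 y x g f"
  by (simp add: inverse_pair_def)

text \<open>A left and a right homotopy inverse agree up to homotopy.\<close>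
lemma inverse_pairI:
  assumes f: "f \<in> cyc x y 0" and l: "l \<in> cyc y x 0" and r: "r \<in> cyc y x 0"
    and lf: "l \<cdot> f - idt C x \<in> bnd x x 0" and fr: "f \<cdot> r - idt C y \<in> bnd y y 0"
  shows "inverse_pair C 0 x y f l"
proof -
  note O = cyc_ob[OF f]
  note h = cycD(1)[OF f] cycD(1)[OF l] cycD(1)[OF r] cyc_idt[OF O(1), THEN cycD(1)] cyc_idt[OF O(2), THEN cycD(1)]
  have lr: "l \<cdot> f \<in> hom x x 0" "f \<cdot> r \<in> hom y y 0" "f \<cdot> l \<in> hom y y 0" by (rule h homI | simp)+
  have "(l \<cdot> f - idt C x) \<cdot> r \<in> bnd y x 0" by (rule bnd_cmp_left[OF r lf]) simp
  moreover have "l \<cdot> (f \<cdot> r - idt C y) \<in> bnd y x 0" by (rule bnd_cmp_right[OF fr l]) simp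
  ultimately have "(l \<cdot> f - idt C x) \<cdot> r - l \<cdot> (f \<cdot> r - idt C y) \<in> bnd y x 0" by (rule bnd_diff)
  also have "(l \<cdot> f - idt C x) \<cdot> r - l \<cdot> (f \<cdot> r - idt C y) = l - r"
    using h lr by (simp add: diff_left diff_right assoc idt_left idt_right)
  finally have "f \<cdot> (l - r) \<in> bnd y y 0" by (rule bnd_cmp_right[OF _ f]) simp
  then have "f \<cdot> l - f \<cdot> r \<in> bnd y y 0" using h by (simp add: diff_right)
  then have "f \<cdot> l - idt C y \<in> bnd y y 0" using fr by (rule bnd_trans)
  then show ?thesis using assms O by (simp add: inverse_pair_iff)
qed

text \<open>If \<open>g f = 1 + N\<close> and \<open>f g = 1 + N'\<close> with \<open>N\<^sup>2\<close> and \<open>N'\<^sup>2\<close> null-homotopic, then \<open>(1 - N) g\<close>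
  and \<open>g (1 - N')\<close> are one-sided homotopy inverses of \<open>f\<close>. This is how invertibility of the outer
  components of a morphism of triangles is transferred to the morphism.\<close>
lemma inverse_pair_of_unipotent:
  assumes f: "f \<in> cyc x y 0" and g: "g \<in> cyc y x 0"
    and K1: "(g \<cdot> f - idt C x) \<cdot> (g \<cdot> f - idt C x) \<in> bnd x x 0"
    and K2: "(f \<cdot> g - idt C y) \<cdot> (f \<cdot> g - idt C y) \<in> bnd y y 0"
  shows "\<exists>g'. inverse_pair C 0 x y f g'"
proof -
  note O = cyc_ob[OF f]
  note h = cycD(1)[OF f] cycD(1)[OF g] cyc_idt[OF O(1), THEN cycD(1)] cyc_idt[OF O(2), THEN cycD(1)]
  have gf: "g \<cdot> f \<in> cyc x x 0" "f \<cdot> g \<in> cyc y y 0" using cyc_cmp[OF f g] cyc_cmp[OF g f] by simp_all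
  note h' = cycD(1)[OF gf(1)] cycD(1)[OF gf(2)]
  have M: "g \<cdot> f - idt C x \<in> cyc x x 0" "f \<cdot> g - idt C y \<in> cyc y y 0"
    by (intro cyc_diff gf cyc_idt O)+
  note hM = cycD(1)[OF M(1)] cycD(1)[OF M(2)]
  have L: "(idt C x - (g \<cdot> f - idt C x)) \<cdot> g \<in> cyc y x 0"
    by (rule cyc_cmp[OF g cyc_diff[OF cyc_idt[OF O(1)] M(1)]]) simp
  have R: "g \<cdot> (idt C y - (f \<cdot> g - idt C y)) \<in> cyc y x 0"
    by (rule cyc_cmp[OF cyc_diff[OF cyc_idt[OF O(2)] M(2)] g]) simp
  have p: "g \<cdot> (f \<cdot> g) \<in> hom y x 0" "g \<cdot> (f \<cdot> (g \<cdot> f)) \<in> hom x x 0" "f \<cdot> (g \<cdot> (f \<cdot> g)) \<in> hom y y 0"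
     "f \<cdot> (g \<cdot> f) \<in> hom x y 0" "g - (g \<cdot> (f \<cdot> g) - g) \<in> hom y x 0" "g \<cdot> (f \<cdot> g) - g \<in> hom y x 0"
    by (rule h h' homI | simp)+
  have "((idt C x - (g \<cdot> f - idt C x)) \<cdot> g) \<cdot> f - idt C x = - ((g \<cdot> f - idt C x) \<cdot> (g \<cdot> f - idt C x))"
    using h h' hM p by (simp add: diff_left diff_right assoc idt_left idt_right)
  moreover have "f \<cdot> (g \<cdot> (idt C y - (f \<cdot> g - idt C y))) - idt C y = - ((f \<cdot> g - idt C y) \<cdot> (f \<cdot> g - idt C y))"
    using h h' hM p by (simp add: diff_left diff_right assoc idt_left idt_right)
  ultimately have "inverse_pair C 0 x y f ((idt C x - (g \<cdot> f - idt C x)) \<cdot> g)"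
    by (intro inverse_pairI[OF f L R]) (simp_all add: bnd_minus_iff K1 K2)
  then show ?thesis by blast
qed

end

section \<open>Columns and morphisms of three-term complexes\<close>

text \<open>A separate locale for facts about triangles: the category of triangles is itself interpreted
  as a \<^const>\<open>dg_category\<close>, and this interpretation should not repeat the theory of triangles.\<close>
locale dg_triangles = dg_category C for C :: "('k::field, 'o, 'h::ab_group_add) dgcat"

lemma ksign_Pair: "ksign k (a::'a::ab_group_add, b::'b::ab_group_add) = (ksign k a, ksign k b)"
  by (simp add: ksign_def)

context dg_triangles
begin

text \<open>The closed part of \<^const>\<open>exact_triangle\<close>: all sign computations with \<open>d h = - g f\<close> hold without
  acyclicity.\<close>
definition precomplex :: "('o, 'h) tri \<Rightarrow> bool" where
  "precomplex t \<longleftrightarrow>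
     tx t \<in> Ob C \<and> ty t \<in> Ob C \<and> tz t \<in> Ob C \<and>
     tf t \<in> cocyc C 0 (tx t) (ty t) \<and> tg t \<in> cocyc C 0 (ty t) (tz t) \<and>
     th t \<in> Hom C (tx t) (tz t) (- 1) \<and>
     dif C (tx t) (tz t) (- 1) (th t) + cmp C (tg t) (tf t) = 0"

lemma precomplexD:
  assumes "precomplex t"
  shows "tx t \<in> Ob C" "ty t \<in> Ob C" "tz t \<in> Ob C"
    "tf t \<in> hom (tx t) (ty t) 0" "tg t \<in> hom (ty t) (tz t) 0" "th t \<in> hom (tx t) (tz t) (- 1)"
    "dif C (tx t) (ty t) 0 (tf t) = 0" "dif C (ty t) (tz t) 0 (tg t) = 0"
    "dif C (tx t) (tz t) (- 1) (th t) = - (tg t \<cdot> tf t)"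
  using assms by (auto simp: precomplex_def cocyc_def hom_def eq_neg_iff_add_eq_0)

definition tothom :: "('o, 'h) tri \<Rightarrow> 'o \<Rightarrow> int \<Rightarrow> ('h \<times> 'h \<times> 'h) set" where
  "tothom t w m = hom w (tx t) m \<times> hom w (ty t) (m - 1) \<times> hom w (tz t) (m - 2)"

lemma totd_closed:
  assumes "precomplex t" "u \<in> tothom t w m" "k = m + 1"
  shows "totd C t w m u \<in> tothom t w k"
proof -
  obtain a b c where u: "u = (a, b, c)" by (cases u)
  have "a \<in> hom w (tx t) m" "b \<in> hom w (ty t) (m - 1)" "c \<in> hom w (tz t) (m - 2)"
    using assms(2) u by (auto simp: tothom_def)
  then show ?thesis
    unfolding u tothom_def assms(3) totd.simps mem_Times_iff fst_conv snd_conv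
    by (intro conjI) (rule precomplexD[OF assms(1)] homI | assumption | simp)+
qed

lemma totd_totd:
  assumes t: "precomplex t" and u: "u \<in> tothom t w m" and k: "k = m + 1"
  shows "totd C t w k (totd C t w m u) = 0"
proof -
  obtain a b c where u_eq: "u = (a, b, c)" by (cases u)
  note D = precomplexD[OF t]
  have a: "a \<in> hom w (tx t) m" and b: "b \<in> hom w (ty t) (m - 1)" and c: "c \<in> hom w (tz t) (m - 2)"
    using u by (auto simp: tothom_def u_eq)
  have m: "dif C w (tx t) m a \<in> hom w (tx t) (m + 1)" "dif C w (ty t) (m - 1) b \<in> hom w (ty t) m"
    "dif C w (tz t) (m - 2) c \<in> hom w (tz t) (m - 1)"
    "tf t \<cdot> a \<in> hom w (ty t) m" "tg t \<cdot> b \<in> hom w (tz t) (m - 1)" "th t \<cdot> a \<in> hom w (tz t) (m - 1)"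
    "- dif C w (ty t) (m - 1) b \<in> hom w (ty t) m"
    "dif C w (tz t) (m - 2) c + tg t \<cdot> b \<in> hom w (tz t) (m - 1)"
    "tg t \<cdot> tf t \<in> hom (tx t) (tz t) 0"
    by (rule a b c D homI | simp)+
  show ?thesis
    using D a b c m unfolding zero_prod_def u_eq k
    by (simp add: dg_simps)
qed

text \<open>A column, i.e. an element of the total complex of \<open>Hom(w,x) \<rightarrow> Hom(w,y) \<rightarrow> Hom(w,z)\<close>, is acted
  on by morphisms into \<open>w\<close> from the right and by triangular matrices from the left.\<close>
fun rac :: "'h \<times> 'h \<times> 'h \<Rightarrow> 'h \<Rightarrow> 'h \<times> 'h \<times> 'h" where
  "rac (a, b, c) e = (a \<cdot> e, b \<cdot> e, c \<cdot> e)"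

fun act :: "'h \<times> 'h \<times> 'h \<times> 'h \<times> 'h \<times> 'h \<Rightarrow> 'h \<times> 'h \<times> 'h \<Rightarrow> 'h \<times> 'h \<times> 'h" where
  "act (A, B, D, U, V, W) (a, b, c) = (A \<cdot> a, U \<cdot> a + B \<cdot> b, W \<cdot> a + V \<cdot> b + D \<cdot> c)"

definition trihom :: "('o, 'h) tri \<Rightarrow> ('o, 'h) tri \<Rightarrow> int \<Rightarrow> ('h \<times> 'h \<times> 'h \<times> 'h \<times> 'h \<times> 'h) set" where
  "trihom t t' m = hom (tx t) (tx t') m \<times> hom (ty t) (ty t') m \<times> hom (tz t) (tz t') m
        \<times> hom (tx t) (ty t') (m - 1) \<times> hom (ty t) (tz t') (m - 1) \<times> hom (tx t) (tz t') (m - 2)"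

lemma rac_closed: "u \<in> tothom t w m \<Longrightarrow> e \<in> hom w' w k \<Longrightarrow> j = m + k \<Longrightarrow> rac u e \<in> tothom t w' j"
  by (cases u) (auto simp: tothom_def intro!: hom_cmp)

lemma totd_rac:
  assumes t: "precomplex t" and u: "u \<in> tothom t w m" and e: "e \<in> hom w' w k" and j: "j = m + k"
  shows "totd C t w' j (rac u e) = rac (totd C t w m u) e + ksign m (rac u (dif C w' w k e))"
proof -
  obtain a b c where u_eq: "u = (a, b, c)" by (cases u)
  note D = precomplexD[OF t]
  have a: "a \<in> hom w (tx t) m" and b: "b \<in> hom w (ty t) (m - 1)" and c: "c \<in> hom w (tz t) (m - 2)"
    using u by (auto simp: tothom_def u_eq)
  have m: "dif C w (ty t) (m - 1) b \<in> hom w (ty t) m"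
    "- dif C w (ty t) (m - 1) b \<in> hom w (ty t) m"
    "dif C w (tz t) (m - 2) c \<in> hom w (tz t) (m - 1)"
    "tf t \<cdot> a \<in> hom w (ty t) m" "tg t \<cdot> b \<in> hom w (tz t) (m - 1)" "th t \<cdot> a \<in> hom w (tz t) (m - 1)"
    "dif C w (tz t) (m - 2) c + tg t \<cdot> b \<in> hom w (tz t) (m - 1)"
    by (rule a b c D homI | simp)+
  show ?thesis
    using D a b c m e unfolding u_eq j
    by (simp add: dg_simps ksign_Pair)
qed

lemma trihomE:
  assumes "\<Phi> \<in> trihom t t' m"
  obtains A B F U V W where "\<Phi> = (A, B, F, U, V, W)"
     "A \<in> hom (tx t) (tx t') m" "B \<in> hom (ty t) (ty t') m" "F \<in> hom (tz t) (tz t') m"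
     "U \<in> hom (tx t) (ty t') (m - 1)" "V \<in> hom (ty t) (tz t') (m - 1)" "W \<in> hom (tx t) (tz t') (m - 2)"
  using assms by (cases \<Phi>) (auto simp: trihom_def)

text \<open>The typing facts needed to distribute composition over the sums in \<^const>\<open>tri_dif\<close>.\<close>
lemma tri_dif_summands:
  assumes t: "precomplex t" and t': "precomplex t'"
    and A: "A \<in> hom (tx t) (tx t') m" "B \<in> hom (ty t) (ty t') m" "F \<in> hom (tz t) (tz t') m"
     "U \<in> hom (tx t) (ty t') (m - 1)" "V \<in> hom (ty t) (tz t') (m - 1)" "W \<in> hom (tx t) (tz t') (m - 2)"
  shows "dif C (tx t) (ty t') (m - 1) U \<in> hom (tx t) (ty t') m"
    "- dif C (tx t) (ty t') (m - 1) U \<in> hom (tx t) (ty t') m"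
    "tf t' \<cdot> A \<in> hom (tx t) (ty t') m" "B \<cdot> tf t \<in> hom (tx t) (ty t') m"
    "- dif C (tx t) (ty t') (m - 1) U + tf t' \<cdot> A \<in> hom (tx t) (ty t') m"
    "ksign m (B \<cdot> tf t) \<in> hom (tx t) (ty t') m"
    "dif C (tx t) (tx t') m A \<in> hom (tx t) (tx t') (m + 1)"
    "dif C (ty t) (ty t') m B \<in> hom (ty t) (ty t') (m + 1)"
    "dif C (tz t) (tz t') m F \<in> hom (tz t) (tz t') (m + 1)"
    "dif C (ty t) (tz t') (m - 1) V \<in> hom (ty t) (tz t') m"
    "tg t' \<cdot> B \<in> hom (ty t) (tz t') m" "F \<cdot> tg t \<in> hom (ty t) (tz t') m"
    "ksign m (F \<cdot> tg t) \<in> hom (ty t) (tz t') m"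
    "dif C (ty t) (tz t') (m - 1) V + tg t' \<cdot> B \<in> hom (ty t) (tz t') m"
    "dif C (tx t) (tz t') (m - 2) W \<in> hom (tx t) (tz t') (m - 1)"
    "tg t' \<cdot> U \<in> hom (tx t) (tz t') (m - 1)" "th t' \<cdot> A \<in> hom (tx t) (tz t') (m - 1)"
    "V \<cdot> tf t \<in> hom (tx t) (tz t') (m - 1)" "F \<cdot> th t \<in> hom (tx t) (tz t') (m - 1)"
    "ksign m (V \<cdot> tf t) \<in> hom (tx t) (tz t') (m - 1)" "ksign m (F \<cdot> th t) \<in> hom (tx t) (tz t') (m - 1)"
    "dif C (tx t) (tz t') (m - 2) W + tg t' \<cdot> U \<in> hom (tx t) (tz t') (m - 1)"
    "dif C (tx t) (tz t') (m - 2) W + tg t' \<cdot> U + th t' \<cdot> A \<in> hom (tx t) (tz t') (m - 1)"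
    "ksign m (V \<cdot> tf t) + ksign m (F \<cdot> th t) \<in> hom (tx t) (tz t') (m - 1)"
    "tg t \<cdot> tf t \<in> hom (tx t) (tz t) 0" "tg t' \<cdot> tf t' \<in> hom (tx t') (tz t') 0"
  by (rule A precomplexD[OF t] precomplexD[OF t'] homI | simp)+

lemma act_closed: "\<Phi> \<in> trihom t t' m \<Longrightarrow> u \<in> tothom t w k \<Longrightarrow> j = m + k \<Longrightarrow> act \<Phi> u \<in> tothom t' w j"
  by (cases \<Phi>; cases u) (auto simp: tothom_def trihom_def intro!: hom_cmp hom_add)

text \<open>The Leibniz rule for the action of morphisms of complexes on columns: it makes closed
  morphisms commute with the total differential up to sign.\<close>
lemma totd_act:
  assumes t: "precomplex t" and t': "precomplex t'" and \<Phi>: "\<Phi> \<in> trihom t t' m"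
    and u: "u \<in> tothom t w k" and j: "j = m + k"
  shows "totd C t' w j (act \<Phi> u) = act (tri_dif C t t' m \<Phi>) u + ksign m (act \<Phi> (totd C t w k u))"
proof -
  obtain a b c where u_eq: "u = (a, b, c)" by (cases u)
  obtain A B F U V W where \<Phi>_eq: "\<Phi> = (A, B, F, U, V, W)" by (cases \<Phi>)
  note D = precomplexD[OF t] note D' = precomplexD[OF t']
  have a: "a \<in> hom w (tx t) k" "b \<in> hom w (ty t) (k - 1)" "c \<in> hom w (tz t) (k - 2)"
    using u by (auto simp: tothom_def u_eq)
  have A: "A \<in> hom (tx t) (tx t') m" "B \<in> hom (ty t) (ty t') m" "F \<in> hom (tz t) (tz t') m"
     "U \<in> hom (tx t) (ty t') (m - 1)" "V \<in> hom (ty t) (tz t') (m - 1)" "W \<in> hom (tx t) (tz t') (m - 2)"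
    using \<Phi> by (auto simp: trihom_def \<Phi>_eq)
  have m: "dif C w (ty t) (k - 1) b \<in> hom w (ty t) k"
    "- dif C w (ty t) (k - 1) b \<in> hom w (ty t) k"
    "dif C w (tz t) (k - 2) c \<in> hom w (tz t) (k - 1)"
    "tf t \<cdot> a \<in> hom w (ty t) k" "tg t \<cdot> b \<in> hom w (tz t) (k - 1)" "th t \<cdot> a \<in> hom w (tz t) (k - 1)"
    "dif C w (tz t) (k - 2) c + tg t \<cdot> b \<in> hom w (tz t) (k - 1)"
    by (rule a D homI | simp)+
  have M: "U \<cdot> a \<in> hom w (ty t') (m + k - 1)"  "B \<cdot> b \<in> hom w (ty t') (m + k - 1)"
    "W \<cdot> a \<in> hom w (tz t') (m + k - 2)"  "V \<cdot> b \<in> hom w (tz t') (m + k - 2)" "F \<cdot> c \<in> hom w (tz t') (m + k - 2)"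
    "W \<cdot> a + V \<cdot> b \<in> hom w (tz t') (m + k - 2)"
    by (rule a A D homI | simp)+
  show ?thesis
    using D D' a A m M tri_dif_summands[OF t t' A] unfolding u_eq j \<Phi>_eq
    by (simp add: dg_simps ksign_Pair)
qed

lemma tri_dif_closed:
  assumes t: "precomplex t" and t': "precomplex t'" and \<Phi>: "\<Phi> \<in> trihom t t' m" and j: "j = m + 1"
  shows "tri_dif C t t' m \<Phi> \<in> trihom t t' j"
proof -
  note D = precomplexD[OF t] note D' = precomplexD[OF t']
  obtain A B F U V W where \<Phi>_eq: "\<Phi> = (A, B, F, U, V, W)"
     and A: "A \<in> hom (tx t) (tx t') m" "B \<in> hom (ty t) (ty t') m" "F \<in> hom (tz t) (tz t') m"
     "U \<in> hom (tx t) (ty t') (m - 1)" "V \<in> hom (ty t) (tz t') (m - 1)" "W \<in> hom (tx t) (tz t') (m - 2)"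
    using \<Phi> by (rule trihomE)
  show ?thesis
    unfolding \<Phi>_eq trihom_def j tri_dif.simps mem_Times_iff fst_conv snd_conv
    by (intro conjI) (rule A D D' homI | simp del: ksign_simps)+
qed

section \<open>The dg-category of triangles\<close>

lemma tri_cmp_closed:
  assumes \<Phi>: "\<Phi> \<in> trihom t t' m" and \<Psi>: "\<Psi> \<in> trihom t' t'' k" and j: "j = m + k"
  shows "tri_cmp C \<Psi> \<Phi> \<in> trihom t t'' j"
proof -
  obtain A B F U V W where \<Phi>_eq: "\<Phi> = (A, B, F, U, V, W)"
     and A: "A \<in> hom (tx t) (tx t') m" "B \<in> hom (ty t) (ty t') m" "F \<in> hom (tz t) (tz t') m"
     "U \<in> hom (tx t) (ty t') (m - 1)" "V \<in> hom (ty t) (tz t') (m - 1)" "W \<in> hom (tx t) (tz t') (m - 2)"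
    using \<Phi> by (rule trihomE)
  obtain A' B' F' U' V' W' where \<Psi>_eq: "\<Psi> = (A', B', F', U', V', W')"
     and A': "A' \<in> hom (tx t') (tx t'') k" "B' \<in> hom (ty t') (ty t'') k" "F' \<in> hom (tz t') (tz t'') k"
     "U' \<in> hom (tx t') (ty t'') (k - 1)" "V' \<in> hom (ty t') (tz t'') (k - 1)" "W' \<in> hom (tx t') (tz t'') (k - 2)"
    using \<Psi> by (rule trihomE)
  show ?thesis
    unfolding \<Phi>_eq \<Psi>_eq trihom_def j tri_cmp.simps mem_Times_iff fst_conv snd_conv
    by (intro conjI) (rule A A' homI | simp)+
qed

lemma tri_dif_tri_dif:
  assumes t: "precomplex t" and t': "precomplex t'" and \<Phi>: "\<Phi> \<in> trihom t t' m"
  shows "tri_dif C t t' (m + 1) (tri_dif C t t' m \<Phi>) = 0"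
proof -
  note D = precomplexD[OF t] note D' = precomplexD[OF t']
  obtain A B F U V W where \<Phi>_eq: "\<Phi> = (A, B, F, U, V, W)"
     and A: "A \<in> hom (tx t) (tx t') m" "B \<in> hom (ty t) (ty t') m" "F \<in> hom (tz t) (tz t') m"
     "U \<in> hom (tx t) (ty t') (m - 1)" "V \<in> hom (ty t) (tz t') (m - 1)" "W \<in> hom (tx t) (tz t') (m - 2)"
    using \<Phi> by (rule trihomE)
  show ?thesis
    using D D' A tri_dif_summands[OF t t' A] unfolding \<Phi>_eq
    by (simp add: dg_simps zero_prod_def)
qed

lemma tri_dif_add:
  assumes t: "precomplex t" and t': "precomplex t'" and \<Phi>: "\<Phi> \<in> trihom t t' m" "\<Psi> \<in> trihom t t' m"
  shows "tri_dif C t t' m (\<Phi> + \<Psi>) = tri_dif C t t' m \<Phi> + tri_dif C t t' m \<Psi>"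
proof -
  note D = precomplexD[OF t] note D' = precomplexD[OF t']
  show ?thesis
    using D D' by (rule_tac trihomE[OF \<Phi>(1)]; rule_tac trihomE[OF \<Phi>(2)]) (simp add: dg_simps)
qed

lemma tri_cmp_assoc:
  assumes \<Phi>: "\<Phi> \<in> trihom t t' m" and \<Psi>: "\<Psi> \<in> trihom t' t'' k" and \<Theta>: "\<Theta> \<in> trihom t'' s l"
  shows "tri_cmp C \<Theta> (tri_cmp C \<Psi> \<Phi>) = tri_cmp C (tri_cmp C \<Theta> \<Psi>) \<Phi>"
proof -
  obtain A B F U V W where \<Phi>_eq: "\<Phi> = (A, B, F, U, V, W)"
     and A: "A \<in> hom (tx t) (tx t') m" "B \<in> hom (ty t) (ty t') m" "F \<in> hom (tz t) (tz t') m"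
     "U \<in> hom (tx t) (ty t') (m - 1)" "V \<in> hom (ty t) (tz t') (m - 1)" "W \<in> hom (tx t) (tz t') (m - 2)"
    using \<Phi> by (rule trihomE)
  obtain A' B' F' U' V' W' where \<Psi>_eq: "\<Psi> = (A', B', F', U', V', W')"
     and A': "A' \<in> hom (tx t') (tx t'') k" "B' \<in> hom (ty t') (ty t'') k" "F' \<in> hom (tz t') (tz t'') k"
     "U' \<in> hom (tx t') (ty t'') (k - 1)" "V' \<in> hom (ty t') (tz t'') (k - 1)" "W' \<in> hom (tx t') (tz t'') (k - 2)"
    using \<Psi> by (rule trihomE)
  obtain A'' B'' F'' U'' V'' W'' where \<Theta>_eq: "\<Theta> = (A'', B'', F'', U'', V'', W'')"
     and A'': "A'' \<in> hom (tx t'') (tx s) l" "B'' \<in> hom (ty t'') (ty s) l" "F'' \<in> hom (tz t'') (tz s) l"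
     "U'' \<in> hom (tx t'') (ty s) (l - 1)" "V'' \<in> hom (ty t'') (tz s) (l - 1)" "W'' \<in> hom (tx t'') (tz s) (l - 2)"
    using \<Theta> by (rule trihomE)
  have P: "U' \<cdot> A \<in> hom (tx t) (ty t'') (k + m - 1)" "B' \<cdot> U \<in> hom (tx t) (ty t'') (k + m - 1)"
     "V' \<cdot> B \<in> hom (ty t) (tz t'') (k + m - 1)" "F' \<cdot> V \<in> hom (ty t) (tz t'') (k + m - 1)"
     "W' \<cdot> A \<in> hom (tx t) (tz t'') (k + m - 2)" "V' \<cdot> U \<in> hom (tx t) (tz t'') (k + m - 2)"
     "F' \<cdot> W \<in> hom (tx t) (tz t'') (k + m - 2)" "W' \<cdot> A + V' \<cdot> U \<in> hom (tx t) (tz t'') (k + m - 2)"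
     "U'' \<cdot> A' \<in> hom (tx t') (ty s) (l + k - 1)" "B'' \<cdot> U' \<in> hom (tx t') (ty s) (l + k - 1)"
     "V'' \<cdot> B' \<in> hom (ty t') (tz s) (l + k - 1)" "F'' \<cdot> V' \<in> hom (ty t') (tz s) (l + k - 1)"
     "W'' \<cdot> A' \<in> hom (tx t') (tz s) (l + k - 2)" "V'' \<cdot> U' \<in> hom (tx t') (tz s) (l + k - 2)"
     "F'' \<cdot> W' \<in> hom (tx t') (tz s) (l + k - 2)" "W'' \<cdot> A' + V'' \<cdot> U' \<in> hom (tx t') (tz s) (l + k - 2)"
    by (rule A A' A'' homI | simp)+
  show ?thesis
    using A A' A'' P unfolding \<Phi>_eq \<Psi>_eq \<Theta>_eq
    by (simp add: dg_simps)
qed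

lemma tri_Leibniz:
  assumes t: "precomplex t" and t': "precomplex t'" and t'': "precomplex t''"
    and \<Phi>: "\<Phi> \<in> trihom t t' m" and \<Psi>: "\<Psi> \<in> trihom t' t'' k"
  shows "tri_dif C t t'' (m + k) (tri_cmp C \<Psi> \<Phi>) =
    tri_cmp C (tri_dif C t' t'' k \<Psi>) \<Phi> + ksign k (tri_cmp C \<Psi> (tri_dif C t t' m \<Phi>))"
proof -
  note D = precomplexD[OF t] note D' = precomplexD[OF t'] note D'' = precomplexD[OF t'']
  obtain A B F U V W where \<Phi>_eq: "\<Phi> = (A, B, F, U, V, W)"
     and A: "A \<in> hom (tx t) (tx t') m" "B \<in> hom (ty t) (ty t') m" "F \<in> hom (tz t) (tz t') m"
     "U \<in> hom (tx t) (ty t') (m - 1)" "V \<in> hom (ty t) (tz t') (m - 1)" "W \<in> hom (tx t) (tz t') (m - 2)"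
    using \<Phi> by (rule trihomE)
  obtain A' B' F' U' V' W' where \<Psi>_eq: "\<Psi> = (A', B', F', U', V', W')"
     and A': "A' \<in> hom (tx t') (tx t'') k" "B' \<in> hom (ty t') (ty t'') k" "F' \<in> hom (tz t') (tz t'') k"
     "U' \<in> hom (tx t') (ty t'') (k - 1)" "V' \<in> hom (ty t') (tz t'') (k - 1)" "W' \<in> hom (tx t') (tz t'') (k - 2)"
    using \<Psi> by (rule trihomE)
  have P: "U' \<cdot> A \<in> hom (tx t) (ty t'') (m + k - 1)" "B' \<cdot> U \<in> hom (tx t) (ty t'') (m + k - 1)"
     "V' \<cdot> B \<in> hom (ty t) (tz t'') (m + k - 1)" "F' \<cdot> V \<in> hom (ty t) (tz t'') (m + k - 1)"
     "W' \<cdot> A \<in> hom (tx t) (tz t'') (m + k - 2)" "V' \<cdot> U \<in> hom (tx t) (tz t'') (m + k - 2)"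
     "F' \<cdot> W \<in> hom (tx t) (tz t'') (m + k - 2)" "W' \<cdot> A + V' \<cdot> U \<in> hom (tx t) (tz t'') (m + k - 2)"
    by (rule A A' homI | simp)+
  show ?thesis
    using D D' D'' A A' P tri_dif_summands[OF t t' A] tri_dif_summands[OF t' t'' A'] unfolding \<Phi>_eq \<Psi>_eq
    by (simp add: dg_simps ksign_Pair) (simp add: algebra_simps ksign_def)
qed

lemma exact_precomplex: "exact_triangle C t \<Longrightarrow> precomplex t"
  by (simp add: exact_triangle_def precomplex_def)

lemma tri_cmp_add_left:
  assumes "\<Phi> \<in> trihom t t' m" "\<Psi> \<in> trihom t' t'' k" "\<Psi>' \<in> trihom t' t'' k"
  shows "tri_cmp C (\<Psi> + \<Psi>') \<Phi> = tri_cmp C \<Psi> \<Phi> + tri_cmp C \<Psi>' \<Phi>"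
  by (rule trihomE[OF assms(1)], rule trihomE[OF assms(2)], rule trihomE[OF assms(3)])
    (simp add: add_left)

lemma tri_cmp_add_right:
  assumes "\<Psi> \<in> trihom t' t'' k" "\<Phi> \<in> trihom t t' m" "\<Phi>' \<in> trihom t t' m"
  shows "tri_cmp C \<Psi> (\<Phi> + \<Phi>') = tri_cmp C \<Psi> \<Phi> + tri_cmp C \<Psi> \<Phi>'"
  by (rule trihomE[OF assms(1)], rule trihomE[OF assms(2)], rule trihomE[OF assms(3)])
    (simp add: add_right)

lemma Hom_triangles:
  assumes "precomplex t" "precomplex t'"
  shows "Hom (triangles C) t t' m = trihom t t' m"
  using precomplexD(1,2,3)[OF assms(1)] precomplexD(1,2,3)[OF assms(2)]
  by (simp add: triangles_def trihom_def hom_def)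

lemma Ob_triangles: "t \<in> Ob (triangles C) \<longleftrightarrow> exact_triangle C t"
  by (simp add: triangles_def)

lemma triangles_simps:
  "dif (triangles C) = tri_dif C" "cmp (triangles C) = tri_cmp C"
  "idt (triangles C) t = (idt C (tx t), idt C (ty t), idt C (tz t), 0, 0, 0)"
  "scl (triangles C) k (A, B, F, U, V, W) = (scl C k A, scl C k B, scl C k F, scl C k U, scl C k V, scl C k W)"
  by (simp_all add: triangles_def)

theorem dg_category_triangles: "dg_category (triangles C)"
proof (rule dg_category.intro, goal_cases)
  case 1 show ?case
    by unfold_locales (auto simp: triangles_def V.scale_right_distrib V.scale_left_distrib)
next
  case (2 x y i)
  then interpret W: vector_space "scl (triangles C)"
    by unfold_locales (auto simp: triangles_def V.scale_right_distrib V.scale_left_distrib)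
  have p: "precomplex x" "precomplex y" using 2 by (auto simp: Ob_triangles exact_precomplex)
  have "W.subspace (trihom x y i)"
    using precomplexD(1,2,3)[OF p(1)] precomplexD(1,2,3)[OF p(2)]
    by (intro W.subspaceI) (auto simp: trihom_def triangles_simps zero_prod_def hom_zero hom_add hom_scl)
  then show ?case by (simp add: Hom_triangles p)
next
  case (3 x y f i) then show ?case by (simp add: Ob_triangles Hom_triangles exact_precomplex triangles_simps tri_dif_closed)
next
  case (4 x y f i f') then show ?case by (simp add: Ob_triangles Hom_triangles exact_precomplex triangles_simps tri_dif_add)
next
  case (5 x y f i c)
  then have p: "precomplex x" "precomplex y" and f: "f \<in> trihom x y i" by (auto simp: Ob_triangles exact_precomplex Hom_triangles)
  show ?case using precomplexD[OF p(1)] precomplexD[OF p(2)]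
    by (rule_tac trihomE[OF f]) (simp add: triangles_simps d_scl scl_right scl_left V.scale_right_distrib V.scale_right_diff_distrib scl_ksign)
next
  case (6 x y f i) then show ?case by (simp add: Ob_triangles Hom_triangles exact_precomplex triangles_simps tri_dif_tri_dif)
next
  case (7 x y z f i g j) then show ?case by (simp add: Ob_triangles Hom_triangles exact_precomplex triangles_simps tri_cmp_closed)
next
  case (8 x y z f i g j g') then show ?case by (simp add: Ob_triangles Hom_triangles exact_precomplex triangles_simps tri_cmp_add_left)
next
  case (9 x y z f i f' g j) then show ?case by (simp add: Ob_triangles Hom_triangles exact_precomplex triangles_simps tri_cmp_add_right)
next
  case (10 x y z f i g j c)
  then have f: "f \<in> trihom x y i" "g \<in> trihom y z j" by (auto simp: Ob_triangles exact_precomplex Hom_triangles)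
  show ?case
    by (rule trihomE[OF f(1)], rule trihomE[OF f(2)]) (simp add: triangles_simps scl_right scl_left V.scale_right_distrib)
next
  case (11 x y z f i g j c)
  then have f: "f \<in> trihom x y i" "g \<in> trihom y z j" by (auto simp: Ob_triangles exact_precomplex Hom_triangles)
  show ?case
    by (rule trihomE[OF f(1)], rule trihomE[OF f(2)]) (simp add: triangles_simps scl_right scl_left V.scale_right_distrib)
next
  case (12 w x y z f i g j h k) then show ?case by (simp add: Ob_triangles Hom_triangles exact_precomplex triangles_simps tri_cmp_assoc)
next
  case (13 x)
  then have p: "precomplex x" by (auto simp: Ob_triangles exact_precomplex)
  show ?case using precomplexD(1,2,3)[OF p]
    by (simp add: Hom_triangles[OF p p] triangles_simps trihom_def hom_idt hom_zero)
next
  case (14 x y f i)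
  then have f: "f \<in> trihom x y i" by (auto simp: Ob_triangles exact_precomplex Hom_triangles)
  show ?case by (rule trihomE[OF f]) (simp add: triangles_simps idt_left zero_left)
next
  case (15 x y f i)
  then have f: "f \<in> trihom x y i" by (auto simp: Ob_triangles exact_precomplex Hom_triangles)
  show ?case by (rule trihomE[OF f]) (simp add: triangles_simps idt_right zero_right)
next
  case (16 x y z f i g j) then show ?case by (simp add: Ob_triangles Hom_triangles exact_precomplex triangles_simps tri_Leibniz)
qed

lemmas exact_precomplexD = precomplexD[OF exact_precomplex]

lemma tot_eq: "precomplex t \<Longrightarrow> w \<in> Ob C \<Longrightarrow> tot C t w m = tothom t w m"
  using precomplexD(1,2,3)[of t] by (simp add: tot_def tothom_def hom_def)

lemma exact_lift:
  assumes t: "exact_triangle C t" and u: "u \<in> tothom t w m" "totd C t w m u = 0" and k: "k = m - 1"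
  shows "\<exists>v \<in> tothom t w k. totd C t w k v = u"
proof -
  have w: "w \<in> Ob C" using u by (cases u) (auto simp: tothom_def hom_def)
  show ?thesis using t u w tot_eq[OF exact_precomplex[OF t] w] unfolding exact_triangle_def k by auto
qed

lemma tothom_add: "u \<in> tothom t w m \<Longrightarrow> v \<in> tothom t w m \<Longrightarrow> u + v \<in> tothom t w m"
  by (cases u; cases v) (auto simp: tothom_def intro: hom_add)
lemma tothom_diff: "u \<in> tothom t w m \<Longrightarrow> v \<in> tothom t w m \<Longrightarrow> u - v \<in> tothom t w m"
  by (cases u; cases v) (auto simp: tothom_def intro: hom_diff)
lemma tothom_ksign: "u \<in> tothom t w m \<Longrightarrow> ksign k u \<in> tothom t w m"
  by (cases u) (auto simp: tothom_def ksign_Pair intro: hom_ksign)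

lemma totd_add:
  assumes "precomplex t" "u \<in> tothom t w m" "v \<in> tothom t w m"
  shows "totd C t w m (u + v) = totd C t w m u + totd C t w m v"
  using precomplexD[OF assms(1)] assms(2,3)
  by (cases u; cases v) (auto simp: tothom_def d_add add_right)

lemma totd_diff:
  assumes "precomplex t" "u \<in> tothom t w m" "v \<in> tothom t w m"
  shows "totd C t w m (u - v) = totd C t w m u - totd C t w m v"
  using totd_add[OF assms(1) tothom_diff[OF assms(2,3)] assms(3)] by simp

lemma totd_ksign:
  assumes "precomplex t" "u \<in> tothom t w m"
  shows "totd C t w m (ksign k u) = ksign k (totd C t w m u)"
  using totd_diff[OF assms(1) tothom_diff[OF assms(2) assms(2)] assms(2)] totd_diff[OF assms assms(2)]
  by (simp add: ksign_def)

section \<open>Contractions of triangles\<close>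

text \<open>These are the equations satisfied by the entries of a degree -1 endomorphism of the total
  object with differential the identity. Its columns at \<open>z\<close>, \<open>y\<close> and \<open>x\<close> are \<open>(D, p, q)\<close>, \<open>(E, r,
  _)\<close> and \<open>(G, i, _)\<close>; the omitted entries with values in \<open>z\<close> satisfy further equations that are
  not listed. The entry \<open>D\<close> is closed, and \<open>- D\<close> represents the third morphism \<open>z \<rightarrow> x[1]\<close> of the
  triangle.\<close>
definition contraction where
  "contraction t D p q E r G i \<longleftrightarrow>
    D \<in> hom (tz t) (tx t) 1 \<and> p \<in> hom (tz t) (ty t) 0 \<and> q \<in> hom (tz t) (tz t) (- 1) \<and>
    E \<in> hom (ty t) (tx t) 0 \<and> r \<in> hom (ty t) (ty t) (- 1) \<and>
    G \<in> hom (tx t) (tx t) (- 1) \<and> i \<in> hom (tx t) (ty t) (- 2) \<and>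
    dif C (tz t) (tx t) 1 D = 0 \<and>
    dif C (tz t) (ty t) 0 p = tf t \<cdot> D \<and>
    dif C (tz t) (tz t) (- 1) q = idt C (tz t) - tg t \<cdot> p - th t \<cdot> D \<and>
    dif C (ty t) (tx t) 0 E = - (D \<cdot> tg t) \<and>
    dif C (ty t) (ty t) (- 1) r = tf t \<cdot> E + p \<cdot> tg t - idt C (ty t) \<and>
    dif C (tx t) (tx t) (- 1) G = idt C (tx t) - E \<cdot> tf t - D \<cdot> th t \<and>
    dif C (tx t) (ty t) (- 2) i = tf t \<cdot> G + r \<cdot> tf t + p \<cdot> th t"

text \<open>Acyclicity gives the columns one after the other: once the columns to the right are known,
  the identity minus their composites with \<open>f\<close>, \<open>g\<close>, \<open>h\<close> is a cocycle, hence a boundary. The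
  column at \<open>z\<close> is kept arbitrary, because it is also the witness in \<^const>\<open>connecting\<close>.\<close>
lemma contraction_extends:
  assumes t: "exact_triangle C t" and S: "(D, p, q) \<in> tothom t (tz t) 1"
    and dS: "totd C t (tz t) 1 (D, p, q) = (0, 0, idt C (tz t))"
  obtains E r G i where "contraction t D p q E r G i"
proof -
  note P = exact_precomplex[OF t]
  note X = precomplexD[OF P]
  have S': "D \<in> hom (tz t) (tx t) 1" "p \<in> hom (tz t) (ty t) 0" "q \<in> hom (tz t) (tz t) (- 1)"
    using S by (simp_all add: tothom_def)
  let ?u = "(0, idt C (ty t), 0) - rac (D, p, q) (tg t)"
  have u: "?u \<in> tothom t (ty t) 1"
    by (intro tothom_diff rac_closed[OF S X(5)]) (use X hom_idt in \<open>auto simp: tothom_def intro: hom_zero\<close>)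
  have "totd C t (ty t) 1 (0, idt C (ty t), 0) = (0, 0, tg t)"
    using X cyc_idt[of "ty t"]
    by (simp add: d_zero zero_right[OF X(4)] zero_right[OF X(6)] idt_right[OF X(5)] cycD)
  moreover have "totd C t (ty t) 1 (rac (D, p, q) (tg t)) = (0, 0, tg t)"
    unfolding totd_rac[OF P S X(5) add_0_right[symmetric]] dS
    using X by (simp add: zero_left[OF X(5)] idt_left[OF X(5)] zero_right[OF S'(1)] zero_right[OF S'(2)] zero_right[OF S'(3)] ksign_Pair)
  ultimately have "totd C t (ty t) 1 ?u = 0"
    by (subst totd_diff[OF P _ rac_closed[OF S X(5)]])
      (use X hom_idt in \<open>auto simp: tothom_def zero_prod_def intro: hom_zero\<close>)
  then obtain E r s where E: "(E, r, s) \<in> tothom t (ty t) 0" "totd C t (ty t) 0 (E, r, s) = ?u"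
    using exact_lift[OF t u, of 0] by auto
  let ?v = "(idt C (tx t), 0, 0) - rac (E, r, s) (tf t) - rac (D, p, q) (th t)"
  have i: "(idt C (tx t), 0, 0) \<in> tothom t (tx t) 0"
    using X hom_idt by (auto simp: tothom_def intro: hom_zero)
  have rE: "rac (E, r, s) (tf t) \<in> tothom t (tx t) 0" by (rule rac_closed[OF E(1) X(4)]) simp
  have rD: "rac (D, p, q) (th t) \<in> tothom t (tx t) 0" by (rule rac_closed[OF S X(6)]) simp
  have v: "?v \<in> tothom t (tx t) 0" by (intro tothom_diff i rE rD)
  have 1: "totd C t (tx t) 0 (idt C (tx t), 0, 0) = (0, tf t, th t)"
    using X cyc_idt[of "tx t"]
    by (simp add: d_zero zero_right[OF X(5)] idt_right[OF X(4)] idt_right[OF X(6)] cycD)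
  have h: "tg t \<cdot> tf t \<in> hom (tx t) (tz t) 0" by (rule hom_cmp X)+ simp
  have rS: "(0, idt C (ty t), 0) - (D \<cdot> tg t, p \<cdot> tg t, q \<cdot> tg t) = (- (D \<cdot> tg t), idt C (ty t) - p \<cdot> tg t, - (q \<cdot> tg t))" by simp
  have E': "E \<in> hom (ty t) (tx t) 0" "r \<in> hom (ty t) (ty t) (- 1)" "s \<in> hom (ty t) (tz t) (- 2)"
    using E(1) by (simp_all add: tothom_def)
  have m: "D \<cdot> tg t \<in> hom (ty t) (tx t) 1" "p \<cdot> tg t \<in> hom (ty t) (ty t) 0" "q \<cdot> tg t \<in> hom (ty t) (tz t) (- 1)"
    by (rule S' X homI | simp)+
  have 2: "totd C t (tx t) 0 (rac (E, r, s) (tf t)) = (0, tf t, 0) - (D \<cdot> (tg t \<cdot> tf t), p \<cdot> (tg t \<cdot> tf t), q \<cdot> (tg t \<cdot> tf t))"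
    unfolding totd_rac[OF P E(1) X(4) add_0_right[symmetric]] unfolding E(2) rac.simps rS
    using X E' m S' hom_idt[of "ty t"]
    by (simp add: zero_right[OF E'(1)] zero_right[OF E'(2)] zero_right[OF E'(3)] minus_left diff_left idt_left assoc)
  have j: "(0::int) = 1 + - 1" by simp
  have 3: "totd C t (tx t) 0 (rac (D, p, q) (th t)) = (0, 0, th t) + (D \<cdot> (tg t \<cdot> tf t), p \<cdot> (tg t \<cdot> tf t), q \<cdot> (tg t \<cdot> tf t))"
    unfolding totd_rac[OF P S X(6) j] unfolding dS
    using X h S' by (simp add: zero_left[OF X(6)] idt_left minus_right ksign_Pair)
  have dv: "totd C t (tx t) 0 ?v = 0"
    unfolding totd_diff[OF P tothom_diff[OF i rE] rD] totd_diff[OF P i rE] unfolding 1 2 3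
    by (simp add: zero_prod_def)
  have "\<exists>v' \<in> tothom t (tx t) (- 1). totd C t (tx t) (- 1) v' = ?v"
    by (rule exact_lift[OF t v dv]) simp
  then obtain G i j where G: "(G, i, j) \<in> tothom t (tx t) (- 1)" "totd C t (tx t) (- 1) (G, i, j) = ?v"
    by (metis prod_cases3)
  have G': "G \<in> hom (tx t) (tx t) (- 1)" "i \<in> hom (tx t) (ty t) (- 2)"
    using G(1) by (simp_all add: tothom_def)
  have "dif C (tz t) (tx t) 1 D = 0 \<and> - dif C (tz t) (ty t) 0 p + tf t \<cdot> D = 0 \<and>
      dif C (tz t) (tz t) (- 1) q + tg t \<cdot> p + th t \<cdot> D = idt C (tz t)"
    using dS by simp
  moreover have "dif C (ty t) (tx t) 0 E = - (D \<cdot> tg t) \<and>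
      - dif C (ty t) (ty t) (- 1) r + tf t \<cdot> E = idt C (ty t) - p \<cdot> tg t"
    using E(2) by simp
  moreover have "dif C (tx t) (tx t) (- 1) G = idt C (tx t) - E \<cdot> tf t - D \<cdot> th t \<and>
      - dif C (tx t) (ty t) (- 2) i + tf t \<cdot> G = - (r \<cdot> tf t) - p \<cdot> th t"
    using G(2) by simp
  ultimately have "contraction t D p q E r G i"
    unfolding contraction_def using S' E' G' by (simp add: algebra_simps eq_neg_iff_add_eq_0)
  then show ?thesis by (rule that)
qed

lemma contractionD:
  assumes "contraction t D p q E r G i"
  shows "D \<in> hom (tz t) (tx t) 1" "p \<in> hom (tz t) (ty t) 0" "q \<in> hom (tz t) (tz t) (- 1)"
    "E \<in> hom (ty t) (tx t) 0" "r \<in> hom (ty t) (ty t) (- 1)"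
    "G \<in> hom (tx t) (tx t) (- 1)" "i \<in> hom (tx t) (ty t) (- 2)"
    "dif C (tz t) (tx t) 1 D = 0"
    "dif C (tz t) (ty t) 0 p = tf t \<cdot> D"
    "dif C (tz t) (tz t) (- 1) q = idt C (tz t) - tg t \<cdot> p - th t \<cdot> D"
    "dif C (ty t) (tx t) 0 E = - (D \<cdot> tg t)"
    "dif C (ty t) (ty t) (- 1) r = tf t \<cdot> E + p \<cdot> tg t - idt C (ty t)"
    "dif C (tx t) (tx t) (- 1) G = idt C (tx t) - E \<cdot> tf t - D \<cdot> th t"
    "dif C (tx t) (ty t) (- 2) i = tf t \<cdot> G + r \<cdot> tf t + p \<cdot> th t"
  using assms by (simp_all add: contraction_def)

lemma col_z:
  assumes "exact_triangle C t" "contraction t D p q E r G i"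
  shows "(D, p, q) \<in> tothom t (tz t) 1" "totd C t (tz t) 1 (D, p, q) = (0, 0, idt C (tz t))"
  using contractionD[OF assms(2)] by (simp_all add: tothom_def)

section \<open>The long exact sequence for morphisms of triangles\<close>

text \<open>The fibre of the projection of a morphism of triangles to its outer diagonal entries
  consists of the entries from the complex \<open>x \<rightarrow> y\<close> to the complex \<open>y' \<rightarrow> z'\<close>. By exactness, \<open>z\<close> is
  the cone of the former via \<open>(g, h)\<close> and \<open>x'\<close> is the fibre of the latter via \<open>(f', h')\<close>, so that
  the fibre is equivalent to \<open>Hom(z,x')\<close>. The equivalence is \<open>\<chi> \<mapsto> (f', h') \<chi> (g, h)\<close>.\<close>
definition iota :: "('o, 'h) tri \<Rightarrow> ('o, 'h) tri \<Rightarrow> 'h \<Rightarrow> 'h \<times> 'h \<times> 'h \<times> 'h \<times> 'h \<times> 'h" where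
  "iota t t' \<chi> = (0, tf t' \<cdot> (\<chi> \<cdot> tg t), 0, tf t' \<cdot> (\<chi> \<cdot> th t), th t' \<cdot> (\<chi> \<cdot> tg t), th t' \<cdot> (\<chi> \<cdot> th t))"

text \<open>Morphisms of triangles with prescribed outer diagonal entries \<open>(a, 0)\<close> and \<open>(0, c)\<close>, built
  from a row of a contraction of the source and from a column of a contraction of the target. They
  fail to be closed exactly by \<open>iota\<close> of the obstructions \<open>a D\<close> and \<open>D' c\<close>.\<close>
definition lift_x :: "('o, 'h) tri \<Rightarrow> 'h \<Rightarrow> 'h \<Rightarrow> int \<Rightarrow> 'h \<Rightarrow> 'h \<times> 'h \<times> 'h \<times> 'h \<times> 'h \<times> 'h" where
  "lift_x t' E G m a = (a, ksign m (tf t' \<cdot> (a \<cdot> E)), 0, ksign m (tf t' \<cdot> (a \<cdot> G)),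
     ksign m (th t' \<cdot> (a \<cdot> E)), ksign m (th t' \<cdot> (a \<cdot> G)))"

definition lift_z :: "('o, 'h) tri \<Rightarrow> 'h \<Rightarrow> 'h \<Rightarrow> int \<Rightarrow> 'h \<Rightarrow> 'h \<times> 'h \<times> 'h \<times> 'h \<times> 'h \<times> 'h" where
  "lift_z t p' q' m c = (0, ksign m (p' \<cdot> (c \<cdot> tg t)), c, ksign m (p' \<cdot> (c \<cdot> th t)),
     ksign m (q' \<cdot> (c \<cdot> tg t)), ksign m (q' \<cdot> (c \<cdot> th t)))"

context
  fixes t t'
  assumes t: "exact_triangle C t" and t': "exact_triangle C t'"
begin

lemma iota_closed: "\<chi> \<in> hom (tz t) (tx t') m \<Longrightarrow> iota t t' \<chi> \<in> trihom t t' m"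
  unfolding iota_def trihom_def mem_Times_iff fst_conv snd_conv
  by (intro conjI) (assumption | rule exact_precomplexD[OF t] exact_precomplexD[OF t'] homI | simp)+

lemma iota_add:
  assumes \<chi>: "\<chi> \<in> hom (tz t) (tx t') m" "\<psi> \<in> hom (tz t) (tx t') m"
  shows "iota t t' (\<chi> + \<psi>) = iota t t' \<chi> + iota t t' \<psi>"
proof -
  note X = exact_precomplexD[OF t] exact_precomplexD[OF t']
  have "\<chi> \<cdot> tg t \<in> hom (ty t) (tx t') m" "\<chi> \<cdot> th t \<in> hom (tx t) (tx t') (m - 1)"
     "\<psi> \<cdot> tg t \<in> hom (ty t) (tx t') m" "\<psi> \<cdot> th t \<in> hom (tx t) (tx t') (m - 1)"
    by (rule \<chi> X homI | simp)+
  then show ?thesis using \<chi> X unfolding iota_def by (simp add: dg_simps)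
qed

lemma iota_zero: "iota t t' 0 = 0"
  using iota_add[of 0 0 0] exact_precomplexD[OF t] exact_precomplexD[OF t'] by (simp add: hom_zero)

lemma iota_minus: "\<chi> \<in> hom (tz t) (tx t') m \<Longrightarrow> iota t t' (- \<chi>) = - iota t t' \<chi>"
  using iota_add[of \<chi> m "- \<chi>"] hom_minus[of \<chi>] iota_zero by (metis add.right_inverse minus_unique)

lemma tri_dif_iota:
  assumes \<chi>: "\<chi> \<in> hom (tz t) (tx t') m"
  shows "tri_dif C t t' m (iota t t' \<chi>) = - iota t t' (dif C (tz t) (tx t') m \<chi>)"
proof -
  note X = exact_precomplexD[OF t] exact_precomplexD[OF t']
  have M: "dif C (tz t) (tx t') m \<chi> \<in> hom (tz t) (tx t') (m + 1)"
    "\<chi> \<cdot> tg t \<in> hom (ty t) (tx t') m" "\<chi> \<cdot> th t \<in> hom (tx t) (tx t') (m - 1)"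
    "dif C (tz t) (tx t') m \<chi> \<cdot> tg t \<in> hom (ty t) (tx t') (m + 1)"
    "dif C (tz t) (tx t') m \<chi> \<cdot> th t \<in> hom (tx t) (tx t') m"
    "\<chi> \<cdot> (tg t \<cdot> tf t) \<in> hom (tx t) (tx t') m"
    "tg t \<cdot> tf t \<in> hom (tx t) (tz t) 0" "tg t' \<cdot> tf t' \<in> hom (tx t') (tz t') 0"
    "th t' \<cdot> (\<chi> \<cdot> tg t) \<in> hom (ty t) (tz t') (m - 1)" "tf t' \<cdot> (\<chi> \<cdot> tg t) \<in> hom (ty t) (ty t') m"
    "tf t' \<cdot> (\<chi> \<cdot> th t) \<in> hom (tx t) (ty t') (m - 1)"  "th t' \<cdot> (\<chi> \<cdot> th t) \<in> hom (tx t) (tz t') (m - 2)"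
    by (rule \<chi> X homI | simp)+
  show ?thesis
    using X \<chi> M unfolding iota_def
    by (cases "even m") (simp_all add: dg_simps d_zero ksign_def)
qed

context
  fixes D p q E r G i D' p' q' E' r' G' i'
  assumes c: "contraction t D p q E r G i" and c': "contraction t' D' p' q' E' r' G' i'"
begin

lemma lift_x_closed: "a \<in> hom (tx t) (tx t') m \<Longrightarrow> lift_x t' E G m a \<in> trihom t t' m"
  unfolding lift_x_def trihom_def mem_Times_iff fst_conv snd_conv
  by (intro conjI) (assumption | rule exact_precomplexD[OF t] exact_precomplexD[OF t'] contractionD[OF c] homI | simp)+

lemma lift_z_closed: "a \<in> hom (tz t) (tz t') m \<Longrightarrow> lift_z t p' q' m a \<in> trihom t t' m"
  unfolding lift_z_def trihom_def mem_Times_iff fst_conv snd_conv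
  by (intro conjI) (assumption | rule exact_precomplexD[OF t] exact_precomplexD[OF t'] contractionD[OF c'] homI | simp)+

lemma tri_dif_lift_x:
  assumes a: "a \<in> cyc (tx t) (tx t') m"
  shows "tri_dif C t t' m (lift_x t' E G m a) = iota t t' (a \<cdot> D)"
proof -
  note X = exact_precomplexD[OF t] exact_precomplexD[OF t']
  note K = contractionD[OF c]
  have M: "a \<cdot> E \<in> hom (ty t) (tx t') m" "a \<cdot> G \<in> hom (tx t) (tx t') (m - 1)"
    "E \<cdot> tf t \<in> hom (tx t) (tx t) 0" "D \<cdot> th t \<in> hom (tx t) (tx t) 0"
    "a \<cdot> (E \<cdot> tf t) \<in> hom (tx t) (tx t') m" "a \<cdot> (D \<cdot> th t) \<in> hom (tx t) (tx t') m"
    "idt C (tx t) - E \<cdot> tf t \<in> hom (tx t) (tx t) 0" "idt C (tx t) \<in> hom (tx t) (tx t) 0"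
    "D \<cdot> tg t \<in> hom (ty t) (tx t) 1" "a \<cdot> (D \<cdot> tg t) \<in> hom (ty t) (tx t') (m + 1)"
    "a - a \<cdot> (E \<cdot> tf t) \<in> hom (tx t) (tx t') m"
    "tg t' \<cdot> tf t' \<in> hom (tx t') (tz t') 0"
    "th t' \<cdot> (a \<cdot> E) \<in> hom (ty t) (tz t') (m - 1)" "tf t' \<cdot> (a \<cdot> E) \<in> hom (ty t) (ty t') m"
    "tf t' \<cdot> (a \<cdot> G) \<in> hom (tx t) (ty t') (m - 1)"  "th t' \<cdot> (a \<cdot> G) \<in> hom (tx t) (tz t') (m - 2)"
    by (rule cycD[OF a] X K homI | simp)+
  show ?thesis
    using X K cycD[OF a] M unfolding iota_def lift_x_def
    by (cases "even m") (simp_all add: dg_simps d_zero ksign_def idt_right[OF cycD(1)[OF a]])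
qed

lemma tri_dif_lift_z:
  assumes a: "a \<in> cyc (tz t) (tz t') m"
  shows "tri_dif C t t' m (lift_z t p' q' m a) = - iota t t' (ksign m (D' \<cdot> a))"
proof -
  note X = exact_precomplexD[OF t] exact_precomplexD[OF t']
  note K = contractionD[OF c']
  have M: "a \<cdot> tg t \<in> hom (ty t) (tz t') m" "a \<cdot> th t \<in> hom (tx t) (tz t') (m - 1)"
    "tg t' \<cdot> p' \<in> hom (tz t') (tz t') 0" "th t' \<cdot> D' \<in> hom (tz t') (tz t') 0"
    "p' \<cdot> (a \<cdot> tg t) \<in> hom (ty t) (ty t') m" "q' \<cdot> (a \<cdot> tg t) \<in> hom (ty t) (tz t') (m - 1)"
    "D' \<cdot> (a \<cdot> tg t) \<in> hom (ty t) (tx t') (m + 1)" "D' \<cdot> (a \<cdot> th t) \<in> hom (tx t) (tx t') m"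
    "p' \<cdot> (a \<cdot> th t) \<in> hom (tx t) (ty t') (m - 1)" "q' \<cdot> (a \<cdot> th t) \<in> hom (tx t) (tz t') (m - 2)"
    "idt C (tz t') - tg t' \<cdot> p' \<in> hom (tz t') (tz t') 0" "idt C (tz t') \<in> hom (tz t') (tz t') 0"
    "D' \<cdot> a \<in> hom (tz t) (tx t') (m + 1)" 
    "tg t \<cdot> tf t \<in> hom (tx t) (tz t) 0" "a \<cdot> (tg t \<cdot> tf t) \<in> hom (tx t) (tz t') m"
    "tf t' \<cdot> D' \<in> hom (tz t') (ty t') 1"
    by (rule cycD[OF a] X K homI | simp)+
  show ?thesis
    using X K cycD[OF a] M unfolding iota_def lift_z_def
    by (cases "even m") (simp_all add: dg_simps d_zero ksign_def idt_left[OF M(1)] idt_left[OF M(2)])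
qed

text \<open>Exactness at \<open>Ext(z,x')\<close>, the harder inclusion. The column at \<open>z\<close> of the contraction of \<open>t\<close>,
  pushed forward by the matrix \<open>\<Phi>\<close>, and the column at \<open>z'\<close> of that of \<open>t'\<close>, composed with \<open>k\<close>,
  bound the same column up to \<open>\<chi>\<close>. Their difference is a boundary by acyclicity, and its first
  entry gives the claim.\<close>
lemma iota_cobounds:
  assumes \<Phi>: "(a, b, k, u, v, w) \<in> trihom t t' m" and \<chi>: "\<chi> \<in> cyc (tz t) (tx t') (m + 1)"
    and d: "tri_dif C t t' m (a, b, k, u, v, w) = iota t t' \<chi>"
  shows "\<chi> - (a \<cdot> D - ksign m (D' \<cdot> k)) \<in> bnd (tz t) (tx t') (m + 1)"
proof -
  note X = exact_precomplexD[OF t] exact_precomplexD[OF t']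
  note K = contractionD[OF c] contractionD[OF c']
  note P = exact_precomplex[OF t] exact_precomplex[OF t']
  have \<Phi>': "a \<in> hom (tx t) (tx t') m" "b \<in> hom (ty t) (ty t') m" "k \<in> hom (tz t) (tz t') m"
     "u \<in> hom (tx t) (ty t') (m - 1)" "v \<in> hom (ty t) (tz t') (m - 1)" "w \<in> hom (tx t) (tz t') (m - 2)"
    using \<Phi> by (simp_all add: trihom_def)
  note S = col_z[OF t c] and S' = col_z[OF t' c']
  have dk: "dif C (tz t) (tz t') m k = 0" using d by (simp add: iota_def)
  have M: "tg t \<cdot> p \<in> hom (tz t) (tz t) 0" "th t \<cdot> D \<in> hom (tz t) (tz t) 0"
    "idt C (tz t) \<in> hom (tz t) (tz t) 0" "\<chi> \<cdot> (tg t \<cdot> p) \<in> hom (tz t) (tx t') (m + 1)"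
    "\<chi> \<cdot> (th t \<cdot> D) \<in> hom (tz t) (tx t') (m + 1)" "idt C (tz t) - tg t \<cdot> p \<in> hom (tz t) (tz t) 0"
    "tf t \<cdot> D \<in> hom (tz t) (ty t) 1" "tg t \<cdot> (tf t \<cdot> D) \<in> hom (tz t) (tz t) 1"
    "\<chi> \<cdot> tg t \<in> hom (ty t) (tx t') (m + 1)" "\<chi> \<cdot> th t \<in> hom (tx t) (tx t') m"
    "tg t \<cdot> tf t \<in> hom (tx t) (tz t) 0"
    by (rule cycD[OF \<chi>] X K homI | simp)+
  \<comment> \<open>The contraction makes \<open>g p + h D\<close> homotopic to the identity of \<open>z\<close> via \<open>q\<close>.\<close>
  define \<chi>1 where "\<chi>1 = \<chi> \<cdot> (tg t \<cdot> p) + \<chi> \<cdot> (th t \<cdot> D)"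
  have \<chi>1: "\<chi>1 \<in> hom (tz t) (tx t') (m + 1)" unfolding \<chi>1_def by (intro hom_add M)
  have d\<chi>1: "dif C (tz t) (tx t') (m + 1) \<chi>1 = 0"
    unfolding \<chi>1_def using X K(1-14) cycD[OF \<chi>] M by (simp add: dg_simps)
  have "\<chi> - \<chi>1 = ksign (m + 1) (dif C (tz t) (tx t') m (\<chi> \<cdot> q))"
    unfolding \<chi>1_def using X K(1-14) cycD[OF \<chi>] M
    by (cases "even m") (simp_all add: dg_simps ksign_def idt_right[OF cycD(1)[OF \<chi>]])
  moreover have "\<chi> \<cdot> q \<in> hom (tz t) (tx t') m" by (rule cycD[OF \<chi>] K homI | simp)+
  ultimately have 1: "\<chi> - \<chi>1 \<in> bnd (tz t) (tx t') (m + 1)" by (simp add: bnd_minus bnd_ksign bndI)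
  let ?X = "(\<chi>1, 0, 0)"
  have X1: "?X \<in> tothom t' (tz t) (m + 1)" using \<chi>1 X by (simp add: tothom_def hom_zero)
  have X2: "act (a, b, k, u, v, w) (D, p, q) \<in> tothom t' (tz t) (m + 1)" by (rule act_closed[OF \<Phi> S(1) refl])
  have X3: "rac (D', p', q') k \<in> tothom t' (tz t) (m + 1)" by (rule rac_closed[OF S'(1) \<Phi>'(3)]) simp
  have "totd C t' (tz t) (m + 1) ?X = act (iota t t' \<chi>) (D, p, q)"
    using X K cycD[OF \<chi>] M d\<chi>1 \<chi>1
    by (simp add: iota_def zero_left[OF K(1)] zero_left[OF K(2)] zero_left[OF K(3)] d_zero zero_right[OF X(14)])
       (simp add: \<chi>1_def dg_simps)
  moreover have "totd C t' (tz t) (m + 1) (act (a, b, k, u, v, w) (D, p, q))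
      = act (iota t t' \<chi>) (D, p, q) + ksign m (0, 0, k)"
    unfolding totd_act[OF P \<Phi> S(1) refl] unfolding d S(2)
    using \<Phi>' by (simp add: zero_right[OF \<Phi>'(1)] zero_right[OF \<Phi>'(4)] zero_right[OF \<Phi>'(2)]
        zero_right[OF \<Phi>'(5)] zero_right[OF \<Phi>'(6)] idt_right[OF \<Phi>'(3)])
  moreover have "totd C t' (tz t) (m + 1) (rac (D', p', q') k) = (0, 0, k)"
    unfolding totd_rac[OF P(2) S'(1) \<Phi>'(3) add.commute] unfolding S'(2) dk
    by (simp add: zero_left[OF \<Phi>'(3)] idt_left[OF \<Phi>'(3)] zero_right[OF K(15)] zero_right[OF K(16)] zero_right[OF K(17)])
  ultimately have "totd C t' (tz t) (m + 1) (act (a, b, k, u, v, w) (D, p, q) - ?X - ksign m (rac (D', p', q') k)) = 0"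
    unfolding totd_diff[OF P(2) tothom_diff[OF X2 X1] tothom_ksign[OF X3]] totd_diff[OF P(2) X2 X1] totd_ksign[OF P(2) X3]
    by simp
  then obtain y where y: "y \<in> tothom t' (tz t) m"
    "totd C t' (tz t) m y = act (a, b, k, u, v, w) (D, p, q) - ?X - ksign m (rac (D', p', q') k)"
    using exact_lift[OF t' tothom_diff[OF tothom_diff[OF X2 X1] tothom_ksign[OF X3]], of m] by auto
  obtain y1 y2 y3 where y_eq: "y = (y1, y2, y3)" by (cases y)
  have "dif C (tz t) (tx t') m y1 = a \<cdot> D - \<chi>1 - ksign m (D' \<cdot> k)" "y1 \<in> hom (tz t) (tx t') m"
    using y by (simp_all add: y_eq tothom_def ksign_Pair)
  then have "a \<cdot> D - \<chi>1 - ksign m (D' \<cdot> k) \<in> bnd (tz t) (tx t') (m + 1)" by (simp add: bndI)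
  from bnd_diff[OF 1 this] show ?thesis by (simp add: algebra_simps)
qed

text \<open>Exactness in the middle: a closed morphism whose outer diagonal entries are null-homotopic
  comes from \<open>Hom(z,x')\<close> up to homotopy. Subtracting the homotopies \<open>e\<close> and \<open>l\<close> leaves a morphism
  from \<open>x \<rightarrow> y\<close> to \<open>y' \<rightarrow> z'\<close>. Acyclicity of the target factors its columns at \<open>y\<close> and at \<open>x\<close>
  through \<open>x'\<close>, giving \<open>\<pi> : y \<rightarrow> x'\<close> and \<open>\<mu> : x \<rightarrow> x'\<close>; the contraction of the source then extends
  \<open>(\<pi>, \<mu>)\<close> along \<open>(g, h)\<close> to \<open>\<chi> : z \<rightarrow> x'\<close>.\<close>
lemma iota_exhausts:
  assumes \<Phi>: "(a, b, k, u, v, w) \<in> trihom t t' m" and d: "tri_dif C t t' m (a, b, k, u, v, w) = 0"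
    and a: "a \<in> bnd (tx t) (tx t') m" and k: "k \<in> bnd (tz t) (tz t') m"
  shows "\<exists>\<chi> \<in> cyc (tz t) (tx t') m. \<exists>\<Psi> \<in> trihom t t' (m - 1).
    (a, b, k, u, v, w) = iota t t' \<chi> + tri_dif C t t' (m - 1) \<Psi>"
proof -
  note X = exact_precomplexD[OF t] exact_precomplexD[OF t']
  note K = contractionD[OF c] contractionD[OF c']
  note P = exact_precomplex[OF t] exact_precomplex[OF t']
  have \<Phi>': "a \<in> hom (tx t) (tx t') m" "b \<in> hom (ty t) (ty t') m" "k \<in> hom (tz t) (tz t') m"
     "u \<in> hom (tx t) (ty t') (m - 1)" "v \<in> hom (ty t) (tz t') (m - 1)" "w \<in> hom (tx t) (tz t') (m - 2)"
    using \<Phi> by (simp_all add: trihom_def)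
  obtain e where e: "e \<in> hom (tx t) (tx t') (m - 1)" "dif C (tx t) (tx t') (m - 1) e = a" using a by (rule bndE)
  obtain l where l: "l \<in> hom (tz t) (tz t') (m - 1)" "dif C (tz t) (tz t') (m - 1) l = k" using k by (rule bndE)
  have db: "dif C (ty t) (ty t') m b = 0"
    and du: "dif C (tx t) (ty t') (m - 1) u = tf t' \<cdot> a - ksign m (b \<cdot> tf t)"
    and dv: "dif C (ty t) (tz t') (m - 1) v = ksign m (k \<cdot> tg t) - tg t' \<cdot> b"
    and dw: "dif C (tx t) (tz t') (m - 2) w = ksign m (v \<cdot> tf t) + ksign m (k \<cdot> th t) - tg t' \<cdot> u - th t' \<cdot> a"
    using d by (simp_all add: zero_prod_def algebra_simps eq_neg_iff_add_eq_0)
  define v1 where "v1 = v - ksign m (l \<cdot> tg t)"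
  have M1: "l \<cdot> tg t \<in> hom (ty t) (tz t') (m - 1)" "l \<cdot> th t \<in> hom (tx t) (tz t') (m - 2)"
    "tf t' \<cdot> e \<in> hom (tx t) (ty t') (m - 1)" "th t' \<cdot> e \<in> hom (tx t) (tz t') (m - 2)"
    "ksign m (l \<cdot> tg t) \<in> hom (ty t) (tz t') (m - 1)" "v1 \<in> hom (ty t) (tz t') (m - 1)"
    unfolding v1_def by (rule e l X \<Phi>' homI | simp)+
  have "(0, b, v1) \<in> tothom t' (ty t) (m + 1)" using \<Phi>' M1 X by (simp add: tothom_def hom_zero)
  moreover have "totd C t' (ty t) (m + 1) (0, b, v1) = 0"
    using X \<Phi>' M1 db dv l by (simp add: v1_def zero_prod_def zero_right[OF X(13)] zero_right[OF X(15)] d_zero dg_simps)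
  ultimately have "\<exists>y \<in> tothom t' (ty t) m. totd C t' (ty t) m y = (0, b, v1)"
    by (rule exact_lift[OF t']) simp
  then obtain \<pi> r1 s1 where y: "(\<pi>, r1, s1) \<in> tothom t' (ty t) m" "totd C t' (ty t) m (\<pi>, r1, s1) = (0, b, v1)"
    by (metis prod_cases3)
  then have \<pi>: "\<pi> \<in> hom (ty t) (tx t') m" "r1 \<in> hom (ty t) (ty t') (m - 1)" "s1 \<in> hom (ty t) (tz t') (m - 2)"
    by (simp_all add: tothom_def)
  have d\<pi>: "dif C (ty t) (tx t') m \<pi> = 0"
    and b_eq: "b = tf t' \<cdot> \<pi> - dif C (ty t) (ty t') (m - 1) r1"
    and v1_eq: "v1 = dif C (ty t) (tz t') (m - 2) s1 + tg t' \<cdot> r1 + th t' \<cdot> \<pi>"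
    using y(2) by auto
  define \<theta> where "\<theta> = - ksign m (\<pi> \<cdot> tf t)"
  define u2 where "u2 = u - tf t' \<cdot> e - ksign m (r1 \<cdot> tf t)"
  define w2 where "w2 = w - th t' \<cdot> e - ksign m (l \<cdot> th t) - ksign m (s1 \<cdot> tf t)"
  have M2: "r1 \<cdot> tf t \<in> hom (tx t) (ty t') (m - 1)" "s1 \<cdot> tf t \<in> hom (tx t) (tz t') (m - 2)"
    "\<pi> \<cdot> tf t \<in> hom (tx t) (tx t') m" "\<theta> \<in> hom (tx t) (tx t') m"
    "u - tf t' \<cdot> e \<in> hom (tx t) (ty t') (m - 1)" "u2 \<in> hom (tx t) (ty t') (m - 1)"
    "w - th t' \<cdot> e \<in> hom (tx t) (tz t') (m - 2)" "w2 \<in> hom (tx t) (tz t') (m - 2)"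
    "w - th t' \<cdot> e - ksign m (l \<cdot> th t) \<in> hom (tx t) (tz t') (m - 2)"
    "ksign m (l \<cdot> th t) \<in> hom (tx t) (tz t') (m - 2)"
    "tf t' \<cdot> \<pi> \<in> hom (ty t) (ty t') m" "th t' \<cdot> \<pi> \<in> hom (ty t) (tz t') (m - 1)"
    "tg t' \<cdot> r1 \<in> hom (ty t) (tz t') (m - 1)"
    "dif C (ty t) (ty t') (m - 1) r1 \<in> hom (ty t) (ty t') m"
    "dif C (ty t) (tz t') (m - 2) s1 \<in> hom (ty t) (tz t') (m - 1)"
    "dif C (ty t) (tz t') (m - 2) s1 + tg t' \<cdot> r1 \<in> hom (ty t) (tz t') (m - 1)"
    "tg t \<cdot> tf t \<in> hom (tx t) (tz t) 0" "tg t' \<cdot> tf t' \<in> hom (tx t') (tz t') 0"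
    unfolding \<theta>_def u2_def w2_def by (rule e l M1 \<pi> X \<Phi>' homI | simp)+
  have v_eq: "v = v1 + ksign m (l \<cdot> tg t)" by (simp add: v1_def)
  have bf: "b \<cdot> tf t = tf t' \<cdot> (\<pi> \<cdot> tf t) - dif C (ty t) (ty t') (m - 1) r1 \<cdot> tf t"
    unfolding b_eq using X M1 M2 \<pi> by (simp add: dg_simps)
  have vf: "v \<cdot> tf t = dif C (ty t) (tz t') (m - 2) s1 \<cdot> tf t + tg t' \<cdot> (r1 \<cdot> tf t) + th t' \<cdot> (\<pi> \<cdot> tf t)
      + ksign m (l \<cdot> (tg t \<cdot> tf t))"
    unfolding v_eq v1_eq using X M1 M2 \<pi> l M1(6)[unfolded v1_eq] by (simp add: dg_simps)
  have "(\<theta>, u2, w2) \<in> tothom t' (tx t) m" using M2 by (simp add: tothom_def)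
  moreover have "totd C t' (tx t) m (\<theta>, u2, w2) = 0"
    using X \<Phi>' M1 M2 \<pi> du dw l e d\<pi> bf vf unfolding \<theta>_def u2_def w2_def zero_prod_def totd.simps
    by (cases "even m") (simp_all add: dg_simps ksign_def)
  ultimately have "\<exists>y \<in> tothom t' (tx t) (m - 1). totd C t' (tx t) (m - 1) y = (\<theta>, u2, w2)"
    by (rule exact_lift[OF t']) simp
  then obtain \<mu> r2 s2 where z: "(\<mu>, r2, s2) \<in> tothom t' (tx t) (m - 1)" "totd C t' (tx t) (m - 1) (\<mu>, r2, s2) = (\<theta>, u2, w2)"
    by (metis prod_cases3)
  then have \<mu>: "\<mu> \<in> hom (tx t) (tx t') (m - 1)" "r2 \<in> hom (tx t) (ty t') (m - 2)" "s2 \<in> hom (tx t) (tz t') (m - 3)"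
    by (simp_all add: tothom_def)
  have d\<mu>: "dif C (tx t) (tx t') (m - 1) \<mu> = - ksign m (\<pi> \<cdot> tf t)"
    and u2_eq: "u2 = tf t' \<cdot> \<mu> - dif C (tx t) (ty t') (m - 2) r2"
    and w2_eq: "w2 = dif C (tx t) (tz t') (m - 3) s2 + tg t' \<cdot> r2 + th t' \<cdot> \<mu>"
    using z(2) by (auto simp: \<theta>_def)
  have M3: "\<pi> \<cdot> p \<in> hom (tz t) (tx t') m" "\<mu> \<cdot> D \<in> hom (tz t) (tx t') m"
    "\<pi> \<cdot> r \<in> hom (ty t) (tx t') (m - 1)" "\<mu> \<cdot> E \<in> hom (ty t) (tx t') (m - 1)"
    "\<pi> \<cdot> i \<in> hom (tx t) (tx t') (m - 2)" "\<mu> \<cdot> G \<in> hom (tx t) (tx t') (m - 2)"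
    "tf t \<cdot> E \<in> hom (ty t) (ty t) 0" "p \<cdot> tg t \<in> hom (ty t) (ty t) 0" "idt C (ty t) \<in> hom (ty t) (ty t) 0"
    "tf t \<cdot> E + p \<cdot> tg t \<in> hom (ty t) (ty t) 0" "D \<cdot> tg t \<in> hom (ty t) (tx t) 1"
    "idt C (tx t) - E \<cdot> tf t \<in> hom (tx t) (tx t) 0" "idt C (tx t) \<in> hom (tx t) (tx t) 0"
    "E \<cdot> tf t \<in> hom (tx t) (tx t) 0" "D \<cdot> th t \<in> hom (tx t) (tx t) 0"
    "tf t \<cdot> G \<in> hom (tx t) (ty t) (- 1)" "r \<cdot> tf t \<in> hom (tx t) (ty t) (- 1)"
    "tf t \<cdot> G + r \<cdot> tf t \<in> hom (tx t) (ty t) (- 1)" "p \<cdot> th t \<in> hom (tx t) (ty t) (- 1)"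
    "tf t \<cdot> D \<in> hom (tz t) (ty t) 1"
    "- (\<pi> \<cdot> r) \<in> hom (ty t) (tx t') (m - 1)" "- (\<pi> \<cdot> i) \<in> hom (tx t) (tx t') (m - 2)"
    by (rule \<pi> \<mu> K X homI | simp)+
  \<comment> \<open>Multiplying the row \<open>(\<pi>, \<mu>)\<close> by the columns of the contraction gives \<open>\<chi>\<close> and homotopies
     \<open>\<eta>\<close>, \<open>\<nu>\<close> between \<open>\<chi> g\<close>, \<open>\<chi> h\<close> and \<open>\<pi>\<close>, \<open>\<mu>\<close>.\<close>
  define \<chi> where "\<chi> = \<pi> \<cdot> p + \<mu> \<cdot> D"
  define \<eta> where "\<eta> = ksign m (\<pi> \<cdot> r + \<mu> \<cdot> E)"
  define \<nu> where "\<nu> = ksign m (\<pi> \<cdot> i + \<mu> \<cdot> G)"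
  have M4: "\<chi> \<in> hom (tz t) (tx t') m" "\<eta> \<in> hom (ty t) (tx t') (m - 1)" "\<nu> \<in> hom (tx t) (tx t') (m - 2)"
    unfolding \<chi>_def \<eta>_def \<nu>_def by (intro hom_add hom_ksign M3)+
  have \<chi>: "\<chi> \<in> cyc (tz t) (tx t') m"
    by (rule cycI[OF M4(1)]) (use X K(1-14) M2 M3 M4 \<pi> \<mu> d\<pi> d\<mu> in \<open>cases "even m"; simp add: \<chi>_def dg_simps ksign_def\<close>)
  have d\<eta>: "dif C (ty t) (tx t') (m - 1) \<eta> = \<chi> \<cdot> tg t - \<pi>"
    using X K(1-14) M2 M3 M4 \<pi> \<mu> d\<pi> d\<mu> unfolding \<chi>_def \<eta>_def
    by (cases "even m") (simp_all add: dg_simps ksign_def idt_right[OF \<pi>(1)])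
  have d\<nu>: "dif C (tx t) (tx t') (m - 2) \<nu> = \<chi> \<cdot> th t + ksign m (\<eta> \<cdot> tf t) - \<mu>"
    using X K(1-14) M2 M3 M4 \<pi> \<mu> d\<pi> d\<mu> unfolding \<chi>_def \<eta>_def \<nu>_def
    by (cases "even m") (simp_all add: dg_simps ksign_def idt_right[OF \<mu>(1)])
  let ?\<Psi> = "(e, r1 + tf t' \<cdot> \<eta>, l, r2 + tf t' \<cdot> \<nu>, s1 + th t' \<cdot> \<eta>, s2 + th t' \<cdot> \<nu>)"
  have M5: "tf t' \<cdot> \<eta> \<in> hom (ty t) (ty t') (m - 1)" "tf t' \<cdot> \<nu> \<in> hom (tx t) (ty t') (m - 2)"
    "th t' \<cdot> \<eta> \<in> hom (ty t) (tz t') (m - 2)" "th t' \<cdot> \<nu> \<in> hom (tx t) (tz t') (m - 3)"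
    "\<chi> \<cdot> tg t \<in> hom (ty t) (tx t') m" "\<chi> \<cdot> th t \<in> hom (tx t) (tx t') (m - 1)"
    "\<eta> \<cdot> tf t \<in> hom (tx t) (tx t') (m - 1)" "\<chi> \<cdot> th t + ksign m (\<eta> \<cdot> tf t) \<in> hom (tx t) (tx t') (m - 1)"
    "ksign m (\<eta> \<cdot> tf t) \<in> hom (tx t) (tx t') (m - 1)"
    "\<chi> \<cdot> th t + \<eta> \<cdot> tf t \<in> hom (tx t) (tx t') (m - 1)" "\<chi> \<cdot> th t - \<eta> \<cdot> tf t \<in> hom (tx t) (tx t') (m - 1)"
    by (rule M4 X homI | simp)+
  have \<Psi>: "?\<Psi> \<in> trihom t t' (m - 1)"
    using e l \<pi> \<mu> M5 by (simp add: trihom_def hom_add)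
  have u_eq: "u = u2 + tf t' \<cdot> e + ksign m (r1 \<cdot> tf t)" by (simp add: u2_def)
  have w_eq: "w = w2 + th t' \<cdot> e + ksign m (l \<cdot> th t) + ksign m (s1 \<cdot> tf t)" by (simp add: w2_def)
  have "(a, b, k, u, v, w) = iota t t' \<chi> + tri_dif C t t' (m - 1) ?\<Psi>"
    unfolding u_eq w_eq v_eq u2_eq w2_eq v1_eq b_eq
    using X M2 M4 M5 \<pi> \<mu> e l d\<eta> d\<nu> unfolding iota_def
    by (cases "even m") (simp_all add: dg_simps ksign_def)
  then show ?thesis using \<chi> \<Psi> by blast
qed

end
end
end

context dg_triangles
begin

interpretation T: dg_category "triangles C" by (rule dg_category_triangles)

lemma T_hom:
  assumes "exact_triangle C t" "exact_triangle C t'"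
  shows "T.hom t t' m = trihom t t' m"
  using assms by (auto simp: T.hom_def Ob_triangles Hom_triangles exact_precomplex)

lemma T_cyc_iff:
  assumes "exact_triangle C t" "exact_triangle C t'"
  shows "\<Phi> \<in> T.cyc t t' m \<longleftrightarrow> \<Phi> \<in> trihom t t' m \<and> tri_dif C t t' m \<Phi> = 0"
  using T_hom[OF assms] by (simp add: T.cyc_def triangles_simps)

lemma T_bnd_iff:
  assumes "exact_triangle C t" "exact_triangle C t'"
  shows "\<Phi> \<in> T.bnd t t' m \<longleftrightarrow> (\<exists>\<Psi> \<in> trihom t t' (m - 1). tri_dif C t t' (m - 1) \<Psi> = \<Phi>)"
  using T_hom[OF assms] by (auto simp: T.bnd_def triangles_simps)

text \<open>The cocycle \<open>- D\<close> represents the connecting morphism of \<open>t\<close> (\<open>connecting_iff\<close> below).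
  Working with \<open>D\<close> itself keeps signs out of the formulas for obstructions.\<close>
definition conn :: "('o, 'h) tri \<Rightarrow> 'h \<Rightarrow> bool" where
  "conn t D \<longleftrightarrow> (\<exists>p q E r G i. contraction t D p q E r G i)"

lemma conn_exists:
  assumes t: "exact_triangle C t"
  shows "\<exists>D. conn t D"
proof -
  have "(0, 0, idt C (tz t)) \<in> tothom t (tz t) 2"
    using exact_precomplexD[OF t] by (simp add: tothom_def hom_zero hom_idt)
  moreover have "totd C t (tz t) 2 (0, 0, idt C (tz t)) = 0"
    using exact_precomplexD[OF t] cycD(2)[OF cyc_idt[of "tz t"]]
    by (simp add: zero_prod_def d_zero zero_right[of _ _ "tz t"] zero_right[of _ _ "ty t"] zero_right[of "tf t"]
      zero_right[of "tg t"] zero_right[of "th t"])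
  ultimately have "\<exists>u \<in> tothom t (tz t) 1. totd C t (tz t) 1 u = (0, 0, idt C (tz t))"
    by (rule exact_lift[OF t]) simp
  then obtain D p q where "(D, p, q) \<in> tothom t (tz t) 1" "totd C t (tz t) 1 (D, p, q) = (0, 0, idt C (tz t))"
    by (metis prod_cases3)
  from contraction_extends[OF t this] show ?thesis unfolding conn_def by metis
qed

lemma conn_cyc: "conn t D \<Longrightarrow> D \<in> cyc (tz t) (tx t) 1"
  by (auto simp: conn_def contraction_def cyc_def)

lemma conn_tf: "conn t D \<Longrightarrow> tf t \<cdot> D \<in> bnd (tz t) (ty t) 1"
  unfolding conn_def contraction_def by (elim exE conjE, rule bndI) auto

lemma conn_tg: "conn t D \<Longrightarrow> D \<cdot> tg t \<in> bnd (ty t) (tx t) 1"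
  unfolding conn_def contraction_def
  by (elim exE conjE, subst bnd_minus_iff[symmetric], rule bndI) auto

lemma connecting_iff:
  assumes t: "exact_triangle C t"
  shows "connecting C t \<delta> \<longleftrightarrow> (\<exists>D. conn t D \<and> \<delta> = ecls C 1 (tz t) (tx t) (- D))"
proof
  assume "connecting C t \<delta>"
  then show "\<exists>D. conn t D \<and> \<delta> = ecls C 1 (tz t) (tx t) (- D)"
    unfolding connecting_def tot_eq[OF exact_precomplex[OF t] exact_precomplexD(3)[OF t]]
    by (metis contraction_extends[OF t] conn_def)
next
  assume "\<exists>D. conn t D \<and> \<delta> = ecls C 1 (tz t) (tx t) (- D)"
  then show "connecting C t \<delta>"
    unfolding connecting_def tot_eq[OF exact_precomplex[OF t] exact_precomplexD(3)[OF t]]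
    by (metis col_z[OF t] conn_def)
qed

context
  fixes t t' D D'
  assumes t: "exact_triangle C t" and t': "exact_triangle C t'"
    and c: "conn t D" and c': "conn t' D'"
begin

lemma tri_cyc_components:
  assumes "(a, b, k, u, v, w) \<in> T.cyc t t' m"
  shows "a \<in> cyc (tx t) (tx t') m" "b \<in> cyc (ty t) (ty t') m" "k \<in> cyc (tz t) (tz t') m"
  using assms by (auto simp: T_cyc_iff[OF t t'] trihom_def cyc_def zero_prod_def)

lemma tri_bnd_components:
  assumes "(a, b, k, u, v, w) \<in> T.bnd t t' m"
  shows "a \<in> bnd (tx t) (tx t') m" "b \<in> bnd (ty t) (ty t') m" "k \<in> bnd (tz t) (tz t') m"
proof -
  obtain \<Psi> where \<Psi>: "\<Psi> \<in> trihom t t' (m - 1)" "tri_dif C t t' (m - 1) \<Psi> = (a, b, k, u, v, w)"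
    using assms by (auto simp: T_bnd_iff[OF t t'])
  obtain A B F U V W where "\<Psi> = (A, B, F, U, V, W)" by (cases \<Psi>)
  with \<Psi> have A: "A \<in> hom (tx t) (tx t') (m - 1)" "- B \<in> hom (ty t) (ty t') (m - 1)" "F \<in> hom (tz t) (tz t') (m - 1)"
    and "dif C (tx t) (tx t') (m - 1) A = a" "dif C (ty t) (ty t') (m - 1) (- B) = b" "dif C (tz t) (tz t') (m - 1) F = k"
    by (auto simp: trihom_def d_minus hom_minus)
  then show "a \<in> bnd (tx t) (tx t') m" "b \<in> bnd (ty t) (ty t') m" "k \<in> bnd (tz t) (tz t') m"
    by (auto intro: bndI[OF A(1)] bndI[OF A(2)] bndI[OF A(3)])
qed

text \<open>Outer components of a closed morphism are compatible with the connecting morphisms: this is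
  \<open>iota_cobounds\<close> for \<open>\<chi> = 0\<close>. The converse is \<open>tri_lift\<close>.\<close>
lemma tri_cyc_compat:
  assumes "(a, b, k, u, v, w) \<in> T.cyc t t' m"
  shows "a \<cdot> D - ksign m (D' \<cdot> k) \<in> bnd (tz t) (tx t') (m + 1)"
proof -
  obtain p q E r G i where K: "contraction t D p q E r G i" using c by (auto simp: conn_def)
  obtain p' q' E' r' G' i' where K': "contraction t' D' p' q' E' r' G' i'" using c' by (auto simp: conn_def)
  have "0 - (a \<cdot> D - ksign m (D' \<cdot> k)) \<in> bnd (tz t) (tx t') (m + 1)"
    by (rule iota_cobounds[OF t t' K K', of a b k u v w m])
      (use assms in \<open>auto simp: T_cyc_iff[OF t t'] iota_zero[OF t t'] cyc_zero exact_precomplexD[OF t] exact_precomplexD[OF t']\<close>)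
  then show ?thesis by (simp add: bnd_sym)
qed

lemma tri_lift_obstruction:
  assumes a: "a \<in> cyc (tx t) (tx t') m" and k: "k \<in> cyc (tz t) (tz t') m"
  shows "\<exists>b u v w. (a, b, k, u, v, w) \<in> trihom t t' m \<and>
    tri_dif C t t' m (a, b, k, u, v, w) = iota t t' (a \<cdot> D - ksign m (D' \<cdot> k))"
proof -
  obtain p q E r G i where K: "contraction t D p q E r G i" using c by (auto simp: conn_def)
  obtain p' q' E' r' G' i' where K': "contraction t' D' p' q' E' r' G' i'" using c' by (auto simp: conn_def)
  note P = exact_precomplex[OF t] exact_precomplex[OF t']
  let ?\<Phi> = "lift_x t' E G m a + lift_z t p' q' m k"
  have M: "lift_x t' E G m a \<in> trihom t t' m" "lift_z t p' q' m k \<in> trihom t t' m"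
    by (rule lift_x_closed[OF t t' K K' cycD(1)[OF a]] lift_z_closed[OF t t' K K' cycD(1)[OF k]])+
  have "tri_dif C t t' m ?\<Phi> = iota t t' (a \<cdot> D) - iota t t' (ksign m (D' \<cdot> k))"
    by (simp add: tri_dif_add[OF P M] tri_dif_lift_x[OF t t' K K' a] tri_dif_lift_z[OF t t' K K' k])
  also have "\<dots> = iota t t' (a \<cdot> D - ksign m (D' \<cdot> k))"
  proof -
    have "a \<cdot> D \<in> hom (tz t) (tx t') (m + 1)" "ksign m (D' \<cdot> k) \<in> hom (tz t) (tx t') (m + 1)"
      by (rule cycD(1)[OF a] cycD(1)[OF k] cycD(1)[OF conn_cyc[OF c]] cycD(1)[OF conn_cyc[OF c']] homI | simp)+
    then show ?thesis
      using iota_add[OF t t' _ hom_minus, of "a \<cdot> D" "m + 1" "ksign m (D' \<cdot> k)"] iota_minus[OF t t'] by simp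
  qed
  finally have d: "tri_dif C t t' m ?\<Phi> = iota t t' (a \<cdot> D - ksign m (D' \<cdot> k))" .
  have "?\<Phi> \<in> trihom t t' m" using M T.hom_add[of _ t t' m] unfolding T_hom[OF t t'] by blast
  moreover have "\<exists>b u v w. ?\<Phi> = (a, b, k, u, v, w)" by (simp add: lift_x_def lift_z_def)
  ultimately show ?thesis using d by metis
qed

lemma iota_cyc: "\<chi> \<in> cyc (tz t) (tx t') m \<Longrightarrow> iota t t' \<chi> \<in> T.cyc t t' m"
  using iota_closed[OF t t'] tri_dif_iota[OF t t'] iota_zero[OF t t'] by (auto simp: T_cyc_iff[OF t t'] cyc_def)

lemma iota_bnd:
  assumes "\<chi> \<in> bnd (tz t) (tx t') m" shows "iota t t' \<chi> \<in> T.bnd t t' m"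
proof -
  obtain e where e: "e \<in> hom (tz t) (tx t') (m - 1)" "dif C (tz t) (tx t') (m - 1) e = \<chi>" using assms by (rule bndE)
  have "iota t t' (- e) \<in> trihom t t' (m - 1)" "tri_dif C t t' (m - 1) (iota t t' (- e)) = iota t t' \<chi>"
    using iota_closed[OF t t' hom_minus[OF e(1)]] tri_dif_iota[OF t t' hom_minus[OF e(1)]] e(2)
      iota_minus[OF t t' hom_dif[OF e(1)]] by (simp_all add: d_minus[OF e(1)])
  then show ?thesis by (auto simp: T_bnd_iff[OF t t'])
qed

text \<open>The partial lift of \<open>(a, k)\<close> has boundary \<open>iota\<close> of the obstruction; as \<open>iota\<close> anticommutes
  with differentials, a cobounding element of the obstruction corrects it.\<close>
lemma tri_lift:
  assumes a: "a \<in> cyc (tx t) (tx t') m" and k: "k \<in> cyc (tz t) (tz t') m"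
    and d: "a \<cdot> D - ksign m (D' \<cdot> k) \<in> bnd (tz t) (tx t') (m + 1)"
  shows "\<exists>b u v w. (a, b, k, u, v, w) \<in> T.cyc t t' m"
proof -
  obtain b u v w where \<Phi>: "(a, b, k, u, v, w) \<in> trihom t t' m"
    "tri_dif C t t' m (a, b, k, u, v, w) = iota t t' (a \<cdot> D - ksign m (D' \<cdot> k))"
    using tri_lift_obstruction[OF a k] by blast
  obtain e where e: "e \<in> hom (tz t) (tx t') m" "dif C (tz t) (tx t') m e = a \<cdot> D - ksign m (D' \<cdot> k)" using bndE[OF d] by auto
  have "(a, b, k, u, v, w) + iota t t' e \<in> T.cyc t t' m"
    using \<Phi> iota_closed[OF t t' e(1)] tri_dif_iota[OF t t' e(1)] e(2) T.hom_add[of _ t t' m]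
      tri_dif_add[OF exact_precomplex[OF t] exact_precomplex[OF t']] by (simp add: T_cyc_iff[OF t t'] T_hom[OF t t'])
  then show ?thesis by (auto simp: iota_def)
qed

lemma iota_bnd_iff:
  assumes \<chi>: "\<chi> \<in> cyc (tz t) (tx t') (m + 1)"
  shows "iota t t' \<chi> \<in> T.bnd t t' (m + 1) \<longleftrightarrow>
    (\<exists>a \<in> cyc (tx t) (tx t') m. \<exists>k \<in> cyc (tz t) (tz t') m.
      \<chi> - (a \<cdot> D - ksign m (D' \<cdot> k)) \<in> bnd (tz t) (tx t') (m + 1))"
proof
  assume "iota t t' \<chi> \<in> T.bnd t t' (m + 1)"
  then obtain \<Psi> where \<Psi>: "\<Psi> \<in> trihom t t' m" "tri_dif C t t' m \<Psi> = iota t t' \<chi>"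
    by (auto simp: T_bnd_iff[OF t t'])
  obtain a b k u v w where \<Psi>_eq: "\<Psi> = (a, b, k, u, v, w)" by (cases \<Psi>)
  obtain p q E r G i where K: "contraction t D p q E r G i" using c by (auto simp: conn_def)
  obtain p' q' E' r' G' i' where K': "contraction t' D' p' q' E' r' G' i'" using c' by (auto simp: conn_def)
  have "a \<in> cyc (tx t) (tx t') m" "k \<in> cyc (tz t) (tz t') m"
    using \<Psi> by (auto simp: \<Psi>_eq trihom_def iota_def cyc_def)
  moreover have "\<chi> - (a \<cdot> D - ksign m (D' \<cdot> k)) \<in> bnd (tz t) (tx t') (m + 1)"
    by (rule iota_cobounds[OF t t' K K' _ \<chi>]) (use \<Psi> in \<open>auto simp: \<Psi>_eq\<close>)
  ultimately show "\<exists>a \<in> cyc (tx t) (tx t') m. \<exists>k \<in> cyc (tz t) (tz t') m.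
      \<chi> - (a \<cdot> D - ksign m (D' \<cdot> k)) \<in> bnd (tz t) (tx t') (m + 1)" by blast
next
  assume "\<exists>a \<in> cyc (tx t) (tx t') m. \<exists>k \<in> cyc (tz t) (tz t') m.
      \<chi> - (a \<cdot> D - ksign m (D' \<cdot> k)) \<in> bnd (tz t) (tx t') (m + 1)"
  then obtain a k where a: "a \<in> cyc (tx t) (tx t') m" "k \<in> cyc (tz t) (tz t') m"
    and b: "\<chi> - (a \<cdot> D - ksign m (D' \<cdot> k)) \<in> bnd (tz t) (tx t') (m + 1)" by blast
  let ?\<psi> = "a \<cdot> D - ksign m (D' \<cdot> k)"
  have "iota t t' ?\<psi> \<in> T.bnd t t' (m + 1)"
    using tri_lift_obstruction[OF a] unfolding T_bnd_iff[OF t t'] by (metis add_diff_cancel_right')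
  moreover have "iota t t' \<chi> = iota t t' (\<chi> - ?\<psi>) + iota t t' ?\<psi>"
  proof -
    have "?\<psi> \<in> hom (tz t) (tx t') (m + 1)"
      by (rule cycD(1)[OF a(1)] cycD(1)[OF a(2)] cycD(1)[OF conn_cyc[OF c]] cycD(1)[OF conn_cyc[OF c']] homI | simp)+
    then show ?thesis using iota_add[OF t t' hom_diff[OF cycD(1)[OF \<chi>]], of ?\<psi> ?\<psi>] by simp
  qed
  ultimately show "iota t t' \<chi> \<in> T.bnd t t' (m + 1)"
    using iota_bnd[OF b] T.bnd_add by metis
qed

lemma tri_cyc_iota:
  assumes \<Phi>: "(a, b, k, u, v, w) \<in> T.cyc t t' m"
    and a: "a \<in> bnd (tx t) (tx t') m" and k: "k \<in> bnd (tz t) (tz t') m"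
  shows "\<exists>\<chi> \<in> cyc (tz t) (tx t') m. (a, b, k, u, v, w) - iota t t' \<chi> \<in> T.bnd t t' m"
proof -
  obtain p q E r G i where K: "contraction t D p q E r G i" using c by (auto simp: conn_def)
  obtain p' q' E' r' G' i' where K': "contraction t' D' p' q' E' r' G' i'" using c' by (auto simp: conn_def)
  obtain \<chi> \<Psi> where \<chi>: "\<chi> \<in> cyc (tz t) (tx t') m" and \<Psi>: "\<Psi> \<in> trihom t t' (m - 1)"
    and eq: "(a, b, k, u, v, w) = iota t t' \<chi> + tri_dif C t t' (m - 1) \<Psi>"
    using iota_exhausts[OF t t' K K' _ _ a k, of b u v w] \<Phi> by (auto simp: T_cyc_iff[OF t t'])
  then have "(a, b, k, u, v, w) - iota t t' \<chi> = tri_dif C t t' (m - 1) \<Psi>" by simp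
  then show ?thesis using \<chi> \<Psi> T_bnd_iff[OF t t'] by metis
qed

end

section \<open>Isomorphisms of triangles\<close>

text \<open>Morphisms with null outer components form a square-zero ideal up to homotopy: they come from
  \<open>\<chi> : z \<rightarrow> x'\<close> and \<open>\<psi> : z' \<rightarrow> x''\<close>, and the product comes from \<open>\<psi> g' f' \<chi>\<close>, where \<open>g' f' = - d h'\<close>.\<close>
lemma tri_outer_null_cmp:
  assumes t: "exact_triangle C t" "exact_triangle C t'" "exact_triangle C t''"
    and \<Phi>: "(a, b, k, u, v, w) \<in> T.cyc t t' m" and \<Psi>: "(a', b', k', u', v', w') \<in> T.cyc t' t'' l"
    and a: "a \<in> bnd (tx t) (tx t') m" "k \<in> bnd (tz t) (tz t') m"
    and a': "a' \<in> bnd (tx t') (tx t'') l" "k' \<in> bnd (tz t') (tz t'') l"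
  shows "tri_cmp C (a', b', k', u', v', w') (a, b, k, u, v, w) \<in> T.bnd t t'' (m + l)"
proof -
  note X = exact_precomplexD[OF t(1)] exact_precomplexD[OF t(2)] exact_precomplexD[OF t(3)]
  obtain D D' D'' where D: "conn t D" "conn t' D'" "conn t'' D''"
    using conn_exists[OF t(1)] conn_exists[OF t(2)] conn_exists[OF t(3)] by blast
  obtain \<chi> where \<chi>: "\<chi> \<in> cyc (tz t) (tx t') m" "(a, b, k, u, v, w) - iota t t' \<chi> \<in> T.bnd t t' m"
    using tri_cyc_iota[OF t(1,2) D(1,2) \<Phi> a] by blast
  obtain \<psi> where \<psi>: "\<psi> \<in> cyc (tz t') (tx t'') l" "(a', b', k', u', v', w') - iota t' t'' \<psi> \<in> T.bnd t' t'' l"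
    using tri_cyc_iota[OF t(2,3) D(2,3) \<Psi> a'] by blast
  let ?\<Phi> = "(a, b, k, u, v, w)" and ?\<Psi> = "(a', b', k', u', v', w')"
  have i: "iota t t' \<chi> \<in> T.cyc t t' m" "iota t' t'' \<psi> \<in> T.cyc t' t'' l"
    by (rule iota_cyc[OF t(1,2) D(1,2) \<chi>(1)] iota_cyc[OF t(2,3) D(2,3) \<psi>(1)])+
  have "tri_cmp C ?\<Psi> (?\<Phi> - iota t t' \<chi>) \<in> T.bnd t t'' (m + l)"
    using T.bnd_cmp_right[OF \<chi>(2) \<Psi> refl] by (simp add: triangles_simps)
  moreover have "tri_cmp C (?\<Psi> - iota t' t'' \<psi>) (iota t t' \<chi>) \<in> T.bnd t t'' (m + l)"
    using T.bnd_cmp_left[OF i(1) \<psi>(2) refl] by (simp add: triangles_simps)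
  moreover have "tri_cmp C ?\<Psi> (?\<Phi> - iota t t' \<chi>) + tri_cmp C (?\<Psi> - iota t' t'' \<psi>) (iota t t' \<chi>) =
      tri_cmp C ?\<Psi> ?\<Phi> - tri_cmp C (iota t' t'' \<psi>) (iota t t' \<chi>)"
    using T.diff_right[OF T.cycD(1)[OF \<Psi>] T.cycD(1)[OF \<Phi>] T.cycD(1)[OF i(1)]]
      T.diff_left[OF T.cycD(1)[OF i(1)] T.cycD(1)[OF \<Psi>] T.cycD(1)[OF i(2)]]
    by (simp add: triangles_simps)
  ultimately have 1: "tri_cmp C ?\<Psi> ?\<Phi> - tri_cmp C (iota t' t'' \<psi>) (iota t t' \<chi>) \<in> T.bnd t t'' (m + l)"
    using T.bnd_add by metis
  have M: "\<chi> \<cdot> tg t \<in> hom (ty t) (tx t') m" "\<chi> \<cdot> th t \<in> hom (tx t) (tx t') (m - 1)"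
    "tf t' \<cdot> \<chi> \<in> hom (tz t) (ty t') m" "tg t' \<cdot> (tf t' \<cdot> \<chi>) \<in> hom (tz t) (tz t') m"
    "tf t' \<cdot> (\<chi> \<cdot> tg t) \<in> hom (ty t) (ty t') m" "tg t' \<cdot> (tf t' \<cdot> (\<chi> \<cdot> tg t)) \<in> hom (ty t) (tz t') m"
    "tf t' \<cdot> (\<chi> \<cdot> th t) \<in> hom (tx t) (ty t') (m - 1)" "tg t' \<cdot> (tf t' \<cdot> (\<chi> \<cdot> th t)) \<in> hom (tx t) (tz t') (m - 1)"
    "\<psi> \<cdot> tg t' \<in> hom (ty t') (tx t'') l" "\<psi> \<cdot> th t' \<in> hom (tx t') (tx t'') (l - 1)"
    "tf t'' \<cdot> (\<psi> \<cdot> tg t') \<in> hom (ty t') (ty t'') l" "tf t'' \<cdot> (\<psi> \<cdot> th t') \<in> hom (tx t') (ty t'') (l - 1)"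
    "th t'' \<cdot> (\<psi> \<cdot> tg t') \<in> hom (ty t') (tz t'') (l - 1)" "th t'' \<cdot> (\<psi> \<cdot> th t') \<in> hom (tx t') (tz t'') (l - 2)"
    "th t' \<cdot> (\<chi> \<cdot> tg t) \<in> hom (ty t) (tz t') (m - 1)"
    "th t' \<cdot> (\<chi> \<cdot> th t) \<in> hom (tx t) (tz t') (m - 2)"
    by (rule cycD(1)[OF \<chi>(1)] cycD(1)[OF \<psi>(1)] X homI | simp)+
  have eq: "tri_cmp C (iota t' t'' \<psi>) (iota t t' \<chi>) = iota t t'' (\<psi> \<cdot> (tg t' \<cdot> (tf t' \<cdot> \<chi>)))"
    using X M cycD(1)[OF \<chi>(1)] cycD(1)[OF \<psi>(1)]
    by (simp add: iota_def zero_left[OF M(5)] zero_left[OF M(7)] zero_right[OF M(12)] zero_right[OF M(11)]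
        zero_right[OF M(14)] zero_right[OF M(13)] zero_left[OF M(15)] zero_left[OF M(16)] zero_right[OF X(4)]
        zero_right[OF hom_zero[OF X(1) X(1)]] assoc)
  have "tg t' \<cdot> tf t' \<in> bnd (tx t') (tz t') 0"
    using bndI[OF X(15), of 0] X(18) by (simp add: bnd_minus_iff)
  then have "(tg t' \<cdot> tf t') \<cdot> \<chi> \<in> bnd (tz t) (tz t') m" by (rule bnd_cmp_left[OF \<chi>(1)]) simp
  then have "\<psi> \<cdot> ((tg t' \<cdot> tf t') \<cdot> \<chi>) \<in> bnd (tz t) (tx t'') (m + l)" by (rule bnd_cmp_right[OF _ \<psi>(1)]) simp
  then have "iota t t'' (\<psi> \<cdot> (tg t' \<cdot> (tf t' \<cdot> \<chi>))) \<in> T.bnd t t'' (m + l)"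
    using iota_bnd[OF t(1,3) D(1,3)] X cycD(1)[OF \<chi>(1)] by (simp add: assoc)
  then have "tri_cmp C (iota t' t'' \<psi>) (iota t t' \<chi>) \<in> T.bnd t t'' (m + l)" unfolding eq .
  from T.bnd_add[OF 1 this] show ?thesis unfolding diff_add_cancel .
qed

text \<open>The inverses of the outer components are again compatible with the connecting morphisms and
  lift to a morphism of triangles. Its composites with the given one differ from the identities by
  morphisms with null outer components, whose squares are null.\<close>
lemma tri_conservative:
  assumes t: "exact_triangle C t" "exact_triangle C t'"
    and \<Phi>: "(a, b, k, u, v, w) \<in> T.cyc t t' 0"
    and a: "inverse_pair C 0 (tx t) (tx t') a a'" and k: "inverse_pair C 0 (tz t) (tz t') k k'"
  shows "\<exists>\<Psi>. inverse_pair (triangles C) 0 t t' (a, b, k, u, v, w) \<Psi>"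
proof -
  note X = exact_precomplexD[OF t(1)] exact_precomplexD[OF t(2)]
  obtain D D' where D: "conn t D" "conn t' D'"
    using conn_exists[OF t(1)] conn_exists[OF t(2)] by blast
  have a1: "a \<in> cyc (tx t) (tx t') 0" "a' \<in> cyc (tx t') (tx t) 0" "a' \<cdot> a - idt C (tx t) \<in> bnd (tx t) (tx t) 0"
      "a \<cdot> a' - idt C (tx t') \<in> bnd (tx t') (tx t') 0"
    using a X by (auto simp: inverse_pair_iff)
  have k1: "k \<in> cyc (tz t) (tz t') 0" "k' \<in> cyc (tz t') (tz t) 0" "k' \<cdot> k - idt C (tz t) \<in> bnd (tz t) (tz t) 0"
      "k \<cdot> k' - idt C (tz t') \<in> bnd (tz t') (tz t') 0"
    using k X by (auto simp: inverse_pair_iff)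
  note h = cycD(1)[OF a1(1)] cycD(1)[OF a1(2)] cycD(1)[OF k1(1)] cycD(1)[OF k1(2)]
     cycD(1)[OF conn_cyc[OF D(1)]] cycD(1)[OF conn_cyc[OF D(2)]] hom_idt[OF X(1)] hom_idt[OF X(12)]
  note cD = conn_cyc[OF D(1)] conn_cyc[OF D(2)]
  have "a \<cdot> D - D' \<cdot> k \<in> bnd (tz t) (tx t') 1" using tri_cyc_compat[OF t D \<Phi>] by simp
  then have "(a \<cdot> D - D' \<cdot> k) \<cdot> k' \<in> bnd (tz t') (tx t') 1" by (rule bnd_cmp_left[OF k1(2)]) simp
  then have 1: "a' \<cdot> ((a \<cdot> D - D' \<cdot> k) \<cdot> k') \<in> bnd (tz t') (tx t) 1" by (rule bnd_cmp_right[OF _ a1(2)]) simp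
  have Dk: "D \<cdot> k' \<in> cyc (tz t') (tx t) 1" and aD: "a' \<cdot> D' \<in> cyc (tz t') (tx t) 1"
    using cyc_cmp[OF k1(2) cD(1)] cyc_cmp[OF cD(2) a1(2)] by simp_all
  have 2: "(a' \<cdot> a - idt C (tx t)) \<cdot> (D \<cdot> k') \<in> bnd (tz t') (tx t) 1"
    by (rule bnd_cmp_left[OF Dk a1(3)]) simp
  have 3: "(a' \<cdot> D') \<cdot> (k \<cdot> k' - idt C (tz t')) \<in> bnd (tz t') (tx t) 1"
    by (rule bnd_cmp_right[OF k1(4) aD]) simp
  have M: "a \<cdot> D \<in> hom (tz t) (tx t') 1" "D' \<cdot> k \<in> hom (tz t) (tx t') 1" "D \<cdot> k' \<in> hom (tz t') (tx t) 1"
    "a' \<cdot> a \<in> hom (tx t) (tx t) 0" "k \<cdot> k' \<in> hom (tz t') (tz t') 0" "a \<cdot> (D \<cdot> k') \<in> hom (tz t') (tx t') 1"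
    "D' \<cdot> (k \<cdot> k') \<in> hom (tz t') (tx t') 1" "a' \<cdot> D' \<in> hom (tz t') (tx t) 1" "idt C (tz t') \<in> hom (tz t') (tz t') 0"
    by (rule h X homI | simp)+
  have "a' \<cdot> D' - ksign 0 (D \<cdot> k') = - (a' \<cdot> ((a \<cdot> D - D' \<cdot> k) \<cdot> k')) + (a' \<cdot> a - idt C (tx t)) \<cdot> (D \<cdot> k')
      - (a' \<cdot> D') \<cdot> (k \<cdot> k' - idt C (tz t'))"
    using h M by (simp add: diff_left diff_right assoc idt_left[OF M(3)] idt_right[OF h(6)])
  then have "a' \<cdot> D' - ksign 0 (D \<cdot> k') \<in> bnd (tz t') (tx t) (0 + 1)"
    using 1 2 3 by (simp add: bnd_add bnd_minus bnd_diff)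
  then obtain b' u' v' w' where \<Psi>: "(a', b', k', u', v', w') \<in> T.cyc t' t 0"
    using tri_lift[OF t(2,1) D(2,1) a1(2) k1(2)] by blast
  have i: "idt (triangles C) t \<in> T.cyc t t 0" "idt (triangles C) t' \<in> T.cyc t' t' 0"
    by (rule T.cyc_idt, simp add: Ob_triangles t)+
  have c1: "tri_cmp C (a', b', k', u', v', w') (a, b, k, u, v, w) - idt (triangles C) t \<in> T.cyc t t 0"
    using T.cyc_diff[OF T.cyc_cmp[OF \<Phi> \<Psi>, of 0] i(1)] by (simp add: triangles_simps)
  have c2: "tri_cmp C (a, b, k, u, v, w) (a', b', k', u', v', w') - idt (triangles C) t' \<in> T.cyc t' t' 0"
    using T.cyc_diff[OF T.cyc_cmp[OF \<Psi> \<Phi>, of 0] i(2)] by (simp add: triangles_simps)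
  let ?P = "(a', b', k', u', v', w')" and ?F = "(a, b, k, u, v, w)"
  have e1: "tri_cmp C ?P ?F - idt (triangles C) t = (a' \<cdot> a - idt C (tx t), b' \<cdot> b - idt C (ty t), k' \<cdot> k - idt C (tz t),
      u' \<cdot> a + b' \<cdot> u, v' \<cdot> b + k' \<cdot> v, w' \<cdot> a + v' \<cdot> u + k' \<cdot> w)"
    by (simp add: triangles_simps)
  have e2: "tri_cmp C ?F ?P - idt (triangles C) t' = (a \<cdot> a' - idt C (tx t'), b \<cdot> b' - idt C (ty t'), k \<cdot> k' - idt C (tz t'),
      u \<cdot> a' + b \<cdot> u', v \<cdot> b' + k \<cdot> v', w \<cdot> a' + v \<cdot> u' + k \<cdot> w')"
    by (simp add: triangles_simps)
  have "tri_cmp C (tri_cmp C ?P ?F - idt (triangles C) t) (tri_cmp C ?P ?F - idt (triangles C) t) \<in> T.bnd t t (0 + 0)"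
    unfolding e1 by (rule tri_outer_null_cmp[OF t(1,1,1) c1[unfolded e1] c1[unfolded e1] a1(3) k1(3) a1(3) k1(3)])
  moreover have "tri_cmp C (tri_cmp C ?F ?P - idt (triangles C) t') (tri_cmp C ?F ?P - idt (triangles C) t') \<in> T.bnd t' t' (0 + 0)"
    unfolding e2 by (rule tri_outer_null_cmp[OF t(2,2,2) c2[unfolded e2] c2[unfolded e2] a1(4) k1(4) a1(4) k1(4)])
  ultimately show ?thesis
    using T.inverse_pair_of_unipotent[OF \<Phi> \<Psi>] unfolding triangles_simps(2) add_0_left by blast
qed

lemma tri_inverse_pair_components:
  assumes t: "exact_triangle C t" "exact_triangle C t'"
    and inv: "inverse_pair (triangles C) 0 t t' (a, b, k, u, v, w) (a', b', k', u', v', w')"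
  shows "inverse_pair C 0 (tx t) (tx t') a a'" "inverse_pair C 0 (ty t) (ty t') b b'"
    "inverse_pair C 0 (tz t) (tz t') k k'"
proof -
  note X = exact_precomplexD(1-3)[OF t(1)] exact_precomplexD(1-3)[OF t(2)]
  obtain D D' where D: "conn t D" "conn t' D'"
    using conn_exists[OF t(1)] conn_exists[OF t(2)] by blast
  have *: "(a, b, k, u, v, w) \<in> T.cyc t t' 0" "(a', b', k', u', v', w') \<in> T.cyc t' t 0"
    "tri_cmp C (a', b', k', u', v', w') (a, b, k, u, v, w) - idt (triangles C) t \<in> T.bnd t t 0"
    "tri_cmp C (a, b, k, u, v, w) (a', b', k', u', v', w') - idt (triangles C) t' \<in> T.bnd t' t' 0"
    using inv T.inverse_pair_iff[of t t'] t unfolding Ob_triangles triangles_simps(2) by auto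
  have d1: "(a' \<cdot> a - idt C (tx t), b' \<cdot> b - idt C (ty t), k' \<cdot> k - idt C (tz t),
      u' \<cdot> a + b' \<cdot> u, v' \<cdot> b + k' \<cdot> v, w' \<cdot> a + v' \<cdot> u + k' \<cdot> w) \<in> T.bnd t t 0"
    using *(3) by (simp add: triangles_simps)
  have d2: "(a \<cdot> a' - idt C (tx t'), b \<cdot> b' - idt C (ty t'), k \<cdot> k' - idt C (tz t'),
      u \<cdot> a' + b \<cdot> u', v \<cdot> b' + k \<cdot> v', w \<cdot> a' + v \<cdot> u' + k \<cdot> w') \<in> T.bnd t' t' 0"
    using *(4) by (simp add: triangles_simps)
  show "inverse_pair C 0 (tx t) (tx t') a a'" "inverse_pair C 0 (ty t) (ty t') b b'"
    "inverse_pair C 0 (tz t) (tz t') k k'"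
    using tri_cyc_components[OF t D *(1)] tri_cyc_components[OF t(2,1) D(2,1) *(2)]
      tri_bnd_components[OF t(1,1) D(1,1) d1] tri_bnd_components[OF t(2,2) D(2,2) d2]
    by (simp_all add: inverse_pair_iff X)
qed

end

section \<open>Triangles from isomorphisms and from extension classes\<close>

context dg_triangles
begin

text \<open>A cycle \<open>(0, 0, c)\<close> is the boundary of \<open>S c\<close>, where \<open>S\<close> is the last column of a contraction.
  So once \<open>S\<close> is known, acyclicity only has to be checked up to cycles concentrated in the third
  term.\<close>
lemma exact_triangleI:
  assumes P: "precomplex t" and S: "S \<in> tothom t (tz t) 1" "totd C t (tz t) 1 S = (0, 0, idt C (tz t))"
    and red: "\<And>w m u. w \<in> Ob C \<Longrightarrow> u \<in> tothom t w m \<Longrightarrow> totd C t w m u = 0 \<Longrightarrow>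
      \<exists>v \<in> tothom t w (m - 1). \<exists>c. u - totd C t w (m - 1) v = (0, 0, c)"
  shows "exact_triangle C t"
proof -
  have "\<exists>v \<in> tot C t w (m - 1). totd C t w (m - 1) v = u"
    if w: "w \<in> Ob C" and u: "u \<in> tot C t w m" "totd C t w m u = 0" for w m u
  proof -
    note u = u[unfolded tot_eq[OF P w]]
    obtain v c where v: "v \<in> tothom t w (m - 1)" and c: "u - totd C t w (m - 1) v = (0, 0, c)"
      using red[OF w u] by blast
    have dv: "totd C t w (m - 1) v \<in> tothom t w m" by (rule totd_closed[OF P v]) simp
    have "(0, 0, c) \<in> tothom t w m" using tothom_diff[OF u(1) dv] by (simp add: c)
    then have ch: "c \<in> hom w (tz t) (m - 2)" by (simp add: tothom_def)
    have "totd C t w m (0, 0, c) = 0"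
      unfolding c[symmetric] totd_diff[OF P u(1) dv] u(2) by (simp add: totd_totd[OF P v])
    then have dc: "dif C w (tz t) (m - 2) c = 0"
      using precomplexD[OF P] by (simp add: zero_prod_def zero_right[OF precomplexD(5)[OF P]] zero_right[OF precomplexD(6)[OF P]])
    have r: "rac S c \<in> tothom t w (m - 1)" by (rule rac_closed[OF S(1) ch]) simp
    obtain a b e where S_eq: "S = (a, b, e)" by (cases S)
    have j: "m - 1 = 1 + (m - 2)" by simp
    have "rac S (0::'h) = 0"
      using S(1) zero_right unfolding S_eq tothom_def zero_prod_def rac.simps mem_Times_iff fst_conv snd_conv by blast
    then have "totd C t w (m - 1) (rac S c) = (0, 0, c)"
      unfolding totd_rac[OF P S(1) ch j] S(2) dc
      by (simp add: zero_left[OF ch] idt_left[OF ch] zero_prod_def)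
    then have "totd C t w (m - 1) (v + rac S c) = u"
      unfolding totd_add[OF P v r] by (simp add: c[symmetric])
    then show ?thesis using tothom_add[OF v r] tot_eq[OF P w] by blast
  qed
  then show ?thesis using P unfolding exact_triangle_def precomplex_def by blast
qed

lemma zero_object_contractible:
  assumes "zero_object C x" shows "x \<in> Ob C" "idt C x \<in> bnd x x 0"
proof -
  show x: "x \<in> Ob C" using assms by (simp add: zero_object_def)
  have "ecls C 0 x x (idt C x) \<in> Ext C 0 x x" "ecls C 0 x x 0 \<in> Ext C 0 x x"
    using x by (auto simp: Ext_def cocyc_eq cyc_idt cyc_zero)
  then have "ecls C 0 x x (idt C x) = ecls C 0 x x 0" using assms by (auto simp: zero_object_def)
  then show "idt C x \<in> bnd x x 0" using x ecls_eq_iff[OF cyc_idt[OF x] cyc_zero[OF x x]] by simp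
qed

text \<open>The triangle that makes a subcategory containing a zero object and closed under extensions
  also closed under isomorphism.\<close>
lemma iso_triangle_exact:
  assumes inv: "inverse_pair C 0 x y f g" and O: "x \<in> Ob C" "y \<in> Ob C" and o: "zero_object C o'"
  shows "exact_triangle C \<lparr>tx = x, ty = y, tz = o', tf = f, tg = 0, th = 0\<rparr>"
proof -
  let ?t = "\<lparr>tx = x, ty = y, tz = o', tf = f, tg = 0, th = 0\<rparr>"
  note O' = zero_object_contractible[OF o]
  obtain e where e: "e \<in> hom o' o' (- 1)" "dif C o' o' (- 1) e = idt C o'" using bndE[OF O'(2)] by auto
  have i: "f \<in> cyc x y 0" "g \<in> cyc y x 0" "g \<cdot> f - idt C x \<in> bnd x x 0" "f \<cdot> g - idt C y \<in> bnd y y 0"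
    using inv O by (auto simp: inverse_pair_iff)
  obtain k where k: "k \<in> hom x x (- 1)" "dif C x x (- 1) k = g \<cdot> f - idt C x" using bndE[OF i(3)] by auto
  obtain l where l: "l \<in> hom y y (- 1)" "dif C y y (- 1) l = f \<cdot> g - idt C y" using bndE[OF i(4)] by auto
  note h = cycD(1)[OF i(1)] cycD(1)[OF i(2)]
  have P: "precomplex ?t"
    using O O' i hom_zero[OF O(2) O'(1), of 0] hom_zero[OF O(1) O'(1), of "-1"]
    by (simp add: precomplex_def cocyc_eq cyc_zero d_zero zero_left[OF h(1)] hom_def)
  show ?thesis
  proof (rule exact_triangleI[OF P, of "(0, 0, e)"])
    show "(0, 0, e) \<in> tothom ?t (tz ?t) 1" using O O' e by (simp add: tothom_def hom_zero)
    show "totd C ?t (tz ?t) 1 (0, 0, e) = (0, 0, idt C (tz ?t))"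
      using O O' e by (simp add: d_zero zero_right[OF h(1)] zero_right[OF hom_zero[OF O(1) O'(1)]])
  next
    fix w m u assume w: "w \<in> Ob C" and u: "u \<in> tothom ?t w m" "totd C ?t w m u = 0"
    obtain a b c where u_eq: "u = (a, b, c)" by (cases u)
    have a: "a \<in> hom w x m" "b \<in> hom w y (m - 1)" "c \<in> hom w o' (m - 2)" using u by (auto simp: u_eq tothom_def)
    have d: "dif C w x m a = 0" "dif C w y (m - 1) b = f \<cdot> a"
      using u by (auto simp: u_eq zero_prod_def)
    \<comment> \<open>Here \<open>a1\<close> bounds \<open>a\<close>, and \<open>b1\<close> is what remains of \<open>b\<close>: a cocycle with \<open>b1 = f g b1\<close> up to \<open>l\<close>.\<close>
    define a1 where "a1 = g \<cdot> b - k \<cdot> a"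
    define b1 where "b1 = b - f \<cdot> a1"
    have M: "g \<cdot> b \<in> hom w x (m - 1)" "k \<cdot> a \<in> hom w x (m - 1)" "f \<cdot> a \<in> hom w y m" "g \<cdot> f \<in> hom x x 0"
      "idt C x \<in> hom x x 0" "idt C y \<in> hom y y 0" "f \<cdot> g \<in> hom y y 0"
      by (rule a h k O homI | simp)+
    have a1: "a1 \<in> hom w x (m - 1)" unfolding a1_def by (intro hom_diff M)
    have da1: "dif C w x (m - 1) a1 = a"
      using a h k d M cycD(2)[OF i(2)] unfolding a1_def by (simp add: dg_simps idt_left)
    have M1: "f \<cdot> a1 \<in> hom w y (m - 1)" by (rule a1 h homI | simp)+
    have b1: "b1 \<in> hom w y (m - 1)" unfolding b1_def by (intro hom_diff a M1)
    have db1: "dif C w y (m - 1) b1 = 0"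
      using a h a1 M1 d da1 cycD(2)[OF i(1)] zero_left[OF a1] unfolding b1_def by (simp add: dg_simps)
    have M2: "g \<cdot> b1 \<in> hom w x (m - 1)" "l \<cdot> b1 \<in> hom w y (m - 2)" "f \<cdot> (g \<cdot> b1) \<in> hom w y (m - 1)"
      "a1 + g \<cdot> b1 \<in> hom w x (m - 1)"
      by (rule a1 b1 h l homI | simp)+
    let ?v = "(a1 + g \<cdot> b1, l \<cdot> b1, 0)"
    have "dif C w x (m - 1) (a1 + g \<cdot> b1) = a"
      using a1 b1 h M2 da1 db1 cycD(2)[OF i(2)] zero_left[OF b1] by (simp add: dg_simps)
    moreover have "- dif C w y (m - 2) (l \<cdot> b1) + f \<cdot> (a1 + g \<cdot> b1) = b"
      using a1 b1 h l M M2 db1 by (simp add: dg_simps idt_left) (simp add: b1_def)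
    ultimately have "u - totd C ?t w (m - 1) ?v = (0, 0, c - (dif C w o' (m - 3) 0 + 0 \<cdot> (l \<cdot> b1) + 0 \<cdot> (a1 + g \<cdot> b1)))"
      by (simp add: u_eq)
    moreover have "?v \<in> tothom ?t w (m - 1)" using M2 w O' by (simp add: tothom_def hom_zero)
    ultimately show "\<exists>v \<in> tothom ?t w (m - 1). \<exists>c. u - totd C ?t w (m - 1) v = (0, 0, c)" by blast
  qed
qed

text \<open>With \<open>z'\<close> a model of \<open>z[-1]\<close>, the class \<open>d0\<close> becomes a morphism \<open>F : z' \<rightarrow> x\<close> of degree 0,
  whose cone \<open>y\<close> gives \<open>z' \<rightarrow> x \<rightarrow> y\<close>. The triangle realizing the class is the rotation \<open>x \<rightarrow> y \<rightarrow> z\<close>.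
  Its second morphism and its homotopy are the entries \<open>D0\<close> and \<open>E0\<close> of a contraction, transported
  along \<open>\<tau> : z' \<rightarrow> z\<close>.\<close>
lemma triangle_of_extension:
  assumes pre: "pretriangulated C" and d0: "d0 \<in> cyc z x 1"
  shows "\<exists>t D. exact_triangle C t \<and> tx t = x \<and> tz t = z \<and> conn t D \<and> d0 + D \<in> bnd z x 1"
proof -
  note O = cyc_ob[OF d0]
  obtain z' \<sigma> \<tau> where z': "z' \<in> Ob C" and inv: "inverse_pair C 1 z z' \<sigma> \<tau>"
    using pre O(1) unfolding pretriangulated_def by blast
  have i: "\<sigma> \<in> cyc z z' 1" "\<tau> \<in> cyc z' z (- 1)" "\<tau> \<cdot> \<sigma> - idt C z \<in> bnd z z 0" "\<sigma> \<cdot> \<tau> - idt C z' \<in> bnd z' z' 0"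
    using inv by (simp_all add: inverse_pair_iff[OF O(1) z'])
  obtain e where e: "e \<in> hom z z (- 1)" "dif C z z (- 1) e = \<tau> \<cdot> \<sigma> - idt C z" using bndE[OF i(3)] by auto
  obtain k where k: "k \<in> hom z' z' (- 1)" "dif C z' z' (- 1) k = \<sigma> \<cdot> \<tau> - idt C z'" using bndE[OF i(4)] by auto
  define F where "F = d0 \<cdot> \<tau>"
  have F: "F \<in> cyc z' x 0" unfolding F_def by (rule cyc_cmp[OF i(2) d0]) simp
  obtain t0 where t0: "exact_triangle C t0" "tx t0 = z'" "ty t0 = x" "tf t0 = F"
    using pre z' O F cocyc_eq[OF z' O(2)] unfolding pretriangulated_def by metis
  define y \<beta> h0 where "y = tz t0" and "\<beta> = tg t0" and "h0 = th t0"
  note X = exact_precomplexD[OF t0(1), unfolded t0 y_def[symmetric] \<beta>_def[symmetric] h0_def[symmetric]]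
  obtain D0 p0 q0 E0 r0 G0 i0 where c0: "contraction t0 D0 p0 q0 E0 r0 G0 i0"
    using conn_exists[OF t0(1)] unfolding conn_def by blast
  note K = contractionD[OF c0, unfolded t0 y_def[symmetric] \<beta>_def[symmetric] h0_def[symmetric]]
  define t where "t = \<lparr>tx = x, ty = y, tz = z, tf = \<beta>, tg = \<tau> \<cdot> D0, th = - (\<tau> \<cdot> E0)\<rparr>"
  have ts: "tx t = x" "ty t = y" "tz t = z" "tf t = \<beta>" "tg t = \<tau> \<cdot> D0" "th t = - (\<tau> \<cdot> E0)"
    by (simp_all add: t_def)
  note h = cycD[OF i(1)] cycD[OF i(2)] cycD[OF F]
  have M: "\<tau> \<cdot> D0 \<in> hom y z 0" "\<tau> \<cdot> E0 \<in> hom x z (- 1)" "D0 \<cdot> \<beta> \<in> hom x z' 1" "- (\<tau> \<cdot> E0) \<in> hom x z (- 1)"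
    by (rule h K X homI | simp)+
  have P: "precomplex t"
    unfolding precomplex_def ts cocyc_eq[OF O(2) X(3)] cocyc_eq[OF X(3) O(1)]
    using X O K h M by (simp add: cycI dg_simps homD(3))
  \<comment> \<open>The last column of a contraction of \<open>t\<close>; the term \<open>e\<close> compensates for \<open>\<tau> \<sigma>\<close> being the
     identity only up to homotopy.\<close>
  define S where "S = (- (F \<cdot> \<sigma>), h0 \<cdot> \<sigma>, - (\<tau> \<cdot> (G0 \<cdot> \<sigma>)) - e)"
  have M2: "F \<cdot> \<sigma> \<in> hom z x 1" "h0 \<cdot> \<sigma> \<in> hom z y 0" "\<tau> \<cdot> (G0 \<cdot> \<sigma>) \<in> hom z z (- 1)"
    "- (F \<cdot> \<sigma>) \<in> hom z x 1" "- (\<tau> \<cdot> (G0 \<cdot> \<sigma>)) - e \<in> hom z z (- 1)" "- (\<tau> \<cdot> (G0 \<cdot> \<sigma>)) \<in> hom z z (- 1)"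
    "\<beta> \<cdot> F \<in> hom z' y 0" "G0 \<cdot> \<sigma> \<in> hom z z' 0" "E0 \<cdot> (F \<cdot> \<sigma>) \<in> hom z z' 1" "D0 \<cdot> (h0 \<cdot> \<sigma>) \<in> hom z z' 1"
    "E0 \<cdot> F \<in> hom z' z' 0" "D0 \<cdot> h0 \<in> hom z' z' 0" "idt C z' - E0 \<cdot> F \<in> hom z' z' 0" "idt C z' \<in> hom z' z' 0"
    "\<sigma> - E0 \<cdot> (F \<cdot> \<sigma>) \<in> hom z z' 1"
    by (rule h K X e z' homI | simp)+
  have S: "S \<in> tothom t (tz t) 1" using M2 by (simp add: S_def tothom_def ts)
  have "dif C z z (- 1) (- (\<tau> \<cdot> (G0 \<cdot> \<sigma>)) - e) + \<tau> \<cdot> (D0 \<cdot> (h0 \<cdot> \<sigma>)) + \<tau> \<cdot> (E0 \<cdot> (F \<cdot> \<sigma>)) = idt C z"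
    using X(1-9) K M2 h e O z' by (simp add: dg_simps idt_left[OF h(1)])
  then have dS: "totd C t (tz t) 1 S = (0, 0, idt C (tz t))"
    using X K M M2 h O z' by (simp add: S_def ts dg_simps)
  have ex: "exact_triangle C t"
  proof (rule exact_triangleI[OF P S dS])
    fix w m u assume w: "w \<in> Ob C" and u: "u \<in> tothom t w m" "totd C t w m u = 0"
    obtain a b c where u_eq: "u = (a, b, c)" by (cases u)
    have a: "a \<in> hom w x m" "b \<in> hom w y (m - 1)" "c \<in> hom w z (m - 2)" using u by (auto simp: u_eq tothom_def ts)
    have d: "dif C w x m a = 0" "dif C w y (m - 1) b = \<beta> \<cdot> a"
        "dif C w z (m - 2) c = - ((\<tau> \<cdot> D0) \<cdot> b) + (\<tau> \<cdot> E0) \<cdot> a"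
      using u minus_left[OF a(1) M(2)] by (auto simp: u_eq zero_prod_def ts algebra_simps eq_neg_iff_add_eq_0)
    have "(0, a, - b) \<in> tothom t0 w (m + 1)" using a w z' by (simp add: tothom_def t0 y_def[symmetric] hom_zero hom_minus)
    moreover have "totd C t0 w (m + 1) (0, a, - b) = 0"
      using a d w z' by (simp add: t0 y_def[symmetric] \<beta>_def[symmetric] h0_def[symmetric] zero_prod_def d_zero d_minus
        zero_right[OF h(5)] zero_right[OF X(6)])
    ultimately have "\<exists>v \<in> tothom t0 w m. totd C t0 w m v = (0, a, - b)" by (rule exact_lift[OF t0(1)]) simp
    then obtain \<zeta> \<xi> \<eta> where v: "(\<zeta>, \<xi>, \<eta>) \<in> tothom t0 w m" "totd C t0 w m (\<zeta>, \<xi>, \<eta>) = (0, a, - b)"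
      by (metis prod_cases3)
    have \<zeta>: "\<zeta> \<in> hom w z' m" "\<xi> \<in> hom w x (m - 1)" "\<eta> \<in> hom w y (m - 2)"
      using v(1) by (simp_all add: tothom_def t0 y_def)
    have d\<zeta>: "dif C w z' m \<zeta> = 0" and a_eq: "dif C w x (m - 1) \<xi> = F \<cdot> \<zeta> - a"
      and b_eq: "dif C w y (m - 2) \<eta> = - b - \<beta> \<cdot> \<xi> - h0 \<cdot> \<zeta>"
      using v(2) by (auto simp: t0 y_def \<beta>_def h0_def algebra_simps)
    \<comment> \<open>By acyclicity of \<open>t0\<close>, the column \<open>(a, b)\<close> would be a boundary if \<open>\<zeta> : w \<rightarrow> z'\<close> were zero. The
       third entry \<open>c\<close> shows that \<open>\<tau> \<zeta>\<close> is a boundary, hence so is \<open>\<zeta>\<close>, by \<open>\<omega>\<close>; composing \<open>\<omega>\<close> with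
       \<open>F\<close> and \<open>h0\<close> gives the correction that removes \<open>\<zeta>\<close>.\<close>
    define c' where "c' = c - \<tau> \<cdot> (D0 \<cdot> \<eta>) - \<tau> \<cdot> (E0 \<cdot> \<xi>)"
    define \<theta> where "\<theta> = c' - \<tau> \<cdot> (G0 \<cdot> \<zeta>)"
    define \<omega> where "\<omega> = - (k \<cdot> \<zeta>) - \<sigma> \<cdot> \<theta>"
    have M3: "\<tau> \<cdot> (D0 \<cdot> \<eta>) \<in> hom w z (m - 2)" "\<tau> \<cdot> (E0 \<cdot> \<xi>) \<in> hom w z (m - 2)" "\<tau> \<cdot> (G0 \<cdot> \<zeta>) \<in> hom w z (m - 2)"
      "D0 \<cdot> \<eta> \<in> hom w z' (m - 1)" "E0 \<cdot> \<xi> \<in> hom w z' (m - 1)" "G0 \<cdot> \<zeta> \<in> hom w z' (m - 1)"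
      "c - \<tau> \<cdot> (D0 \<cdot> \<eta>) \<in> hom w z (m - 2)" "c' \<in> hom w z (m - 2)" "\<theta> \<in> hom w z (m - 2)"
      "k \<cdot> \<zeta> \<in> hom w z' (m - 1)" "\<sigma> \<cdot> \<theta> \<in> hom w z' (m - 1)" "- (k \<cdot> \<zeta>) \<in> hom w z' (m - 1)"
      "\<omega> \<in> hom w z' (m - 1)" "F \<cdot> \<zeta> \<in> hom w x m" "h0 \<cdot> \<zeta> \<in> hom w y (m - 1)" "\<beta> \<cdot> \<xi> \<in> hom w y (m - 1)"
      "- b \<in> hom w y (m - 1)" "- b - \<beta> \<cdot> \<xi> \<in> hom w y (m - 1)" "\<beta> \<cdot> a \<in> hom w y m"
      "E0 \<cdot> (F \<cdot> \<zeta>) \<in> hom w z' m" "D0 \<cdot> (h0 \<cdot> \<zeta>) \<in> hom w z' m" "\<zeta> - E0 \<cdot> (F \<cdot> \<zeta>) \<in> hom w z' m"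
      "D0 \<cdot> b \<in> hom w z' m" "D0 \<cdot> (\<beta> \<cdot> \<xi>) \<in> hom w z' m" "E0 \<cdot> a \<in> hom w z' m" "- (D0 \<cdot> b) \<in> hom w z' m"
      "- (D0 \<cdot> b) - D0 \<cdot> (\<beta> \<cdot> \<xi>) \<in> hom w z' m" "- (D0 \<cdot> b) - D0 \<cdot> (\<beta> \<cdot> \<xi>) - D0 \<cdot> (h0 \<cdot> \<zeta>) \<in> hom w z' m"
      "E0 \<cdot> (F \<cdot> \<zeta>) - E0 \<cdot> a \<in> hom w z' m" "\<sigma> \<cdot> \<tau> \<in> hom z' z' 0" "- (D0 \<cdot> (\<beta> \<cdot> \<xi>)) \<in> hom w z' m"
      "D0 \<cdot> b + D0 \<cdot> (\<beta> \<cdot> \<xi>) \<in> hom w z' m"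
      unfolding \<omega>_def \<theta>_def c'_def by (rule a h K X e k z' \<zeta> homI | simp)+
    have dc': "dif C w z (m - 2) c' = \<tau> \<cdot> (D0 \<cdot> (h0 \<cdot> \<zeta>)) + \<tau> \<cdot> (E0 \<cdot> (F \<cdot> \<zeta>))"
      unfolding c'_def using X(1-9) K h a M M3 \<zeta> d d\<zeta> a_eq b_eq by (simp add: dg_simps)
    have dX: "dif C w z (m - 2) \<theta> = \<tau> \<cdot> \<zeta>"
      unfolding \<theta>_def using X(1-9) K h M2 M3 \<zeta> d\<zeta> dc' by (simp add: dg_simps idt_left[OF \<zeta>(1)])
    have d\<omega>: "dif C w z' (m - 1) \<omega> = \<zeta>"
      unfolding \<omega>_def using X(1-9) K h k M2 M3 \<zeta> d\<zeta> dX by (simp add: dg_simps idt_left[OF \<zeta>(1)])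
    let ?v = "(F \<cdot> \<omega> - \<xi>, \<eta> - h0 \<cdot> \<omega>, 0)"
    have M4: "F \<cdot> \<omega> \<in> hom w x (m - 1)" "h0 \<cdot> \<omega> \<in> hom w y (m - 2)" "F \<cdot> \<omega> - \<xi> \<in> hom w x (m - 1)" "\<eta> - h0 \<cdot> \<omega> \<in> hom w y (m - 2)"
      by (rule X h \<zeta> M3 homI | simp)+
    have "?v \<in> tothom t w (m - 1)" using M4 w O by (simp add: tothom_def ts hom_zero)
    moreover have "dif C w x (m - 1) (F \<cdot> \<omega> - \<xi>) = a"
      using X h M3 M4 \<zeta> a_eq d\<omega> by (simp add: dg_simps)
    moreover have "- dif C w y (m - 2) (\<eta> - h0 \<cdot> \<omega>) + \<beta> \<cdot> (F \<cdot> \<omega> - \<xi>) = b"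
      using X h M2 M3 M4 \<zeta> b_eq d\<omega> by (simp add: dg_simps)
    ultimately have "?v \<in> tothom t w (m - 1) \<and> (\<exists>c. u - totd C t w (m - 1) ?v = (0, 0, c))"
      by (simp add: u_eq ts)
    then show "\<exists>v \<in> tothom t w (m - 1). \<exists>c. u - totd C t w (m - 1) v = (0, 0, c)" by blast
  qed
  have "conn t (- (F \<cdot> \<sigma>))"
    using contraction_extends[OF ex S[unfolded S_def] dS[unfolded S_def]] unfolding conn_def by metis
  moreover have "d0 + - (F \<cdot> \<sigma>) \<in> bnd z x 1"
  proof -
    have "d0 \<cdot> (\<tau> \<cdot> \<sigma> - idt C z) \<in> bnd z x 1" by (rule bnd_cmp_right[OF i(3) d0]) simp
    also have "d0 \<cdot> (\<tau> \<cdot> \<sigma> - idt C z) = F \<cdot> \<sigma> - d0"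
      using diff_right[OF cycD(1)[OF d0] hom_cmp[OF h(1,3)] hom_idt[OF O(1)]] assoc[OF h(1,3) cycD(1)[OF d0]]
        idt_right[OF cycD(1)[OF d0]] by (simp add: F_def)
    finally show ?thesis using bnd_sym by fastforce
  qed
  ultimately show ?thesis using ex ts by blast
qed

end

section \<open>Counting cosets\<close>

text \<open>Dimensions of cohomology spaces are compared by counting classes over a finite field.
  Classes are kept as sets of representatives inside an ambient group, in the form in which \<^const>\<open>Ext\<close>
  presents them.\<close>
definition add_subgroup :: "'v::ab_group_add set \<Rightarrow> bool" where
  "add_subgroup S \<longleftrightarrow> 0 \<in> S \<and> (\<forall>x\<in>S. \<forall>y\<in>S. x - y \<in> S)"

definition coset :: "'v::ab_group_add set \<Rightarrow> 'v set \<Rightarrow> 'v \<Rightarrow> 'v set" where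
  "coset Z B f = {g \<in> Z. g - f \<in> B}"

definition cosets :: "'v::ab_group_add set \<Rightarrow> 'v set \<Rightarrow> 'v set set" where
  "cosets Z B = coset Z B ` Z"

lemma add_subgroupD:
  assumes "add_subgroup S"
  shows "0 \<in> S" "x \<in> S \<Longrightarrow> y \<in> S \<Longrightarrow> x - y \<in> S" "x \<in> S \<Longrightarrow> - x \<in> S" "x \<in> S \<Longrightarrow> y \<in> S \<Longrightarrow> x + y \<in> S"
proof -
  show 0: "0 \<in> S" and d: "x \<in> S \<Longrightarrow> y \<in> S \<Longrightarrow> x - y \<in> S" for x y using assms by (auto simp: add_subgroup_def)
  show n: "x \<in> S \<Longrightarrow> - x \<in> S" for x using d[OF 0, of x] by simp
  show "x \<in> S \<Longrightarrow> y \<in> S \<Longrightarrow> x + y \<in> S" using d[of x "- y"] n[of y] by simp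
qed

lemma coset_eq_iff:
  assumes "add_subgroup B" "f \<in> Z" "g \<in> Z"
  shows "coset Z B f = coset Z B g \<longleftrightarrow> f - g \<in> B"
proof
  assume "coset Z B f = coset Z B g"
  moreover have "f \<in> coset Z B f" using assms add_subgroupD(1)[OF assms(1)] by (simp add: coset_def)
  ultimately show "f - g \<in> B" by (auto simp: coset_def)
next
  assume fg: "f - g \<in> B"
  have "h - f \<in> B \<longleftrightarrow> h - g \<in> B" for h
    using add_subgroupD(4)[OF assms(1), of "h - f" "f - g"] add_subgroupD(2)[OF assms(1), of "h - g" "f - g"] fg by auto
  then show "coset Z B f = coset Z B g" by (simp add: coset_def)
qed

lemma card_cosets_eq_1:
  assumes "add_subgroup Z" "add_subgroup B" "Z \<subseteq> B" shows "card (cosets Z B) = 1"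
proof -
  have "coset Z B f = coset Z B 0" if "f \<in> Z" for f
    using that coset_eq_iff[OF assms(2) that add_subgroupD(1)[OF assms(1)]] assms(3) by auto
  then have "cosets Z B = {coset Z B 0}"
    using add_subgroupD(1)[OF assms(1)] unfolding cosets_def by blast
  then show ?thesis by simp
qed

text \<open>The first isomorphism theorem for \<open>F : Z / B \<rightarrow> Z' / B'\<close>: choosing representatives \<open>r\<close> of the
  kernel and preimages \<open>s\<close> of the image, every class is a sum \<open>r k + s w\<close> in exactly one way.\<close>
lemma cosets_kernel_image:
  assumes Z: "add_subgroup Z" and B: "add_subgroup B" "B \<subseteq> Z"
    and B': "add_subgroup B'"
    and F: "\<And>f g. f \<in> Z \<Longrightarrow> g \<in> Z \<Longrightarrow> F (f - g) = F f - F g" and FZ: "\<And>f. f \<in> Z \<Longrightarrow> F f \<in> Z'"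
    and FB: "\<And>f. f \<in> B \<Longrightarrow> F f \<in> B'"
  shows "\<exists>\<phi>. bij_betw \<phi> (cosets {f \<in> Z. F f \<in> B'} B \<times> cosets {g \<in> Z'. \<exists>f\<in>Z. g - F f \<in> B'} B') (cosets Z B)"
proof -
  let ?K = "{f \<in> Z. F f \<in> B'}" and ?I = "{g \<in> Z'. \<exists>f\<in>Z. g - F f \<in> B'}"
  note Z' = add_subgroupD[OF Z] and b = add_subgroupD[OF B(1)] and b' = add_subgroupD[OF B']
  have "\<forall>k\<in>cosets ?K B. \<exists>f. f \<in> ?K \<and> k = coset ?K B f" unfolding cosets_def by blast
  from bchoice[OF this] obtain r where r: "\<And>k. k \<in> cosets ?K B \<Longrightarrow> r k \<in> ?K"
    "\<And>k. k \<in> cosets ?K B \<Longrightarrow> k = coset ?K B (r k)"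
    by blast
  have Fad: "F (f + g) = F f + F g" if "f \<in> Z" "g \<in> Z" for f g
    using F[of f 0] F[of 0 g] F[of f "- g"] F[of 0 0] Z'(1) Z'(3)[OF that(2)] that by simp
  have "\<forall>w\<in>cosets ?I B'. \<exists>f. f \<in> Z \<and> w = coset ?I B' (F f)"
  proof
    fix w assume "w \<in> cosets ?I B'"
    then obtain g f where g: "g \<in> ?I" "w = coset ?I B' g" and f: "f \<in> Z" "g - F f \<in> B'" by (auto simp: cosets_def)
    have "F f \<in> ?I" using f b'(1) FZ by force
    then have "coset ?I B' g = coset ?I B' (F f)" using coset_eq_iff[OF B' g(1)] f by simp
    then show "\<exists>f. f \<in> Z \<and> w = coset ?I B' (F f)" using g f by auto
  qed
  from bchoice[OF this] obtain s where s: "\<And>w. w \<in> cosets ?I B' \<Longrightarrow> s w \<in> Z" "\<And>w. w \<in> cosets ?I B' \<Longrightarrow> w = coset ?I B' (F (s w))"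
    by blast
  have FI: "F f \<in> ?I" if "f \<in> Z" for f using that b'(1) FZ by force
  let ?\<phi> = "\<lambda>(k, w). coset Z B (r k + s w)"
  have "bij_betw ?\<phi> (cosets ?K B \<times> cosets ?I B') (cosets Z B)"
  proof (rule bij_betw_imageI)
    show "inj_on ?\<phi> (cosets ?K B \<times> cosets ?I B')"
    proof (rule inj_onI, clarify)
      fix k w k' w' assume kw: "k \<in> cosets ?K B" "w \<in> cosets ?I B'" "k' \<in> cosets ?K B" "w' \<in> cosets ?I B'"
        and eq: "coset Z B (r k + s w) = coset Z B (r k' + s w')"
      note R = r(1)[OF kw(1)] r(1)[OF kw(3)] s(1)[OF kw(2)] s(1)[OF kw(4)]
      have "(r k + s w) - (r k' + s w') \<in> B"
        using eq R coset_eq_iff[OF B(1) Z'(4) Z'(4), of "r k" "s w" "r k'" "s w'"] by auto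
      then have d: "(r k - r k') + (s w - s w') \<in> B" by (simp add: algebra_simps)
      then have "F ((r k - r k') + (s w - s w')) \<in> B'" by (rule FB)
      moreover have "F ((r k - r k') + (s w - s w')) = (F (r k) - F (r k')) + (F (s w) - F (s w'))"
        using R Z'(2) by (simp add: Fad F)
      moreover have "F (r k) - F (r k') \<in> B'" using R b'(2) by auto
      ultimately have "F (s w) - F (s w') \<in> B'" using b'(2)[of "F (r k) - F (r k') + (F (s w) - F (s w'))" "F (r k) - F (r k')"] by simp
      then have "coset ?I B' (F (s w)) = coset ?I B' (F (s w'))" by (rule iffD2[OF coset_eq_iff[OF B' FI[OF R(3)] FI[OF R(4)]]])
      then have w: "w = w'" by (rule trans[OF s(2)[OF kw(2)] trans[OF _ s(2)[OF kw(4), symmetric]]])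
      with d have "r k - r k' \<in> B" by simp
      then have "coset ?K B (r k) = coset ?K B (r k')" by (rule iffD2[OF coset_eq_iff[OF B(1) R(1,2)]])
      then have "k = k'" by (rule trans[OF r(2)[OF kw(1)] trans[OF _ r(2)[OF kw(3), symmetric]]])
      with w show "k = k' \<and> w = w'" by simp
    qed
    show "?\<phi> ` (cosets ?K B \<times> cosets ?I B') = cosets Z B"
    proof (intro equalityI subsetI)
      fix y assume "y \<in> ?\<phi> ` (cosets ?K B \<times> cosets ?I B')"
      then obtain k w where "k \<in> cosets ?K B" "w \<in> cosets ?I B'" "y = coset Z B (r k + s w)" by auto
      then show "y \<in> cosets Z B" using r(1) s(1) Z'(4) by (auto simp: cosets_def)
    next
      fix y assume "y \<in> cosets Z B"
      then obtain f where f: "f \<in> Z" "y = coset Z B f" by (auto simp: cosets_def)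
      define w where "w = coset ?I B' (F f)"
      have w: "w \<in> cosets ?I B'" using FI[OF f(1)] by (auto simp: w_def cosets_def)
      have "F f - F (s w) \<in> B'"
        by (rule iffD1[OF coset_eq_iff[OF B' FI[OF f(1)] FI[OF s(1)[OF w]]]])
           (rule trans[OF w_def[symmetric] s(2)[OF w]])
      then have k0: "f - s w \<in> ?K" using f s(1)[OF w] Z'(2) by (simp add: F)
      define k where "k = coset ?K B (f - s w)"
      have k: "k \<in> cosets ?K B" using k0 by (auto simp: k_def cosets_def)
      have "(f - s w) - r k \<in> B"
        by (rule iffD1[OF coset_eq_iff[OF B(1) k0 r(1)[OF k]]]) (rule trans[OF k_def[symmetric] r(2)[OF k]])
      then have "f - (r k + s w) \<in> B" by (simp add: algebra_simps)
      then have "y = ?\<phi> (k, w)"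
        using f coset_eq_iff[OF B(1) f(1) Z'(4)] r(1)[OF k] s(1)[OF w] by auto
      then show "y \<in> ?\<phi> ` (cosets ?K B \<times> cosets ?I B')" using k w by blast
    qed
  qed
  then show ?thesis by blast
qed

lemma card_cosets_kernel_image:
  assumes "add_subgroup Z" "add_subgroup B" "B \<subseteq> Z" "add_subgroup B'"
    "\<And>f g. f \<in> Z \<Longrightarrow> g \<in> Z \<Longrightarrow> F (f - g) = F f - F g" "\<And>f. f \<in> Z \<Longrightarrow> F f \<in> Z'"
    "\<And>f. f \<in> B \<Longrightarrow> F f \<in> B'"
  shows "card (cosets Z B) = card (cosets {f \<in> Z. F f \<in> B'} B) * card (cosets {g \<in> Z'. \<exists>f\<in>Z. g - F f \<in> B'} B')"
    and "finite (cosets Z B) \<longleftrightarrow> finite (cosets {f \<in> Z. F f \<in> B'} B) \<and> finite (cosets {g \<in> Z'. \<exists>f\<in>Z. g - F f \<in> B'} B')"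
proof -
  let ?K = "{f \<in> Z. F f \<in> B'}" and ?I = "{g \<in> Z'. \<exists>f\<in>Z. g - F f \<in> B'}"
  obtain \<phi> where \<phi>: "bij_betw \<phi> (cosets ?K B \<times> cosets ?I B') (cosets Z B)"
    using cosets_kernel_image[OF assms] by blast
  show "card (cosets Z B) = card (cosets ?K B) * card (cosets ?I B')"
    using bij_betw_same_card[OF \<phi>] by (simp add: card_cartesian_product)
  have "0 \<in> ?K" "F 0 \<in> ?I"
    using add_subgroupD(1)[OF assms(1)] add_subgroupD(1)[OF assms(4)] assms(5)[of 0 0] assms(6)[of 0]
    by (auto intro!: bexI[of _ 0])
  then have "cosets ?K B \<noteq> {}" "cosets ?I B' \<noteq> {}" unfolding cosets_def by blast+
  then show "finite (cosets Z B) \<longleftrightarrow> finite (cosets ?K B) \<and> finite (cosets ?I B')"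
    using bij_betw_finite[OF \<phi>] by (auto simp: finite_cartesian_product_iff)
qed

section \<open>Dimensions of quotients and numbers of cosets\<close>

context vector_space
begin

lemma subspace_add_subgroup: "subspace S \<Longrightarrow> add_subgroup S"
  by (auto simp: add_subgroup_def subspace_0 subspace_diff)

text \<open>Coordinates with respect to \<open>S\<close> enumerate \<open>(V + W) / W\<close>. This makes the number of cosets a
  power of the field size, whatever basis is chosen.\<close>
lemma quot_basis_bij_cosets:
  assumes W: "subspace W" and S: "finite S" "quot_basis scale S V W"
    and V: "subspace V"
  shows "bij_betw (\<lambda>c. coset {y. \<exists>v\<in>V. y - v \<in> W} W (\<Sum>v\<in>S. scale (c v) v))
    (S \<rightarrow>\<^sub>E UNIV) (cosets {y. \<exists>v\<in>V. y - v \<in> W} W)"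
proof (rule bij_betw_imageI)
  let ?Y = "{y. \<exists>v\<in>V. y - v \<in> W}" and ?f = "\<lambda>c. \<Sum>v\<in>S. scale (c v) v"
  have SV: "S \<subseteq> V" "V \<subseteq> span (S \<union> W)" "independent S" "span S \<inter> W \<subseteq> {0}"
    using S by (auto simp: quot_basis_def)
  have gW: "add_subgroup W" by (rule subspace_add_subgroup[OF W])
  have fS: "?f c \<in> span S" for c by (intro span_sum span_scale span_base)
  have fY: "?f c \<in> ?Y" for c
    using SV(1) subspace_sum[OF V, of S "\<lambda>v. scale (c v) v"] subspace_scale[OF V] subspace_0[OF W]
    by (auto intro!: bexI[of _ "?f c"])
  show "inj_on (\<lambda>c. coset ?Y W (?f c)) (S \<rightarrow>\<^sub>E UNIV)"
  proof (rule inj_onI)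
    fix c c' assume c: "c \<in> S \<rightarrow>\<^sub>E UNIV" "c' \<in> S \<rightarrow>\<^sub>E UNIV" and eq: "coset ?Y W (?f c) = coset ?Y W (?f c')"
    have "?f c - ?f c' \<in> W" by (rule iffD1[OF coset_eq_iff[OF gW fY fY] eq])
    moreover have "?f c - ?f c' \<in> span S" by (intro span_diff fS)
    ultimately have "?f c - ?f c' = 0" using SV(4) by blast
    then have "(\<Sum>v\<in>S. scale (c v - c' v) v) = 0" by (simp add: scale_left_diff_distrib sum_subtractf)
    note zero = independentD[OF SV(3) S(1) subset_refl this]
    show "c = c'" by (rule PiE_ext[OF c]) (use zero in simp)
  qed
  show "(\<lambda>c. coset ?Y W (?f c)) ` (S \<rightarrow>\<^sub>E UNIV) = cosets ?Y W"
  proof (intro equalityI subsetI)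
    fix y assume "y \<in> (\<lambda>c. coset ?Y W (?f c)) ` (S \<rightarrow>\<^sub>E UNIV)"
    then obtain c where "y = coset ?Y W (?f c)" by (rule imageE)
    then show "y \<in> cosets ?Y W" unfolding cosets_def using fY[of c] by (rule image_eqI)
  next
    fix y assume "y \<in> cosets ?Y W"
    then obtain g v where g: "g \<in> ?Y" "y = coset ?Y W g" and v: "v \<in> V" "g - v \<in> W" by (auto simp: cosets_def)
    obtain a b where ab: "v = a + b" "a \<in> span S" "b \<in> W"
      using subsetD[OF SV(2) v(1)] unfolding span_Un span_eq_iff[THEN iffD2, OF W] by blast
    obtain c where c: "a = ?f c" using ab(2) span_finite[OF S(1)] by auto
    have f: "?f (restrict c S) = a" unfolding c by (rule sum.cong) auto
    have "?f (restrict c S) - g \<in> W"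
      unfolding f using add_subgroupD(3)[OF gW add_subgroupD(4)[OF gW ab(3) v(2)]] by (simp add: ab(1) algebra_simps)
    then have "coset ?Y W (?f (restrict c S)) = y"
      unfolding g(2) by (rule iffD2[OF coset_eq_iff[OF gW fY g(1)]])
    moreover have "restrict c S \<in> S \<rightarrow>\<^sub>E UNIV" by simp
    ultimately show "y \<in> (\<lambda>c. coset ?Y W (?f c)) ` (S \<rightarrow>\<^sub>E UNIV)"
      by (intro image_eqI[OF sym])
  qed
qed

lemma quot_basis_exists:
  assumes W: "subspace W" and V: "subspace V"
  obtains S where "quot_basis scale S V W"
proof -
  obtain S0 where S0: "S0 \<subseteq> W" "independent S0" "W \<subseteq> span S0" by (rule maximal_independent_subset)
  obtain B where B: "S0 \<subseteq> B" "B \<subseteq> S0 \<union> V" "independent B" "S0 \<union> V \<subseteq> span B"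
    using maximal_independent_subset_extend[of S0 "S0 \<union> V"] S0(2) by blast
  have "quot_basis scale (B - S0) V W"
    unfolding quot_basis_def
  proof (intro conjI)
    show "B - S0 \<subseteq> V" using B by blast
    show "V \<subseteq> span ((B - S0) \<union> W)" using B(4) span_mono[of B "(B - S0) \<union> W"] S0(1) by blast
    show "independent (B - S0)" by (rule independent_mono[OF B(3)]) blast
    show "span (B - S0) \<inter> W \<subseteq> {0}"
    proof
      fix x assume "x \<in> span (B - S0) \<inter> W"
      then have x: "x \<in> span (B - S0)" "x \<in> span S0" using S0(3) by auto
      have "representation B x = representation (B - S0) x" "representation B x = representation S0 x"
        using representation_extend[OF B(3) x(1)] representation_extend[OF B(3) x(2)] B(1) by auto
      then have "representation B x b = 0" for b
        using representation_ne_zero[of "B - S0" x b] representation_ne_zero[of S0 x b] by auto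
      moreover have "x \<in> span B" using x(2) span_mono[OF B(1)] by blast
      ultimately show "x \<in> {0}" using sum_nonzero_representation_eq[OF B(3), of x] by simp
    qed
  qed
  then show ?thesis by (rule that)
qed

end

text \<open>Since \<^const>\<open>quot_dim\<close> is defined by an arbitrary choice of basis, counting is what determines
  it. The version with \<open>V + W\<close> follows the definition of \<^const>\<open>quot_basis\<close> and applies to the rank in
  \<^const>\<open>rho\<close> directly.\<close>
lemma quot_dim_card:
  fixes s :: "'k::{finite,field} \<Rightarrow> 'v::ab_group_add \<Rightarrow> 'v"
  assumes "vector_space s" and W: "module.subspace s W" and V: "module.subspace s V"
  defines "Y \<equiv> {y. \<exists>v\<in>V. y - v \<in> W}"
  shows "quot_findim s V W \<longleftrightarrow> finite (cosets Y W)"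
    and "quot_findim s V W \<Longrightarrow> card (cosets Y W) = CARD('k) ^ quot_dim s V W"
proof -
  interpret vector_space s by fact
  have c: "finite (cosets Y W)" "card (cosets Y W) = CARD('k) ^ card S" if "finite S" "quot_basis s S V W" for S
    using bij_betw_finite[OF quot_basis_bij_cosets[OF W that V]] bij_betw_same_card[OF quot_basis_bij_cosets[OF W that V]]
      that(1) by (auto simp: Y_def card_PiE finite_PiE)
  show *: "card (cosets Y W) = CARD('k) ^ quot_dim s V W" if q: "quot_findim s V W"
  proof -
    have "finite (SOME S. finite S \<and> quot_basis s S V W) \<and> quot_basis s (SOME S. finite S \<and> quot_basis s S V W) V W"
      using q unfolding quot_findim_def by (rule someI_ex)
    then show ?thesis using c unfolding quot_dim_def by blast
  qed
  show "quot_findim s V W \<longleftrightarrow> finite (cosets Y W)"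
  proof
    assume "quot_findim s V W" then show "finite (cosets Y W)" using c by (auto simp: quot_findim_def)
  next
    assume f: "finite (cosets Y W)"
    obtain S where S: "quot_basis s S V W" by (rule quot_basis_exists[OF W V])
    have gW: "add_subgroup W" by (rule subspace_add_subgroup[OF W])
    have SV: "S \<subseteq> V" "span S \<inter> W \<subseteq> {0}" using S by (auto simp: quot_basis_def)
    have SY: "v \<in> Y" if "v \<in> S" for v
      using that SV(1) add_subgroupD(1)[OF gW] by (auto simp: Y_def intro!: bexI[of _ v])
    have "inj_on (coset Y W) S"
    proof (rule inj_onI)
      fix v w assume vw: "v \<in> S" "w \<in> S" "coset Y W v = coset Y W w"
      have "v - w \<in> W" by (rule iffD1[OF coset_eq_iff[OF gW SY[OF vw(1)] SY[OF vw(2)]] vw(3)])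
      moreover have "v - w \<in> span S" using vw by (intro span_diff span_base)
      ultimately show "v = w" using SV(2) by auto
    qed
    moreover have "coset Y W ` S \<subseteq> cosets Y W" using SY by (auto simp: cosets_def)
    ultimately have "finite S" using f by (meson finite_imageD finite_subset)
    then show "quot_findim s V W" using S by (auto simp: quot_findim_def)
  qed
qed

lemma quot_dim_card_sub:
  fixes s :: "'k::{finite,field} \<Rightarrow> 'v::ab_group_add \<Rightarrow> 'v"
  assumes "vector_space s" and W: "module.subspace s W" and V: "module.subspace s V" and "W \<subseteq> V"
  shows "quot_findim s V W \<longleftrightarrow> finite (cosets V W)"
    and "quot_findim s V W \<Longrightarrow> card (cosets V W) = CARD('k) ^ quot_dim s V W"
proof -
  interpret vector_space s by fact
  have "{y. \<exists>v\<in>V. y - v \<in> W} = V"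
    using assms(4) subspace_add[OF V] subspace_0[OF W] by (force simp: algebra_simps)
  then show "quot_findim s V W \<longleftrightarrow> finite (cosets V W)"
    "quot_findim s V W \<Longrightarrow> card (cosets V W) = CARD('k) ^ quot_dim s V W"
    using quot_dim_card[OF assms(1) W V] by simp_all
qed

section \<open>Calabi-Yau duality\<close>

text \<open>A functional vanishing on the kernel of \<open>d\<close> factors through the image of \<open>d\<close>, and
  functionals extend from a subspace to the whole space. This is exactness of the dual complex.\<close>
lemma (in vector_space) functional_on_image:
  assumes A: "subspace A" and d: "\<And>u v. u \<in> A \<Longrightarrow> v \<in> A \<Longrightarrow> d (u + v) = d u + d v" "\<And>c u. u \<in> A \<Longrightarrow> d (scale c u) = scale c (d u)"
    and \<phi>: "\<And>u v. u \<in> A \<Longrightarrow> v \<in> A \<Longrightarrow> \<phi> (u + v) = \<phi> u + \<phi> v" "\<And>c u. u \<in> A \<Longrightarrow> \<phi> (scale c u) = c * \<phi> u"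
    and ker: "\<And>u. u \<in> A \<Longrightarrow> d u = 0 \<Longrightarrow> \<phi> u = 0"
  shows "\<exists>\<psi>. (\<forall>u v. \<psi> (u + v) = \<psi> u + \<psi> v) \<and> (\<forall>c u. \<psi> (scale c u) = c * \<psi> u) \<and> (\<forall>u\<in>A. \<psi> (d u) = \<phi> u)"
proof -
  interpret K: vector_space "(*) :: 'a \<Rightarrow> 'a \<Rightarrow> 'a" by unfold_locales (simp_all add: algebra_simps)
  interpret VK: vector_space_pair scale "(*) :: 'a \<Rightarrow> 'a \<Rightarrow> 'a" by unfold_locales
  have dm: "d (u - v) = d u - d v" and \<phi>m: "\<phi> (u - v) = \<phi> u - \<phi> v" if "u \<in> A" "v \<in> A" for u v
    using d(1)[of "u - v" v] \<phi>(1)[of "u - v" v] that subspace_diff[OF A] by (simp_all add: algebra_simps)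
  obtain S where S: "S \<subseteq> d ` A" "independent S" "d ` A \<subseteq> span S" by (rule maximal_independent_subset)
  have "\<forall>b\<in>S. \<exists>u. u \<in> A \<and> d u = b" using S(1) by blast
  from bchoice[OF this] obtain g where g: "\<And>b. b \<in> S \<Longrightarrow> g b \<in> A" "\<And>b. b \<in> S \<Longrightarrow> d (g b) = b" by blast
  define \<psi> where "\<psi> = VK.construct S (\<lambda>b. \<phi> (g b))"
  have lin: "Vector_Spaces.linear scale (*) \<psi>" unfolding \<psi>_def by (rule VK.linear_construct[OF S(2)])
  have \<psi>: "\<psi> (u + v) = \<psi> u + \<psi> v" "\<psi> (scale c u) = c * \<psi> u" for u v c
    by (rule VK.linear_add[OF lin], rule VK.linear_scale[OF lin])
  let ?T = "{b. \<exists>u\<in>A. d u = b \<and> \<psi> b = \<phi> u}"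
  have "subspace ?T"
  proof (rule subspaceI)
    have "d 0 = 0" "\<phi> 0 = 0" "\<psi> 0 = 0"
      using dm[of 0 0] \<phi>m[of 0 0] subspace_0[OF A] \<psi>(2)[of 0 0] by simp_all
    then show "0 \<in> ?T" using subspace_0[OF A] by force
  next
    fix x y assume "x \<in> ?T" "y \<in> ?T"
    then obtain u v where "u \<in> A" "d u = x" "\<psi> x = \<phi> u" "v \<in> A" "d v = y" "\<psi> y = \<phi> v" by blast
    then have "u + v \<in> A" "d (u + v) = x + y" "\<psi> (x + y) = \<phi> (u + v)"
      using d \<phi> \<psi> subspace_add[OF A] by simp_all
    then show "x + y \<in> ?T" by blast
  next
    fix c x assume "x \<in> ?T"
    then obtain u where "u \<in> A" "d u = x" "\<psi> x = \<phi> u" by blast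
    then have "scale c u \<in> A" "d (scale c u) = scale c x" "\<psi> (scale c x) = \<phi> (scale c u)"
      using d \<phi> \<psi> subspace_scale[OF A] by simp_all
    then show "scale c x \<in> ?T" by blast
  qed
  moreover have "S \<subseteq> ?T"
  proof
    fix b assume b: "b \<in> S"
    then have "\<psi> b = \<phi> (g b)" unfolding \<psi>_def by (rule VK.construct_basis[OF S(2)])
    then show "b \<in> ?T" using g[OF b] by blast
  qed
  ultimately have T: "span S \<subseteq> ?T" using span_minimal by blast
  have "\<psi> (d u) = \<phi> u" if u: "u \<in> A" for u
  proof -
    have "d u \<in> ?T" using T S(3) u by blast
    then obtain v where v: "v \<in> A" "d v = d u" "\<psi> (d u) = \<phi> v" by blast
    then have "\<phi> (u - v) = 0" using ker[of "u - v"] dm[OF u v(1)] subspace_diff[OF A u v(1)] by simp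
    then show ?thesis using \<phi>m[OF u v(1)] v(3) by simp
  qed
  then show ?thesis using \<psi> by blast
qed

context dg_category
begin

context
  fixes n :: int and P :: "('k, 'o, 'h, 'p::ab_group_add) dgbimod" and F G
  assumes P: "dg_bimodule C P"
    and F: "bimod_quasi_iso C P (shifted_diagonal C n) F"
    and G: "bimod_quasi_iso C P (dual_diagonal C) G"
begin

interpretation P: dg_bimodule C P by (rule P)

text \<open>A roof \<open>F, G\<close> of quasi-isomorphisms identifies a class \<open>a \<in> Ext\<^sup>i\<^sup>+\<^sup>n(x,y)\<close> with a
  functional on \<open>Ext\<^sup>-\<^sup>i(y,x)\<close>, by a cocycle of the apex lying over both. The relation is used
  instead of a choice of such cocycles, which need not be compatible with the bimodule actions.\<close>
definition represents where
  "represents x y i a \<phi> \<longleftrightarrow> x \<in> Ob C \<and> y \<in> Ob C \<and> a \<in> cyc x y (i + n) \<and>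
    (\<exists>p\<in>mcocyc P i x y. F x y i p - a \<in> bnd x y (i + n) \<and> \<phi> = G x y i p)"

lemma shifted_cocyc: "x \<in> Ob C \<Longrightarrow> y \<in> Ob C \<Longrightarrow> mcocyc (shifted_diagonal C n) i x y = cyc x y (i + n)"
  by (auto simp: mcocyc_def shifted_diagonal_def cyc_def hom_def ksign_def)

lemma shifted_cobnd: "x \<in> Ob C \<Longrightarrow> y \<in> Ob C \<Longrightarrow> mcobnd (shifted_diagonal C n) i x y = bnd x y (i + n)"
proof -
  assume O: "x \<in> Ob C" "y \<in> Ob C"
  have "ksign n ` bnd x y (i + n) = bnd x y (i + n)"
  proof (intro equalityI subsetI)
    fix f assume "f \<in> bnd x y (i + n)"
    then have "ksign n f \<in> bnd x y (i + n)" by (rule bnd_ksign)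
    moreover have "f = ksign n (ksign n f)" by (simp add: ksign_def del: ksign_simps)
    ultimately show "f \<in> ksign n ` bnd x y (i + n)" by blast
  qed (auto simp: bnd_ksign)
  moreover have "mcobnd (shifted_diagonal C n) i x y = ksign n ` bnd x y (i + n)"
    using O by (simp add: mcobnd_def shifted_diagonal_def bnd_def hom_def image_image algebra_simps)
  ultimately show ?thesis by simp
qed

lemma mcocyc_subgroup: "x \<in> Ob C \<Longrightarrow> y \<in> Ob C \<Longrightarrow> p \<in> mcocyc P i x y \<Longrightarrow> p' \<in> mcocyc P i x y \<Longrightarrow> p - p' \<in> mcocyc P i x y"
proof -
  assume a: "x \<in> Ob C" "y \<in> Ob C" "p \<in> mcocyc P i x y" "p' \<in> mcocyc P i x y"
  interpret W: vector_space "mscl P" by (rule P.vector_space)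
  have d: "p - p' \<in> Mod P x y i" using W.subspace_diff[OF P.Mod_subspace[OF a(1,2)]] a(3,4) by (auto simp: mcocyc_def)
  have "mdif P x y i ((p - p') + p') = mdif P x y i (p - p') + mdif P x y i p'"
    by (rule P.mdif_add) (use a d in \<open>auto simp: mcocyc_def\<close>)
  then show ?thesis using a d by (simp add: mcocyc_def)
qed

lemma morphism_diff:
  assumes H: "bimod_morphism C P N H" and a: "x \<in> Ob C" "y \<in> Ob C" "p \<in> Mod P x y i" "p' \<in> Mod P x y i"
  shows "H x y i (p - p') = H x y i p - H x y i p'"
proof -
  interpret W: vector_space "mscl P" by (rule P.vector_space)
  have d: "p - p' \<in> Mod P x y i" using W.subspace_diff[OF P.Mod_subspace[OF a(1,2)]] a(3,4) by auto
  have "H x y i ((p - p') + p') = H x y i (p - p') + H x y i p'"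
    using H a d unfolding bimod_morphism_def by blast
  then show ?thesis by simp
qed

lemma represents_exists:
  assumes "a \<in> cyc x y (i + n)" shows "\<exists>\<phi>. represents x y i a \<phi>"
proof -
  note O = cyc_ob[OF assms]
  obtain p where "p \<in> mcocyc P i x y" "F x y i p - a \<in> bnd x y (i + n)"
    using F assms O unfolding bimod_quasi_iso_def by (metis shifted_cocyc shifted_cobnd)
  then show ?thesis using assms O unfolding represents_def by blast
qed

lemma represents_diff:
  assumes "represents x y i a \<phi>" "represents x y i a' \<phi>'"
  shows "represents x y i (a - a') (\<phi> - \<phi>')"
proof -
  obtain p p' where p: "p \<in> mcocyc P i x y" "F x y i p - a \<in> bnd x y (i + n)" "\<phi> = G x y i p"
    "p' \<in> mcocyc P i x y" "F x y i p' - a' \<in> bnd x y (i + n)" "\<phi>' = G x y i p'"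
    and O: "x \<in> Ob C" "y \<in> Ob C" and a: "a \<in> cyc x y (i + n)" "a' \<in> cyc x y (i + n)"
    using assms unfolding represents_def by blast
  have m: "p \<in> Mod P x y i" "p' \<in> Mod P x y i" using p by (auto simp: mcocyc_def)
  have "F x y i (p - p') = F x y i p - F x y i p'" "G x y i (p - p') = \<phi> - \<phi>'"
    using morphism_diff[OF _ O m] F G p by (auto simp: bimod_quasi_iso_def)
  moreover have eq: "(F x y i p - a) - (F x y i p' - a') = (F x y i p - F x y i p') - (a - a')" by simp
  have "(F x y i p - F x y i p') - (a - a') \<in> bnd x y (i + n)" using bnd_diff[OF p(2,5)] unfolding eq .
  ultimately show ?thesis using mcocyc_subgroup[OF O p(1,4)] O cyc_diff[OF a] unfolding represents_def by metis
qed

lemma represents_functional: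
  assumes "represents x y i a \<phi>"
  shows "v \<in> Hom C y x (- i) \<Longrightarrow> v' \<in> Hom C y x (- i) \<Longrightarrow> \<phi> (v + v') = \<phi> v + \<phi> v'"
    "v \<in> Hom C y x (- i) \<Longrightarrow> \<phi> (scl C c v) = c * \<phi> v"
    "v \<notin> Hom C y x (- i) \<Longrightarrow> \<phi> v = 0"
    "v \<in> bnd y x (- i) \<Longrightarrow> \<phi> v = 0"
proof -
  obtain p where p: "p \<in> mcocyc P i x y" "\<phi> = G x y i p" and O: "x \<in> Ob C" "y \<in> Ob C"
    using assms unfolding represents_def by blast
  have G': "bimod_morphism C P (dual_diagonal C) G" using G by (simp add: bimod_quasi_iso_def)
  have pm: "p \<in> Mod P x y i" "mdif P x y i p = 0" using p(1) by (auto simp: mcocyc_def)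
  have 1: "\<phi> \<in> Mod (dual_diagonal C) x y i" using G' O pm unfolding bimod_morphism_def p(2) by blast
  then show "v \<in> Hom C y x (- i) \<Longrightarrow> v' \<in> Hom C y x (- i) \<Longrightarrow> \<phi> (v + v') = \<phi> v + \<phi> v'"
    "v \<in> Hom C y x (- i) \<Longrightarrow> \<phi> (scl C c v) = c * \<phi> v"
    "v \<notin> Hom C y x (- i) \<Longrightarrow> \<phi> v = 0"
    by (auto simp: dual_diagonal_def)
  have "G x y (i + 1) (mdif P x y i p) = mdif (dual_diagonal C) x y i \<phi>"
    using G' O pm(1) unfolding bimod_morphism_def p(2) by blast
  moreover have "G x y (i + 1) 0 = 0"
  proof -
    have "mdif P x y i p \<in> Mod P x y (i + 1)" using P.mdif_Mod O pm by blast
    then show ?thesis using morphism_diff[OF G' O, of 0 "i + 1" 0] pm(2) by simp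
  qed
  ultimately have "mdif (dual_diagonal C) x y i \<phi> = 0" using pm(2) by simp
  then have 2: "mdif (dual_diagonal C) x y i \<phi> u = 0" for u by simp
  show "\<phi> v = 0" if v: "v \<in> bnd y x (- i)"
  proof -
    obtain u where u: "u \<in> hom y x (- i - 1)" "dif C y x (- i - 1) u = v" using bndE[OF v] by blast
    have "- (i + 1) = - i - 1" by simp
    then have "ksign i (\<phi> v) = 0" using 2[of u] u homD(3)[OF u(1)] by (simp add: dual_diagonal_def)
    then show ?thesis by (auto simp: ksign_def split: if_splits)
  qed
qed

text \<open>Non-degeneracy: a functional vanishing on cocycles is a coboundary of the dual complex, so
  the quasi-isomorphisms carry this back to the class \<open>a\<close>.\<close>
lemma represents_null:
  assumes r: "represents x y i a \<phi>" and v: "\<And>v. v \<in> cyc y x (- i) \<Longrightarrow> \<phi> v = 0"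
  shows "a \<in> bnd x y (i + n)"
proof -
  obtain p where p: "p \<in> mcocyc P i x y" "F x y i p - a \<in> bnd x y (i + n)" "\<phi> = G x y i p"
    and O: "x \<in> Ob C" "y \<in> Ob C" using r unfolding represents_def by blast
  note R = represents_functional[OF r]
  have "\<exists>\<psi>. (\<forall>u v. \<psi> (u + v) = \<psi> u + \<psi> v) \<and> (\<forall>c u. \<psi> (scl C c u) = c * \<psi> u) \<and>
      (\<forall>u\<in>Hom C y x (- i). \<psi> (dif C y x (- i) u) = \<phi> u)"
  proof (rule V.functional_on_image[OF subspace[OF O(2,1)]])
    show "\<phi> u = 0" if "u \<in> Hom C y x (- i)" "dif C y x (- i) u = 0" for u
      using v[of u] that O by (simp add: cyc_def hom_def)
  qed (use R O in \<open>auto simp: dif_add dif_scl\<close>)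
  then obtain \<psi> where \<psi>: "\<And>u v. \<psi> (u + v) = \<psi> u + \<psi> v" "\<And>c u. \<psi> (scl C c u) = c * \<psi> u"
    "\<And>u. u \<in> Hom C y x (- i) \<Longrightarrow> \<psi> (dif C y x (- i) u) = \<phi> u" by blast
  \<comment> \<open>The sign cancels the factor \<open>- (-1)\<^sup>i\<^sup>-\<^sup>1\<close> in the differential of the dual bimodule.\<close>
  define \<psi>' where "\<psi>' v = (if v \<in> Hom C y x (- (i - 1)) then ksign i (\<psi> v) else 0)" for v
  have "\<psi>' \<in> Mod (dual_diagonal C) x y (i - 1)"
    using V.subspace_add[OF subspace[OF O(2,1)]] V.subspace_scale[OF subspace[OF O(2,1)]]
    by (auto simp: dual_diagonal_def \<psi>'_def \<psi> ksign_def)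
  moreover have "mdif (dual_diagonal C) x y (i - 1) \<psi>' = \<phi>"
  proof
    fix v
    have "dif C y x (- i) v \<in> Hom C y x (1 - i)" if "v \<in> Hom C y x (- i)"
      using dif_Hom[OF O(2,1) that] by simp
    then show "mdif (dual_diagonal C) x y (i - 1) \<psi>' v = \<phi> v"
      using \<psi>(3)[of v] R(3)[of v] by (simp add: dual_diagonal_def \<psi>'_def ksign_def)
  qed
  ultimately have "G x y i p \<in> mcobnd (dual_diagonal C) i x y"
    unfolding mcobnd_def p(3)[symmetric] by (intro image_eqI[of _ _ \<psi>']) simp_all
  then have "p \<in> mcobnd P i x y" using G O p(1) unfolding bimod_quasi_iso_def by blast
  then obtain m where m: "m \<in> Mod P x y (i - 1)" "mdif P x y (i - 1) m = p" unfolding mcobnd_def by blast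
  have F': "bimod_morphism C P (shifted_diagonal C n) F" using F by (simp add: bimod_quasi_iso_def)
  have "F x y (i - 1 + 1) (mdif P x y (i - 1) m) = mdif (shifted_diagonal C n) x y (i - 1) (F x y (i - 1) m)"
    "F x y (i - 1) m \<in> Mod (shifted_diagonal C n) x y (i - 1)"
    using F' O m(1) unfolding bimod_morphism_def by blast+
  then have "F x y i p \<in> mcobnd (shifted_diagonal C n) i x y" unfolding mcobnd_def using m(2) by auto
  then have "F x y i p \<in> bnd x y (i + n)" using shifted_cobnd[OF O] by simp
  from bnd_diff[OF this p(2)] show ?thesis by simp
qed

text \<open>Both halves of the roof are compatible with the right action of \<open>d\<close>, so acting on a common
  cocycle of the apex represents \<open>a d\<close> by \<open>v \<mapsto> \<phi> (d v)\<close>. The left action is treated in the same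
  way.\<close>
lemma represents_right:
  assumes r: "represents x x 0 a \<phi>" and d: "d \<in> cyc z x 1"
  shows "represents z x 1 (a \<cdot> d) (\<lambda>v. if v \<in> Hom C x z (- 1) then \<phi> (d \<cdot> v) else 0)"
proof -
  obtain p where p: "p \<in> mcocyc P 0 x x" "F x x 0 p - a \<in> bnd x x n" "\<phi> = G x x 0 p"
    and O: "x \<in> Ob C" and a: "a \<in> cyc x x n" using r unfolding represents_def by auto
  have pm: "p \<in> Mod P x x 0" "mdif P x x 0 p = 0" using p(1) by (auto simp: mcocyc_def)
  note z = cyc_ob(1)[OF d] and dh = homD(3)[OF cycD(1)[OF d]]
  interpret W: vector_space "mscl P" by (rule P.vector_space)
  have F': "bimod_morphism C P (shifted_diagonal C n) F" and G': "bimod_morphism C P (dual_diagonal C) G"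
    using F G by (simp_all add: bimod_quasi_iso_def)
  let ?q = "ract P z x x 0 1 p d"
  have q: "?q \<in> Mod P z x 1" using P.ract_Mod[OF z O O pm(1) dh] by simp
  have z1: "ract P z x x 1 1 0 d = 0"
    using P.ract_scl_left[OF z O O _ dh, of 0 1 0] W.subspace_0[OF P.Mod_subspace[OF O O, of 1]] by simp
  have z2: "ract P z x x 0 2 p 0 = 0"
    using P.ract_scl_right[OF z O O pm(1), of 0 2 0] V.subspace_0[OF subspace[OF z O]] by simp
  have "mdif P z x 1 ?q = 0"
    using P.Leibniz_right[OF z O O pm(1) dh] pm(2) cycD(2)[OF d] z1 z2 by simp
  then have qc: "?q \<in> mcocyc P 1 z x" using q by (simp add: mcocyc_def)
  have "F z x (0 + 1) ?q = ract (shifted_diagonal C n) z x x 0 1 (F x x 0 p) d"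
    using F' z O pm(1) dh unfolding bimod_morphism_def by blast
  then have Fq: "F z x 1 ?q = F x x 0 p \<cdot> d" by (simp add: shifted_diagonal_def)
  have "G z x (0 + 1) ?q = ract (dual_diagonal C) z x x 0 1 (G x x 0 p) d"
    using G' z O pm(1) dh unfolding bimod_morphism_def by blast
  then have Gq: "G z x 1 ?q = (\<lambda>v. if v \<in> Hom C x z (- 1) then \<phi> (d \<cdot> v) else 0)"
    by (simp add: dual_diagonal_def p(3) cong: if_cong)
  have "(F x x 0 p - a) \<cdot> d \<in> bnd z x (1 + n)" by (rule bnd_cmp_left[OF d p(2) refl])
  moreover have Fp: "F x x 0 p \<in> cyc x x n" using cyc_add[OF bnd_cyc[OF p(2)] a] by simp
  ultimately have "F z x 1 ?q - a \<cdot> d \<in> bnd z x (1 + n)"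
    unfolding Fq diff_left[OF cycD(1)[OF d] cycD(1)[OF Fp] cycD(1)[OF a]] by blast
  moreover have "a \<cdot> d \<in> cyc z x (1 + n)" by (rule cyc_cmp[OF d a refl])
  ultimately show ?thesis using qc z O Gq unfolding represents_def by metis
qed

lemma represents_left:
  assumes r: "represents z z 0 c \<phi>" and d: "d \<in> cyc z x 1"
  shows "represents z x 1 (ksign n (d \<cdot> c)) (\<lambda>v. if v \<in> Hom C x z (- 1) then - \<phi> (v \<cdot> d) else 0)"
proof -
  obtain p where p: "p \<in> mcocyc P 0 z z" "F z z 0 p - c \<in> bnd z z n" "\<phi> = G z z 0 p"
    and z: "z \<in> Ob C" and c: "c \<in> cyc z z n" using r unfolding represents_def by auto
  have pm: "p \<in> Mod P z z 0" "mdif P z z 0 p = 0" using p(1) by (auto simp: mcocyc_def)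
  note O = cyc_ob(2)[OF d] and dh = homD(3)[OF cycD(1)[OF d]]
  interpret W: vector_space "mscl P" by (rule P.vector_space)
  have F': "bimod_morphism C P (shifted_diagonal C n) F" and G': "bimod_morphism C P (dual_diagonal C) G"
    using F G by (simp_all add: bimod_quasi_iso_def)
  let ?q = "lact P z z x 1 0 d p"
  have q: "?q \<in> Mod P z x 1" using P.lact_Mod[OF z z O dh pm(1)] by simp
  have z1: "lact P z z x 1 1 d 0 = 0"
    using P.lact_scl_right[OF z z O dh, of 0 1 0] W.subspace_0[OF P.Mod_subspace[OF z z, of 1]] by simp
  have z2: "lact P z z x 2 0 0 p = 0"
    using P.lact_scl_left[OF z z O _ pm(1), of 0 2 0] V.subspace_0[OF subspace[OF z O]] by simp
  have "mdif P z x 1 ?q = 0"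
    using P.Leibniz_left[OF z z O dh pm(1)] pm(2) cycD(2)[OF d] z1 z2 by simp
  then have qc: "?q \<in> mcocyc P 1 z x" using q by (simp add: mcocyc_def)
  have "F z x (0 + 1) ?q = lact (shifted_diagonal C n) z z x 1 0 d (F z z 0 p)"
    using F' z O pm(1) dh unfolding bimod_morphism_def by blast
  then have Fq: "F z x 1 ?q = ksign n (d \<cdot> F z z 0 p)" by (simp add: shifted_diagonal_def)
  have "G z x (0 + 1) ?q = lact (dual_diagonal C) z z x 1 0 d (G z z 0 p)"
    using G' z O pm(1) dh unfolding bimod_morphism_def by blast
  then have Gq: "G z x 1 ?q = (\<lambda>v. if v \<in> Hom C x z (- 1) then - \<phi> (v \<cdot> d) else 0)"
    by (simp add: dual_diagonal_def p(3) cong: if_cong)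
  have "d \<cdot> (F z z 0 p - c) \<in> bnd z x (1 + n)" by (rule bnd_cmp_right[OF p(2) d]) simp
  moreover have Fp: "F z z 0 p \<in> cyc z z n" using cyc_add[OF bnd_cyc[OF p(2)] c] by simp
  ultimately have "ksign n (d \<cdot> F z z 0 p - d \<cdot> c) \<in> bnd z x (1 + n)"
    unfolding diff_right[OF cycD(1)[OF d] cycD(1)[OF Fp] cycD(1)[OF c]] by (blast intro: bnd_ksign)
  moreover have "ksign n (d \<cdot> c) \<in> cyc z x (1 + n)" by (intro cyc_ksign cyc_cmp[OF c d]) simp
  ultimately show ?thesis using qc z O Gq Fq unfolding represents_def by (metis ksign_simps(4))
qed

text \<open>In terms of the duality pairing, \<open>\<langle>a d, u\<rangle> = \<langle>a, d u\<rangle>\<close>. If all \<open>d u\<close> are null then \<open>a d\<close>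
  pairs to zero with everything, hence is null. This transports the vanishing of composites from
  degree \<open>-1\<close> to degree \<open>n\<close>.\<close>
lemma pairing_vanish_right:
  assumes a: "a \<in> cyc x x n" and d: "d \<in> cyc z x 1"
    and u: "\<And>u. u \<in> cyc x z (- 1) \<Longrightarrow> d \<cdot> u \<in> bnd x x 0"
  shows "a \<cdot> d \<in> bnd z x (n + 1)"
proof -
  have "\<exists>\<phi>. represents x x 0 a \<phi>" by (rule represents_exists) (simp add: a)
  then obtain \<phi> where r: "represents x x 0 a \<phi>" ..
  have "a \<cdot> d \<in> bnd z x (1 + n)"
  proof (rule represents_null[OF represents_right[OF r d]])
    fix v assume "v \<in> cyc x z (- 1)"
    then have "d \<cdot> v \<in> bnd x x (- 0)" using u by simp
    then have "\<phi> (d \<cdot> v) = 0" by (rule represents_functional(4)[OF r])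
    then show "(if v \<in> Hom C x z (- 1) then \<phi> (d \<cdot> v) else 0) = 0" by simp
  qed
  then show ?thesis by (simp add: add.commute)
qed

lemma pairing_vanish_left:
  assumes c: "c \<in> cyc z z n" and d: "d \<in> cyc z x 1"
    and u: "\<And>u. u \<in> cyc x z (- 1) \<Longrightarrow> u \<cdot> d \<in> bnd z z 0"
  shows "d \<cdot> c \<in> bnd z x (n + 1)"
proof -
  have "\<exists>\<phi>. represents z z 0 c \<phi>" by (rule represents_exists) (simp add: c)
  then obtain \<phi> where r: "represents z z 0 c \<phi>" ..
  have "ksign n (d \<cdot> c) \<in> bnd z x (1 + n)"
  proof (rule represents_null[OF represents_left[OF r d]])
    fix v assume "v \<in> cyc x z (- 1)"
    then have "v \<cdot> d \<in> bnd z z (- 0)" using u by simp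
    then have "\<phi> (v \<cdot> d) = 0" by (rule represents_functional(4)[OF r])
    then show "(if v \<in> Hom C x z (- 1) then - \<phi> (v \<cdot> d) else 0) = 0" by simp
  qed
  then show ?thesis by (simp add: bnd_ksign_iff add.commute)
qed

text \<open>A functional is determined by its values on a basis, and by non-degeneracy it determines the
  class it represents. The resulting inequality of dimensions is enough, as it can be applied
  twice.\<close>
lemma ext_functionals:
  assumes O: "x \<in> Ob C" "y \<in> Ob C" and S: "finite S" "quot_basis (scl C) S (cyc y x (- i)) (bnd y x (- i))"
  shows "\<exists>f. inj_on f (cosets (cyc x y (i + n)) (bnd x y (i + n))) \<and>
    f ` cosets (cyc x y (i + n)) (bnd x y (i + n)) \<subseteq> (S \<rightarrow>\<^sub>E UNIV :: ('h \<Rightarrow> 'k) set)"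
proof -
  let ?Z = "cyc x y (i + n)" and ?B = "bnd x y (i + n)"
  have gB: "add_subgroup ?B" by (rule V.subspace_add_subgroup[OF bnd_subspace[OF O]])
  have "\<forall>\<alpha>\<in>cosets ?Z ?B. \<exists>a\<phi>. fst a\<phi> \<in> ?Z \<and> \<alpha> = coset ?Z ?B (fst a\<phi>) \<and> represents x y i (fst a\<phi>) (snd a\<phi>)"
  proof
    fix \<alpha> assume "\<alpha> \<in> cosets ?Z ?B"
    then obtain a where a: "a \<in> ?Z" "\<alpha> = coset ?Z ?B a" by (auto simp: cosets_def)
    then obtain \<phi> where "represents x y i a \<phi>" using represents_exists by blast
    then show "\<exists>a\<phi>. fst a\<phi> \<in> ?Z \<and> \<alpha> = coset ?Z ?B (fst a\<phi>) \<and> represents x y i (fst a\<phi>) (snd a\<phi>)"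
      using a by (intro exI[of _ "(a, \<phi>)"]) simp
  qed
  from bchoice[OF this] obtain g where g: "\<And>\<alpha>. \<alpha> \<in> cosets ?Z ?B \<Longrightarrow> fst (g \<alpha>) \<in> ?Z"
    "\<And>\<alpha>. \<alpha> \<in> cosets ?Z ?B \<Longrightarrow> \<alpha> = coset ?Z ?B (fst (g \<alpha>))"
    "\<And>\<alpha>. \<alpha> \<in> cosets ?Z ?B \<Longrightarrow> represents x y i (fst (g \<alpha>)) (snd (g \<alpha>))" by blast
  have SV: "S \<subseteq> cyc y x (- i)" "cyc y x (- i) \<subseteq> V.span (S \<union> bnd y x (- i))"
    using S by (auto simp: quot_basis_def)
  have "inj_on (\<lambda>\<alpha>. restrict (snd (g \<alpha>)) S) (cosets ?Z ?B)"
  proof (rule inj_onI)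
    fix \<alpha> \<beta> assume \<alpha>: "\<alpha> \<in> cosets ?Z ?B" and \<beta>: "\<beta> \<in> cosets ?Z ?B"
      and eq: "restrict (snd (g \<alpha>)) S = restrict (snd (g \<beta>)) S"
    define \<phi> where "\<phi> = snd (g \<alpha>) - snd (g \<beta>)"
    have r: "represents x y i (fst (g \<alpha>) - fst (g \<beta>)) \<phi>"
      unfolding \<phi>_def by (rule represents_diff[OF g(3)[OF \<alpha>] g(3)[OF \<beta>]])
    note R = represents_functional[OF r]
    have zS: "\<phi> v = 0" if "v \<in> S" for v
      using fun_cong[OF eq, of v] that by (simp add: \<phi>_def)
    let ?T = "{v \<in> Hom C y x (- i). \<phi> v = 0}"
    have H: "V.subspace (Hom C y x (- i))" by (rule subspace[OF O(2,1)])
    have "V.subspace ?T"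
    proof (rule V.subspaceI)
      show "0 \<in> ?T" using V.subspace_0[OF H] R(2)[OF V.subspace_0[OF H], of 0] by simp
    qed (use R(1,2) V.subspace_add[OF H] V.subspace_scale[OF H] in auto)
    moreover have "S \<union> bnd y x (- i) \<subseteq> ?T"
      using SV(1) zS R(4) by (auto simp: cyc_def hom_def dest: bnd_cyc)
    ultimately have "cyc y x (- i) \<subseteq> ?T" using SV(2) V.span_minimal by blast
    then have "fst (g \<alpha>) - fst (g \<beta>) \<in> ?B" using represents_null[OF r] by blast
    then have "coset ?Z ?B (fst (g \<alpha>)) = coset ?Z ?B (fst (g \<beta>))"
      by (rule iffD2[OF coset_eq_iff[OF gB g(1)[OF \<alpha>] g(1)[OF \<beta>]]])
    then show "\<alpha> = \<beta>" by (rule trans[OF g(2)[OF \<alpha>] trans[OF _ g(2)[OF \<beta>, symmetric]]])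
  qed
  moreover have "(\<lambda>\<alpha>. restrict (snd (g \<alpha>)) S) ` cosets ?Z ?B \<subseteq> (S \<rightarrow>\<^sub>E UNIV)" by (rule image_subsetI) simp
  ultimately show ?thesis by blast
qed

end

lemma Ext_cosets:
  assumes "x \<in> Ob C" "y \<in> Ob C" shows "Ext C i x y = cosets (cyc x y i) (bnd x y i)"
  unfolding Ext_def cosets_def coset_def ecls_def cocyc_eq[OF assms] cobnd_eq[OF assms] ..

lemma bnd_sub_cyc: "bnd x y i \<subseteq> cyc x y i"
  by (auto dest: bnd_cyc)

end

locale finite_dg_category = dg_category C
  for C :: "('k::{finite,field}, 'o, 'h::ab_group_add) dgcat" +
  assumes finite_Ext: "x \<in> Ob C \<Longrightarrow> y \<in> Ob C \<Longrightarrow> finite (Ext C i x y)"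
begin

lemma quot_findim_Ext:
  assumes "x \<in> Ob C" "y \<in> Ob C" shows "quot_findim (scl C) (cyc x y i) (bnd x y i)"
  using finite_Ext[OF assms] quot_dim_card_sub(1)[OF V.vector_space_axioms bnd_subspace[OF assms] cyc_subspace[OF assms] bnd_sub_cyc]
  by (simp add: Ext_cosets assms)

lemma card_Ext:
  assumes "x \<in> Ob C" "y \<in> Ob C" shows "card (Ext C i x y) = CARD('k) ^ ext_dim C i x y"
  using quot_dim_card_sub(2)[OF V.vector_space_axioms bnd_subspace[OF assms] cyc_subspace[OF assms] bnd_sub_cyc quot_findim_Ext[OF assms]]
  by (simp add: Ext_cosets assms ext_dim_def cocyc_eq cobnd_eq)

lemma card_field: "CARD('k) > 1"
proof -
  have "card {0, 1 :: 'k} \<le> CARD('k)" by (rule card_mono) auto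
  then show ?thesis by simp
qed

lemma calabi_yau_ext_dim_le:
  assumes cy: "calabi_yau C n" and O: "x \<in> Ob C" "y \<in> Ob C"
  shows "ext_dim C (i + n) x y \<le> ext_dim C (- i) y x"
proof -
  obtain P :: "('k, 'o, 'h, 'o list \<times> 'h list \<Rightarrow> 'k) dgbimod" and F G where
    P: "dg_bimodule C P" "bimod_quasi_iso C P (shifted_diagonal C n) F" "bimod_quasi_iso C P (dual_diagonal C) G"
    using cy unfolding calabi_yau_def bimod_equivalent_def by blast
  define S where "S = (SOME S. finite S \<and> quot_basis (scl C) S (cyc y x (- i)) (bnd y x (- i)))"
  have "finite S \<and> quot_basis (scl C) S (cyc y x (- i)) (bnd y x (- i))"
    using quot_findim_Ext[OF O(2,1)] unfolding quot_findim_def S_def by (rule someI_ex)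
  then have S: "finite S" "quot_basis (scl C) S (cyc y x (- i)) (bnd y x (- i))" by auto
  have d: "ext_dim C (- i) y x = card S"
    by (simp add: ext_dim_def quot_dim_def S_def cocyc_eq[OF O(2,1)] cobnd_eq[OF O(2,1)])
  have fin: "finite (S \<rightarrow>\<^sub>E UNIV :: ('h \<Rightarrow> 'k) set)" using S(1) by (intro finite_PiE) auto
  have "card (Ext C (i + n) x y) \<le> card (S \<rightarrow>\<^sub>E UNIV :: ('h \<Rightarrow> 'k) set)"
    using ext_functionals[OF P O S] card_inj_on_le[OF _ _ fin] Ext_cosets[OF O] by metis
  also have "\<dots> = CARD('k) ^ ext_dim C (- i) y x"
    unfolding d by (rule card_funcsetE[OF S(1)])
  finally show ?thesis using card_field by (simp add: card_Ext O)
qed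

lemma calabi_yau_ext_dim:
  assumes cy: "calabi_yau C n" and O: "x \<in> Ob C" shows "ext_dim C (n - i) x x = ext_dim C i x x"
  using calabi_yau_ext_dim_le[OF cy O O, of "- i"] calabi_yau_ext_dim_le[OF cy O O, of "i - n"] by simp

end

section \<open>Invariance under isomorphism\<close>

context dg_category
begin

definition Isos :: "'o \<Rightarrow> 'o \<Rightarrow> 'h set set" where
  "Isos x y = {ecls C 0 x y f |f. \<exists>g. inverse_pair C 0 x y f g}"

lemma Aut_Isos: "Aut C x = Isos x x"
  by (simp add: Aut_def Isos_def)

definition rep :: "'h set \<Rightarrow> 'h" where
  "rep \<alpha> = (SOME f. f \<in> \<alpha>)"

lemma ExtE:
  assumes "\<alpha> \<in> Ext C i x y" "x \<in> Ob C" "y \<in> Ob C"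
  shows "rep \<alpha> \<in> cyc x y i" "ecls C i x y (rep \<alpha>) = \<alpha>"
proof -
  obtain f where f: "f \<in> cyc x y i" "\<alpha> = ecls C i x y f" using assms by (auto simp: Ext_def cocyc_eq)
  then have "rep \<alpha> \<in> \<alpha>" unfolding rep_def by (intro someI[of "\<lambda>f. f \<in> \<alpha>" f]) (simp add: ecls_self)
  then have r: "rep \<alpha> \<in> cyc x y i" "rep \<alpha> - f \<in> bnd x y i" using f assms by (simp_all add: mem_ecls)
  then show "rep \<alpha> \<in> cyc x y i" "ecls C i x y (rep \<alpha>) = \<alpha>" using f ecls_eq_iff by simp_all
qed

lemma ecls_Ext: "f \<in> cyc x y i \<Longrightarrow> ecls C i x y f \<in> Ext C i x y"
  unfolding Ext_def by (rule imageI) (simp add: cocyc_eq cyc_ob)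

lemma Isos_Ext: "x \<in> Ob C \<Longrightarrow> y \<in> Ob C \<Longrightarrow> Isos x y \<subseteq> Ext C 0 x y"
  by (auto simp: Isos_def inverse_pair_iff ecls_Ext)

lemma inverse_pair_cong:
  assumes "inverse_pair C 0 x y f g" "f' - f \<in> bnd x y 0" "x \<in> Ob C" "y \<in> Ob C"
  shows "inverse_pair C 0 x y f' g"
proof -
  have i: "f \<in> cyc x y 0" "g \<in> cyc y x 0" "g \<cdot> f - idt C x \<in> bnd x x 0" "f \<cdot> g - idt C y \<in> bnd y y 0"
    using assms by (simp_all add: inverse_pair_iff)
  have f': "f' \<in> cyc x y 0" using cyc_add[OF bnd_cyc[OF assms(2)] i(1)] by simp
  have "g \<cdot> (f' - f) \<in> bnd x x 0" by (rule bnd_cmp_right[OF assms(2) i(2)]) simp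
  moreover have "(f' - f) \<cdot> g \<in> bnd y y 0" by (rule bnd_cmp_left[OF i(2) assms(2)]) simp
  ultimately have "g \<cdot> f' - g \<cdot> f \<in> bnd x x 0" "f' \<cdot> g - f \<cdot> g \<in> bnd y y 0"
    using diff_right[OF cycD(1)[OF i(2)] cycD(1)[OF f'] cycD(1)[OF i(1)]]
      diff_left[OF cycD(1)[OF i(2)] cycD(1)[OF f'] cycD(1)[OF i(1)]] by simp_all
  then show ?thesis using bnd_trans[OF _ i(3)] bnd_trans[OF _ i(4)] f' i assms(3,4) by (simp add: inverse_pair_iff)
qed

lemma IsosE:
  assumes "\<alpha> \<in> Isos x y" "x \<in> Ob C" "y \<in> Ob C"
  shows "\<exists>g. inverse_pair C 0 x y (rep \<alpha>) g"
proof -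
  obtain f g where f: "\<alpha> = ecls C 0 x y f" "inverse_pair C 0 x y f g" using assms by (auto simp: Isos_def)
  have fc: "f \<in> cyc x y 0" using f assms by (simp add: inverse_pair_iff)
  have "\<alpha> \<in> Ext C 0 x y" using assms Isos_Ext by blast
  note r = ExtE[OF this assms(2,3)]
  have "rep \<alpha> - f \<in> bnd x y 0" using r f(1) ecls_eq_iff[OF r(1) fc] by simp
  then show ?thesis using inverse_pair_cong[OF f(2) _ assms(2,3)] by blast
qed

lemma inverse_pair_cmp:
  assumes "inverse_pair C 0 x y f g" "inverse_pair C 0 y z f' g'" "x \<in> Ob C" "y \<in> Ob C" "z \<in> Ob C"
  shows "inverse_pair C 0 x z (f' \<cdot> f) (g \<cdot> g')"
proof -
  have i: "f \<in> cyc x y 0" "g \<in> cyc y x 0" "g \<cdot> f - idt C x \<in> bnd x x 0" "f \<cdot> g - idt C y \<in> bnd y y 0"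
    "f' \<in> cyc y z 0" "g' \<in> cyc z y 0" "g' \<cdot> f' - idt C y \<in> bnd y y 0" "f' \<cdot> g' - idt C z \<in> bnd z z 0"
    using assms by (simp_all add: inverse_pair_iff)
  note h = cycD(1)[OF i(1)] cycD(1)[OF i(2)] cycD(1)[OF i(5)] cycD(1)[OF i(6)] hom_idt[OF assms(4)]
  have M: "f' \<cdot> f \<in> hom x z 0" "g \<cdot> g' \<in> hom z x 0" "g' \<cdot> f' \<in> hom y y 0" "f \<cdot> g \<in> hom y y 0" 
    "g' \<cdot> (f' \<cdot> f) \<in> hom x y 0" "f \<cdot> (g \<cdot> g') \<in> hom z y 0" by (rule h homI | simp)+
  have "g \<cdot> ((g' \<cdot> f' - idt C y) \<cdot> f) \<in> bnd x x 0"
    by (rule bnd_cmp_right[OF bnd_cmp_left[OF i(1,7) refl] i(2)]) simp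
  then have 1: "(g \<cdot> g') \<cdot> (f' \<cdot> f) - g \<cdot> f \<in> bnd x x 0"
    using h M by (simp add: diff_left diff_right assoc idt_left)
  have "f' \<cdot> ((f \<cdot> g - idt C y) \<cdot> g') \<in> bnd z z 0"
    by (rule bnd_cmp_right[OF bnd_cmp_left[OF i(6,4) refl] i(5)]) simp
  then have 2: "(f' \<cdot> f) \<cdot> (g \<cdot> g') - f' \<cdot> g' \<in> bnd z z 0"
    using h M by (simp add: diff_left diff_right assoc idt_left)
  show ?thesis
    unfolding inverse_pair_iff[OF assms(3,5)]
    using bnd_trans[OF 1 i(3)] bnd_trans[OF 2 i(8)] cyc_cmp[OF i(1,5)] cyc_cmp[OF i(6,2)] by simp
qed

lemma isomorphic_sym: "isomorphic C x y \<Longrightarrow> isomorphic C y x"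
  unfolding isomorphic_def by (blast intro: inverse_pair_sym)

lemma isomorphic_trans:
  "isomorphic C x y \<Longrightarrow> isomorphic C y z \<Longrightarrow> x \<in> Ob C \<Longrightarrow> y \<in> Ob C \<Longrightarrow> z \<in> Ob C \<Longrightarrow> isomorphic C x z"
  unfolding isomorphic_def by (blast intro: inverse_pair_cmp)

lemma isomorphic_refl: "x \<in> Ob C \<Longrightarrow> isomorphic C x x"
proof -
  assume x: "x \<in> Ob C"
  have "inverse_pair C 0 x x (idt C x) (idt C x)"
    using x cyc_idt[OF x] idt_left[OF hom_idt[OF x]] bnd_zero[OF x x] by (simp add: inverse_pair_iff)
  then show ?thesis by (auto simp: isomorphic_def)
qed

lemma iso_class_eq:
  assumes "isomorphic C x y" "x \<in> Ob C" "y \<in> Ob C" "S \<subseteq> Ob C"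
  shows "iso_class C S x = iso_class C S y"
proof -
  have "isomorphic C x w \<longleftrightarrow> isomorphic C y w" if "w \<in> S" for w
    using that assms(2-) isomorphic_trans[OF assms(1)] isomorphic_trans[OF isomorphic_sym[OF assms(1)]] by blast
  then show ?thesis by (auto simp: iso_class_def)
qed

text \<open>Only injectivity is proved: applied to both directions of an isomorphism it gives equality
  of cardinalities of finite sets.\<close>
lemma post_cmp_inj:
  assumes inv: "inverse_pair C 0 y y' \<theta> \<eta>" and O: "x \<in> Ob C" "y \<in> Ob C" "y' \<in> Ob C"
  shows "inj_on (\<lambda>\<alpha>. ecls C i x y' (\<theta> \<cdot> rep \<alpha>)) (Ext C i x y)"
    and "(\<lambda>\<alpha>. ecls C i x y' (\<theta> \<cdot> rep \<alpha>)) ` Ext C i x y \<subseteq> Ext C i x y'"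
    and "(\<lambda>\<alpha>. ecls C 0 x y' (\<theta> \<cdot> rep \<alpha>)) ` Isos x y \<subseteq> Isos x y'"
proof -
  have i: "\<theta> \<in> cyc y y' 0" "\<eta> \<in> cyc y' y 0" "\<eta> \<cdot> \<theta> - idt C y \<in> bnd y y 0"
    using inv O by (simp_all add: inverse_pair_iff)
  have c: "\<theta> \<cdot> f \<in> cyc x y' i" if "f \<in> cyc x y i" for f i using cyc_cmp[OF that i(1)] by simp
  show "inj_on (\<lambda>\<alpha>. ecls C i x y' (\<theta> \<cdot> rep \<alpha>)) (Ext C i x y)"
  proof (rule inj_onI)
    fix \<alpha> \<beta> assume a: "\<alpha> \<in> Ext C i x y" "\<beta> \<in> Ext C i x y"
      and eq: "ecls C i x y' (\<theta> \<cdot> rep \<alpha>) = ecls C i x y' (\<theta> \<cdot> rep \<beta>)"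
    note A = ExtE[OF a(1) O(1,2)] and B = ExtE[OF a(2) O(1,2)]
    define e where "e = rep \<alpha> - rep \<beta>"
    have e: "e \<in> cyc x y i" unfolding e_def by (rule cyc_diff[OF A(1) B(1)])
    have "\<theta> \<cdot> rep \<alpha> - \<theta> \<cdot> rep \<beta> \<in> bnd x y' i" using eq ecls_eq_iff[OF c[OF A(1)] c[OF B(1)]] by simp
    then have "\<theta> \<cdot> e \<in> bnd x y' i" unfolding e_def diff_right[OF cycD(1)[OF i(1)] cycD(1)[OF A(1)] cycD(1)[OF B(1)]] .
    then have "\<eta> \<cdot> (\<theta> \<cdot> e) \<in> bnd x y i" by (rule bnd_cmp_right[OF _ i(2)]) simp
    moreover have "(\<eta> \<cdot> \<theta> - idt C y) \<cdot> e \<in> bnd x y i" by (rule bnd_cmp_left[OF e i(3)]) simp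
    moreover have "(\<eta> \<cdot> \<theta> - idt C y) \<cdot> e = \<eta> \<cdot> (\<theta> \<cdot> e) - e"
      using diff_left[OF cycD(1)[OF e] hom_cmp[OF cycD(1)[OF i(1)] cycD(1)[OF i(2)]] hom_idt[OF O(2)]]
        assoc[OF cycD(1)[OF e] cycD(1)[OF i(1)] cycD(1)[OF i(2)]] idt_left[OF cycD(1)[OF e]] by simp
    ultimately have "e \<in> bnd x y i" using bnd_diff[of "\<eta> \<cdot> (\<theta> \<cdot> e)" x y i "\<eta> \<cdot> (\<theta> \<cdot> e) - e"] by simp
    then have "ecls C i x y (rep \<alpha>) = ecls C i x y (rep \<beta>)" using ecls_eq_iff[OF A(1) B(1)] by (simp add: e_def)
    then show "\<alpha> = \<beta>" by (simp add: A(2) B(2))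
  qed
  show "(\<lambda>\<alpha>. ecls C i x y' (\<theta> \<cdot> rep \<alpha>)) ` Ext C i x y \<subseteq> Ext C i x y'"
    using ExtE(1)[OF _ O(1,2)] c ecls_Ext by blast
  show "(\<lambda>\<alpha>. ecls C 0 x y' (\<theta> \<cdot> rep \<alpha>)) ` Isos x y \<subseteq> Isos x y'"
  proof (rule image_subsetI)
    fix \<alpha> assume "\<alpha> \<in> Isos x y"
    then obtain g where "inverse_pair C 0 x y (rep \<alpha>) g" using IsosE O by blast
    from inverse_pair_cmp[OF this inv O] show "ecls C 0 x y' (\<theta> \<cdot> rep \<alpha>) \<in> Isos x y'" by (auto simp: Isos_def)
  qed
qed

lemma pre_cmp_inj:
  assumes inv: "inverse_pair C 0 x x' \<theta> \<eta>" and O: "x \<in> Ob C" "x' \<in> Ob C" "y \<in> Ob C"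
  shows "inj_on (\<lambda>\<alpha>. ecls C i x y (rep \<alpha> \<cdot> \<theta>)) (Ext C i x' y)"
    and "(\<lambda>\<alpha>. ecls C i x y (rep \<alpha> \<cdot> \<theta>)) ` Ext C i x' y \<subseteq> Ext C i x y"
    and "(\<lambda>\<alpha>. ecls C 0 x y (rep \<alpha> \<cdot> \<theta>)) ` Isos x' y \<subseteq> Isos x y"
proof -
  have i: "\<theta> \<in> cyc x x' 0" "\<eta> \<in> cyc x' x 0" "\<theta> \<cdot> \<eta> - idt C x' \<in> bnd x' x' 0"
    using inv O by (simp_all add: inverse_pair_iff)
  have c: "f \<cdot> \<theta> \<in> cyc x y i" if "f \<in> cyc x' y i" for f i using cyc_cmp[OF i(1) that] by simp
  show "inj_on (\<lambda>\<alpha>. ecls C i x y (rep \<alpha> \<cdot> \<theta>)) (Ext C i x' y)"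
  proof (rule inj_onI)
    fix \<alpha> \<beta> assume a: "\<alpha> \<in> Ext C i x' y" "\<beta> \<in> Ext C i x' y"
      and eq: "ecls C i x y (rep \<alpha> \<cdot> \<theta>) = ecls C i x y (rep \<beta> \<cdot> \<theta>)"
    note A = ExtE[OF a(1) O(2,3)] and B = ExtE[OF a(2) O(2,3)]
    define e where "e = rep \<alpha> - rep \<beta>"
    have e: "e \<in> cyc x' y i" unfolding e_def by (rule cyc_diff[OF A(1) B(1)])
    have "rep \<alpha> \<cdot> \<theta> - rep \<beta> \<cdot> \<theta> \<in> bnd x y i" using eq ecls_eq_iff[OF c[OF A(1)] c[OF B(1)]] by simp
    then have "e \<cdot> \<theta> \<in> bnd x y i" unfolding e_def diff_left[OF cycD(1)[OF i(1)] cycD(1)[OF A(1)] cycD(1)[OF B(1)]] .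
    then have "(e \<cdot> \<theta>) \<cdot> \<eta> \<in> bnd x' y i" by (rule bnd_cmp_left[OF i(2)]) simp
    moreover have "e \<cdot> (\<theta> \<cdot> \<eta> - idt C x') \<in> bnd x' y i" by (rule bnd_cmp_right[OF i(3) e]) simp
    moreover have "e \<cdot> (\<theta> \<cdot> \<eta> - idt C x') = (e \<cdot> \<theta>) \<cdot> \<eta> - e"
      using diff_right[OF cycD(1)[OF e] hom_cmp[OF cycD(1)[OF i(2)] cycD(1)[OF i(1)]] hom_idt[OF O(2)]]
        assoc[OF cycD(1)[OF i(2)] cycD(1)[OF i(1)] cycD(1)[OF e]] idt_right[OF cycD(1)[OF e]] by simp
    ultimately have "e \<in> bnd x' y i" using bnd_diff[of "(e \<cdot> \<theta>) \<cdot> \<eta>" x' y i "(e \<cdot> \<theta>) \<cdot> \<eta> - e"] by simp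
    then have "ecls C i x' y (rep \<alpha>) = ecls C i x' y (rep \<beta>)" using ecls_eq_iff[OF A(1) B(1)] by (simp add: e_def)
    then show "\<alpha> = \<beta>" by (simp add: A(2) B(2))
  qed
  show "(\<lambda>\<alpha>. ecls C i x y (rep \<alpha> \<cdot> \<theta>)) ` Ext C i x' y \<subseteq> Ext C i x y"
    using ExtE(1)[OF _ O(2,3)] c ecls_Ext by blast
  show "(\<lambda>\<alpha>. ecls C 0 x y (rep \<alpha> \<cdot> \<theta>)) ` Isos x' y \<subseteq> Isos x y"
  proof (rule image_subsetI)
    fix \<alpha> assume "\<alpha> \<in> Isos x' y"
    then obtain g where "inverse_pair C 0 x' y (rep \<alpha>) g" using IsosE O by blast
    from inverse_pair_cmp[OF inv this O] show "ecls C 0 x y (rep \<alpha> \<cdot> \<theta>) \<in> Isos x y" by (auto simp: Isos_def)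
  qed
qed

end

context finite_dg_category
begin

lemma finite_Isos: "x \<in> Ob C \<Longrightarrow> y \<in> Ob C \<Longrightarrow> finite (Isos x y)"
  using finite_subset[OF Isos_Ext finite_Ext] by blast

lemma card_post:
  assumes iso: "isomorphic C y y'" and O: "x \<in> Ob C" "y \<in> Ob C" "y' \<in> Ob C"
  shows "card (Ext C i x y) = card (Ext C i x y')" "card (Isos x y) = card (Isos x y')"
proof -
  obtain \<theta> \<eta> where inv: "inverse_pair C 0 y y' \<theta> \<eta>" using iso by (auto simp: isomorphic_def)
  note inv' = inverse_pair_sym[OF inv]
  note P = post_cmp_inj[OF inv O] and P' = post_cmp_inj[OF inv' O(1,3,2)]
  show "card (Ext C i x y) = card (Ext C i x y')"
    by (rule le_antisym[OF card_inj_on_le[OF P(1,2) finite_Ext[OF O(1,3)]] card_inj_on_le[OF P'(1,2) finite_Ext[OF O(1,2)]]])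
  show "card (Isos x y) = card (Isos x y')"
    by (rule le_antisym[OF card_inj_on_le[OF inj_on_subset[OF P(1) Isos_Ext[OF O(1,2)]] P(3) finite_Isos[OF O(1,3)]]
        card_inj_on_le[OF inj_on_subset[OF P'(1) Isos_Ext[OF O(1,3)]] P'(3) finite_Isos[OF O(1,2)]]])
qed

lemma card_pre:
  assumes iso: "isomorphic C x x'" and O: "x \<in> Ob C" "x' \<in> Ob C" "y \<in> Ob C"
  shows "card (Ext C i x y) = card (Ext C i x' y)" "card (Isos x y) = card (Isos x' y)"
proof -
  obtain \<theta> \<eta> where inv: "inverse_pair C 0 x x' \<theta> \<eta>" using iso by (auto simp: isomorphic_def)
  note inv' = inverse_pair_sym[OF inv]
  note P = pre_cmp_inj[OF inv O] and P' = pre_cmp_inj[OF inv' O(2,1,3)]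
  show "card (Ext C i x y) = card (Ext C i x' y)"
    by (rule le_antisym[OF card_inj_on_le[OF P'(1,2) finite_Ext[OF O(2,3)]] card_inj_on_le[OF P(1,2) finite_Ext[OF O(1,3)]]])
  show "card (Isos x y) = card (Isos x' y)"
    by (rule le_antisym[OF card_inj_on_le[OF inj_on_subset[OF P'(1) Isos_Ext[OF O(1,3)]] P'(3) finite_Isos[OF O(2,3)]]
        card_inj_on_le[OF inj_on_subset[OF P(1) Isos_Ext[OF O(2,3)]] P(3) finite_Isos[OF O(1,3)]]])
qed

lemma card_Aut_iso:
  assumes "isomorphic C x y" "x \<in> Ob C" "y \<in> Ob C"
  shows "card (Aut C x) = card (Aut C y)" "card (Isos x y) = card (Aut C x)"
  using card_post(2)[OF assms(1,2,2,3)] card_pre(2)[OF assms(1,2,3,3)] by (simp_all add: Aut_Isos)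

lemma ext_dim_iso:
  assumes "isomorphic C x x'" "isomorphic C y y'" "x \<in> Ob C" "x' \<in> Ob C" "y \<in> Ob C" "y' \<in> Ob C"
  shows "ext_dim C i x y = ext_dim C i x' y'"
  using card_pre(1)[OF assms(1,3,4,5), of i] card_post(1)[OF assms(2,4,5,6), of i] card_field
  by (simp add: card_Ext assms)

lemma card_Aut_pos: "x \<in> Ob C \<Longrightarrow> card (Aut C x) > 0"
proof -
  assume x: "x \<in> Ob C"
  then have "Isos x x \<noteq> {}" using isomorphic_refl[OF x] by (auto simp: Isos_def isomorphic_def)
  then show ?thesis using finite_Isos[OF x x] by (simp add: Aut_Isos card_gt_0_iff)
qed

end

section \<open>Counting morphisms of triangles\<close>

locale finite_dg_triangles = dg_triangles C + finite_dg_category C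
  for C :: "('k::{finite,field}, 'o, 'h::ab_group_add) dgcat"
begin

interpretation T: dg_category "triangles C" by (rule dg_category_triangles)

text \<open>The connecting map \<open>Ext\<^sup>m(x,x') \<oplus> Ext\<^sup>m(z,z') \<rightarrow> Ext\<^sup>m\<^sup>+\<^sup>1(z,x')\<close> of the long exact sequence,
  on cocycles. The size of its image is \<open>bdry_card\<close>, the field size to the power of the rank.\<close>
definition bdry :: "int \<Rightarrow> 'h \<Rightarrow> 'h \<Rightarrow> 'h \<times> 'h \<Rightarrow> 'h" where
  "bdry m D D' = (\<lambda>(a, k). a \<cdot> D - ksign m (D' \<cdot> k))"

definition bdry_image :: "('o, 'h) tri \<Rightarrow> ('o, 'h) tri \<Rightarrow> 'h \<Rightarrow> 'h \<Rightarrow> int \<Rightarrow> 'h set" where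
  "bdry_image t t' D D' m = {\<chi> \<in> cyc (tz t) (tx t') (m + 1).
     \<exists>f \<in> cyc (tx t) (tx t') m \<times> cyc (tz t) (tz t') m. \<chi> - bdry m D D' f \<in> bnd (tz t) (tx t') (m + 1)}"

definition bdry_card :: "('o, 'h) tri \<Rightarrow> ('o, 'h) tri \<Rightarrow> 'h \<Rightarrow> 'h \<Rightarrow> int \<Rightarrow> nat" where
  "bdry_card t t' D D' m = card (cosets (bdry_image t t' D D' m) (bnd (tz t) (tx t') (m + 1)))"

lemma add_subgroup_Times: "add_subgroup A \<Longrightarrow> add_subgroup B \<Longrightarrow> add_subgroup (A \<times> B)"
  by (auto simp: add_subgroup_def zero_prod_def)

lemma card_cosets_Times:
  assumes "add_subgroup B" "add_subgroup B'"
  shows "card (cosets (A \<times> A') (B \<times> B')) = card (cosets A B) * card (cosets A' B')"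
    "finite (cosets A B) \<Longrightarrow> finite (cosets A' B') \<Longrightarrow> finite (cosets (A \<times> A') (B \<times> B'))"
proof -
  have "coset (A \<times> A') (B \<times> B') (f, g) = coset A B f \<times> coset A' B' g" for f g
    by (auto simp: coset_def)
  then have eq: "cosets (A \<times> A') (B \<times> B') = (\<lambda>(\<alpha>, \<beta>). \<alpha> \<times> \<beta>) ` (cosets A B \<times> cosets A' B')"
    unfolding cosets_def by (auto simp: image_iff) blast
  have ne: "\<alpha> \<noteq> {}" if "\<alpha> \<in> cosets A B" for \<alpha> using that add_subgroupD(1)[OF assms(1)] by (auto simp: cosets_def coset_def)
  have ne': "\<alpha> \<noteq> {}" if "\<alpha> \<in> cosets A' B'" for \<alpha> using that add_subgroupD(1)[OF assms(2)] by (auto simp: cosets_def coset_def)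
  have "inj_on (\<lambda>(\<alpha>, \<beta>). \<alpha> \<times> \<beta>) (cosets A B \<times> cosets A' B')"
    using ne ne' by (auto simp: inj_on_def times_eq_iff)
  then show "card (cosets (A \<times> A') (B \<times> B')) = card (cosets A B) * card (cosets A' B')"
    unfolding eq by (simp add: card_image card_cartesian_product)
  show "finite (cosets A B) \<Longrightarrow> finite (cosets A' B') \<Longrightarrow> finite (cosets (A \<times> A') (B \<times> B'))"
    unfolding eq by simp
qed

context
  fixes t t' D D'
  assumes t: "exact_triangle C t" and t': "exact_triangle C t'"
    and c: "conn t D" and c': "conn t' D'"
begin

lemmas Ot = exact_precomplexD(1-3)[OF t] exact_precomplexD(1-3)[OF t']

lemma cyc_grp: "x \<in> Ob C \<Longrightarrow> y \<in> Ob C \<Longrightarrow> add_subgroup (cyc x y i)"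
  by (rule V.subspace_add_subgroup[OF cyc_subspace])
lemma bnd_grp: "x \<in> Ob C \<Longrightarrow> y \<in> Ob C \<Longrightarrow> add_subgroup (bnd x y i)"
  by (rule V.subspace_add_subgroup[OF bnd_subspace])

lemma bdry_cyc: "f \<in> cyc (tx t) (tx t') m \<times> cyc (tz t) (tz t') m \<Longrightarrow> bdry m D D' f \<in> cyc (tz t) (tx t') (m + 1)"
  using conn_cyc[OF c] conn_cyc[OF c'] by (auto simp: bdry_def intro!: cyc_diff cyc_ksign cyc_cmp[of D _ _ 1] cyc_cmp[of _ _ _ m D'])

lemma bdry_bnd: "f \<in> bnd (tx t) (tx t') m \<times> bnd (tz t) (tz t') m \<Longrightarrow> bdry m D D' f \<in> bnd (tz t) (tx t') (m + 1)"
  by (auto simp: bdry_def intro!: bnd_diff bnd_ksign bnd_cmp_left[OF conn_cyc[OF c]] bnd_cmp_right[OF _ conn_cyc[OF c']])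

lemma bdry_diff:
  assumes "f \<in> cyc (tx t) (tx t') m \<times> cyc (tz t) (tz t') m" "g \<in> cyc (tx t) (tx t') m \<times> cyc (tz t) (tz t') m"
  shows "bdry m D D' (f - g) = bdry m D D' f - bdry m D D' g"
proof -
  obtain a k where f: "f = (a, k)" by (cases f)
  obtain a' k' where g: "g = (a', k')" by (cases g)
  have h: "a \<in> hom (tx t) (tx t') m" "a' \<in> hom (tx t) (tx t') m" "k \<in> hom (tz t) (tz t') m" "k' \<in> hom (tz t) (tz t') m"
    using assms by (auto simp: f g cyc_def)
  show ?thesis
    using diff_left[OF cycD(1)[OF conn_cyc[OF c]] h(1,2)] diff_right[OF cycD(1)[OF conn_cyc[OF c']] h(3,4)]
    by (simp add: f g bdry_def)
qed

text \<open>The Euler characteristic of a piece of the long exact sequence \<open>Ext\<^sup>m\<^sup>-\<^sup>1(x,x') \<oplus>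
  Ext\<^sup>m\<^sup>-\<^sup>1(z,z') \<rightarrow> Ext\<^sup>m(z,x') \<rightarrow> Ext\<^sup>m(t,t') \<rightarrow> Ext\<^sup>m(x,x') \<oplus> Ext\<^sup>m(z,z') \<rightarrow> Ext\<^sup>m\<^sup>+\<^sup>1(z,x')\<close> in
  multiplicative form. It multiplies three instances of kernel times image: for the connecting
  map, for \<open>iota\<close> and for the projection to the outer diagonal entries.\<close>
theorem Ext_triangles_count:
  shows "finite (Ext (triangles C) m t t')"
    and "card (Ext (triangles C) m t t') * bdry_card t t' D D' (m - 1) * bdry_card t t' D D' m =
      card (Ext C m (tz t) (tx t')) * (card (Ext C m (tx t) (tx t')) * card (Ext C m (tz t) (tz t')))"
proof -
  let ?G = "cyc (tx t) (tx t') m \<times> cyc (tz t) (tz t') m" and ?H = "bnd (tx t) (tx t') m \<times> bnd (tz t) (tz t') m"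
  let ?A = "cyc (tz t) (tx t') m" and ?B = "bnd (tz t) (tx t') m"
  let ?A' = "cyc (tz t) (tx t') (m + 1)" and ?B' = "bnd (tz t) (tx t') (m + 1)"
  let ?Z = "T.cyc t t' m" and ?W = "T.bnd t t' m"
  have tO: "t \<in> Ob (triangles C)" "t' \<in> Ob (triangles C)" using t t' by (simp_all add: Ob_triangles)
  note grp = cyc_grp bnd_grp add_subgroup_Times Ot
  have gZ: "add_subgroup ?Z" "add_subgroup ?W"
    by (rule T.V.subspace_add_subgroup[OF T.cyc_subspace[OF tO]] T.V.subspace_add_subgroup[OF T.bnd_subspace[OF tO]])+
  let ?r = "\<lambda>(a, b, k, u, v, w). (a, k)"
  have finA: "finite (cosets ?A ?B)" using finite_Ext[OF Ot(3,4)] Ext_cosets[OF Ot(3,4)] by simp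
  have finG: "finite (cosets ?G ?H)"
    using card_cosets_Times(2)[OF bnd_grp bnd_grp, OF Ot(1,4) Ot(3,6)] finite_Ext[OF Ot(1,4)] finite_Ext[OF Ot(3,6)]
      Ext_cosets[OF Ot(1,4)] Ext_cosets[OF Ot(3,6)] by simp

  have gG: "add_subgroup ?G" and gH: "add_subgroup ?H" by (intro grp)+
  have sub: "?H \<subseteq> ?G" by (intro Sigma_mono bnd_sub_cyc)
  have b: "card (cosets ?G ?H) = card (cosets {f \<in> ?G. bdry m D D' f \<in> ?B'} ?H) * bdry_card t t' D D' m"
    "finite (cosets ?G ?H) \<longleftrightarrow> finite (cosets {f \<in> ?G. bdry m D D' f \<in> ?B'} ?H) \<and> finite (cosets (bdry_image t t' D D' m) ?B')"
    using card_cosets_kernel_image[OF gG gH sub bnd_grp[OF Ot(3,4)] bdry_diff bdry_cyc bdry_bnd]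
    unfolding bdry_card_def bdry_image_def by blast+

  have iota_ker: "{\<chi> \<in> ?A. iota t t' \<chi> \<in> ?W} = bdry_image t t' D D' (m - 1)"
    using iota_bnd_iff[OF t t' c c', of _ "m - 1"] by (auto simp: bdry_image_def bdry_def Bex_def)
  have iota_diff: "iota t t' (f - g) = iota t t' f - iota t t' g" if "f \<in> ?A" "g \<in> ?A" for f g
    using iota_add[OF t t' cycD(1)[OF that(1)] hom_minus[OF cycD(1)[OF that(2)]]] iota_minus[OF t t' cycD(1)[OF that(2)]] by simp
  let ?I = "{\<Phi> \<in> ?Z. \<exists>\<chi>\<in>?A. \<Phi> - iota t t' \<chi> \<in> ?W}"
  have i: "card (cosets ?A ?B) = bdry_card t t' D D' (m - 1) * card (cosets ?I ?W)"
    "finite (cosets ?A ?B) \<longleftrightarrow> finite (cosets (bdry_image t t' D D' (m - 1)) ?B) \<and> finite (cosets ?I ?W)"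
    using card_cosets_kernel_image[of ?A ?B ?W "iota t t'" ?Z] gZ bnd_sub_cyc[of "tz t" "tx t'" m] iota_diff
      iota_cyc[OF t t' c c'] iota_bnd[OF t t' c c']
    by (simp_all add: grp iota_ker bdry_card_def)

  have r_ker: "{\<Phi> \<in> ?Z. ?r \<Phi> \<in> ?H} = ?I"
  proof (intro equalityI subsetI)
    fix \<Phi> assume \<Phi>: "\<Phi> \<in> {\<Phi> \<in> ?Z. ?r \<Phi> \<in> ?H}"
    obtain a b k u v w where e: "\<Phi> = (a, b, k, u, v, w)" by (cases \<Phi>)
    show "\<Phi> \<in> ?I" using \<Phi> tri_cyc_iota[OF t t' c c', of a b k u v w m] by (simp add: e)
  next
    fix \<Phi> assume \<Phi>: "\<Phi> \<in> ?I"
    obtain a b k u v w where e: "\<Phi> = (a, b, k, u, v, w)" by (cases \<Phi>)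
    obtain \<chi> where \<chi>: "\<chi> \<in> ?A" "\<Phi> - iota t t' \<chi> \<in> ?W" using \<Phi> by blast
    then have "(a, b - tf t' \<cdot> (\<chi> \<cdot> tg t), k, u - tf t' \<cdot> (\<chi> \<cdot> th t), v - th t' \<cdot> (\<chi> \<cdot> tg t), w - th t' \<cdot> (\<chi> \<cdot> th t)) \<in> ?W"
      by (simp add: e iota_def)
    from tri_bnd_components[OF t t' c c' this] show "\<Phi> \<in> {\<Phi> \<in> ?Z. ?r \<Phi> \<in> ?H}" using \<Phi> by (simp add: e)
  qed
  have r_im: "{f \<in> ?G. \<exists>\<Phi>\<in>?Z. f - ?r \<Phi> \<in> ?H} = {f \<in> ?G. bdry m D D' f \<in> ?B'}"
  proof (intro equalityI subsetI)
    fix f assume f: "f \<in> {f \<in> ?G. \<exists>\<Phi>\<in>?Z. f - ?r \<Phi> \<in> ?H}"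
    then obtain a b k u v w where \<Phi>: "(a, b, k, u, v, w) \<in> ?Z" "f - (a, k) \<in> ?H" by force
    have ak: "(a, k) \<in> ?G" using tri_cyc_components[OF t t' c c' \<Phi>(1)] by simp
    have "bdry m D D' (a, k) \<in> ?B'" using tri_cyc_compat[OF t t' c c' \<Phi>(1)] by (simp add: bdry_def)
    moreover have "bdry m D D' f - bdry m D D' (a, k) \<in> ?B'"
      using bdry_bnd[OF \<Phi>(2)] bdry_diff[of f m "(a, k)"] f ak by simp
    ultimately have "bdry m D D' f \<in> ?B'" using bnd_add by fastforce
    then show "f \<in> {f \<in> ?G. bdry m D D' f \<in> ?B'}" using f by blast
  next
    fix f assume f: "f \<in> {f \<in> ?G. bdry m D D' f \<in> ?B'}"
    obtain a k where e: "f = (a, k)" by (cases f)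
    obtain b u v w where \<Phi>: "(a, b, k, u, v, w) \<in> ?Z"
      using tri_lift[OF t t' c c', of a m k] f by (auto simp: e bdry_def)
    have "f - ?r (a, b, k, u, v, w) \<in> ?H" by (simp add: e zero_prod_def bnd_zero Ot)
    then show "f \<in> {f \<in> ?G. \<exists>\<Phi>\<in>?Z. f - ?r \<Phi> \<in> ?H}" using \<Phi> f
      unfolding mem_Collect_eq by (intro conjI bexI[of _ "(a, b, k, u, v, w)"]) simp_all
  qed
  have r_diff: "?r (f - g) = ?r f - ?r g" for f g :: "'h \<times> 'h \<times> 'h \<times> 'h \<times> 'h \<times> 'h"
    by (cases f; cases g) simp
  have r_cyc: "?r f \<in> ?G" if "f \<in> ?Z" for f
    using tri_cyc_components[OF t t' c c'] that by (cases f) auto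
  have r_bnd: "?r f \<in> ?H" if "f \<in> ?W" for f
    using tri_bnd_components[OF t t' c c'] that by (cases f) auto
  have r: "card (cosets ?Z ?W) = card (cosets ?I ?W) * card (cosets {f \<in> ?G. bdry m D D' f \<in> ?B'} ?H)"
    "finite (cosets ?Z ?W) \<longleftrightarrow> finite (cosets ?I ?W) \<and> finite (cosets {f \<in> ?G. bdry m D D' f \<in> ?B'} ?H)"
    using card_cosets_kernel_image[OF gZ T.bnd_sub_cyc gH r_diff r_cyc r_bnd, unfolded r_ker r_im] by blast+
  have E: "Ext (triangles C) m t t' = cosets ?Z ?W" by (rule T.Ext_cosets[OF tO])
  show "finite (Ext (triangles C) m t t')"
    unfolding E r(2) using b(2) i(2) finA finG by blast
  have G: "card (cosets ?G ?H) = card (Ext C m (tx t) (tx t')) * card (Ext C m (tz t) (tz t'))"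
    using card_cosets_Times(1)[OF bnd_grp bnd_grp, OF Ot(1,4) Ot(3,6)] Ext_cosets[OF Ot(1,4)] Ext_cosets[OF Ot(3,6)] by simp
  show "card (Ext (triangles C) m t t') * bdry_card t t' D D' (m - 1) * bdry_card t t' D D' m =
      card (Ext C m (tz t) (tx t')) * (card (Ext C m (tx t) (tx t')) * card (Ext C m (tz t) (tz t')))"
    unfolding E r(1) G[symmetric] b(1) Ext_cosets[OF Ot(3,4)] i(1) by simp
qed

lemma bdry_card_eq_1:
  assumes "\<And>a. a \<in> cyc (tx t) (tx t') m \<Longrightarrow> a \<cdot> D \<in> bnd (tz t) (tx t') (m + 1)"
    and "\<And>k. k \<in> cyc (tz t) (tz t') m \<Longrightarrow> D' \<cdot> k \<in> bnd (tz t) (tx t') (m + 1)"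
  shows "bdry_card t t' D D' m = 1"
proof -
  have "bdry m D D' f \<in> bnd (tz t) (tx t') (m + 1)" if "f \<in> cyc (tx t) (tx t') m \<times> cyc (tz t) (tz t') m" for f
    using that assms by (auto simp: bdry_def intro!: bnd_diff bnd_ksign)
  note null = this
  have "bdry_image t t' D D' m = bnd (tz t) (tx t') (m + 1)"
  proof (intro equalityI subsetI)
    fix \<chi> assume "\<chi> \<in> bdry_image t t' D D' m"
    then obtain f where "f \<in> cyc (tx t) (tx t') m \<times> cyc (tz t) (tz t') m" "\<chi> - bdry m D D' f \<in> bnd (tz t) (tx t') (m + 1)"
      unfolding bdry_image_def by blast
    then show "\<chi> \<in> bnd (tz t) (tx t') (m + 1)" using bnd_add[OF _ null] by fastforce
  next
    fix \<chi> assume \<chi>: "\<chi> \<in> bnd (tz t) (tx t') (m + 1)"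
    have z: "(0, 0) \<in> cyc (tx t) (tx t') m \<times> cyc (tz t) (tz t') m" by (simp add: cyc_zero Ot)
    have "\<chi> - bdry m D D' (0, 0) \<in> bnd (tz t) (tx t') (m + 1)" by (rule bnd_diff[OF \<chi> null[OF z]])
    then show "\<chi> \<in> bdry_image t t' D D' m" unfolding bdry_image_def using z bnd_cyc[OF \<chi>] by blast
  qed
  then show ?thesis
    unfolding bdry_card_def using card_cosets_eq_1[OF bnd_grp bnd_grp] Ot by simp
qed

end
end

section \<open>The exponent of a triangle in the subcategory\<close>

lemma minus_one_powi: "(- 1 :: real) powi i = (if even i then 1 else - 1)"
  by (simp add: power_int_minus_left)

lemma alternating_telescope:
  fixes r :: "int \<Rightarrow> real"
  assumes "a \<le> b + 1"
  shows "(\<Sum>m\<in>{a..b}. (- 1) powi m * (r (m - 1) + r m)) = (- 1) powi a * r (a - 1) + (- 1) powi b * r b"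
proof -
  have "a - 1 \<le> b" using assms by simp
  then show ?thesis
  proof (induction b rule: int_ge_induct)
    case base
    then show ?case by (simp add: minus_one_powi)
  next
    case (step b)
    have "{a..b + 1} = insert (b + 1) {a..b}" using step.hyps by auto
    then show ?case using step.IH by (simp add: minus_one_powi algebra_simps)
  qed
qed

text \<open>For odd \<open>n\<close> the reflection \<open>m \<mapsto> n - m\<close> reverses the sign of every summand.\<close>
lemma alternating_symmetric:
  fixes e :: "int \<Rightarrow> real"
  assumes "odd n" "a + b = n" "\<And>m. e (n - m) = e m"
  shows "(\<Sum>m\<in>{a..b}. (- 1) powi m * e m) = 0"
proof -
  have "(\<Sum>m\<in>{a..b}. (- 1) powi m * e m) = (\<Sum>m\<in>{a..b}. (- 1) powi (n - m) * e (n - m))"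
    by (rule sum.reindex_bij_witness[of _ "\<lambda>m. n - m" "\<lambda>m. n - m"]) (use assms(2) in auto)
  also have "\<dots> = - (\<Sum>m\<in>{a..b}. (- 1) powi m * e m)"
    using assms(1,3) by (simp add: minus_one_powi sum_negf[symmetric] if_distrib cong: if_cong)
      (intro sum.cong refl; auto)
  finally show ?thesis by simp
qed

context finite_dg_triangles
begin

interpretation T: dg_category "triangles C" by (rule dg_category_triangles)

lemma finite_dg_category_triangles: "finite_dg_category (triangles C)"
proof
  fix t t' i assume "t \<in> Ob (triangles C)" "t' \<in> Ob (triangles C)"
  then have t: "exact_triangle C t" "exact_triangle C t'" by (simp_all add: Ob_triangles)
  then show "finite (Ext (triangles C) i t t')"
    using conn_exists[OF t(1)] conn_exists[OF t(2)] Ext_triangles_count(1)[OF t] by blast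
qed

interpretation T: finite_dg_category "triangles C" by (rule finite_dg_category_triangles)

lemma Ext_pos: "x \<in> Ob C \<Longrightarrow> y \<in> Ob C \<Longrightarrow> card (Ext C i x y) > 0"
  using card_field by (simp add: card_Ext)

definition exact_sub :: "'o set \<Rightarrow> bool" where
  "exact_sub E \<longleftrightarrow> E \<subseteq> Ob C \<and> induces_exact_structure C E"

context
  fixes E assumes E: "exact_sub E"
begin

lemma E_ob: "x \<in> E \<Longrightarrow> x \<in> Ob C"
  using E by (auto simp: exact_sub_def)

lemma E_middle: "exact_triangle C t \<Longrightarrow> tx t \<in> E \<Longrightarrow> tz t \<in> E \<Longrightarrow> ty t \<in> E"
  using E unfolding exact_sub_def induces_exact_structure_def by blast

lemma E_mono:
  assumes t: "exact_triangle C t" "tx t \<in> E" "tz t \<in> E" and u: "w \<in> E" "u \<in> cyc w (tx t) 0"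
    and b: "tf t \<cdot> u \<in> bnd w (ty t) 0"
  shows "u \<in> bnd w (tx t) 0"
proof -
  note X = exact_precomplexD[OF t(1)]
  have "mono_in C E (tx t) (ty t) (tf t)" using E t unfolding exact_sub_def induces_exact_structure_def by blast
  moreover have "ecls C 0 w (ty t) (tf t \<cdot> u) = ecls C 0 w (ty t) (tf t \<cdot> 0)"
    using ecls_eq_iff[OF bnd_cyc[OF b] cyc_zero[OF E_ob[OF u(1)] X(2)]] b by (simp add: zero_right[OF X(4)])
  moreover have "u \<in> cocyc C 0 w (tx t)" "0 \<in> cocyc C 0 w (tx t)"
    using u X(1) cocyc_eq[OF E_ob[OF u(1)] X(1)] by (simp_all add: cyc_zero E_ob)
  ultimately have "ecls C 0 w (tx t) u = ecls C 0 w (tx t) 0" using u(1) unfolding mono_in_def by blast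
  then show ?thesis using ecls_eq_iff[OF u(2) cyc_zero[OF E_ob[OF u(1)] X(1)]] by simp
qed

lemma E_epi:
  assumes t: "exact_triangle C t" "tx t \<in> E" "tz t \<in> E" and u: "w \<in> E" "u \<in> cyc (tz t) w 0"
    and b: "u \<cdot> tg t \<in> bnd (ty t) w 0"
  shows "u \<in> bnd (tz t) w 0"
proof -
  note X = exact_precomplexD[OF t(1)]
  have "epi_in C E (ty t) (tz t) (tg t)" using E t unfolding exact_sub_def induces_exact_structure_def by blast
  moreover have "ecls C 0 (ty t) w (u \<cdot> tg t) = ecls C 0 (ty t) w (0 \<cdot> tg t)"
    using ecls_eq_iff[OF bnd_cyc[OF b] cyc_zero[OF X(2) E_ob[OF u(1)]]] b by (simp add: zero_left[OF X(5)])
  moreover have "u \<in> cocyc C 0 (tz t) w" "0 \<in> cocyc C 0 (tz t) w"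
    using u X(3) cocyc_eq[OF X(3) E_ob[OF u(1)]] by (simp_all add: cyc_zero E_ob)
  ultimately have "ecls C 0 (tz t) w u = ecls C 0 (tz t) w 0" using u(1) unfolding epi_in_def by blast
  then show ?thesis using ecls_eq_iff[OF u(2) cyc_zero[OF X(3) E_ob[OF u(1)]]] by simp
qed

text \<open>Consecutive morphisms of a triangle compose to zero, so \<open>a D\<close> is killed by \<open>g\<close>, which is an
  epimorphism in \<open>E\<close>. Dually, \<open>D k\<close> is killed by the monomorphism \<open>f\<close>.\<close>
lemma conn_left_null:
  assumes t: "exact_triangle C t" "tx t \<in> E" "tz t \<in> E" "conn t D" and w: "w \<in> E" "a \<in> cyc (tx t) w (- 1)"
  shows "a \<cdot> D \<in> bnd (tz t) w 0"
proof (rule E_epi[OF t(1-3) w(1)])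
  show "a \<cdot> D \<in> cyc (tz t) w 0" using cyc_cmp[OF conn_cyc[OF t(4)] w(2)] by simp
  have "a \<cdot> (D \<cdot> tg t) \<in> bnd (ty t) w 0" by (rule bnd_cmp_right[OF conn_tg[OF t(4)] w(2)]) simp
  then show "a \<cdot> D \<cdot> tg t \<in> bnd (ty t) w 0"
    using assoc[OF exact_precomplexD(5)[OF t(1)] cycD(1)[OF conn_cyc[OF t(4)]] cycD(1)[OF w(2)]] by simp
qed

lemma conn_right_null:
  assumes t: "exact_triangle C t" "tx t \<in> E" "tz t \<in> E" "conn t D" and w: "w \<in> E" "k \<in> cyc w (tz t) (- 1)"
  shows "D \<cdot> k \<in> bnd w (tx t) 0"
proof (rule E_mono[OF t(1-3) w(1)])
  show "D \<cdot> k \<in> cyc w (tx t) 0" using cyc_cmp[OF w(2) conn_cyc[OF t(4)]] by simp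
  have "tf t \<cdot> D \<cdot> k \<in> bnd w (ty t) 0" by (rule bnd_cmp_left[OF w(2) conn_tf[OF t(4)]]) simp
  then show "tf t \<cdot> (D \<cdot> k) \<in> bnd w (ty t) 0"
    using assoc[OF cycD(1)[OF w(2)] cycD(1)[OF conn_cyc[OF t(4)]] exact_precomplexD(4)[OF t(1)]] by simp
qed

lemma E_bdry_card_low:
  assumes t: "exact_triangle C t" "tx t \<in> E" "tz t \<in> E" "conn t D"
    and t': "exact_triangle C t'" "tx t' \<in> E" "tz t' \<in> E" "conn t' D'"
  shows "bdry_card t t' D D' (- 1) = 1"
  using bdry_card_eq_1[OF t(1) t'(1) t(4) t'(4), of "- 1"] conn_left_null[OF t t'(2)] conn_right_null[OF t' t(3)] by simp

text \<open>By Calabi-Yau duality, the connecting map in degree \<open>n\<close> vanishes because the one in degree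
  \<open>-1\<close> does.\<close>
lemma E_bdry_card_high:
  assumes cy: "calabi_yau C n" and t: "exact_triangle C t" "tx t \<in> E" "tz t \<in> E" "conn t D"
  shows "bdry_card t t D D n = 1"
proof (rule bdry_card_eq_1[OF t(1,1,4,4)])
  obtain P :: "('k, 'o, 'h, 'o list \<times> 'h list \<Rightarrow> 'k) dgbimod" and F G where
    P: "dg_bimodule C P" "bimod_quasi_iso C P (shifted_diagonal C n) F" "bimod_quasi_iso C P (dual_diagonal C) G"
    using cy unfolding calabi_yau_def bimod_equivalent_def by blast
  note d = conn_cyc[OF t(4)]
  show "a \<cdot> D \<in> bnd (tz t) (tx t) (n + 1)" if "a \<in> cyc (tx t) (tx t) n" for a
    by (rule pairing_vanish_right[OF P that d conn_right_null[OF t t(2)]])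
  show "D \<cdot> k \<in> bnd (tz t) (tx t) (n + 1)" if "k \<in> cyc (tz t) (tz t) n" for k
    by (rule pairing_vanish_left[OF P that d conn_left_null[OF t t(3)]])
qed

text \<open>Logarithms of \<open>Ext_triangles_count\<close> express each \<open>dim Ext\<^sup>m(t,t)\<close> by the outer terms and two
  consecutive ranks. Both ranges of summation are symmetric under \<open>m \<mapsto> n - m\<close> and their boundary
  terms involve only the ranks in degrees \<open>-1\<close> and \<open>n\<close>.\<close>
lemma E_euler_form:
  assumes cy: "calabi_yau C n" "odd n" and t: "exact_triangle C t" "tx t \<in> E" "tz t \<in> E"
    and ab: "(a = 0 \<and> b = n \<or> a = n + 1 \<and> b = - 1)" "a \<le> b + 1"
  shows "euler_form (triangles C) {a..b} t t = euler_form C {a..b} (tz t) (tx t)"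
proof -
  obtain D where D: "conn t D" using conn_exists[OF t(1)] ..
  define q where "q = real CARD('k)"
  have q: "q > 1" using card_field by (simp add: q_def)
  define r where "r m = log q (real (bdry_card t t D D m))" for m
  have O: "tx t \<in> Ob C" "tz t \<in> Ob C" "t \<in> Ob (triangles C)" using t E_ob by (auto simp: Ob_triangles)
  let ?e = "\<lambda>m. real (ext_dim C m (tz t) (tx t))" and ?x = "\<lambda>m. real (ext_dim C m (tx t) (tx t))"
    and ?z = "\<lambda>m. real (ext_dim C m (tz t) (tz t))" and ?t = "\<lambda>m. real (ext_dim (triangles C) m t t)"
  have main: "?t m = ?e m + ?x m + ?z m - (r (m - 1) + r m)" for m
  proof -
    have eq: "CARD('k) ^ ext_dim (triangles C) m t t * bdry_card t t D D (m - 1) * bdry_card t t D D m =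
      CARD('k) ^ (ext_dim C m (tz t) (tx t) + ext_dim C m (tx t) (tx t) + ext_dim C m (tz t) (tz t))"
      using Ext_triangles_count(2)[OF t(1,1) D D, of m] by (simp add: card_Ext O T.card_Ext power_add)
    have "CARD('k) ^ ext_dim (triangles C) m t t * bdry_card t t D D (m - 1) * bdry_card t t D D m > 0"
      unfolding eq using card_field by simp
    then have pos: "bdry_card t t D D (m - 1) > 0" "bdry_card t t D D m > 0" by auto
    have "log q (real (CARD('k) ^ ext_dim (triangles C) m t t * bdry_card t t D D (m - 1) * bdry_card t t D D m)) =
        ?t m + r (m - 1) + r m"
      using q pos by (simp add: log_mult r_def q_def[symmetric] log_nat_power)
    moreover have "log q (real (CARD('k) ^ (ext_dim C m (tz t) (tx t) + ext_dim C m (tx t) (tx t) + ext_dim C m (tz t) (tz t)))) =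
        ?e m + ?x m + ?z m"
      using q by (simp add: q_def[symmetric] log_nat_power)
    ultimately show ?thesis unfolding eq by simp
  qed
  have r0: "r (- 1) = 0" "r n = 0"
    using E_bdry_card_low[OF t D t D] E_bdry_card_high[OF cy(1) t D] by (simp_all add: r_def)
  have sx: "(\<Sum>m\<in>{a..b}. (- 1) powi m * ?x m) = 0" "(\<Sum>m\<in>{a..b}. (- 1) powi m * ?z m) = 0"
    by (rule alternating_symmetric[OF cy(2)]; use ab calabi_yau_ext_dim[OF cy(1)] O in auto)+
  have "(\<Sum>m\<in>{a..b}. (- 1) powi m * (r (m - 1) + r m)) = 0"
    using alternating_telescope[OF ab(2), of r] ab(1) r0 by auto
  moreover have "euler_form (triangles C) {a..b} t t = (\<Sum>m\<in>{a..b}. (- 1) powi m * ?e m) + (\<Sum>m\<in>{a..b}. (- 1) powi m * ?x m)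
      + (\<Sum>m\<in>{a..b}. (- 1) powi m * ?z m) - (\<Sum>m\<in>{a..b}. (- 1) powi m * (r (m - 1) + r m))"
    unfolding euler_form_def main by (simp add: sum.distrib sum_subtractf algebra_simps)
  ultimately show ?thesis using sx by (simp add: euler_form_def)
qed

text \<open>The morphism comes from some \<open>\<chi> : z \<rightarrow> x\<close>, and its component at \<open>y\<close> is \<open>f \<chi> g\<close>. If this is
  null then so is \<open>\<chi>\<close>, because \<open>f\<close> is a monomorphism and \<open>g\<close> an epimorphism in \<open>E\<close>; this uses that
  \<open>y\<close> lies in \<open>E\<close>.\<close>
lemma E_tri_faithful:
  assumes t: "exact_triangle C t" "tx t \<in> E" "tz t \<in> E"
    and \<Phi>: "(a, b, k, u, v, w) \<in> T.cyc t t 0"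
    and null: "a \<in> bnd (tx t) (tx t) 0" "b \<in> bnd (ty t) (ty t) 0" "k \<in> bnd (tz t) (tz t) 0"
  shows "(a, b, k, u, v, w) \<in> T.bnd t t 0"
proof -
  obtain D where D: "conn t D" using conn_exists[OF t(1)] ..
  note X = exact_precomplexD[OF t(1)]
  have y: "ty t \<in> E" by (rule E_middle[OF t])
  obtain \<chi> where \<chi>: "\<chi> \<in> cyc (tz t) (tx t) 0" "(a, b, k, u, v, w) - iota t t \<chi> \<in> T.bnd t t 0"
    using tri_cyc_iota[OF t(1,1) D D \<Phi> null(1,3)] by blast
  have "(a, b - tf t \<cdot> (\<chi> \<cdot> tg t), k, u - tf t \<cdot> (\<chi> \<cdot> th t), v - th t \<cdot> (\<chi> \<cdot> tg t), w - th t \<cdot> (\<chi> \<cdot> th t)) \<in> T.bnd t t 0"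
    using \<chi>(2) by (simp add: iota_def)
  from tri_bnd_components(2)[OF t(1,1) D D this]
  have b: "tf t \<cdot> (\<chi> \<cdot> tg t) \<in> bnd (ty t) (ty t) 0" using bnd_diff[OF null(2)] by fastforce
  have tg: "tg t \<in> cyc (ty t) (tz t) 0" using X by (simp add: cyc_def)
  have "\<chi> \<cdot> tg t \<in> cyc (ty t) (tx t) 0" by (rule cyc_cmp[OF tg \<chi>(1)]) simp
  from E_mono[OF t y this b] have "\<chi> \<cdot> tg t \<in> bnd (ty t) (tx t) 0" .
  from E_epi[OF t t(2) \<chi>(1) this] have "\<chi> \<in> bnd (tz t) (tx t) 0" .
  from T.bnd_add[OF \<chi>(2) iota_bnd[OF t(1,1) D D this]] show ?thesis by simp
qed

text \<open>The map \<open>Ext\<^sup>0(t,t) \<rightarrow> Ext\<^sup>0(x,x) \<oplus> Ext\<^sup>0(y,y) \<oplus> Ext\<^sup>0(z,z)\<close> is injective by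
  \<open>E_tri_faithful\<close>, so its rank, computed by counting its image, equals the dimension of its
  source.\<close>
lemma E_rho:
  assumes t: "exact_triangle C t" "tx t \<in> E" "tz t \<in> E"
  shows "rho C t = 0"
proof -
  obtain D where D: "conn t D" using conn_exists[OF t(1)] ..
  note X = exact_precomplexD[OF t(1)]
  have tO: "t \<in> Ob (triangles C)" using t by (simp add: Ob_triangles)
  let ?s = "\<lambda>k (a, b, c). (scl C k a, scl C k b, scl C k c)"
  let ?p = "\<lambda>(a, b, c, u, v, w). (a :: 'h, b :: 'h, c :: 'h)"
  let ?Z = "T.cyc t t 0" and ?B = "T.bnd t t 0"
  let ?W = "bnd (tx t) (tx t) 0 \<times> bnd (ty t) (ty t) 0 \<times> bnd (tz t) (tz t) 0"
  interpret W: vector_space ?s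
    by unfold_locales (auto simp: V.scale_right_distrib V.scale_left_distrib)
  have sW: "W.subspace ?W"
    using V.subspace_0[OF bnd_subspace] V.subspace_add[OF bnd_subspace] V.subspace_scale[OF bnd_subspace] X
    by (intro W.subspaceI) (auto simp: zero_prod_def)
  have sV: "W.subspace (?p ` ?Z)"
  proof (rule W.subspaceI)
    show "0 \<in> ?p ` ?Z" using T.cyc_zero[OF tO tO, of 0] by (force simp: zero_prod_def)
  next
    fix x y assume "x \<in> ?p ` ?Z" "y \<in> ?p ` ?Z"
    then obtain f g where f: "f \<in> ?Z" "x = ?p f" "g \<in> ?Z" "y = ?p g" by blast
    have eq: "x + y = ?p (f + g)" unfolding f by (cases f; cases g) simp
    show "x + y \<in> ?p ` ?Z" unfolding eq by (rule imageI[OF T.cyc_add[OF f(1,3)]])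
  next
    fix c x assume "x \<in> ?p ` ?Z"
    then obtain f where f: "f \<in> ?Z" "x = ?p f" by blast
    have eq: "?s c x = ?p (scl (triangles C) c f)" unfolding f by (cases f) (simp add: triangles_simps)
    show "?s c x \<in> ?p ` ?Z" unfolding eq by (rule imageI[OF T.V.subspace_scale[OF T.cyc_subspace[OF tO tO] f(1)]])
  qed
  have gr: "add_subgroup ?Z" "add_subgroup ?B" "add_subgroup ?W"
    by (rule T.V.subspace_add_subgroup[OF T.cyc_subspace[OF tO tO]] T.V.subspace_add_subgroup[OF T.bnd_subspace[OF tO tO]]
      W.subspace_add_subgroup[OF sW])+
  have p_diff: "?p (f - g) = ?p f - ?p g" for f g :: "'h \<times> 'h \<times> 'h \<times> 'h \<times> 'h \<times> 'h" by (cases f; cases g) simp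
  have p_bnd: "?p f \<in> ?W" if "f \<in> ?B" for f using tri_bnd_components[OF t(1,1) D D] that by (cases f) auto
  let ?K = "{f \<in> ?Z. ?p f \<in> ?W}" and ?Y = "{y. \<exists>v \<in> ?p ` ?Z. y - v \<in> ?W}"
  have "{g \<in> UNIV. \<exists>f\<in>A. g - \<pi> f \<in> B} = {y. \<exists>v \<in> \<pi> ` A. y - v \<in> B}"
    for A :: "('h \<times> 'h \<times> 'h \<times> 'h \<times> 'h \<times> 'h) set" and B and \<pi> :: "_ \<Rightarrow> 'h \<times> 'h \<times> 'h" by auto
  then have Y: "{g \<in> UNIV. \<exists>f\<in>?Z. g - ?p f \<in> ?W} = ?Y" .
  note count = card_cosets_kernel_image[OF gr(1,2) T.bnd_sub_cyc gr(3) p_diff UNIV_I p_bnd, unfolded Y]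
  have K: "?K \<subseteq> ?B" using E_tri_faithful[OF t] by auto
  have "add_subgroup ?K"
    using gr(1,3) p_diff unfolding add_subgroup_def by (auto simp: zero_prod_def)
  then have K1: "card (cosets ?K ?B) = 1" by (rule card_cosets_eq_1[OF _ gr(2) K])
  have fin: "finite (cosets ?Z ?B)" using T.finite_Ext[OF tO tO] T.Ext_cosets[OF tO tO] by metis
  then have "quot_findim ?s (?p ` ?Z) ?W"
    using count(2) quot_dim_card(1)[OF W.vector_space_axioms sW sV] by blast
  then have "CARD('k) ^ quot_dim ?s (?p ` ?Z) ?W = card (cosets ?Y ?W)"
    using quot_dim_card(2)[OF W.vector_space_axioms sW sV] by simp
  also have "\<dots> = card (cosets ?Z ?B)" using count(1) K1 by simp
  also have "\<dots> = CARD('k) ^ ext_dim (triangles C) 0 t t" using T.card_Ext[OF tO tO] T.Ext_cosets[OF tO tO] by metis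
  finally have "quot_dim ?s (?p ` ?Z) ?W = ext_dim (triangles C) 0 t t" using card_field by simp
  then show ?thesis
    unfolding rho_def T.cocyc_eq[OF tO tO] cobnd_eq[OF X(1,1)] cobnd_eq[OF X(2,2)] cobnd_eq[OF X(3,3)] by simp
qed

lemma E_gamma:
  assumes "calabi_yau C n" "odd n" and t: "exact_triangle C t" "tx t \<in> E" "tz t \<in> E"
  shows "gamma C n t = (if n \<ge> 1 then euler_form C {0..n} (tz t) (tx t) else - euler_form C {n + 1..- 1} (tz t) (tx t))"
proof -
  have "n \<noteq> 0" using assms(2) by auto
  then consider "n \<ge> 1" | "n = - 1" | "n < - 1" by linarith
  then show ?thesis
  proof cases
    case 1 then show ?thesis using E_euler_form[OF assms, of 0 n] by (simp add: gamma_def E_rho[OF t])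
  next
    case 2 then show ?thesis by (simp add: gamma_def E_rho[OF t] euler_form_def)
  next
    case 3 then show ?thesis using E_euler_form[OF assms, of "n + 1" "- 1"] by (simp add: gamma_def E_rho[OF t])
  qed
qed

end
end

section \<open>Extension classes and orbits of triangles\<close>

context finite_dg_triangles
begin

interpretation T: finite_dg_category "triangles C" by (rule finite_dg_category_triangles)

text \<open>The identities of the outer terms are compatible with the connecting morphisms, so they lift
  to a morphism of triangles, which is invertible because its outer components are.\<close>
lemma connecting_iso:
  assumes t: "exact_triangle C t" "exact_triangle C t'" and o: "tx t = tx t'" "tz t = tz t'"
    and d: "connecting C t \<delta>" "connecting C t' \<delta>"
  shows "isomorphic (triangles C) t t'"
proof -
  note X = exact_precomplexD[OF t(1)] exact_precomplexD[OF t(2)]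
  obtain D D' where D: "conn t D" "\<delta> = ecls C 1 (tz t) (tx t) (- D)" "conn t' D'" "\<delta> = ecls C 1 (tz t') (tx t') (- D')"
    using connecting_iff[OF t(1), THEN iffD1, OF d(1)] connecting_iff[OF t(2), THEN iffD1, OF d(2)] by metis
  note c = conn_cyc[OF D(1)] conn_cyc[OF D(3)]
  have "- D - (- D') \<in> bnd (tz t) (tx t) 1"
    using ecls_eq_iff[of "- D" "tz t" "tx t" 1 "- D'"] c D(2,4) o by (simp add: cyc_minus)
  then have "idt C (tx t') \<cdot> D - ksign 0 (D' \<cdot> idt C (tz t')) \<in> bnd (tz t) (tx t') (0 + 1)"
    using idt_left[OF cycD(1)[OF c(1)]] idt_right[OF cycD(1)[OF c(2)]] o bnd_sym[of D' D] by simp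
  moreover have "idt C (tx t') \<in> cyc (tx t) (tx t') 0" "idt C (tz t') \<in> cyc (tz t) (tz t') 0"
    using cyc_idt X o by simp_all
  ultimately obtain b u v w where \<Phi>: "(idt C (tx t'), b, idt C (tz t'), u, v, w) \<in> T.cyc t t' 0"
    using tri_lift[OF t D(1,3)] by blast
  have "inverse_pair C 0 (tx t) (tx t') (idt C (tx t')) (idt C (tx t'))" "inverse_pair C 0 (tz t) (tz t') (idt C (tz t')) (idt C (tz t'))"
    using cyc_idt X o idt_left[OF hom_idt] bnd_zero by (simp_all add: inverse_pair_iff)
  from tri_conservative[OF t \<Phi> this] show ?thesis unfolding isomorphic_def by blast
qed

lemma tri_isomorphic_components:
  assumes "isomorphic (triangles C) t t'" "exact_triangle C t" "exact_triangle C t'"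
  shows "isomorphic C (tx t) (tx t')" "isomorphic C (ty t) (ty t')" "isomorphic C (tz t) (tz t')"
proof -
  obtain \<Phi> \<Psi> where i: "inverse_pair (triangles C) 0 t t' \<Phi> \<Psi>" using assms by (auto simp: isomorphic_def)
  obtain a b k u v w a' b' k' u' v' w' where e: "\<Phi> = (a, b, k, u, v, w)" "\<Psi> = (a', b', k', u', v', w')"
    by (cases \<Phi>; cases \<Psi>) blast
  from tri_inverse_pair_components[OF assms(2,3) i[unfolded e]]
  show "isomorphic C (tx t) (tx t')" "isomorphic C (ty t) (ty t')" "isomorphic C (tz t) (tz t')"
    unfolding isomorphic_def by blast+
qed

lemma card_fibred:
  assumes "finite S" "finite P" "q ` S \<subseteq> P" "\<And>p. p \<in> P \<Longrightarrow> card {s \<in> S. q s = p} = N"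
  shows "card S = card P * N"
proof -
  have "card S = (\<Sum>p\<in>P. \<Sum>s\<in>{s \<in> S. q s = p}. 1)" using sum.group[OF assms(1-3), of "\<lambda>_. 1 :: nat"] by simp
  also have "\<dots> = (\<Sum>p\<in>P. N)" by (rule sum.cong) (use assms(4) in simp_all)
  finally show ?thesis by simp
qed

definition tri_of :: "'o \<Rightarrow> 'o \<Rightarrow> 'h set \<Rightarrow> ('o, 'h) tri" where
  "tri_of z x \<delta> = (SOME t. exact_triangle C t \<and> tx t = x \<and> tz t = z \<and> connecting C t \<delta>)"

lemma tri_of:
  assumes pre: "pretriangulated C" and O: "x \<in> Ob C" "z \<in> Ob C" and \<delta>: "\<delta> \<in> Ext C 1 z x"
  shows "exact_triangle C (tri_of z x \<delta>)" "tx (tri_of z x \<delta>) = x" "tz (tri_of z x \<delta>) = z" "connecting C (tri_of z x \<delta>) \<delta>"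
proof -
  note R = ExtE[OF \<delta> O(2,1)]
  obtain t D where t: "exact_triangle C t" "tx t = x" "tz t = z" "conn t D" "rep \<delta> + D \<in> bnd z x 1"
    using triangle_of_extension[OF pre R(1)] by blast
  have "ecls C 1 z x (rep \<delta>) = ecls C 1 z x (- D)"
    using ecls_eq_iff[OF R(1) cyc_minus[OF conn_cyc[OF t(4), unfolded t(2,3)]]] t(5) by simp
  then have "connecting C t \<delta>" using connecting_iff[OF t(1)] t R(2) by metis
  then have "\<exists>t. exact_triangle C t \<and> tx t = x \<and> tz t = z \<and> connecting C t \<delta>" using t by blast
  from someI_ex[OF this] show "exact_triangle C (tri_of z x \<delta>)" "tx (tri_of z x \<delta>) = x" "tz (tri_of z x \<delta>) = z" "connecting C (tri_of z x \<delta>) \<delta>"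
    unfolding tri_of_def by blast+
qed

context
  fixes E assumes E: "exact_sub E" and pre: "pretriangulated C"
begin

text \<open>The set \<open>I\<close> consists of the isomorphisms from \<open>t0\<close> to the triangles chosen for the extension
  classes, and \<open>q\<close> takes their outer components. Compatibility with connecting morphisms forces
  the class of the target to be that of \<open>- A D0 K\<^sup>-\<^sup>1\<close>, and for this class \<open>(A, K)\<close> lifts. Any two
  lifts differ by \<open>iota \<chi>\<close> for some \<open>\<chi> \<in> Hom(z,x)\<close>. Distinct classes of \<open>\<chi>\<close> give distinct lifts:
  the kernel of \<open>iota\<close> is the image of the connecting map in degree -1, which vanishes in \<open>E\<close>.\<close>
lemma isos_over_outer:
  assumes xz: "x \<in> E" "z \<in> E" and t0: "exact_triangle C t0" "tx t0 = x" "tz t0 = z"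
    and A: "A \<in> Aut C x" and K: "K \<in> Aut C z"
  defines "I \<equiv> Sigma {\<delta> \<in> Ext C 1 z x. isomorphic (triangles C) t0 (tri_of z x \<delta>)} (\<lambda>\<delta>. T.Isos t0 (tri_of z x \<delta>))"
    and "q \<equiv> (\<lambda>(\<delta>, \<alpha>). (ecls C 0 x x (fst (T.rep \<alpha>)), ecls C 0 z z (fst (snd (snd (T.rep \<alpha>))))))"
  shows "card {s \<in> I. q s = (A, K)} = card (Ext C 0 z x)"
proof -
  have O: "x \<in> Ob C" "z \<in> Ob C" using xz E_ob[OF E] by auto
  have t0O: "t0 \<in> Ob (triangles C)" using t0 by (simp add: Ob_triangles)
  define a k where "a = rep A" and "k = rep K"
  have AE: "A \<in> Ext C 0 x x" "K \<in> Ext C 0 z z" using A K Isos_Ext O by (auto simp: Aut_Isos)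
  note ra = ExtE[OF AE(1) O(1,1), folded a_def] and rk = ExtE[OF AE(2) O(2,2), folded k_def]
  obtain a' where ia: "inverse_pair C 0 x x a a'" using IsosE[OF A[unfolded Aut_Isos] O(1,1)] by (auto simp: a_def)
  obtain k' where ik: "inverse_pair C 0 z z k k'" using IsosE[OF K[unfolded Aut_Isos] O(2,2)] by (auto simp: k_def)
  have k': "k' \<in> cyc z z 0" "k' \<cdot> k - idt C z \<in> bnd z z 0" "k \<cdot> k' - idt C z \<in> bnd z z 0"
    using ik O by (simp_all add: inverse_pair_iff)
  obtain D0 where D0: "conn t0 D0" using conn_exists[OF t0(1)] ..
  note c0 = conn_cyc[OF D0, unfolded t0]
  define D where "D = a \<cdot> D0 \<cdot> k'"
  have aD: "a \<cdot> D0 \<in> cyc z x 1" using cyc_cmp[OF c0 ra(1)] by simp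
  have D: "D \<in> cyc z x 1" unfolding D_def using cyc_cmp[OF k'(1) aD] by simp
  define \<delta>s where "\<delta>s = ecls C 1 z x (- D)"
  have \<delta>s: "\<delta>s \<in> Ext C 1 z x" unfolding \<delta>s_def by (rule ecls_Ext[OF cyc_minus[OF D]])
  define t1 where "t1 = tri_of z x \<delta>s"
  note t1 = tri_of[OF pre O \<delta>s, folded t1_def]
  have t1O: "t1 \<in> Ob (triangles C)" using t1 by (simp add: Ob_triangles)
  obtain D1 where D1: "conn t1 D1" "\<delta>s = ecls C 1 z x (- D1)" using t1 connecting_iff[OF t1(1)] by auto
  note c1 = conn_cyc[OF D1(1), unfolded t1]
  have "- D1 - (- D) \<in> bnd z x 1" using ecls_eq_iff[OF cyc_minus[OF c1] cyc_minus[OF D]] D1(2) \<delta>s_def by simp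
  then have DD: "D - D1 \<in> bnd z x 1" by simp
  have uniq: "Dd - D \<in> bnd z x 1" if Dd: "Dd \<in> cyc z x 1" and "a \<cdot> D0 - Dd \<cdot> k \<in> bnd z x 1" for Dd
  proof -
    have "(a \<cdot> D0 - Dd \<cdot> k) \<cdot> k' \<in> bnd z x 1" by (rule bnd_cmp_left[OF k'(1) that(2)]) simp
    moreover have "Dd \<cdot> (k \<cdot> k' - idt C z) \<in> bnd z x 1" by (rule bnd_cmp_right[OF k'(3) Dd]) simp
    moreover have "Dd \<cdot> k \<in> hom z x 1" "k \<cdot> k' \<in> hom z z 0"
      by (rule cycD(1)[OF Dd] cycD(1)[OF rk(1)] cycD(1)[OF k'(1)] homI | simp)+
    then have "(a \<cdot> D0 - Dd \<cdot> k) \<cdot> k' + Dd \<cdot> (k \<cdot> k' - idt C z) = D - Dd"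
      using cycD(1)[OF Dd] cycD(1)[OF rk(1)] cycD(1)[OF k'(1)] cycD(1)[OF aD] hom_idt[OF O(2)]
        assoc[OF cycD(1)[OF k'(1)] cycD(1)[OF rk(1)] cycD(1)[OF Dd]] idt_right[OF cycD(1)[OF Dd]]
      by (simp add: diff_left diff_right D_def)
    ultimately have "D - Dd \<in> bnd z x 1" using bnd_add by metis
    then show ?thesis by (simp add: bnd_sym)
  qed
  have "a \<cdot> D0 - D1 \<cdot> k \<in> bnd z x 1"
  proof -
    have "(D - D1) \<cdot> k \<in> bnd z x 1" by (rule bnd_cmp_left[OF rk(1) DD]) simp
    moreover have "(a \<cdot> D0) \<cdot> (k' \<cdot> k - idt C z) \<in> bnd z x 1" by (rule bnd_cmp_right[OF k'(2) aD]) simp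
    moreover have "k' \<cdot> k \<in> hom z z 0" by (rule cycD(1)[OF rk(1)] cycD(1)[OF k'(1)] homI | simp)+
    then have "(D - D1) \<cdot> k - (a \<cdot> D0) \<cdot> (k' \<cdot> k - idt C z) = a \<cdot> D0 - D1 \<cdot> k"
      using cycD(1)[OF D] cycD(1)[OF c1] cycD(1)[OF rk(1)] cycD(1)[OF k'(1)] cycD(1)[OF aD] hom_idt[OF O(2)]
        assoc[OF cycD(1)[OF rk(1)] cycD(1)[OF k'(1)] cycD(1)[OF aD]] idt_right[OF cycD(1)[OF aD]]
      by (simp add: diff_left diff_right D_def)
    ultimately show ?thesis using bnd_diff by metis
  qed
  then obtain b u v w where "(a, b, k, u, v, w) \<in> T.cyc t0 t1 0"
    using tri_lift[OF t0(1) t1(1) D0 D1(1), of a 0 k] ra(1) rk(1) t0 t1 by auto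
  then obtain \<Phi>0 where \<Phi>0: "\<Phi>0 \<in> T.cyc t0 t1 0" "\<Phi>0 = (a, b, k, u, v, w)" by blast
  \<comment> \<open>Up to homotopy, these are all lifts of \<open>(a, k)\<close>, parametrized by \<open>\<chi>\<close>.\<close>
  define F where "F \<chi> = \<Phi>0 + iota t0 t1 \<chi>" for \<chi>
  have io: "iota t0 t1 \<chi> \<in> T.cyc t0 t1 0" if "\<chi> \<in> cyc z x 0" for \<chi>
    using iota_cyc[OF t0(1) t1(1) D0 D1(1), of \<chi> 0] that t0 t1 by simp
  have F: "F \<chi> \<in> T.cyc t0 t1 0" if "\<chi> \<in> cyc z x 0" for \<chi> unfolding F_def by (intro T.cyc_add \<Phi>0 io that)
  have Fc: "fst (F \<chi>) = a" "fst (snd (snd (F \<chi>))) = k" for \<chi> by (simp_all add: F_def \<Phi>0(2) iota_def)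
  have Finv: "\<exists>\<Psi>. inverse_pair (triangles C) 0 t0 t1 (F \<chi>) \<Psi>" if "\<chi> \<in> cyc z x 0" for \<chi>
  proof -
    obtain b' u' v' w' where e: "F \<chi> = (a, b', k, u', v', w')" using Fc[of \<chi>] by (cases "F \<chi>") auto
    show ?thesis unfolding e
      by (rule tri_conservative[OF t0(1) t1(1), where a' = a' and k' = k']) (use F[OF that] ia ik t0 t1 e in auto)
  qed
  have outer: "fst \<Psi> - fst \<Phi> \<in> bnd x x 0" "fst (snd (snd \<Psi>)) - fst (snd (snd \<Phi>)) \<in> bnd z z 0"
    if h: "\<Psi> - \<Phi> \<in> T.bnd t0 t' 0" "exact_triangle C t'" "tx t' = x" "tz t' = z" for \<Phi> \<Psi> t'
  proof -
    obtain D' where D': "conn t' D'" using conn_exists[OF h(2)] ..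
    obtain p1 p2 p3 p4 p5 p6 where e: "\<Psi> - \<Phi> = (p1, p2, p3, p4, p5, p6)" by (cases "\<Psi> - \<Phi>")
    from arg_cong[OF e, of fst] arg_cong[OF e, of "\<lambda>x. fst (snd (snd x))"]
    have "fst \<Psi> - fst \<Phi> = p1" "fst (snd (snd \<Psi>)) - fst (snd (snd \<Phi>)) = p3" by simp_all
    then show "fst \<Psi> - fst \<Phi> \<in> bnd x x 0" "fst (snd (snd \<Psi>)) - fst (snd (snd \<Phi>)) \<in> bnd z z 0"
      using tri_bnd_components(1,3)[OF t0(1) h(2) D0 D' h(1)[unfolded e]] t0 h by simp_all
  qed
  have ocyc: "fst \<Phi> \<in> cyc x x 0" "fst (snd (snd \<Phi>)) \<in> cyc z z 0"
    if h: "\<Phi> \<in> T.cyc t0 t' 0" "exact_triangle C t'" "tx t' = x" "tz t' = z" for \<Phi> t'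
  proof -
    obtain D' where D': "conn t' D'" using conn_exists[OF h(2)] ..
    show "fst \<Phi> \<in> cyc x x 0" "fst (snd (snd \<Phi>)) \<in> cyc z z 0"
      using tri_cyc_components(1,3)[OF t0(1) h(2) D0 D'] h t0 by (cases \<Phi>; auto)+
  qed
  define G where "G \<alpha> = (\<delta>s, ecls (triangles C) 0 t0 t1 (F (rep \<alpha>)))" for \<alpha>
  have iso01: "isomorphic (triangles C) t0 t1"
    using Finv[OF cyc_zero[OF O(2,1)]] unfolding isomorphic_def by blast
  have "bij_betw G (Ext C 0 z x) {s \<in> I. q s = (A, K)}"
  proof (rule bij_betw_imageI)
    show "inj_on G (Ext C 0 z x)"
    proof (rule inj_onI)
      fix \<alpha> \<beta> assume a: "\<alpha> \<in> Ext C 0 z x" "\<beta> \<in> Ext C 0 z x" and eq: "G \<alpha> = G \<beta>"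
      note ra = ExtE[OF a(1) O(2,1)] and rb = ExtE[OF a(2) O(2,1)]
      have "F (rep \<alpha>) - F (rep \<beta>) \<in> T.bnd t0 t1 0"
        using eq T.ecls_eq_iff[OF F[OF ra(1)] F[OF rb(1)]] by (simp add: G_def)
      then have "iota t0 t1 (rep \<alpha> - rep \<beta>) \<in> T.bnd t0 t1 (- 1 + 1)"
        using iota_add[OF t0(1) t1(1), of "rep \<alpha>" 0 "- rep \<beta>"] iota_minus[OF t0(1) t1(1), of "rep \<beta>" 0]
          cycD(1)[OF ra(1)] cycD(1)[OF rb(1)] t0 t1 by (simp add: F_def hom_minus)
      then obtain e g where eg: "e \<in> cyc x x (- 1)" "g \<in> cyc z z (- 1)"
        "(rep \<alpha> - rep \<beta>) - (e \<cdot> D0 - ksign (- 1) (D1 \<cdot> g)) \<in> bnd z x 0"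
        using iota_bnd_iff[OF t0(1) t1(1) D0 D1(1), of "rep \<alpha> - rep \<beta>" "- 1"] cyc_diff[OF ra(1) rb(1)] t0 t1 by auto
      have "e \<cdot> D0 \<in> bnd z x 0" using conn_left_null[OF E t0(1) _ _ D0, of x e] eg xz t0 by simp
      moreover have "D1 \<cdot> g \<in> bnd z x 0" using conn_right_null[OF E t1(1) _ _ D1(1), of z g] eg xz t1 by simp
      ultimately have "e \<cdot> D0 - ksign (- 1) (D1 \<cdot> g) \<in> bnd z x 0" by (intro bnd_diff bnd_ksign)
      from bnd_add[OF eg(3) this] have "rep \<alpha> - rep \<beta> \<in> bnd z x 0" by simp
      then show "\<alpha> = \<beta>" using ecls_eq_iff[OF ra(1) rb(1)] ra(2) rb(2) by simp
    qed
    show "G ` Ext C 0 z x = {s \<in> I. q s = (A, K)}"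
    proof (intro equalityI subsetI)
      fix s assume "s \<in> G ` Ext C 0 z x"
      then obtain \<alpha> where \<alpha>: "\<alpha> \<in> Ext C 0 z x" "s = G \<alpha>" by blast
      note r = ExtE[OF \<alpha>(1) O(2,1)]
      let ?\<beta> = "ecls (triangles C) 0 t0 t1 (F (rep \<alpha>))"
      have \<beta>: "?\<beta> \<in> T.Isos t0 t1" using Finv[OF r(1)] unfolding T.Isos_def by blast
      then have sI: "s \<in> I" using \<delta>s iso01 by (simp add: I_def \<alpha>(2) G_def t1_def[symmetric])
      have "?\<beta> \<in> Ext (triangles C) 0 t0 t1" by (rule T.ecls_Ext[OF F[OF r(1)]])
      note rb = T.ExtE[OF this t0O t1O]
      have "T.rep ?\<beta> - F (rep \<alpha>) \<in> T.bnd t0 t1 0" using rb T.ecls_eq_iff[OF rb(1) F[OF r(1)]] by simp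
      from outer[OF this t1(1-3)] have "fst (T.rep ?\<beta>) - a \<in> bnd x x 0" "fst (snd (snd (T.rep ?\<beta>))) - k \<in> bnd z z 0"
        by (simp_all add: Fc)
      then have "q s = (A, K)"
        using ecls_eq_iff[OF ocyc(1)[OF rb(1) t1(1-3)] ra(1)] ecls_eq_iff[OF ocyc(2)[OF rb(1) t1(1-3)] rk(1)] ra(2) rk(2)
        by (simp add: q_def \<alpha>(2) G_def)
      then show "s \<in> {s \<in> I. q s = (A, K)}" using sI by simp
    next
      fix s assume s: "s \<in> {s \<in> I. q s = (A, K)}"
      obtain \<delta> \<alpha> where s_eq: "s = (\<delta>, \<alpha>)" by (cases s)
      have \<delta>: "\<delta> \<in> Ext C 1 z x" and \<alpha>: "\<alpha> \<in> T.Isos t0 (tri_of z x \<delta>)"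
        and qs: "ecls C 0 x x (fst (T.rep \<alpha>)) = A" "ecls C 0 z z (fst (snd (snd (T.rep \<alpha>)))) = K"
        using s by (auto simp: s_eq I_def q_def)
      note td = tri_of[OF pre O \<delta>]
      have tdO: "tri_of z x \<delta> \<in> Ob (triangles C)" using td by (simp add: Ob_triangles)
      obtain Dd where Dd: "conn (tri_of z x \<delta>) Dd" "\<delta> = ecls C 1 z x (- Dd)" using td connecting_iff[OF td(1)] by auto
      note cd = conn_cyc[OF Dd(1), unfolded td(2,3)]
      have "\<alpha> \<in> Ext (triangles C) 0 t0 (tri_of z x \<delta>)" using \<alpha> T.Isos_Ext[OF t0O tdO] by blast
      note r = T.ExtE[OF this t0O tdO]
      obtain a1 b1 k1 u1 v1 w1 where e1: "T.rep \<alpha> = (a1, b1, k1, u1, v1, w1)" by (cases "T.rep \<alpha>")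
      have a1: "a1 \<in> cyc x x 0" "k1 \<in> cyc z z 0" using ocyc[OF r(1) td(1-3)] by (simp_all add: e1)
      have a1a: "a1 - a \<in> bnd x x 0" "k1 - k \<in> bnd z z 0"
        using qs ecls_eq_iff[OF a1(1) ra(1)] ecls_eq_iff[OF a1(2) rk(1)] ra(2) rk(2) by (simp_all add: e1)
      have "a1 \<cdot> D0 - Dd \<cdot> k1 \<in> bnd z x 1"
        using tri_cyc_compat[OF t0(1) td(1) D0 Dd(1) r(1)[unfolded e1]] t0 td by simp
      moreover have "(a1 - a) \<cdot> D0 \<in> bnd z x 1" by (rule bnd_cmp_left[OF c0 a1a(1)]) simp
      moreover have "Dd \<cdot> (k1 - k) \<in> bnd z x 1" by (rule bnd_cmp_right[OF a1a(2) cd]) simp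
      ultimately have "(a1 \<cdot> D0 - Dd \<cdot> k1) - (a1 - a) \<cdot> D0 + Dd \<cdot> (k1 - k) \<in> bnd z x 1"
        by (rule bnd_add[OF bnd_diff])
      then have "a \<cdot> D0 - Dd \<cdot> k \<in> bnd z x 1"
        using diff_left[OF cycD(1)[OF c0] cycD(1)[OF a1(1)] cycD(1)[OF ra(1)]]
          diff_right[OF cycD(1)[OF cd] cycD(1)[OF a1(2)] cycD(1)[OF rk(1)]] by simp
      from uniq[OF cd this] have "- Dd - (- D) \<in> bnd z x 1" using bnd_sym[of D Dd] by simp
      then have "\<delta> = \<delta>s" using ecls_eq_iff[OF cyc_minus[OF cd] cyc_minus[OF D]] by (simp add: Dd(2) \<delta>s_def)
      then have tt: "tri_of z x \<delta> = t1" by (simp add: t1_def)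
      note r = r[unfolded tt]
      have dif: "T.rep \<alpha> - \<Phi>0 = (a1 - a, b1 - b, k1 - k, u1 - u, v1 - v, w1 - w)" by (simp add: e1 \<Phi>0(2))
      have "T.rep \<alpha> - \<Phi>0 \<in> T.cyc t0 t1 0" by (rule T.cyc_diff[OF r(1) \<Phi>0(1)])
      then obtain \<chi> where \<chi>: "\<chi> \<in> cyc z x 0" "T.rep \<alpha> - \<Phi>0 - iota t0 t1 \<chi> \<in> T.bnd t0 t1 0"
        using tri_cyc_iota[OF t0(1) t1(1) D0 D1(1), of "a1 - a" "b1 - b" "k1 - k" "u1 - u" "v1 - v" "w1 - w" 0] a1a t0 t1
        unfolding dif by auto
      define \<gamma> where "\<gamma> = ecls C 0 z x \<chi>"
      have \<gamma>: "\<gamma> \<in> Ext C 0 z x" unfolding \<gamma>_def by (rule ecls_Ext[OF \<chi>(1)])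
      note rg = ExtE[OF \<gamma> O(2,1)]
      have "\<chi> - rep \<gamma> \<in> bnd z x 0" using ecls_eq_iff[OF \<chi>(1) rg(1)] rg(2) by (simp add: \<gamma>_def)
      then have "iota t0 t1 (\<chi> - rep \<gamma>) \<in> T.bnd t0 t1 0" using iota_bnd[OF t0(1) t1(1) D0 D1(1), of "\<chi> - rep \<gamma>" 0] t0 t1 by simp
      then have "T.rep \<alpha> - \<Phi>0 - iota t0 t1 \<chi> + iota t0 t1 (\<chi> - rep \<gamma>) \<in> T.bnd t0 t1 0" using \<chi>(2) T.bnd_add by blast
      moreover have "iota t0 t1 (\<chi> - rep \<gamma>) = iota t0 t1 \<chi> - iota t0 t1 (rep \<gamma>)"
        using iota_add[OF t0(1) t1(1), of \<chi> 0 "- rep \<gamma>"] iota_minus[OF t0(1) t1(1), of "rep \<gamma>" 0]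
          cycD(1)[OF \<chi>(1)] cycD(1)[OF rg(1)] t0 t1 by (simp add: hom_minus)
      moreover have "T.rep \<alpha> - \<Phi>0 - iota t0 t1 \<chi> + (iota t0 t1 \<chi> - iota t0 t1 (rep \<gamma>)) = T.rep \<alpha> - F (rep \<gamma>)"
        unfolding F_def by (simp only: algebra_simps)
      ultimately have "T.rep \<alpha> - F (rep \<gamma>) \<in> T.bnd t0 t1 0" by metis
      then have "\<alpha> = ecls (triangles C) 0 t0 t1 (F (rep \<gamma>))" using T.ecls_eq_iff[OF r(1) F[OF rg(1)]] r(2) by simp
      then have "s = G \<gamma>" by (simp add: s_eq G_def \<open>\<delta> = \<delta>s\<close>)
      then show "s \<in> G ` Ext C 0 z x" using \<gamma> by blast
    qed
  qed
  from bij_betw_same_card[OF this] show ?thesis by (rule sym)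
qed

text \<open>Both sides count isomorphisms from \<open>t0\<close> to the triangles chosen for the extension classes:
  the left-hand side groups them by the target, the right-hand side by the outer components.\<close>
theorem orbit_count:
  assumes xz: "x \<in> E" "z \<in> E" and t0: "exact_triangle C t0" "tx t0 = x" "tz t0 = z"
  shows "card {\<delta> \<in> Ext C 1 z x. isomorphic (triangles C) t0 (tri_of z x \<delta>)} * card (Aut (triangles C) t0) =
    card (Aut C x) * card (Aut C z) * card (Ext C 0 z x)"
proof -
  let ?O = "{\<delta> \<in> Ext C 1 z x. isomorphic (triangles C) t0 (tri_of z x \<delta>)}"
  let ?I = "Sigma ?O (\<lambda>\<delta>. T.Isos t0 (tri_of z x \<delta>))"
  let ?q = "\<lambda>(\<delta> :: 'h set, \<alpha>). (ecls C 0 x x (fst (T.rep \<alpha>)), ecls C 0 z z (fst (snd (snd (T.rep \<alpha>)))))"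
  have O: "x \<in> Ob C" "z \<in> Ob C" using xz E_ob[OF E] by auto
  have t0O: "t0 \<in> Ob (triangles C)" using t0 by (simp add: Ob_triangles)
  have finO: "finite ?O" using finite_Ext[OF O(2,1)] by simp
  have tO: "tri_of z x \<delta> \<in> Ob (triangles C)" if "\<delta> \<in> Ext C 1 z x" for \<delta>
    using tri_of(1)[OF pre O that] by (simp add: Ob_triangles)
  have "card ?I = (\<Sum>\<delta>\<in>?O. card (T.Isos t0 (tri_of z x \<delta>)))"
    by (rule card_SigmaI[OF finO]) (use T.finite_Isos[OF t0O tO] in blast)
  also have "\<dots> = (\<Sum>\<delta>\<in>?O. card (Aut (triangles C) t0))"
    by (rule sum.cong[OF refl]) (use T.card_Aut_iso(2)[OF _ t0O tO] in blast)
  finally have 1: "card ?I = card ?O * card (Aut (triangles C) t0)" by simp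
  have "card ?I = card (Aut C x \<times> Aut C z) * card (Ext C 0 z x)"
  proof (rule card_fibred)
    show "finite ?I" using finO T.finite_Isos[OF t0O tO] by (intro finite_SigmaI) blast+
    show "finite (Aut C x \<times> Aut C z)" using finite_Isos O by (simp add: Aut_Isos)
    show "?q ` ?I \<subseteq> Aut C x \<times> Aut C z"
    proof (rule image_subsetI)
      fix s assume "s \<in> ?I"
      then obtain \<delta> \<alpha> where s: "s = (\<delta>, \<alpha>)" "\<delta> \<in> Ext C 1 z x" "\<alpha> \<in> T.Isos t0 (tri_of z x \<delta>)" by blast
      note td = tri_of[OF pre O s(2)]
      obtain \<Psi> where i: "inverse_pair (triangles C) 0 t0 (tri_of z x \<delta>) (T.rep \<alpha>) \<Psi>"
        using T.IsosE[OF s(3) t0O tO[OF s(2)]] by blast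
      obtain a b k u v w a' b' k' u' v' w' where e: "T.rep \<alpha> = (a, b, k, u, v, w)" "\<Psi> = (a', b', k', u', v', w')"
        by (cases "T.rep \<alpha>"; cases \<Psi>) blast
      from tri_inverse_pair_components(1,3)[OF t0(1) td(1) i[unfolded e]]
      show "?q s \<in> Aut C x \<times> Aut C z" using t0 td by (auto simp: s e Aut_def)
    qed
    show "card {s \<in> ?I. ?q s = p} = card (Ext C 0 z x)" if "p \<in> Aut C x \<times> Aut C z" for p
      using isos_over_outer[OF xz t0, of "fst p" "snd p"] that by (cases p) auto
  qed
  then show ?thesis using 1 by (simp add: card_cartesian_product)
qed

end
end

section \<open>Rescaling the basis of an algebra\<close>

lemma lookup_map: "f 0 = 0 \<Longrightarrow> Poly_Mapping.lookup (Poly_Mapping.map f p) k = f (Poly_Mapping.lookup p k)"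
  by (simp add: Poly_Mapping.map.rep_eq when_def)

lemma lookup_map_times: "Poly_Mapping.lookup (Poly_Mapping.map ((*) (c :: 'a :: mult_zero)) p) k = c * Poly_Mapping.lookup p k"
  by (rule lookup_map) simp

definition rescale :: "('b \<Rightarrow> complex) \<Rightarrow> ('b \<Rightarrow>\<^sub>0 complex) \<Rightarrow> 'b \<Rightarrow>\<^sub>0 complex" where
  "rescale w u = (\<Sum>Z\<in>Poly_Mapping.keys u. Poly_Mapping.single Z (w Z * Poly_Mapping.lookup u Z))"

lemma lookup_rescale: "Poly_Mapping.lookup (rescale w u) Z = w Z * Poly_Mapping.lookup u Z"
proof -
  have "Poly_Mapping.lookup (rescale w u) Z = (\<Sum>Y\<in>Poly_Mapping.keys u. if Y = Z then w Z * Poly_Mapping.lookup u Z else 0)"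
    unfolding rescale_def lookup_sum by (rule sum.cong) (auto simp: lookup_single when_def)
  then show ?thesis by (simp add: in_keys_iff)
qed

lemma based_algebra_rescale:
  assumes w: "\<And>Z. Z \<in> B \<Longrightarrow> w Z \<noteq> 0" and BB: "B \<subseteq> B'"
    and prod: "\<And>Z X Y. Z \<in> B \<Longrightarrow> X \<in> B \<Longrightarrow>
      w Y * Poly_Mapping.lookup (p Z X) Y = w Z * w X * Poly_Mapping.lookup (p' Z X) Y"
    and one: "w e = 1"
  shows "algebra_embedding (based_algebra B p e) (based_algebra B' p' e) (rescale w)"
proof -
  have keys: "Poly_Mapping.keys (rescale w u) = Poly_Mapping.keys u" if "Poly_Mapping.keys u \<subseteq> B" for u
    using w that by (auto simp: in_keys_iff lookup_rescale)
  have car: "carrier (based_algebra B p e) = {u. Poly_Mapping.keys u \<subseteq> B}" "carrier (based_algebra B' p' e) = {u. Poly_Mapping.keys u \<subseteq> B'}"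
    by (simp_all add: based_algebra_def)
  show ?thesis unfolding algebra_embedding_def
  proof (intro conjI allI ballI)
    show "rescale w \<in> ring_hom (based_algebra B p e) (based_algebra B' p' e)"
    proof (rule ring_hom_memI)
      fix u assume u: "u \<in> carrier (based_algebra B p e)"
      then show "rescale w u \<in> carrier (based_algebra B' p' e)" using keys BB by (auto simp: car)
      fix v assume v: "v \<in> carrier (based_algebra B p e)"
      have uB: "Poly_Mapping.keys u \<subseteq> B" "Poly_Mapping.keys v \<subseteq> B" using u v by (simp_all add: car)
      show "rescale w (u \<oplus>\<^bsub>based_algebra B p e\<^esub> v) = rescale w u \<oplus>\<^bsub>based_algebra B' p' e\<^esub> rescale w v"
        by (rule poly_mapping_eqI) (simp add: based_algebra_def lookup_rescale lookup_add algebra_simps)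
      show "rescale w (u \<otimes>\<^bsub>based_algebra B p e\<^esub> v) = rescale w u \<otimes>\<^bsub>based_algebra B' p' e\<^esub> rescale w v"
      proof (rule poly_mapping_eqI)
        fix Y
        have "Poly_Mapping.lookup (rescale w (u \<otimes>\<^bsub>based_algebra B p e\<^esub> v)) Y =
            (\<Sum>Z\<in>Poly_Mapping.keys u. \<Sum>X\<in>Poly_Mapping.keys v.
              Poly_Mapping.lookup u Z * Poly_Mapping.lookup v X * (w Y * Poly_Mapping.lookup (p Z X) Y))"
          by (simp add: based_algebra_def lookup_rescale lookup_sum lookup_map_times sum_distrib_left mult_ac)
        also have "\<dots> = (\<Sum>Z\<in>Poly_Mapping.keys u. \<Sum>X\<in>Poly_Mapping.keys v.
              Poly_Mapping.lookup u Z * Poly_Mapping.lookup v X * (w Z * w X * Poly_Mapping.lookup (p' Z X) Y))"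
          by (intro sum.cong refl arg_cong[of _ _ "(*) _"] prod) (use uB in blast)+
        also have "\<dots> = Poly_Mapping.lookup (rescale w u \<otimes>\<^bsub>based_algebra B' p' e\<^esub> rescale w v) Y"
          by (simp add: based_algebra_def lookup_rescale lookup_sum lookup_map_times keys uB mult_ac)
        finally show "Poly_Mapping.lookup (rescale w (u \<otimes>\<^bsub>based_algebra B p e\<^esub> v)) Y =
          Poly_Mapping.lookup (rescale w u \<otimes>\<^bsub>based_algebra B' p' e\<^esub> rescale w v) Y" .
      qed
    next
      show "rescale w \<one>\<^bsub>based_algebra B p e\<^esub> = \<one>\<^bsub>based_algebra B' p' e\<^esub>"
        by (rule poly_mapping_eqI) (auto simp: based_algebra_def lookup_rescale lookup_single one when_def)
    qed
  next
    fix c u assume "u \<in> carrier (based_algebra B p e)"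
    show "rescale w (c \<odot>\<^bsub>based_algebra B p e\<^esub> u) = c \<odot>\<^bsub>based_algebra B' p' e\<^esub> rescale w u"
      by (rule poly_mapping_eqI) (simp add: based_algebra_def lookup_rescale lookup_map_times)
  next
    show "inj_on (rescale w) (carrier (based_algebra B p e))"
    proof (rule inj_onI)
      fix u v assume uv: "u \<in> carrier (based_algebra B p e)" "v \<in> carrier (based_algebra B p e)" "rescale w u = rescale w v"
      show "u = v"
      proof (rule poly_mapping_eqI)
        fix Z
        have "w Z * Poly_Mapping.lookup u Z = w Z * Poly_Mapping.lookup v Z"
          using uv(3) lookup_rescale by metis
        then show "Poly_Mapping.lookup u Z = Poly_Mapping.lookup v Z"
          using uv(1,2) w[of Z] by (cases "Z \<in> B") (simp, metis car(1) in_keys_iff mem_Collect_eq subsetD)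
      qed
    qed
  qed
qed

section \<open>Structure constants and the embedding\<close>

context finite_dg_triangles
begin

interpretation T: finite_dg_category "triangles C" by (rule finite_dg_category_triangles)

context
  fixes E n
  assumes E: "exact_sub E" and add: "full_additive_subcategory C E" and pre: "pretriangulated C"
    and odd: "odd n" and cy: "calabi_yau C n"
begin

lemma E_iso_closed: "x \<in> E \<Longrightarrow> isomorphic C x y \<Longrightarrow> y \<in> Ob C \<Longrightarrow> y \<in> E"
proof -
  assume a: "x \<in> E" "isomorphic C x y" "y \<in> Ob C"
  obtain f g where i: "inverse_pair C 0 x y f g" using a by (auto simp: isomorphic_def)
  obtain o' where o': "o' \<in> E" "zero_object C o'" using add unfolding full_additive_subcategory_def by blast
  from E_middle[OF E iso_triangle_exact[OF i E_ob[OF E a(1)] a(3) o'(2)]] show "y \<in> E" using a o' by simp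
qed

lemma iso_class_E: "x \<in> E \<Longrightarrow> iso_class C E x = iso_class C (Ob C) x"
  using E_iso_closed E_ob[OF E] by (auto simp: iso_class_def)

lemma Iso_E: "Z \<in> Iso C E \<Longrightarrow> (SOME z. z \<in> Z) \<in> E \<and> (SOME z. z \<in> Z) \<in> Z \<and> Z = iso_class C E (SOME z. z \<in> Z)"
proof -
  assume "Z \<in> Iso C E"
  then obtain z where z: "z \<in> E" "Z = iso_class C E z" by (auto simp: Iso_def)
  have "z \<in> Z" using z isomorphic_refl[OF E_ob[OF E z(1)]] by (simp add: iso_class_def)
  then have s: "(SOME z. z \<in> Z) \<in> Z" by (rule someI)
  then have "(SOME z. z \<in> Z) \<in> E" "isomorphic C z (SOME z. z \<in> Z)" using z by (auto simp: iso_class_def)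
  then show ?thesis
    using s z iso_class_eq[of z "SOME z. z \<in> Z" E] E_ob[OF E] by blast
qed

text \<open>The scalar relating \<open>a\<^sub>z\<close> and \<open>h\<^sub>z\<close>, as a function of the isomorphism class.\<close>
definition wt :: "'o set \<Rightarrow> real" where
  "wt Z = sqrt (real (card (Aut C (SOME z. z \<in> Z))))"

lemma wt_iso_class:
  assumes "x \<in> Ob C" shows "wt (iso_class C (Ob C) x) = sqrt (real (card (Aut C x)))"
proof -
  have "x \<in> iso_class C (Ob C) x" using assms isomorphic_refl by (simp add: iso_class_def)
  then have "(SOME z. z \<in> iso_class C (Ob C) x) \<in> iso_class C (Ob C) x" by (rule someI)
  then have "isomorphic C x (SOME z. z \<in> iso_class C (Ob C) x)" "(SOME z. z \<in> iso_class C (Ob C) x) \<in> Ob C"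
    by (auto simp: iso_class_def)
  then show ?thesis using card_Aut_iso(1) assms by (simp add: wt_def)
qed

text \<open>The middle term is defined by choosing an object, and \<open>tri_of\<close> by choosing a triangle; the
  choices agree up to isomorphism, since triangles with equal connecting morphisms are isomorphic.\<close>
lemma middle_term_tri_of:
  assumes xz: "x \<in> E" "z \<in> E" and \<delta>: "\<delta> \<in> Ext C 1 z x"
  shows "middle_term C E z x \<delta> = iso_class C (Ob C) (ty (tri_of z x \<delta>))"
proof -
  note t = tri_of[OF pre E_ob[OF E xz(1)] E_ob[OF E xz(2)] \<delta>]
  define y where "y = (SOME y. \<exists>t. exact_triangle C t \<and> tx t = x \<and> ty t = y \<and> tz t = z \<and> connecting C t \<delta>)"
  have "\<exists>y t. exact_triangle C t \<and> tx t = x \<and> ty t = y \<and> tz t = z \<and> connecting C t \<delta>" using t by blast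
  then have "\<exists>t. exact_triangle C t \<and> tx t = x \<and> ty t = y \<and> tz t = z \<and> connecting C t \<delta>"
    unfolding y_def by (rule someI_ex)
  then obtain t' where t': "exact_triangle C t'" "tx t' = x" "ty t' = y" "tz t' = z" "connecting C t' \<delta>" by blast
  have "isomorphic (triangles C) t' (tri_of z x \<delta>)"
    by (rule connecting_iso[OF t'(1) t(1) _ _ t'(5) t(4)]) (simp_all add: t t')
  then have iso: "isomorphic C y (ty (tri_of z x \<delta>))" using tri_isomorphic_components(2)[OF _ t'(1) t(1)] t'(3) by simp
  have yE: "y \<in> E" using E_middle[OF E t'(1)] t' xz by simp
  have "middle_term C E z x \<delta> = iso_class C E y" by (simp add: middle_term_def y_def)
  also have "\<dots> = iso_class C (Ob C) y" by (rule iso_class_E[OF yE])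
  also have "\<dots> = iso_class C (Ob C) (ty (tri_of z x \<delta>))"
    by (rule iso_class_eq[OF iso E_ob[OF E yE] exact_precomplexD(2)[OF t(1)] subset_refl])
  finally show ?thesis .
qed

text \<open>Both structure constants are sums over \<open>Ext\<^sup>1(z,x)\<close>, once the sum over classes \<open>U\<close> of
  triangles is replaced by the sum over the extension classes \<open>\<delta>\<close> with triangle in \<open>U\<close>. The weight
  of each \<open>U\<close> matches by \<open>orbit_count\<close>, which turns \<open>|Aut x| |Aut z| / |Aut t|\<close> into \<open>|{\<delta>}| /
  |Hom(z,x)|\<close>, and by \<open>E_gamma\<close>.\<close>
lemma structure_constants:
  assumes Z: "Z \<in> Iso C E" and X: "X \<in> Iso C E"
  shows "complex_of_real (wt Y) * Poly_Mapping.lookup (twisted_hall_prod C n E Z X) Y =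
    complex_of_real (wt Z) * complex_of_real (wt X) * Poly_Mapping.lookup (cy_hall_prod C n Z X) Y"
proof -
  define z x where "z = (SOME z. z \<in> Z)" and "x = (SOME x. x \<in> X)"
  have zE: "z \<in> E" and xE: "x \<in> E" using Iso_E[OF Z] Iso_E[OF X] by (simp_all add: z_def x_def)
  have O: "x \<in> Ob C" "z \<in> Ob C" using E_ob[OF E] xE zE by auto
  define e where "e = (if n \<ge> 1 then euler_form C {0..n} z x else - euler_form C {n + 1..- 1} z x)"
  define Q where "Q = real CARD('k) powr (e / 2)"
  define cls where "cls \<delta> = iso_class (triangles C) (Ob (triangles C)) (tri_of z x \<delta>)" for \<delta>
  define rt where "rt U = (SOME t. t \<in> U)" for U :: "('o, 'h) tri set"
  define mid where "mid U = iso_class C (Ob C) (ty (rt U))" for U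
  let ?H = "real (card (Ext C 0 z x))"
  let ?\<U> = "{U. U \<in> Iso (triangles C) (Ob (triangles C)) \<and> (\<exists>t\<in>U. tx t = x \<and> tz t = z)}"
  have TO: "t \<in> Ob (triangles C) \<longleftrightarrow> exact_triangle C t" for t by (rule Ob_triangles)
  note to = tri_of[OF pre O]

  have rt: "exact_triangle C (rt U)" "isomorphic (triangles C) t (rt U)" if U: "U \<in> ?\<U>" and t: "t \<in> U" for U t
  proof -
    obtain s where s: "exact_triangle C s" "U = iso_class (triangles C) (Ob (triangles C)) s"
      using U TO by (auto simp: Iso_def)
    have "rt U \<in> U" unfolding rt_def using t by (rule someI)
    then have r: "exact_triangle C (rt U)" "isomorphic (triangles C) s (rt U)" and t': "exact_triangle C t" "isomorphic (triangles C) s t"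
      using s t TO by (auto simp: iso_class_def)
    then show "exact_triangle C (rt U)" "isomorphic (triangles C) t (rt U)"
      using T.isomorphic_trans[OF T.isomorphic_sym[OF t'(2)] r(2)] s(1) TO by blast+
  qed
  have cls_iff: "cls \<delta> = U \<longleftrightarrow> isomorphic (triangles C) t (tri_of z x \<delta>)"
    if U: "U \<in> ?\<U>" and t: "t \<in> U" and \<delta>: "\<delta> \<in> Ext C 1 z x" for U t \<delta>
  proof -
    obtain s where s: "exact_triangle C s" "U = iso_class (triangles C) (Ob (triangles C)) s"
      using U TO by (auto simp: Iso_def)
    have t': "exact_triangle C t" "isomorphic (triangles C) s t" using s t TO by (auto simp: iso_class_def)
    have Ut: "U = iso_class (triangles C) (Ob (triangles C)) t"
      unfolding s(2) by (rule T.iso_class_eq[OF t'(2)]) (use s t' TO in auto)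
    show ?thesis
    proof
      assume "cls \<delta> = U"
      moreover have "tri_of z x \<delta> \<in> cls \<delta>" using to(1)[OF \<delta>] TO T.isomorphic_refl by (simp add: cls_def iso_class_def)
      ultimately show "isomorphic (triangles C) t (tri_of z x \<delta>)" unfolding Ut by (simp add: iso_class_def)
    next
      assume "isomorphic (triangles C) t (tri_of z x \<delta>)"
      from T.iso_class_eq[OF this _ _ subset_refl] show "cls \<delta> = U"
        unfolding Ut cls_def using t'(1) to(1)[OF \<delta>] TO by simp
    qed
  qed
  have cls_in: "cls \<delta> \<in> ?\<U>" if \<delta>: "\<delta> \<in> Ext C 1 z x" for \<delta>
  proof -
    have "tri_of z x \<delta> \<in> cls \<delta>" using to(1)[OF \<delta>] TO T.isomorphic_refl by (simp add: cls_def iso_class_def)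
    then show ?thesis using to(1-3)[OF \<delta>] TO by (auto simp: cls_def Iso_def)
  qed
  have \<U>: "?\<U> = cls ` Ext C 1 z x"
  proof (intro equalityI subsetI)
    fix U assume U: "U \<in> ?\<U>"
    then obtain t where t: "t \<in> U" "tx t = x" "tz t = z" by blast
    have te: "exact_triangle C t" using U t(1) TO by (auto simp: Iso_def iso_class_def)
    obtain D where D: "conn t D" using conn_exists[OF te] ..
    define \<delta> where "\<delta> = ecls C 1 z x (- D)"
    have \<delta>: "\<delta> \<in> Ext C 1 z x" unfolding \<delta>_def using conn_cyc[OF D] t by (intro ecls_Ext cyc_minus) simp
    have "connecting C t \<delta>" using D t unfolding connecting_iff[OF te] \<delta>_def by blast
    then have "isomorphic (triangles C) t (tri_of z x \<delta>)"
      using connecting_iso[OF te to(1)[OF \<delta>] _ _ _ to(4)[OF \<delta>]] to(2,3)[OF \<delta>] t by simp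
    then have "cls \<delta> = U" using cls_iff[OF U t(1) \<delta>] by simp
    then show "U \<in> cls ` Ext C 1 z x" using \<delta> by blast
  qed (use cls_in in blast)
  have fin: "finite (Ext C 1 z x)" by (rule finite_Ext[OF O(2,1)])
  have middle: "middle_term C E z x \<delta> = mid (cls \<delta>)" if \<delta>: "\<delta> \<in> Ext C 1 z x" for \<delta>
  proof -
    have m: "tri_of z x \<delta> \<in> cls \<delta>" using to(1)[OF \<delta>] TO T.isomorphic_refl by (simp add: cls_def iso_class_def)
    note r = rt[OF cls_in[OF \<delta>] m]
    have "isomorphic C (ty (tri_of z x \<delta>)) (ty (rt (cls \<delta>)))" by (rule tri_isomorphic_components(2)[OF r(2) to(1)[OF \<delta>] r(1)])
    then show ?thesis
      unfolding middle_term_tri_of[OF xE zE \<delta>] mid_def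
      using exact_precomplexD(2)[OF to(1)[OF \<delta>]] exact_precomplexD(2)[OF r(1)] by (intro iso_class_eq) auto
  qed

  \<comment> \<open>The representative \<open>rt U\<close> has outer terms that are only isomorphic to \<open>x\<close> and \<open>z\<close>, whereas the orbit
     count needs a member \<open>t\<close> of \<open>U\<close> with outer terms equal to \<open>x\<close> and \<open>z\<close>; all quantities are isomorphism invariant.\<close>
  define coef where "coef U = sqrt (real (card (Aut C x)) * real (card (Aut C (ty (rt U)))) * real (card (Aut C z)))
      / real (card (Aut (triangles C) (rt U))) * real CARD('k) powr (gamma C n (rt U) / 2)" for U
  have key: "wt Z * wt X * coef U = real (card {\<delta> \<in> Ext C 1 z x. cls \<delta> = U}) * (wt (mid U) * Q / ?H)" if U: "U \<in> ?\<U>" for U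
  proof -
    obtain t where t: "t \<in> U" "tx t = x" "tz t = z" using U by blast
    have te: "exact_triangle C t" using U t(1) TO by (auto simp: Iso_def iso_class_def)
    note r = rt[OF U t(1)]
    note c = tri_isomorphic_components[OF r(2) te r(1)]
    note ro = exact_precomplexD(1-3)[OF r(1)]
    have rE: "tx (rt U) \<in> E" "tz (rt U) \<in> E" using E_iso_closed c t xE zE ro by auto
    have dims: "ext_dim C i (tz (rt U)) (tx (rt U)) = ext_dim C i z x" for i
      using ext_dim_iso[OF c(3,1)] t ro O by simp
    have gamma: "gamma C n (rt U) = e"
      unfolding E_gamma[OF E cy odd r(1) rE] e_def euler_form_def dims ..
    have autT: "card (Aut (triangles C) (rt U)) = card (Aut (triangles C) t)"
      using T.card_Aut_iso(1)[OF r(2)] te r(1) TO by simp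
    have fib: "{\<delta> \<in> Ext C 1 z x. cls \<delta> = U} = {\<delta> \<in> Ext C 1 z x. isomorphic (triangles C) t (tri_of z x \<delta>)}"
      using cls_iff[OF U t(1)] by blast
    have cnt: "real (card {\<delta> \<in> Ext C 1 z x. cls \<delta> = U}) * real (card (Aut (triangles C) (rt U))) =
        real (card (Aut C x)) * real (card (Aut C z)) * ?H"
      unfolding autT fib of_nat_mult[symmetric] orbit_count[OF E pre xE zE te t(2,3)] ..
    have pos: "real (card (Aut (triangles C) (rt U))) > 0" "?H > 0"
      using T.card_Aut_pos r(1) TO Ext_pos[OF O(2,1)] by simp_all
    have wts: "wt Z = sqrt (real (card (Aut C z)))" "wt X = sqrt (real (card (Aut C x)))"
      "wt (mid U) = sqrt (real (card (Aut C (ty (rt U)))))"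
      using wt_iso_class[OF ro(2)] by (simp_all add: wt_def z_def x_def mid_def)
    have "wt Z * wt X * coef U = real (card (Aut C x)) * real (card (Aut C z)) / real (card (Aut (triangles C) (rt U))) * (wt (mid U) * Q)"
    proof -
      have sq: "sqrt (real m) * sqrt (real m) = real m" for m by simp
      have "wt Z * wt X * coef U = (sqrt (real (card (Aut C x))) * sqrt (real (card (Aut C x)))) *
          (sqrt (real (card (Aut C z))) * sqrt (real (card (Aut C z)))) / real (card (Aut (triangles C) (rt U))) * (wt (mid U) * Q)"
        unfolding coef_def gamma wts Q_def real_sqrt_mult by (simp only: mult_ac times_divide_eq_left times_divide_eq_right)
      then show ?thesis unfolding sq .
    qed
    also have "real (card (Aut C x)) * real (card (Aut C z)) / real (card (Aut (triangles C) (rt U))) =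
        real (card {\<delta> \<in> Ext C 1 z x. cls \<delta> = U}) / ?H"
      using cnt pos by (simp add: field_simps)
    finally show ?thesis by simp
  qed

  have L: "Poly_Mapping.lookup (twisted_hall_prod C n E Z X) Y =
      complex_of_real (\<Sum>\<delta>\<in>Ext C 1 z x. if mid (cls \<delta>) = Y then Q / ?H else 0)"
  proof -
    have "Poly_Mapping.lookup (hall_prod C E Z X) Y =
        1 / of_nat (card (Ext C 0 z x)) * (\<Sum>\<delta>\<in>Ext C 1 z x. if middle_term C E z x \<delta> = Y then 1 else 0)"
      unfolding hall_prod_def Let_def z_def[symmetric] x_def[symmetric] lookup_map_times lookup_sum
      by (simp add: lookup_single when_def)
    also have "\<dots> = 1 / of_nat (card (Ext C 0 z x)) * (\<Sum>\<delta>\<in>Ext C 1 z x. if mid (cls \<delta>) = Y then 1 else 0)"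
      by (intro arg_cong[of _ _ "(*) _"] sum.cong refl) (simp add: middle)
    finally have h: "Poly_Mapping.lookup (hall_prod C E Z X) Y =
        1 / of_nat (card (Ext C 0 z x)) * (\<Sum>\<delta>\<in>Ext C 1 z x. if mid (cls \<delta>) = Y then 1 else 0)" .
    have "Poly_Mapping.lookup (twisted_hall_prod C n E Z X) Y = complex_of_real Q * of_rat (Poly_Mapping.lookup (hall_prod C E Z X) Y)"
      unfolding twisted_hall_prod_def Let_def z_def[symmetric] x_def[symmetric] e_def[symmetric] Q_def[symmetric]
      by (rule lookup_map) simp
    also have "\<dots> = complex_of_real (\<Sum>\<delta>\<in>Ext C 1 z x. if mid (cls \<delta>) = Y then Q / ?H else 0)"
      unfolding h by (simp add: of_rat_mult of_rat_divide of_rat_sum sum_distrib_left if_distrib cong: if_cong)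
    finally show ?thesis .
  qed
  have R: "Poly_Mapping.lookup (cy_hall_prod C n Z X) Y = complex_of_real (\<Sum>U\<in>?\<U>. if mid U = Y then coef U else 0)"
  proof -
    have "Poly_Mapping.lookup (cy_hall_prod C n Z X) Y = (\<Sum>U\<in>?\<U>. if mid U = Y then complex_of_real (coef U) else 0)"
      unfolding cy_hall_prod_def Let_def z_def[symmetric] x_def[symmetric] rt_def[symmetric] coef_def[symmetric] mid_def[symmetric] lookup_sum
      by (simp add: lookup_single when_def)
    then show ?thesis by (simp add: if_distrib cong: if_cong)
  qed
  have "wt Y * (\<Sum>\<delta>\<in>Ext C 1 z x. if mid (cls \<delta>) = Y then Q / ?H else 0) =
      (\<Sum>\<delta>\<in>Ext C 1 z x. if mid (cls \<delta>) = Y then wt (mid (cls \<delta>)) * Q / ?H else 0)"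
    by (auto simp: sum_distrib_left intro!: sum.cong)
  also have "\<dots> = (\<Sum>U\<in>?\<U>. \<Sum>\<delta>\<in>{\<delta> \<in> Ext C 1 z x. cls \<delta> = U}. if mid (cls \<delta>) = Y then wt (mid (cls \<delta>)) * Q / ?H else 0)"
    by (rule sum.group[symmetric, OF fin]) (simp_all add: \<U> fin)
  also have "\<dots> = (\<Sum>U\<in>?\<U>. if mid U = Y then wt Z * wt X * coef U else 0)"
    by (rule sum.cong[OF refl]) (simp add: key)
  also have "\<dots> = wt Z * wt X * (\<Sum>U\<in>?\<U>. if mid U = Y then coef U else 0)"
    by (auto simp: sum_distrib_left intro!: sum.cong)
  finally have main: "wt Y * (\<Sum>\<delta>\<in>Ext C 1 z x. if mid (cls \<delta>) = Y then Q / ?H else 0) =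
      wt Z * wt X * (\<Sum>U\<in>?\<U>. if mid U = Y then coef U else 0)" .
  show ?thesis unfolding L R of_real_mult[symmetric] main ..
qed

text \<open>The unit is preserved because a zero object has exactly one automorphism.\<close>
lemma zero_class_E: "zero_class C E = zero_class C (Ob C)" "wt (zero_class C (Ob C)) = 1"
proof -
  obtain o' where o': "o' \<in> E" "zero_object C o'" using add unfolding full_additive_subcategory_def by blast
  have iso: "isomorphic C x y" if x: "zero_object C x" and y: "zero_object C y" for x y
  proof -
    note X = zero_object_contractible[OF x] and Y = zero_object_contractible[OF y]
    have "inverse_pair C 0 x y 0 0"
      using X Y zero_left[OF hom_zero[OF X(1) Y(1), of 0]] zero_left[OF hom_zero[OF Y(1) X(1), of 0]]
      by (simp add: inverse_pair_iff cyc_zero bnd_minus_iff)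
    then show ?thesis by (auto simp: isomorphic_def)
  qed
  have "x \<in> E" if "zero_object C x" for x
    using E_iso_closed[OF o'(1) iso[OF o'(2) that]] that by (simp add: zero_object_def)
  then show "zero_class C E = zero_class C (Ob C)" using E_ob[OF E] by (auto simp: zero_class_def)
  have "o' \<in> zero_class C (Ob C)" using o' by (simp add: zero_class_def zero_object_def)
  then have "(SOME z. z \<in> zero_class C (Ob C)) \<in> zero_class C (Ob C)" by (rule someI)
  then have s: "zero_object C (SOME z. z \<in> zero_class C (Ob C))" by (simp add: zero_class_def)
  define s where "s = (SOME z. z \<in> zero_class C (Ob C))"
  have sO: "s \<in> Ob C" "zero_object C s" using s by (simp_all add: s_def zero_object_def)
  have "\<exists>!\<alpha>. \<alpha> \<in> Ext C 0 s s" using sO by (auto simp: zero_object_def)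
  then obtain \<alpha> where "Ext C 0 s s = {\<alpha>}" by auto
  then have "card (Aut C s) \<le> 1" using card_mono[of "{\<alpha>}" "Aut C s"] Isos_Ext[OF sO(1,1)] by (simp add: Aut_Isos)
  then have "card (Aut C s) = 1" using card_Aut_pos[OF sO(1)] by simp
  then show "wt (zero_class C (Ob C)) = 1" by (simp add: wt_def s_def)
qed

theorem hall_embedding:
  "algebra_embedding (twisted_hall_algebra C n E) (cy_hall_algebra C n) (rescale (\<lambda>Z. complex_of_real (wt Z)))"
  "z \<in> E \<Longrightarrow> rescale (\<lambda>Z. complex_of_real (wt Z)) (hall_m C E z) = hall_a C z"
proof -
  show "algebra_embedding (twisted_hall_algebra C n E) (cy_hall_algebra C n) (rescale (\<lambda>Z. complex_of_real (wt Z)))"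
    unfolding twisted_hall_algebra_def cy_hall_algebra_def zero_class_E(1)
  proof (rule based_algebra_rescale)
    show "complex_of_real (wt Z) \<noteq> 0" if "Z \<in> Iso C E" for Z
      using card_Aut_pos[OF E_ob[OF E]] Iso_E[OF that] by (simp add: wt_def)
    show "Iso C E \<subseteq> Iso C (Ob C)" using iso_class_E E_ob[OF E] by (auto simp: Iso_def)
  qed (simp_all add: structure_constants zero_class_E(2))
  show "rescale (\<lambda>Z. complex_of_real (wt Z)) (hall_m C E z) = hall_a C z" if "z \<in> E"
    by (rule poly_mapping_eqI)
      (auto simp: hall_m_def hall_a_def lookup_rescale lookup_single when_def iso_class_E[OF that] wt_iso_class[OF E_ob[OF E that]])
qed

end
end

theorem theorem3p12:
  fixes C :: "('k::{finite,field}, 'o, 'h::ab_group_add) dgcat"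
    and n :: int
    and E :: "'o set"
  assumes "dg_category C"
    and "pretriangulated C"
    and "idempotent_complete C"
    and "degreewise_finite C"
    and "odd n"
    and "calabi_yau C n"
    and "full_additive_subcategory C E"
    and "induces_exact_structure C E"
  shows "\<exists>\<Phi>. algebra_embedding (twisted_hall_algebra C n E) (cy_hall_algebra C n) \<Phi> \<and>
    (\<forall>z\<in>E. \<Phi> (hall_m C E z) = hall_a C z)"
proof -
  interpret dg_category C by fact
  have "finite_dg_category C"
  proof
    fix x y i assume O: "x \<in> Ob C" "y \<in> Ob C"
    have "quot_findim (scl C) (cyc x y i) (bnd x y i)"
      using assms(4) O unfolding degreewise_finite_def cocyc_eq[OF O, symmetric] cobnd_eq[OF O, symmetric] by blast
    then show "finite (Ext C i x y)"
      using quot_dim_card_sub(1)[OF V.vector_space_axioms bnd_subspace[OF O] cyc_subspace[OF O] bnd_sub_cyc]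
      by (simp add: Ext_cosets O)
  qed
  then interpret finite_dg_category C .
  interpret finite_dg_triangles C ..
  have "exact_sub E" using assms(7,8) by (simp add: exact_sub_def full_additive_subcategory_def)
  from hall_embedding[OF this assms(7,2,5,6)] show ?thesis by blast
qed

end
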